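(* Up to isomorphism, the only excluded minors for the class of $\mathbb{Z}_3$-gainable biased graphs are $(4K_2,\emptyset)$, $\pm K_3$, and $-K_4$.
   Context: Graphs are finite and may have loops and parallel edges. A cycle of a graph is a nonempty connected subgraph in which every vertex has degree $2$ (so a loop is a 1-edge cycle and two parallel edges form a 2-edge cycle). A theta subgraph consists of two distinct vertices and three internally disjoint paths joining them. A biased graph is a pair $\Omega=(G,\mathcal{B})$ where $G$ is a graph and $\mathcal{B}$ is a set of cycles of $G$ such that no theta subgraph of $G$ contains exactly two cycles in $\mathcal{B}$; cycles in $\mathcal{B}$ are balanced, other cycles are unbalanced. A set of edges is balanced if every cycle contained in it is balanced. Gainings. An arc of $G$ is a triple $(e,u,v)$, where $e$ is an edge, $u,v$ are vertices incident with $e$, and $u\neq v$ if $e$ is not a loop. For a group $\Gamma$, a $\Gamma$-gaining of $G$ is a function $\gamma$ from the arcs of $G$ to $\Gamma$ with $\gamma(e,v,u)=\gamma(e,u,v)^{-1}$ for every non-loop edge $e$. The gain of a walk $u_0,e_0,u_1,\ldots,e_{n-1},u_n$ is $\gamma(e_0,u_0,u_1)\cdots\gamma(e_{n-1},u_{n-1},u_n)$. A simple closed walk of a cycle is a closed walk traversing the cycle exactly once; whether its gain is the identity does not depend on the choice of starting vertex or direction. Let $\mathcal{B}_\gamma$ be the set of cycles whose simple closed walks have identity gain. The biased graph $(G,\mathcal{B})$ is $\Gamma$-gainable if there is a $\Gamma$-gaining $\gamma$ of $G$ with $\mathcal{B}=\mathcal{B}_\gamma$. $\mathbb{Z}_n$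 is the cyclic group of order $n$. Minors. Let $A,B$ be disjoint sets of edges of $\Omega=(G,\mathcal{B})$ with $A$ balanced. Then $\Omega/A\backslash B$ is the biased graph whose underlying graph $G/A\backslash B$ is obtained by deleting $B$ and contracting $A$ (vertices are the connected components of $(V(G),A)$, edge set $E(G)-(A\cup B)$), where a cycle $C$ of $G/A\backslash B$ is balanced if and only if a (equivalently every) cycle $C'$ of $G$ with $C\subseteq C'$ and $C'-C\subseteq A$ (as edge sets) is balanced. A minor of $\Omega$ is any biased graph obtained from some $\Omega/A\backslash B$ by possibly deleting isolated vertices. An excluded minor for a minor-closed class is a biased graph not in the class all of whose proper minors are in the class. Particular biased graphs. $nK_2$ is the graph with two vertices and $n$ parallel edges joining them; $(nK_2,\emptyset)$ has no balanced cycle. $-G$ is the biased graph on $G$ whose balanced cycles are exactly the even-length cycles. $\pm G$ is obtained from $G$ by replacing each edge with two parallel edges, one positive and one negative, a cycle being balanced if and only if it contains an even number of negative edges. *)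

theory Defs
  imports "HOL-Algebra.Elementary_Groups"
begin

section \<open>Graphs with loops and parallel edges\<close>

text \<open>Each edge has a set of one (loop) or two ends.
  The values of \<open>ends\<close> outside \<open>edges\<close> are irrelevant.\<close>

record ('v, 'e) mgraph =
  verts :: "'v set"
  edges :: "'e set"
  ends :: "'e \<Rightarrow> 'v set"

definition mgraph :: "('v, 'e) mgraph \<Rightarrow> bool" where
  "mgraph G \<longleftrightarrow> finite (verts G) \<and> finite (edges G) \<and>
     (\<forall>e\<in>edges G. ends G e \<subseteq> verts G \<and> (card (ends G e) = 1 \<or> card (ends G e) = 2))"

definition is_loop :: "('v, 'e) mgraph \<Rightarrow> 'e \<Rightarrow> bool" where
  "is_loop G e \<longleftrightarrow> card (ends G e) = 1"

definition arcs :: "('v, 'e) mgraph \<Rightarrow> ('e \<times> 'v \<times> 'v) set" where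
  "arcs G = {(e, u, v). e \<in> edges G \<and> u \<in> ends G e \<and> v \<in> ends G e \<and>
     (\<not> is_loop G e \<longrightarrow> u \<noteq> v)}"

text \<open>A walk from \<open>u\<close> to \<open>v\<close> is represented by the list of arcs it traverses.\<close>

type_synonym ('v, 'e) walk = "('e \<times> 'v \<times> 'v) list"

fun is_walk :: "('v, 'e) mgraph \<Rightarrow> 'v \<Rightarrow> ('v, 'e) walk \<Rightarrow> 'v \<Rightarrow> bool" where
  "is_walk G u [] v \<longleftrightarrow> u \<in> verts G \<and> u = v"
| "is_walk G u ((e, a, b) # p) v \<longleftrightarrow> (e, a, b) \<in> arcs G \<and> a = u \<and> is_walk G b p v"

definition walk_edges :: "('v, 'e) walk \<Rightarrow> 'e list" where
  "walk_edges p = map (\<lambda>(e, a, b). e) p"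

text \<open>The vertices of a walk apart from its last one.\<close>

definition walk_starts :: "('v, 'e) walk \<Rightarrow> 'v list" where
  "walk_starts p = map (\<lambda>(e, a, b). a) p"

definition is_path :: "('v, 'e) mgraph \<Rightarrow> 'v \<Rightarrow> ('v, 'e) walk \<Rightarrow> 'v \<Rightarrow> bool" where
  "is_path G u p v \<longleftrightarrow> is_walk G u p v \<and> distinct (walk_starts p @ [v])"

definition internal_verts :: "('v, 'e) walk \<Rightarrow> 'v set" where
  "internal_verts p = set (tl (walk_starts p))"

text \<open>\<open>u\<close> and \<open>v\<close> lie in the same component of the graph \<open>(verts G, X)\<close>.\<close>

definition joined :: "('v, 'e) mgraph \<Rightarrow> 'e set \<Rightarrow> 'v \<Rightarrow> 'v \<Rightarrow> bool" where
  "joined G X u v \<longleftrightarrow> (\<exists>p. is_walk G u p v \<and> set (walk_edges p) \<subseteq> X)"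

text \<open>The degree of \<open>v\<close> in the graph with edge set \<open>X\<close>; loops count twice.\<close>

definition vert_degree :: "('v, 'e) mgraph \<Rightarrow> 'e set \<Rightarrow> 'v \<Rightarrow> nat" where
  "vert_degree G X v = card {e \<in> X. v \<in> ends G e} + card {e \<in> X. v \<in> ends G e \<and> is_loop G e}"

text \<open>Subgraphs without isolated vertices, in particular cycles and thetas, are
  identified with their edge sets; the vertices are then the ends of the edges.\<close>

definition is_cycle :: "('v, 'e) mgraph \<Rightarrow> 'e set \<Rightarrow> bool" where
  "is_cycle G C \<longleftrightarrow> C \<noteq> {} \<and> C \<subseteq> edges G \<and>
     (\<forall>u \<in> \<Union>(ends G ` C). \<forall>v \<in> \<Union>(ends G ` C). joined G C u v) \<and>
     (\<forall>v \<in> \<Union>(ends G ` C). vert_degree G C v = 2)"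

text \<open>Disjointness of the edge sets is needed only to exclude that the same
  one-edge path is used repeatedly.\<close>

definition internally_disjoint :: "('v, 'e) walk \<Rightarrow> ('v, 'e) walk \<Rightarrow> bool" where
  "internally_disjoint p q \<longleftrightarrow> internal_verts p \<inter> internal_verts q = {} \<and>
     set (walk_edges p) \<inter> set (walk_edges q) = {}"

definition is_theta :: "('v, 'e) mgraph \<Rightarrow> 'e set \<Rightarrow> bool" where
  "is_theta G T \<longleftrightarrow> (\<exists>u v p q r. u \<noteq> v \<and> is_path G u p v \<and> is_path G u q v \<and> is_path G u r v \<and>
     internally_disjoint p q \<and> internally_disjoint p r \<and> internally_disjoint q r \<and>
     T = set (walk_edges p) \<union> set (walk_edges q) \<union> set (walk_edges r))"


section \<open>Biased graphs\<close>

type_synonym ('v, 'e) biased = "('v, 'e) mgraph \<times> 'e set set"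

fun biased_graph :: "('v, 'e) biased \<Rightarrow> bool" where
  "biased_graph (G, \<B>) \<longleftrightarrow> mgraph G \<and> (\<forall>C\<in>\<B>. is_cycle G C) \<and>
     (\<forall>T. is_theta G T \<longrightarrow> card {C \<in> \<B>. C \<subseteq> T} \<noteq> 2)"

fun balanced_edges :: "('v, 'e) biased \<Rightarrow> 'e set \<Rightarrow> bool" where
  "balanced_edges (G, \<B>) X \<longleftrightarrow> (\<forall>C. is_cycle G C \<and> C \<subseteq> X \<longrightarrow> C \<in> \<B>)"

text \<open>Meaningful for biased graphs only, where ends lie in \<open>verts\<close> and cycles in \<open>edges\<close>.\<close>

fun biased_iso :: "('v, 'e) biased \<Rightarrow> ('w, 'f) biased \<Rightarrow> bool" (infix "\<cong>\<^sub>b" 50) where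
  "(G, \<B>) \<cong>\<^sub>b (H, \<C>) \<longleftrightarrow> (\<exists>f g. bij_betw f (verts G) (verts H) \<and> bij_betw g (edges G) (edges H) \<and>
     (\<forall>e\<in>edges G. ends H (g e) = f ` ends G e) \<and>
     \<C> = (\<lambda>C. g ` C) ` \<B>)"


section \<open>Gainings\<close>

definition gaining :: "('a, 'm) monoid_scheme \<Rightarrow> ('v, 'e) mgraph \<Rightarrow> ('e \<times> 'v \<times> 'v \<Rightarrow> 'a) \<Rightarrow> bool" where
  "gaining \<Gamma> G \<gamma> \<longleftrightarrow> \<gamma> \<in> arcs G \<rightarrow> carrier \<Gamma> \<and>
     (\<forall>(e, u, v) \<in> arcs G. \<not> is_loop G e \<longrightarrow> \<gamma> (e, v, u) = inv\<^bsub>\<Gamma>\<^esub> \<gamma> (e, u, v))"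

definition walk_gain :: "('a, 'm) monoid_scheme \<Rightarrow> ('e \<times> 'v \<times> 'v \<Rightarrow> 'a) \<Rightarrow> ('v, 'e) walk \<Rightarrow> 'a" where
  "walk_gain \<Gamma> \<gamma> p = foldr (\<lambda>a x. \<gamma> a \<otimes>\<^bsub>\<Gamma>\<^esub> x) p \<one>\<^bsub>\<Gamma>\<^esub>"

definition simple_closed_walk :: "('v, 'e) mgraph \<Rightarrow> 'e set \<Rightarrow> ('v, 'e) walk \<Rightarrow> bool" where
  "simple_closed_walk G C p \<longleftrightarrow> (\<exists>u. is_walk G u p u) \<and>
     distinct (walk_starts p) \<and> distinct (walk_edges p) \<and> set (walk_edges p) = C"

definition gain_balanced ::
    "('a, 'm) monoid_scheme \<Rightarrow> ('v, 'e) mgraph \<Rightarrow> ('e \<times> 'v \<times> 'v \<Rightarrow> 'a) \<Rightarrow> 'e set set" where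
  "gain_balanced \<Gamma> G \<gamma> =
     {C. is_cycle G C \<and> (\<forall>p. simple_closed_walk G C p \<longrightarrow> walk_gain \<Gamma> \<gamma> p = \<one>\<^bsub>\<Gamma>\<^esub>)}"

fun gainable :: "('a, 'm) monoid_scheme \<Rightarrow> ('v, 'e) biased \<Rightarrow> bool" where
  "gainable \<Gamma> (G, \<B>) \<longleftrightarrow> (\<exists>\<gamma>. gaining \<Gamma> G \<gamma> \<and> \<B> = gain_balanced \<Gamma> G \<gamma>)"


section \<open>Minors\<close>

definition component :: "('v, 'e) mgraph \<Rightarrow> 'e set \<Rightarrow> 'v \<Rightarrow> 'v set" where
  "component G X u = {v. joined G X u v}"

text \<open>The graph \<open>G/A\B\<close>.\<close>

definition graph_minor :: "('v, 'e) mgraph \<Rightarrow> 'e set \<Rightarrow> 'e set \<Rightarrow> ('v set, 'e) mgraph" where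
  "graph_minor G A B =
     \<lparr> verts = component G A ` verts G,
       edges = edges G - (A \<union> B),
       ends = (\<lambda>e. component G A ` ends G e) \<rparr>"

fun contract_delete :: "('v, 'e) biased \<Rightarrow> 'e set \<Rightarrow> 'e set \<Rightarrow> ('v set, 'e) biased" where
  "contract_delete (G, \<B>) A B =
     (graph_minor G A B,
      {C. is_cycle (graph_minor G A B) C \<and>
          (\<exists>C'. is_cycle G C' \<and> C \<subseteq> C' \<and> C' - C \<subseteq> A \<and> C' \<in> \<B>)})"

fun isolated_verts :: "('v, 'e) biased \<Rightarrow> 'v set" where
  "isolated_verts (G, \<B>) = {v \<in> verts G. \<forall>e\<in>edges G. v \<notin> ends G e}"

fun delete_verts :: "('v, 'e) biased \<Rightarrow> 'v set \<Rightarrow> ('v, 'e) biased" where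
  "delete_verts (G, \<B>) W = (G\<lparr>verts := verts G - W\<rparr>, \<B>)"

definition is_minor :: "('v set, 'e) biased \<Rightarrow> ('v, 'e) biased \<Rightarrow> bool" where
  "is_minor M \<Omega> \<longleftrightarrow> (\<exists>A B W. A \<subseteq> edges (fst \<Omega>) \<and> B \<subseteq> edges (fst \<Omega>) \<and> A \<inter> B = {} \<and>
     balanced_edges \<Omega> A \<and> W \<subseteq> isolated_verts (contract_delete \<Omega> A B) \<and>
     M = delete_verts (contract_delete \<Omega> A B) W)"

text \<open>The trivial minor of \<open>\<Omega>\<close> (no edge or vertex removed) has the singletons as its
  vertices, so it is \<open>\<Omega>\<close> only up to isomorphism. As graphs are finite, every other
  minor is not isomorphic to \<open>\<Omega>\<close>.\<close>

definition proper_minor :: "('v set, 'e) biased \<Rightarrow> ('v, 'e) biased \<Rightarrow> bool" where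
  "proper_minor M \<Omega> \<longleftrightarrow> is_minor M \<Omega> \<and> \<not> M \<cong>\<^sub>b \<Omega>"

text \<open>Excluded minors for the class of \<open>\<Gamma>\<close>-gainable biased graphs. The class contains
  graphs over different vertex types, so it is not a parameter of the definition.\<close>

definition excluded_minor_gainable :: "('a, 'm) monoid_scheme \<Rightarrow> ('v, 'e) biased \<Rightarrow> bool" where
  "excluded_minor_gainable \<Gamma> \<Omega> \<longleftrightarrow> biased_graph \<Omega> \<and> \<not> gainable \<Gamma> \<Omega> \<and>
     (\<forall>M. proper_minor M \<Omega> \<longrightarrow> gainable \<Gamma> M)"


section \<open>Particular biased graphs\<close>

definition complete_graph :: "nat \<Rightarrow> (nat, nat set) mgraph" where
  "complete_graph n = \<lparr> verts = {..<n}, edges = {e. e \<subseteq> {..<n} \<and> card e = 2}, ends = (\<lambda>e. e) \<rparr>"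

definition multi_K2 :: "nat \<Rightarrow> (nat, nat) mgraph" where
  "multi_K2 n = \<lparr> verts = {0, 1}, edges = {..<n}, ends = (\<lambda>e. {0, 1}) \<rparr>"

definition all_negative :: "('v, 'e) mgraph \<Rightarrow> ('v, 'e) biased" where
  "all_negative G = (G, {C. is_cycle G C \<and> even (card C)})"

datatype sign = Positive | Negative

definition doubled_graph :: "('v, 'e) mgraph \<Rightarrow> ('v, 'e \<times> sign) mgraph" where
  "doubled_graph G = \<lparr> verts = verts G, edges = edges G \<times> UNIV, ends = (\<lambda>(e, s). ends G e) \<rparr>"

definition plus_minus :: "('v, 'e) mgraph \<Rightarrow> ('v, 'e \<times> sign) biased" where
  "plus_minus G = (doubled_graph G,
     {C. is_cycle (doubled_graph G) C \<and> even (card {x \<in> C. snd x = Negative})})"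

end

theory Submission
  imports Defs
begin


text \<open>Let \<open>(G, B)\<close> be an excluded minor and call a gain right on a cycle if it is zero exactly when
  the cycle is balanced. For every edge there are gains that are right on all cycles avoiding the
  edge, and gains that are right on all cycles not having the edge as a chord, the latter because
  the edge can be contracted. Hence, if no gain is right on all members of a set of cycles, this set
  covers all edges and every edge is a chord of one of its members. So a few contradictory cycles
  determine the whole graph.

  Let \<open>e, e'\<close> be parallel edges forming an unbalanced cycle. Relative to a gain that is right on the
  cycles avoiding \<open>e'\<close>, every path parallel to \<open>e\<close> with gain different from that of \<open>e\<close> votes for
  one of two gains of \<open>e'\<close>. If all votes agree, the gain extends to \<open>e'\<close>. Two disagreeing
  paths with smallest union consist of parallel edges, which gives \<open>(4K\<^sub>2, \<emptyset>)\<close>, or form a doubled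
  triangle together with \<open>e, e'\<close>, which gives \<open>\<plusminus>K\<^sub>3\<close>.

  Without parallel edges, contract the first edge \<open>e\<close> of a longest path. A cycle on which the
  resulting gain is not right has \<open>e\<close> as a chord, and together with \<open>e\<close> and a part of the longest
  path it forms a subdivided \<open>K\<^sub>4\<close> with contradictory cycles, which must be \<open>-K\<^sub>4\<close>.\<close>

text \<open>Balance is linear: a cycle cut into two paths with common ends has gain zero iff the two
  paths have equal gains modulo 3. Three residues leave no room for four paths with pairwise
  different gains, which is the origin of \<open>(4K\<^sub>2, \<emptyset>)\<close>; the other two
  graphs fail because 2 is invertible modulo 3, so that their balanced cycles force an unbalanced
  one to have gain zero. Chords matter because contracting an edge that is not a chord leaves a
  cycle a cycle, possibly shortened, whereas contracting a chord pinches it into two, and the minor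
  no longer controls its gain. With parallel edges, the obstacle is that two disagreeing paths may
  cross arbitrarily often; minimality is exploited through mixed paths that follow one of them and
  then the other. Without parallel edges, the obstacle is to join the two sides of the wrong cycle
  by a path that avoids both ends of the contracted edge. The start of a longest path has all its
  neighbours on that path, so the remainder of the path behind the first edge contains such a
  connection.\<close>

section \<open>Arcs, walks, paths and simple closed walks\<close>

abbreviation wE :: "('v, 'e) walk \<Rightarrow> 'e set" where
  "wE p \<equiv> set (walk_edges p)"

abbreviation wS :: "('v, 'e) walk \<Rightarrow> 'v set" where
  "wS p \<equiv> set (walk_starts p)"

definition rev_walk :: "('v, 'e) walk \<Rightarrow> ('v, 'e) walk" where
  "rev_walk p = rev (map (\<lambda>(e, a, b). (e, b, a)) p)"

lemma walk_edges_simps [simp]: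
  "walk_edges [] = []" "walk_edges ((e, a, b) # p) = e # walk_edges p"
  "walk_edges (p @ q) = walk_edges p @ walk_edges q"
  "length (walk_edges p) = length p"
  "walk_edges p = [] \<longleftrightarrow> p = []"
  by (auto simp: walk_edges_def)

lemma walk_starts_simps [simp]:
  "walk_starts [] = []" "walk_starts ((e, a, b) # p) = a # walk_starts p"
  "walk_starts (p @ q) = walk_starts p @ walk_starts q"
  "length (walk_starts p) = length p"
  "walk_starts p = [] \<longleftrightarrow> p = []"
  by (auto simp: walk_starts_def)

lemma rev_walk_simps [simp]:
  "rev_walk [] = []" "rev_walk ((e, a, b) # p) = rev_walk p @ [(e, b, a)]"
  "rev_walk (p @ q) = rev_walk q @ rev_walk p"
  "wE (rev_walk p) = wE p"
  "rev_walk (rev_walk p) = p"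
  "rev_walk p = [] \<longleftrightarrow> p = []"
  by (auto simp: rev_walk_def walk_edges_def rev_map image_iff comp_def split: prod.splits)
    (force simp: case_prod_unfold)+

lemma walk_edges_rev_walk: "walk_edges (rev_walk p) = rev (walk_edges p)"
  by (induction p) auto

lemma arcs_sym: "(e, a, b) \<in> arcs G \<Longrightarrow> (e, b, a) \<in> arcs G"
  by (auto simp: arcs_def)

lemma arcsD: "(e, a, b) \<in> arcs G \<Longrightarrow> e \<in> edges G \<and> a \<in> ends G e \<and> b \<in> ends G e"
  by (auto simp: arcs_def)

lemma arc_edge: "(e, a, b) \<in> arcs G \<Longrightarrow> e \<in> edges G"
  and arc_end1: "(e, a, b) \<in> arcs G \<Longrightarrow> a \<in> ends G e"
  and arc_end2: "(e, a, b) \<in> arcs G \<Longrightarrow> b \<in> ends G e"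
  by (auto simp: arcs_def)

lemma mgraphD:
  assumes "mgraph G" "e \<in> edges G"
  shows "ends G e \<subseteq> verts G" "card (ends G e) = 1 \<or> card (ends G e) = 2" "finite (ends G e)"
proof -
  show "ends G e \<subseteq> verts G" and c: "card (ends G e) = 1 \<or> card (ends G e) = 2"
    using assms by (auto simp: mgraph_def)
  show "finite (ends G e)"
    using c by (auto intro: card_ge_0_finite)
qed

lemma ends_arc:
  assumes "mgraph G" "(e, a, b) \<in> arcs G"
  shows "ends G e = {a, b}"
proof -
  have e: "e \<in> edges G" "a \<in> ends G e" "b \<in> ends G e" "card (ends G e) \<noteq> 1 \<longrightarrow> a \<noteq> b"
    using assms(2) by (auto simp: arcs_def is_loop_def)
  consider "card (ends G e) = 1" | "card (ends G e) = 2"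
    using mgraphD(2)[OF assms(1) e(1)] by blast
  then show ?thesis
  proof cases
    case 1
    then show ?thesis
      using e by (auto simp: card_1_singleton_iff)
  next
    case 2
    then show ?thesis
      using e by (auto simp: card_2_iff)
  qed
qed

lemma is_loop_arc: "mgraph G \<Longrightarrow> (e, a, b) \<in> arcs G \<Longrightarrow> is_loop G e \<longleftrightarrow> a = b"
  by (simp add: is_loop_def ends_arc card_insert_if)

lemma arcsI:
  assumes "mgraph G" "e \<in> edges G" "ends G e = {a, b}"
  shows "(e, a, b) \<in> arcs G"
  using assms by (auto simp: arcs_def is_loop_def)

lemma edge_arcE:
  assumes "mgraph G" "e \<in> edges G"
  obtains a b where "(e, a, b) \<in> arcs G"
proof -
  consider x where "ends G e = {x}" | x y where "ends G e = {x, y}"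
    using mgraphD(2)[OF assms] by (auto simp: card_2_iff card_1_singleton_iff)
  then show thesis
    by cases (use arcsI[OF assms] that in fastforce)+
qed

lemma arc_unique:
  assumes "mgraph G" "(e, a, b) \<in> arcs G" "(e, a, c) \<in> arcs G"
  shows "b = c"
  using ends_arc[OF assms(1,2)] ends_arc[OF assms(1,3)] by (auto simp: doubleton_eq_iff)

lemma arc_same_edge:
  assumes "mgraph G" "(e, a, b) \<in> arcs G" "(e, c, d) \<in> arcs G"
  shows "c = a \<and> d = b \<or> c = b \<and> d = a"
  using ends_arc[OF assms(1,2)] ends_arc[OF assms(1,3)] by (auto simp: doubleton_eq_iff)

lemma arc_verts:
  assumes "mgraph G" "(e, a, b) \<in> arcs G"
  shows "a \<in> verts G" "b \<in> verts G"
  using assms mgraphD(1)[OF assms(1)] by (auto simp: arcs_def)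

lemma is_walk_verts:
  assumes "mgraph G" "is_walk G u p v"
  shows "u \<in> verts G" "v \<in> verts G"
  using assms(2)
  by (induction p arbitrary: u) (auto dest: arc_verts[OF assms(1)])

lemma is_walk_append:
  assumes "mgraph G"
  shows "is_walk G u (p @ q) v \<longleftrightarrow> (\<exists>w. is_walk G u p w \<and> is_walk G w q v)"
proof (induction p arbitrary: u)
  case Nil
  then show ?case
    using is_walk_verts[OF assms] by auto
qed auto

lemma is_walk_snoc:
  assumes "mgraph G"
  shows "is_walk G u (p @ [(e, a, b)]) v \<longleftrightarrow> is_walk G u p a \<and> (e, a, b) \<in> arcs G \<and> v = b"
  using arc_verts[OF assms] by (auto simp: is_walk_append[OF assms])

lemma is_walk_rev:
  assumes "mgraph G"
  shows "is_walk G u p v \<Longrightarrow> is_walk G v (rev_walk p) u"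
  by (induction p arbitrary: u)
    (auto simp: is_walk_append[OF assms] intro: arcs_sym arc_verts[OF assms])

lemma is_walk_end_unique: "is_walk G u p v \<Longrightarrow> is_walk G u p w \<Longrightarrow> v = w"
  by (induction p arbitrary: u) auto

lemma is_walk_start: "is_walk G u p v \<Longrightarrow> p \<noteq> [] \<Longrightarrow> hd (walk_starts p) = u"
  by (cases p) auto

lemma is_walk_start_unique: "is_walk G u p v \<Longrightarrow> is_walk G w p x \<Longrightarrow> p \<noteq> [] \<Longrightarrow> u = w"
  by (cases p) auto

lemma is_walk_edges: "is_walk G u p v \<Longrightarrow> wE p \<subseteq> edges G"
proof (induction p arbitrary: u)
  case (Cons x p)
  then show ?case
    using arc_edge by (cases x) fastforce
qed auto

lemma walk_starts_rev:
  assumes "is_walk G u p v"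
  shows "walk_starts (rev_walk p) @ [u] = rev (walk_starts p @ [v])"
  using assms by (induction p arbitrary: u) auto

lemma walk_starts_rev_set:
  assumes "is_walk G u p v"
  shows "insert u (wS (rev_walk p)) = insert v (wS p)"
  using arg_cong[OF walk_starts_rev[OF assms], of set] by simp

lemma is_walk_start_in: "is_walk G u p v \<Longrightarrow> u \<in> insert v (wS p)"
  by (cases p) auto

lemma walk_ends:
  assumes "mgraph G" "is_walk G u p v"
  shows "\<Union>(ends G ` wE p) \<subseteq> insert v (wS p)"
  using assms(2)
proof (induction p arbitrary: u)
  case (Cons x p)
  obtain e a b where x: "x = (e, a, b)" by (cases x)
  have "is_walk G b p v" "(e, a, b) \<in> arcs G"
    using Cons.prems x by auto
  then show ?case
    using Cons.IH[of b] is_walk_start_in[of G b p v] ends_arc[OF assms(1), of e a b] x by auto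
qed auto

lemma walk_ends_eq:
  assumes "mgraph G" "is_walk G u p v" "p \<noteq> []"
  shows "\<Union>(ends G ` wE p) = insert v (wS p)"
proof
  show "\<Union>(ends G ` wE p) \<subseteq> insert v (wS p)"
    by (rule walk_ends[OF assms(1,2)])
  have "v \<in> \<Union>(ends G ` wE p)"
    using assms(2,3)
  proof (induction p arbitrary: u)
    case (Cons x p)
    then show ?case
      by (cases x; cases p) (auto dest: arc_end2)
  qed auto
  moreover have "wS p \<subseteq> \<Union>(ends G ` wE p)"
    using assms(2)
  proof (induction p arbitrary: u)
    case (Cons x p)
    then show ?case
      using arc_end1 by (cases x) fastforce
  qed auto
  ultimately show "insert v (wS p) \<subseteq> \<Union>(ends G ` wE p)"
    by auto
qed

lemma is_path_Nil [simp]: "is_path G u [] v \<longleftrightarrow> u \<in> verts G \<and> u = v"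
  by (simp add: is_path_def)

lemma is_path_Cons:
  "is_path G u ((e, a, b) # p) v \<longleftrightarrow> (e, a, b) \<in> arcs G \<and> a = u \<and> is_path G b p v \<and> u \<notin> insert v (wS p)"
  by (auto simp: is_path_def)

lemma is_path_walk: "is_path G u p v \<Longrightarrow> is_walk G u p v"
  by (simp add: is_path_def)

lemma is_path_append:
  assumes "mgraph G"
  shows "is_path G u (p @ q) v \<longleftrightarrow>
    (\<exists>w. is_path G u p w \<and> is_path G w q v \<and> wS p \<inter> insert v (wS q) = {})"
proof (cases "q = []")
  case True
  then show ?thesis
    using is_walk_verts[OF assms] by (auto simp: is_path_def)
next
  case q: False
  have "is_walk G w q v \<Longrightarrow> w \<in> wS q" for w
    using q by (cases q) auto
  then show ?thesis
    by (auto simp: is_path_def is_walk_append[OF assms])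
qed

lemma is_path_rev:
  assumes "mgraph G" "is_path G u p v"
  shows "is_path G v (rev_walk p) u"
  using assms walk_starts_rev[of G u p v] by (auto simp: is_path_def is_walk_rev)

lemma is_path_single:
  assumes "mgraph G" "(e, a, b) \<in> arcs G" "a \<noteq> b"
  shows "is_path G a [(e, a, b)] b"
  using assms arc_verts[OF assms(1,2)] by (simp add: is_path_Cons)

lemma path_first_edge:
  assumes "mgraph G" "is_path G u ((e, u, w) # p) v"
  shows "e \<notin> wE p" "\<And>f. f \<in> wE p \<Longrightarrow> u \<notin> ends G f"
proof -
  have p: "is_walk G w p v" "u \<notin> insert v (wS p)" "(e, u, w) \<in> arcs G"
    using assms(2) by (auto simp: is_path_Cons is_path_def)
  show *: "\<And>f. f \<in> wE p \<Longrightarrow> u \<notin> ends G f"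
    using walk_ends[OF assms(1) p(1)] p(2) by auto
  show "e \<notin> wE p"
    using * arcsD[OF p(3)] by blast
qed

lemma path_distinct_edges:
  assumes "mgraph G" "is_path G u p v"
  shows "distinct (walk_edges p)"
  using assms(2)
proof (induction p arbitrary: u)
  case (Cons x p)
  obtain e a b where x: "x = (e, a, b)" by (cases x)
  have "e \<notin> wE p"
    using path_first_edge(1)[OF assms(1)] Cons.prems x by (auto simp: is_path_Cons)
  then show ?case
    using Cons x by (auto simp: is_path_Cons)
qed auto

lemma path_no_loop:
  assumes "mgraph G" "is_path G u p v" "e \<in> wE p"
  shows "\<not> is_loop G e"
  using assms(2,3)
proof (induction p arbitrary: u)
  case (Cons x p)
  obtain f a b where x: "x = (f, a, b)" by (cases x)
  have "a \<noteq> b"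
    using Cons.prems(1) x is_walk_start_in[of G b p v] by (auto simp: is_path_Cons is_path_def)
  then show ?case
    using Cons x is_loop_arc[OF assms(1), of f a b] by (auto simp: is_path_Cons)
qed auto

text \<open>A path has only one edge at its first vertex, so its edge set determines it edge by
  edge. This is why a cycle, given as a set of edges, has essentially one walk around it.\<close>

lemma path_same_edges_eq:
  assumes "mgraph G" "is_path G u p v" "is_path G u q v" "wE p = wE q"
  shows "p = q"
  using assms(2-)
proof (induction p arbitrary: u q)
  case (Cons x p)
  obtain e a b where x: "x = (e, a, b)" by (cases x)
  obtain f c d q' where q: "q = (f, c, d) # q'"
    using Cons.prems(3) x by (cases q) auto
  have c: "a = u" "c = u" and arc: "(e, u, b) \<in> arcs G" "(f, u, d) \<in> arcs G"
    using Cons.prems(1,2) x q by (auto simp: is_path_Cons)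
  have "e \<in> wE q"
    using Cons.prems(3) x by auto
  then have ef: "e = f"
    using path_first_edge(2)[OF assms(1), of u f d q' v e] Cons.prems(2) q c arcsD[OF arc(1)] by auto
  then have "b = d"
    using arc_unique[OF assms(1)] arc by blast
  have "e \<notin> wE p" "f \<notin> wE q'"
    using path_first_edge(1)[OF assms(1)] Cons.prems(1,2) x q c by blast+
  then have "wE p = wE q'"
    using Cons.prems(3) x q ef by auto
  then have "p = q'"
    using Cons.IH[of b q'] Cons.prems(1,2) x q \<open>b = d\<close> by (auto simp: is_path_Cons)
  then show ?case
    using x q ef \<open>b = d\<close> c by simp
qed (auto simp: walk_edges_def)

text \<open>The normal form in which cycles are handled: one arc and a path back. The condition
  \<open>e \<notin> wE P\<close> excludes the walk that merely returns along
  \<open>e\<close>.\<close>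

lemma scw_Cons:
  assumes "mgraph G"
  shows "simple_closed_walk G C ((e, a, b) # P) \<longleftrightarrow>
    (e, a, b) \<in> arcs G \<and> is_path G b P a \<and> e \<notin> wE P \<and> C = insert e (wE P)"
proof
  assume *: "simple_closed_walk G C ((e, a, b) # P)"
  then show "(e, a, b) \<in> arcs G \<and> is_path G b P a \<and> e \<notin> wE P \<and> C = insert e (wE P)"
    by (auto simp: simple_closed_walk_def is_path_def)
next
  assume "(e, a, b) \<in> arcs G \<and> is_path G b P a \<and> e \<notin> wE P \<and> C = insert e (wE P)"
  then show "simple_closed_walk G C ((e, a, b) # P)"
    using path_distinct_edges[OF assms] by (auto simp: simple_closed_walk_def is_path_def)
qed

lemma scw_rotate:
  assumes "mgraph G" "simple_closed_walk G C (p @ q)"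
  shows "simple_closed_walk G C (q @ p)"
proof -
  obtain u where "is_walk G u (p @ q) u"
    using assms by (auto simp: simple_closed_walk_def)
  then have "\<exists>w. is_walk G w (q @ p) w"
    by (auto simp: is_walk_append[OF assms(1)])
  then show ?thesis
    using assms(2) by (auto simp: simple_closed_walk_def)
qed

lemma scw_rotate_edge:
  assumes "mgraph G" "simple_closed_walk G C p" "e \<in> C"
  obtains a b p1 p2 where "p = p1 @ (e, a, b) # p2" "simple_closed_walk G C ((e, a, b) # p2 @ p1)"
proof -
  have "e \<in> wE p"
    using assms by (simp add: simple_closed_walk_def)
  then obtain x where "x \<in> set p" "fst x = e"
    by (auto simp: walk_edges_def)
  then obtain a b p1 p2 where "p = p1 @ (e, a, b) # p2"
    by (metis split_list prod.collapse)
  then show thesis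
    using that scw_rotate[OF assms(1), of C p1 "(e, a, b) # p2"] assms(2) by auto
qed

lemma scw_reverse:
  assumes "mgraph G" "simple_closed_walk G C ((e, a, b) # P)"
  shows "simple_closed_walk G C ((e, b, a) # rev_walk P)"
  using assms(2) by (auto simp: scw_Cons[OF assms(1)] arcs_sym is_path_rev[OF assms(1)])

lemma scw_arc:
  assumes "mgraph G" "simple_closed_walk G C p" "(e, a, b) \<in> arcs G" "e \<in> C"
  obtains P where "simple_closed_walk G C ((e, a, b) # P)"
proof -
  obtain c d p1 p2 where p: "simple_closed_walk G C ((e, c, d) # p2 @ p1)"
    using scw_rotate_edge[OF assms(1,2,4)] by metis
  then have "(e, c, d) \<in> arcs G"
    by (simp add: scw_Cons[OF assms(1)])
  then have "c = a \<and> d = b \<or> c = b \<and> d = a"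
    using arc_same_edge[OF assms(1,3)] by blast
  then show thesis
    using p scw_reverse[OF assms(1) p] that by auto
qed

lemma scw_ends:
  assumes "mgraph G" "simple_closed_walk G C p"
  shows "\<Union>(ends G ` C) = wS p"
proof (cases "p = []")
  case True
  then show ?thesis using assms by (auto simp: simple_closed_walk_def)
next
  case False
  obtain u where u: "is_walk G u p u" "C = wE p"
    using assms by (auto simp: simple_closed_walk_def)
  have "u \<in> wS p"
    using u False by (cases p) auto
  then show ?thesis
    using walk_ends_eq[OF assms(1) u(1) False] u by auto
qed

subsection \<open>Cycles and simple closed walks\<close>

lemma joined_refl: "v \<in> verts G \<Longrightarrow> joined G X v v"
  unfolding joined_def by (rule exI[of _ "[]"]) simp

lemma joined_sym: "mgraph G \<Longrightarrow> joined G X u v \<Longrightarrow> joined G X v u"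
  unfolding joined_def by (metis is_walk_rev rev_walk_simps(4))

lemma joined_trans: "mgraph G \<Longrightarrow> joined G X u v \<Longrightarrow> joined G X v w \<Longrightarrow> joined G X u w"
  unfolding joined_def by (metis (no_types, lifting) Un_least is_walk_append set_append walk_edges_simps(3))

lemma joined_arc: "mgraph G \<Longrightarrow> (e, u, v) \<in> arcs G \<Longrightarrow> e \<in> X \<Longrightarrow> joined G X u v"
  unfolding joined_def by (rule exI[of _ "[(e, u, v)]"]) (auto dest: arc_verts)

lemma joined_mono: "joined G X u v \<Longrightarrow> X \<subseteq> Y \<Longrightarrow> joined G Y u v"
  unfolding joined_def by blast

lemma walk_joined:
  assumes "mgraph G" "is_walk G u p v" "x \<in> insert v (wS p)"
  shows "joined G (wE p) u x"
  using assms(2,3)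
proof (induction p arbitrary: u)
  case Nil
  then show ?case by (auto intro: joined_refl)
next
  case (Cons y p)
  obtain e b where y: "y = (e, u, b)" "(e, u, b) \<in> arcs G" "is_walk G b p v"
    using Cons.prems by (cases y) auto
  show ?case
  proof (cases "x = u")
    case True
    then show ?thesis using joined_refl is_walk_verts[OF assms(1) Cons.prems(1)] by simp
  next
    case False
    then have "joined G (wE p) b x"
      using Cons.IH[OF y(3)] Cons.prems(2) y by auto
    then have "joined G (wE (y # p)) b x"
      by (rule joined_mono) (use y in auto)
    moreover have "joined G (wE (y # p)) u b"
      using y by (auto intro: joined_arc[OF assms(1)])
    ultimately show ?thesis
      using joined_trans[OF assms(1)] by blast
  qed
qed

lemma scw_degree:
  assumes "mgraph G" "simple_closed_walk G C p" "v \<in> wS p"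
  shows "vert_degree G C v = 2"
proof -
  obtain x where "x \<in> set p" "fst (snd x) = v"
    using assms(3) by (auto simp: walk_starts_def)
  then obtain e b p1 p2 where "p = p1 @ (e, v, b) # p2"
    by (metis split_list prod.collapse)
  then obtain P where "simple_closed_walk G C ((e, v, b) # P)"
    using scw_rotate[OF assms(1), of C p1 "(e, v, b) # p2"] assms(2) by auto
  then have P: "(e, v, b) \<in> arcs G" "is_path G b P v" "e \<notin> wE P" "C = insert e (wE P)"
    by (auto simp: scw_Cons[OF assms(1)])
  show ?thesis
  proof (cases "P = []")
    case True
    then have "b = v" and C: "C = {e}"
      using P by auto
    then have "{f \<in> C. v \<in> ends G f} = {e}" "{f \<in> C. v \<in> ends G f \<and> is_loop G f} = {e}"
      using ends_arc[OF assms(1) P(1)] is_loop_arc[OF assms(1) P(1)] by auto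
    then show ?thesis
      by (simp add: vert_degree_def)
  next
    case False
    then obtain g x y P' where "P = P' @ [(g, x, y)]"
      by (metis rev_exhaust prod_cases3)
    then have P': "P = P' @ [(g, x, v)]"
      using P(2) is_walk_snoc[OF assms(1)] by (auto simp: is_path_def)
    have r: "is_path G v ((g, v, x) # rev_walk P') b"
      using is_path_rev[OF assms(1) P(2)] P' by simp
    have "v \<notin> ends G f" if "f \<in> wE P'" for f
      using path_first_edge(2)[OF assms(1) r] that by auto
    moreover have "v \<in> ends G g"
      using r arcsD by (fastforce simp: is_path_Cons)
    ultimately have "{f \<in> C. v \<in> ends G f} = {e, g}"
      using P P' arcsD[OF P(1)] by auto
    moreover have "e \<noteq> g"
      using P P' by auto
    moreover have "v \<noteq> b"
      using r by (auto simp: is_path_Cons)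
    then have "{f \<in> C. v \<in> ends G f \<and> is_loop G f} = {}"
      using path_no_loop[OF assms(1) P(2)] is_loop_arc[OF assms(1) P(1)] P by auto
    ultimately show ?thesis
      unfolding vert_degree_def by (metis card_2_iff card.empty add_0_right)
  qed
qed

lemma scw_is_cycle:
  assumes "mgraph G" "simple_closed_walk G C p" "p \<noteq> []"
  shows "is_cycle G C"
proof -
  obtain u where u: "is_walk G u p u" "C = wE p"
    using assms by (auto simp: simple_closed_walk_def)
  have j: "joined G C u x" if "x \<in> \<Union>(ends G ` C)" for x
    using walk_joined[OF assms(1) u(1)] that scw_ends[OF assms(1,2)] u(2) by auto
  then have "joined G C x y" if "x \<in> \<Union>(ends G ` C)" "y \<in> \<Union>(ends G ` C)" for x y
    using that joined_trans[OF assms(1)] joined_sym[OF assms(1)] by meson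
  moreover have "C \<noteq> {}" "C \<subseteq> edges G"
    using u is_walk_edges[OF u(1)] assms(3) by auto
  ultimately show ?thesis
    unfolding is_cycle_def
    using scw_degree[OF assms(1,2)] scw_ends[OF assms(1,2)] by blast
qed

lemma is_cycle_finite: "mgraph G \<Longrightarrow> is_cycle G C \<Longrightarrow> finite C"
  by (auto simp: is_cycle_def mgraph_def intro: finite_subset)

lemma joined_closed:
  assumes "joined G X u v" "u \<in> S"
    "\<And>e a b. (e, a, b) \<in> arcs G \<Longrightarrow> e \<in> X \<Longrightarrow> a \<in> S \<Longrightarrow> b \<in> S"
  shows "v \<in> S"
proof -
  have "is_walk G u p v \<Longrightarrow> wE p \<subseteq> X \<Longrightarrow> u \<in> S \<Longrightarrow> v \<in> S" for p
    by (induction p arbitrary: u) (use assms(3) in auto)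
  then show ?thesis
    using assms(1,2) by (auto simp: joined_def)
qed

text \<open>An edge of \<open>C\<close> outside \<open>D\<close> at a vertex of \<open>D\<close>
  would raise the degree there above 2. Hence the vertices of \<open>D\<close> are closed under the
  edges of \<open>C\<close>, and connectivity of \<open>C\<close> puts all its edges into
  \<open>D\<close>.\<close>

lemma cycle_subset_eq:
  assumes "mgraph G" "is_cycle G C" "is_cycle G D" "D \<subseteq> C"
  shows "D = C"
proof -
  note fin = is_cycle_finite[OF assms(1,2)]
  let ?S = "\<Union>(ends G ` D)"
  have in_D: "e \<in> D" if "e \<in> C" "v \<in> ends G e" "v \<in> ?S" for e v
  proof (rule ccontr)
    assume "e \<notin> D"
    have "v \<in> \<Union>(ends G ` C)" using that by auto
    then have C2: "vert_degree G C v = 2" and D2: "vert_degree G D v = 2"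
      using assms(2,3) that by (auto simp: is_cycle_def)
    have 1: "card {e \<in> D. v \<in> ends G e} < card {e \<in> C. v \<in> ends G e}"
      by (rule psubset_card_mono) (use fin that \<open>e \<notin> D\<close> assms(4) in auto)
    have 2: "card {e \<in> D. v \<in> ends G e \<and> is_loop G e} \<le> card {e \<in> C. v \<in> ends G e \<and> is_loop G e}"
      by (rule card_mono) (use fin assms(4) in auto)
    show False
      using C2 D2 1 2 by (simp add: vert_degree_def)
  qed
  obtain d x where d: "d \<in> D" "x \<in> ends G d"
    using assms(3) mgraphD(2)[OF assms(1)] unfolding is_cycle_def
    by (metis card.empty ex_in_conv subsetD zero_neq_numeral zero_neq_one)
  have "e \<in> D" if e: "e \<in> C" for e
  proof -
    have "e \<in> edges G" using e assms(2) by (auto simp: is_cycle_def)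
    then obtain a b where ab: "(e, a, b) \<in> arcs G"
      using edge_arcE[OF assms(1)] by blast
    then have "a \<in> ends G e"
      by (simp add: arcsD)
    have "joined G C x a"
      using assms(2,4) d e \<open>a \<in> ends G e\<close> unfolding is_cycle_def by blast
    then have "a \<in> ?S"
    proof (rule joined_closed)
      show "x \<in> ?S" using d by auto
      fix f b c assume f: "(f, b, c) \<in> arcs G" "f \<in> C" "b \<in> ?S"
      then have "f \<in> D" using in_D arcsD by fast
      then show "c \<in> ?S" using arcsD[OF f(1)] by auto
    qed
    then show ?thesis
      using in_D[OF e \<open>a \<in> ends G e\<close>] by simp
  qed
  then show ?thesis
    using assms(4) by auto
qed

lemma path_length:
  assumes "mgraph G" "is_path G u p v"
  shows "length p < card (verts G)"
proof -
  have fin: "finite (verts G)" using assms(1) by (simp add: mgraph_def)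
  have "wS p \<subseteq> verts G"
    using assms(2)
  proof (induction p arbitrary: u)
    case (Cons x p)
    then show ?case
      using arc_verts[OF assms(1)] by (cases x) (fastforce simp: is_path_Cons)
  qed auto
  moreover have "v \<in> verts G"
    using is_walk_verts[OF assms(1)] assms(2) by (auto simp: is_path_def)
  ultimately have "card (set (walk_starts p @ [v])) \<le> card (verts G)"
    by (intro card_mono) (use fin in auto)
  moreover have "card (set (walk_starts p @ [v])) = length (walk_starts p @ [v])"
    using assms(2) by (intro distinct_card) (simp add: is_path_def)
  ultimately show ?thesis by simp
qed

text \<open>Every vertex of the edge set \<open>X\<close> not being a leaf, the first vertex of a longest path in
  \<open>X\<close> has a second neighbour, which closes a cycle.\<close>

lemma scw_within:
  assumes "mgraph G" "X \<subseteq> edges G" "X \<noteq> {}"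
    "\<And>v. v \<in> \<Union>(ends G ` X) \<Longrightarrow> vert_degree G X v = 2"
  obtains D p where "D \<subseteq> X" "simple_closed_walk G D p" "p \<noteq> []"
proof (cases "\<exists>e\<in>X. is_loop G e")
  case True
  then obtain e where e: "e \<in> X" "is_loop G e" by auto
  then obtain a b where ab: "(e, a, b) \<in> arcs G"
    using edge_arcE[OF assms(1)] assms(2) by blast
  then have "a = b"
    using is_loop_arc[OF assms(1)] e by blast
  then have "simple_closed_walk G {e} [(e, a, b)]"
    using ab arc_verts[OF assms(1) ab] by (simp add: scw_Cons[OF assms(1)])
  then show thesis
    using that[of "{e}"] e by blast
next
  case no_loop: False
  let ?P = "\<lambda>(u, p, v). is_path G u p v \<and> wE p \<subseteq> X"
  obtain e where e: "e \<in> X" using assms(3) by auto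
  then obtain a b where ab: "(e, a, b) \<in> arcs G"
    using edge_arcE[OF assms(1)] assms(2) by blast
  have "a \<noteq> b"
    using is_loop_arc[OF assms(1) ab] no_loop e by auto
  then have init: "?P (a, [(e, a, b)], b)"
    using is_path_single[OF assms(1) ab] e by auto
  obtain u p v where p: "is_path G u p v" "wE p \<subseteq> X"
    and max: "\<And>u' p' v'. is_path G u' p' v' \<Longrightarrow> wE p' \<subseteq> X \<Longrightarrow> length p' \<le> length p"
  proof -
    have "\<forall>x. ?P x \<longrightarrow> length (fst (snd x)) < card (verts G)"
      using path_length[OF assms(1)] by auto
    then obtain x where "?P x" "\<forall>y. ?P y \<longrightarrow> length (fst (snd y)) \<le> length (fst (snd x))"
      using ex_has_greatest_nat[of ?P "(a, [(e, a, b)], b)" "\<lambda>x. length (fst (snd x))"] init by blast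
    then show thesis
      using that[of "fst x" "fst (snd x)" "snd (snd x)"] by (auto simp: case_prod_unfold)
  qed
  have "p \<noteq> []"
    using max[of a "[(e, a, b)]" b] init by auto
  then obtain f w p' where p': "p = (f, u, w) # p'"
    using p(1) by (cases p) (auto simp: is_path_Cons)
  have f: "f \<in> X" "(f, u, w) \<in> arcs G"
    using p p' by (auto simp: is_path_Cons)
  then have "vert_degree G X u = 2"
    using assms(4) arcsD by fast
  moreover have "{e \<in> X. u \<in> ends G e \<and> is_loop G e} = {}"
    using no_loop by auto
  ultimately have "card {e \<in> X. u \<in> ends G e} = 2"
    by (simp add: vert_degree_def)
  then obtain g where g: "g \<in> X" "u \<in> ends G g" "g \<noteq> f"
    by (auto simp: card_2_iff)
  then obtain y where gy: "(g, y, u) \<in> arcs G"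
    using edge_arcE[OF assms(1), of g] assms(2) ends_arc[OF assms(1)] arcs_sym by (metis insert_iff singletonD subsetD)
  then have "y \<noteq> u"
    using is_loop_arc[OF assms(1)] no_loop g by blast
  show thesis
  proof (cases "y \<in> insert v (wS p)")
    case False
    then have "is_path G y ((g, y, u) # p) v"
      using p(1) gy by (simp add: is_path_Cons)
    then show thesis
      using max[of y "(g, y, u) # p" v] p g by simp
  next
    case True
    have "\<exists>p1 p2. p = p1 @ p2 \<and> is_path G u p1 y"
    proof (cases "y = v")
      case True
      then show ?thesis using p by (intro exI[of _ p] exI[of _ "[]"]) simp
    next
      case False
      then have "y \<in> wS p" using \<open>y \<in> insert v (wS p)\<close> by simp
      then obtain x where "x \<in> set p" "fst (snd x) = y"
        by (auto simp: walk_starts_def)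
      then obtain h b p1 p2 where p12: "p = p1 @ (h, y, b) # p2"
        by (metis split_list prod.collapse)
      then have "is_path G u p1 y"
        using p(1) by (auto simp: is_path_append[OF assms(1)] is_path_Cons)
      then show ?thesis using p12 by blast
    qed
    then obtain p1 p2 where p12: "p = p1 @ p2" "is_path G u p1 y" by blast
    have "g \<notin> wE p"
      using path_first_edge(2)[OF assms(1)] p(1) p' g by auto
    then have "simple_closed_walk G (insert g (wE p1)) ((g, y, u) # p1)"
      using p12 gy by (simp add: scw_Cons[OF assms(1)])
    then show thesis
      using that[of "insert g (wE p1)"] g p p12 by force
  qed
qed

text \<open>The degree condition already yields a simple closed walk on some part of
  \<open>C\<close>. The edges of this walk form a cycle, and as no cycle properly contains another,
  the walk uses all of \<open>C\<close>.\<close>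

lemma is_cycle_scw:
  assumes "mgraph G"
  shows "is_cycle G C \<longleftrightarrow> (\<exists>p. p \<noteq> [] \<and> simple_closed_walk G C p)"
proof
  assume C: "is_cycle G C"
  then have "C \<subseteq> edges G" "C \<noteq> {}" "\<And>v. v \<in> \<Union>(ends G ` C) \<Longrightarrow> vert_degree G C v = 2"
    unfolding is_cycle_def by blast+
  then obtain D p where D: "D \<subseteq> C" "simple_closed_walk G D p" "p \<noteq> []"
    using scw_within[OF assms] by metis
  then have "is_cycle G D"
    using scw_is_cycle[OF assms] by blast
  then have "D = C"
    using cycle_subset_eq[OF assms C] D by blast
  then show "\<exists>p. p \<noteq> [] \<and> simple_closed_walk G C p"
    using D by blast
qed (use scw_is_cycle[OF assms] in blast)

lemma cycle_through_arc:
  assumes "mgraph G" "is_cycle G C" "(e, a, b) \<in> arcs G" "e \<in> C"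
  obtains P where "is_path G b P a" "e \<notin> wE P" "C = insert e (wE P)"
    "simple_closed_walk G C ((e, a, b) # P)"
proof -
  obtain p where "simple_closed_walk G C p"
    using assms is_cycle_scw by blast
  from scw_arc[OF assms(1) this assms(3,4)] show thesis
    using that by (auto simp: scw_Cons[OF assms(1)])
qed

subsection \<open>Integer gains modulo 3\<close>

definition gs :: "('e \<times> 'v \<times> 'v \<Rightarrow> int) \<Rightarrow> ('v, 'e) walk \<Rightarrow> int" where
  "gs \<gamma> p = sum_list (map \<gamma> p)"

text \<open>Integers modulo 3 stand for the elements of \<open>\<int>\<^sub>3\<close>, so that linear arithmetic applies.\<close>

definition zgain :: "('v, 'e) mgraph \<Rightarrow> ('e \<times> 'v \<times> 'v \<Rightarrow> int) \<Rightarrow> bool" where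
  "zgain G \<gamma> \<longleftrightarrow> (\<forall>e u v. (e, u, v) \<in> arcs G \<longrightarrow> u \<noteq> v \<longrightarrow> 3 dvd \<gamma> (e, u, v) + \<gamma> (e, v, u))"

definition bal :: "('v, 'e) mgraph \<Rightarrow> ('e \<times> 'v \<times> 'v \<Rightarrow> int) \<Rightarrow> 'e set \<Rightarrow> bool" where
  "bal G \<gamma> C \<longleftrightarrow> (\<forall>p. simple_closed_walk G C p \<longrightarrow> 3 dvd gs \<gamma> p)"

lemma gs_simps [simp]:
  "gs \<gamma> [] = 0" "gs \<gamma> (x # p) = \<gamma> x + gs \<gamma> p" "gs \<gamma> (p @ q) = gs \<gamma> p + gs \<gamma> q"
  by (simp_all add: gs_def)

lemma gs_cong: "(\<And>x. x \<in> set p \<Longrightarrow> \<gamma> x = \<delta> x) \<Longrightarrow> gs \<gamma> p = gs \<delta> p"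
  by (induction p) auto

lemma zgainD: "zgain G \<gamma> \<Longrightarrow> (e, u, v) \<in> arcs G \<Longrightarrow> u \<noteq> v \<Longrightarrow> 3 dvd \<gamma> (e, u, v) + \<gamma> (e, v, u)"
  by (simp add: zgain_def)

lemma gs_rev_path:
  assumes "zgain G \<gamma>" "is_path G u p v"
  shows "3 dvd gs \<gamma> p + gs \<gamma> (rev_walk p)"
  using assms(2)
proof (induction p arbitrary: u)
  case (Cons x p)
  obtain e a b where x: "x = (e, a, b)" by (cases x)
  have b: "is_path G b p v" "(e, a, b) \<in> arcs G" "a \<notin> insert v (wS p)"
    using Cons.prems x by (auto simp: is_path_Cons)
  then have "a \<noteq> b"
    using is_walk_start_in[of G b p v] by (auto simp: is_path_def)
  then have "3 dvd \<gamma> (e, a, b) + \<gamma> (e, b, a)"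
    using zgainD[OF assms(1) b(2)] by blast
  from dvd_add[OF this Cons.IH[OF b(1)]] show ?case
    using x by (simp add: algebra_simps)
qed simp

lemma arith_sum_dvd3:
  fixes a b c d :: int
  assumes "3 dvd a + b" "3 dvd c + d" "3 dvd b + c"
  shows "3 dvd d + a"
  using assms by presburger

text \<open>Rotate any other walk so that it starts with the same edge; what follows is a path with
  the same edges as \<open>P\<close>, hence \<open>P\<close> or its reverse. Rotation keeps the sum
  and reversal negates it modulo 3, so balance may be tested on a single walk.\<close>

lemma bal_scw:
  assumes "mgraph G" "zgain G \<gamma>" "simple_closed_walk G C p"
  shows "bal G \<gamma> C \<longleftrightarrow> 3 dvd gs \<gamma> p"
proof -
  have "3 dvd gs \<gamma> q" if q: "simple_closed_walk G C q" and d: "3 dvd gs \<gamma> p" for q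
  proof (cases p)
    case Nil
    then show ?thesis using q assms(3) by (auto simp: simple_closed_walk_def)
  next
    case (Cons x P)
    obtain e a b where x: "x = (e, a, b)" by (cases x)
    have P: "is_path G b P a" "(e, a, b) \<in> arcs G" "C = insert e (wE P)" "e \<notin> wE P"
      using assms(3) Cons x by (auto simp: scw_Cons[OF assms(1)])
    obtain c d q1 q2 where qs: "q = q1 @ (e, c, d) # q2"
      and Q: "simple_closed_walk G C ((e, c, d) # q2 @ q1)"
    proof -
      have "e \<in> C" using P(3) by simp
      show thesis by (rule scw_rotate_edge[OF assms(1) q \<open>e \<in> C\<close>]) (rule that)
    qed
    have Q': "is_path G d (q2 @ q1) c" "(e, c, d) \<in> arcs G" "C = insert e (wE (q2 @ q1))" "e \<notin> wE (q2 @ q1)"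
      using Q by (auto simp only: scw_Cons[OF assms(1)])
    have E: "wE P = wE (q2 @ q1)"
      using P Q' by auto
    have gq: "gs \<gamma> q = \<gamma> (e, c, d) + gs \<gamma> (q2 @ q1)"
      using qs by simp
    consider "c = a" "d = b" | "c = b" "d = a"
      using arc_same_edge[OF assms(1) P(2) Q'(2)] by auto
    then show ?thesis
    proof cases
      case 1
      then have "P = q2 @ q1"
        using path_same_edges_eq[OF assms(1) P(1) _ E] Q' by blast
      then show ?thesis using d gq 1 Cons x by simp
    next
      case 2
      show ?thesis
      proof (cases "a = b")
        \<comment> \<open>For a loop, \<open>\<gamma>\<close> need not be antisymmetric, but then
          both walks consist of that loop alone, traversed as the same arc.\<close>
        case True
        then have "P = q2 @ q1"
          using path_same_edges_eq[OF assms(1) P(1) _ E] Q' 2 by blast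
        then show ?thesis using d gq 2 True Cons x by simp
      next
        case False
        have "P = rev_walk (q2 @ q1)"
          by (rule path_same_edges_eq[OF assms(1) P(1) is_path_rev[OF assms(1)]])
            (use Q' E 2 in \<open>auto simp del: walk_edges_simps(3) rev_walk_simps(3)\<close>)
        moreover have "3 dvd gs \<gamma> (q2 @ q1) + gs \<gamma> (rev_walk (q2 @ q1))"
          by (rule gs_rev_path[OF assms(2) Q'(1)])
        moreover have "3 dvd \<gamma> (e, a, b) + \<gamma> (e, b, a)"
          by (rule zgainD[OF assms(2) P(2) False])
        ultimately show ?thesis
          using d gq 2 Cons x arith_sum_dvd3[of "gs \<gamma> (q2 @ q1)" "gs \<gamma> P" "\<gamma> (e, a, b)" "\<gamma> (e, b, a)"]
          by (simp only: gs_simps(2) add.commute)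
      qed
    qed
  qed
  then show ?thesis
    using assms(3) by (auto simp: bal_def)
qed

section \<open>Translation between gains in the group of order 3 and integers modulo 3\<close>

lemma Z3_carrier: "carrier (integer_mod_group 3) = {0..<3}"
  by (simp add: carrier_integer_mod_group)

lemma Z3_mult: "x \<otimes>\<^bsub>integer_mod_group 3\<^esub> y = (x + y) mod 3"
  by (simp add: integer_mod_group_def)

lemma Z3_one: "\<one>\<^bsub>integer_mod_group 3\<^esub> = 0"
  by (simp add: integer_mod_group_def)

lemma Z3_inv: "x \<in> {0..<3} \<Longrightarrow> inv\<^bsub>integer_mod_group 3\<^esub> x = (- x) mod 3"
  using inv_integer_mod_group[of x 3] by (simp add: carrier_integer_mod_group)

lemma Z3_walk_gain: "walk_gain (integer_mod_group 3) \<gamma> p = gs \<gamma> p mod 3"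
  by (induction p) (auto simp: walk_gain_def Z3_one Z3_mult mod_simps)

lemma gs_mod: "gs (\<lambda>x. \<gamma> x mod 3) p mod 3 = gs \<gamma> p mod (3::int)"
  by (induction p) (auto, metis mod_add_cong mod_mod_trivial)

lemma gainable_Z3_iff:
  assumes "mgraph G"
  shows "gainable (integer_mod_group 3) (G, B) \<longleftrightarrow> (\<exists>\<gamma>. zgain G \<gamma> \<and> B = {C. is_cycle G C \<and> bal G \<gamma> C})"
proof
  assume "gainable (integer_mod_group 3) (G, B)"
  then obtain \<gamma> where \<gamma>: "gaining (integer_mod_group 3) G \<gamma>" "B = gain_balanced (integer_mod_group 3) G \<gamma>"
    by auto
  have "3 dvd \<gamma> (e, u, v) + \<gamma> (e, v, u)" if "(e, u, v) \<in> arcs G" "u \<noteq> v" for e u v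
  proof -
    have "\<not> is_loop G e" using that is_loop_arc[OF assms] by blast
    have "\<gamma> \<in> arcs G \<rightarrow> carrier (integer_mod_group 3)"
      using \<gamma>(1) by (simp add: gaining_def)
    from funcset_mem[OF this that(1)] have "\<gamma> (e, u, v) \<in> {0..<3}"
      by (simp add: Z3_carrier)
    moreover have "\<gamma> (e, v, u) = inv\<^bsub>integer_mod_group 3\<^esub> \<gamma> (e, u, v)"
      using \<gamma>(1) that(1) \<open>\<not> is_loop G e\<close> unfolding gaining_def by blast
    ultimately have "\<gamma> (e, v, u) = (- \<gamma> (e, u, v)) mod 3"
      using Z3_inv by simp
    then show ?thesis by presburger
  qed
  then have "zgain G \<gamma>" by (simp add: zgain_def)
  moreover have "B = {C. is_cycle G C \<and> bal G \<gamma> C}"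
    using \<gamma>(2) by (simp add: gain_balanced_def bal_def Z3_walk_gain Z3_one dvd_eq_mod_eq_0)
  ultimately show "\<exists>\<gamma>. zgain G \<gamma> \<and> B = {C. is_cycle G C \<and> bal G \<gamma> C}" by blast
next
  assume "\<exists>\<gamma>. zgain G \<gamma> \<and> B = {C. is_cycle G C \<and> bal G \<gamma> C}"
  then obtain \<gamma> where \<gamma>: "zgain G \<gamma>" "B = {C. is_cycle G C \<and> bal G \<gamma> C}" by blast
  let ?\<delta> = "\<lambda>x. \<gamma> x mod 3"
  have "?\<delta> (e, v, u) = inv\<^bsub>integer_mod_group 3\<^esub> ?\<delta> (e, u, v)"
    if "(e, u, v) \<in> arcs G" "\<not> is_loop G e" for e u v
  proof -
    have "u \<noteq> v" using that is_loop_arc[OF assms] by blast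
    then have "3 dvd \<gamma> (e, u, v) + \<gamma> (e, v, u)"
      using zgainD[OF \<gamma>(1) that(1)] by blast
    then have "\<gamma> (e, v, u) mod 3 = (- (\<gamma> (e, u, v) mod 3)) mod 3" by presburger
    then show ?thesis
      using Z3_inv[of "?\<delta> (e, u, v)"] by simp
  qed
  then have "gaining (integer_mod_group 3) G ?\<delta>"
    by (auto simp: gaining_def Z3_carrier)
  moreover have "B = gain_balanced (integer_mod_group 3) G ?\<delta>"
    using \<gamma>(2) gs_mod[of \<gamma>] by (simp add: gain_balanced_def bal_def Z3_walk_gain Z3_one dvd_eq_mod_eq_0)
  ultimately show "gainable (integer_mod_group 3) (G, B)" by auto
qed

subsection \<open>Cycles from pairs of paths and thetas\<close>

abbreviation idisj :: "('v, 'e) walk \<Rightarrow> ('v, 'e) walk \<Rightarrow> bool" where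
  "idisj \<equiv> internally_disjoint"

lemma idisj_iff:
  "idisj p q \<longleftrightarrow> set (tl (walk_starts p)) \<inter> set (tl (walk_starts q)) = {} \<and> wE p \<inter> wE q = {}"
  by (simp add: internally_disjoint_def internal_verts_def)

lemma idisj_sym: "idisj p q \<Longrightarrow> idisj q p"
  by (auto simp: idisj_iff)

lemma path_starts_tl: "is_path G u p v \<Longrightarrow> u \<noteq> v \<Longrightarrow> walk_starts p = u # tl (walk_starts p)"
  by (cases p) (auto simp: is_path_Cons)

lemma idisj_scw:
  assumes "mgraph G" "is_path G u p v" "is_path G u q v" "u \<noteq> v" "idisj p q"
  shows "simple_closed_walk G (wE p \<union> wE q) (p @ rev_walk q)"
proof -
  have w: "is_walk G u (p @ rev_walk q) u"
    using assms by (auto simp: is_walk_append[OF assms(1)] is_path_def intro: is_walk_rev[OF assms(1)])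
  have p: "walk_starts p = u # tl (walk_starts p)" and q: "walk_starts q = u # tl (walk_starts q)"
    using path_starts_tl assms by fast+
  have dp: "distinct (walk_starts p @ [v])" and dq: "distinct (walk_starts q @ [v])"
    using assms by (auto simp: is_path_def)
  have "walk_starts (rev_walk q) @ [u] = v # rev (walk_starts q)"
    using walk_starts_rev[of G u q v] assms(3) by (simp add: is_path_def)
  also have "\<dots> = (v # rev (tl (walk_starts q))) @ [u]"
    by (subst q) simp
  finally have r: "walk_starts (rev_walk q) = v # rev (tl (walk_starts q))"
    by simp
  have "distinct (u # tl (walk_starts q))" "v \<notin> set (u # tl (walk_starts q))"
    using dq q by (metis distinct_append disjoint_iff list.set_intros(1))+
  then have "v \<notin> set (tl (walk_starts q))" "u \<notin> set (tl (walk_starts q))"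
    "distinct (tl (walk_starts q))"
    by auto
  moreover have "v \<notin> wS p" "distinct (walk_starts p)"
    using dp by auto
  moreover have "wS p = insert u (set (tl (walk_starts p)))"
    by (subst p) simp
  ultimately have "distinct (walk_starts (p @ rev_walk q))"
    using assms(4,5) by (auto simp: r idisj_iff)
  moreover have "distinct (walk_edges (p @ rev_walk q))"
    using path_distinct_edges[OF assms(1)] assms by (auto simp: walk_edges_rev_walk idisj_iff)
  ultimately show ?thesis
    using w by (auto simp: simple_closed_walk_def)
qed

lemma idisj_cycle:
  assumes "mgraph G" "is_path G u p v" "is_path G u q v" "u \<noteq> v" "idisj p q"
  shows "is_cycle G (wE p \<union> wE q)"
proof (rule scw_is_cycle[OF assms(1) idisj_scw[OF assms]])
  show "p @ rev_walk q \<noteq> []" using assms(2,4) by auto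
qed

text \<open>Reversing \<open>q\<close> negates its gain, so a cycle cut into two paths imposes a
  linear condition modulo 3 on their gains. Most balance conditions below are used in this
  form.\<close>

lemma idisj_bal:
  assumes "mgraph G" "zgain G \<gamma>" "is_path G u p v" "is_path G u q v" "u \<noteq> v" "idisj p q"
  shows "bal G \<gamma> (wE p \<union> wE q) \<longleftrightarrow> 3 dvd gs \<gamma> p - gs \<gamma> q"
proof -
  have "3 dvd gs \<gamma> q + gs \<gamma> (rev_walk q)"
    by (rule gs_rev_path[OF assms(2,4)])
  from dvd_diff_left_iff[OF this, of "gs \<gamma> (p @ rev_walk q)"]
  have "3 dvd gs \<gamma> (p @ rev_walk q) \<longleftrightarrow> 3 dvd gs \<gamma> p - gs \<gamma> q"
    by simp
  then show ?thesis
    using bal_scw[OF assms(1,2) idisj_scw[OF assms(1,3-6)]] by simp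
qed

text \<open>Inner vertices of a path in a theta have degree 2 there, so that a cycle in the theta
  contains all or none of its edges.\<close>

lemma degree2_pair:
  assumes "mgraph G" "is_cycle G C" "v \<in> ends G e" "e \<in> C" "{x \<in> C. v \<in> ends G x} \<subseteq> {e, f}"
    "\<not> is_loop G e"
  shows "f \<in> C"
proof (rule ccontr)
  assume "f \<notin> C"
  then have *: "{x \<in> C. v \<in> ends G x} = {e}"
    using assms by auto
  then have **: "{x \<in> C. v \<in> ends G x \<and> is_loop G x} = {}"
    using assms(6) by auto
  have "vert_degree G C v = 1"
    unfolding vert_degree_def * ** by simp
  then show False
    using assms(2-4) by (auto simp: is_cycle_def)
qed

lemma cycle_path_all:
  assumes "mgraph G" "is_cycle G C" "is_path G u p v" "wE p \<inter> C \<noteq> {}"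
    "\<And>x f. x \<in> set (tl (walk_starts p)) \<Longrightarrow> f \<in> C \<Longrightarrow> x \<in> ends G f \<Longrightarrow> f \<in> wE p"
  shows "wE p \<subseteq> C"
  using assms(3-)
proof (induction p arbitrary: u)
  case Nil
  then show ?case by simp
next
  case (Cons y p)
  obtain f b where y: "y = (f, u, b)" "(f, u, b) \<in> arcs G" "is_path G b p v"
    using Cons.prems(1) by (cases y) (auto simp: is_path_Cons)
  show ?case
  proof (cases p)
    case Nil
    then show ?thesis using Cons.prems y by auto
  next
    case (Cons z p')
    obtain g c where z: "z = (g, b, c)" "(g, b, c) \<in> arcs G" "is_path G c p' v"
      using y Cons by (cases z) (auto simp: is_path_Cons)
    have nl: "\<not> is_loop G f" "\<not> is_loop G g"
      using path_no_loop[OF assms(1) Cons.prems(1)] y z Cons by auto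
    have fg: "{x \<in> C. b \<in> ends G x} \<subseteq> {f, g}"
    proof -
      have "x \<in> wE (y # p)" if "x \<in> C" "b \<in> ends G x" for x
        using Cons.prems(3)[of b x] that y z Cons by auto
      moreover have "b \<notin> ends G x" if "x \<in> wE p'" for x
        using path_first_edge(2)[OF assms(1), of b g c p' v x] that y z Cons by auto
      ultimately show ?thesis using y z Cons by auto
    qed
    have fe: "f \<in> C \<longleftrightarrow> g \<in> C"
      using degree2_pair[OF assms(1,2) arc_end2[OF y(2)] _ _ nl(1), of g]
        degree2_pair[OF assms(1,2) arc_end1[OF z(2)] _ _ nl(2), of f] fg by (auto simp: insert_commute)
    have notin_f: "x \<notin> ends G f" if "x \<in> set (tl (walk_starts p))" for x
    proof -
      have "x \<noteq> b" "x \<noteq> u"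
        using that Cons.prems(1) y Cons z by (auto simp: is_path_Cons)
      then show ?thesis using ends_arc[OF assms(1) y(2)] by auto
    qed
    have "wE p \<inter> C \<noteq> {}"
      using Cons.prems(2) y fe z Cons by auto
    moreover have "h \<in> wE p" if "x \<in> set (tl (walk_starts p))" "h \<in> C" "x \<in> ends G h" for x h
      using Cons.prems(3)[of x h] that notin_f[of x] y Cons z by auto
    ultimately have "wE p \<subseteq> C"
      by (rule Cons.IH[OF y(3)])
    then show ?thesis using fe y z Cons by auto
  qed
qed

lemma path_start_edge:
  assumes "mgraph G" "is_path G u p v" "u \<noteq> v"
  obtains e where "e \<in> wE p" "u \<in> ends G e" "\<And>f. f \<in> wE p \<Longrightarrow> u \<in> ends G f \<Longrightarrow> f = e"
proof -
  obtain e b p' where p: "p = (e, u, b) # p'" "(e, u, b) \<in> arcs G"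
    using assms(2,3) by (cases p) (auto simp: is_path_Cons)
  show thesis
  proof (rule that)
    show "e \<in> wE p" "u \<in> ends G e"
      using p arc_end1[OF p(2)] by auto
    show "f = e" if "f \<in> wE p" "u \<in> ends G f" for f
      using path_first_edge(2)[OF assms(1), of u e b p' v f] assms(2) p that by auto
  qed
qed

lemma path_inner:
  assumes "mgraph G" "is_path G u p v" "u \<noteq> v" "e \<in> wE p"
  shows "ends G e \<subseteq> {u, v} \<union> set (tl (walk_starts p))"
proof -
  have "ends G e \<subseteq> insert v (wS p)"
    using walk_ends[OF assms(1), of u p v] assms by (auto simp: is_path_def)
  moreover have "wS p = insert u (set (tl (walk_starts p)))"
    using path_starts_tl[OF assms(2,3)] by (metis list.simps(15))
  ultimately show ?thesis by auto
qed

text \<open>\<open>C\<close> contains each of the three paths entirely or not at all, and its degree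
  at \<open>u\<close> counts the paths that it contains. Since this degree is 2, exactly two of them
  are used.\<close>

lemma theta_cycles:
  assumes G: "mgraph G" and C: "is_cycle G C" and "u \<noteq> v"
    and p: "is_path G u p v" and q: "is_path G u q v" and r: "is_path G u r v"
    and pq: "idisj p q" and pr: "idisj p r" and qr: "idisj q r"
    and sub: "C \<subseteq> wE p \<union> wE q \<union> wE r"
  shows "C \<in> {wE p \<union> wE q, wE p \<union> wE r, wE q \<union> wE r}"
proof -
  have uv: "u \<notin> set (tl (walk_starts x))" "v \<notin> set (tl (walk_starts x))" if "is_path G u x v" for x
    using that path_starts_tl[OF that \<open>u \<noteq> v\<close>]
    by (metis distinct.simps(2) distinct_append is_path_def, metis Un_iff disjoint_iff distinct_append
        is_path_def list.set_intros(1,2))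
  have all: "wE x \<subseteq> C" if x: "is_path G u x v" "idisj x y" "idisj x z" "is_path G u y v" "is_path G u z v"
    "C \<subseteq> wE x \<union> wE y \<union> wE z" "wE x \<inter> C \<noteq> {}" for x y z
  proof (rule cycle_path_all[OF G C x(1,7)])
    fix w f assume w: "w \<in> set (tl (walk_starts x))" "f \<in> C" "w \<in> ends G f"
    have "w \<noteq> u" "w \<noteq> v" "w \<notin> set (tl (walk_starts y))" "w \<notin> set (tl (walk_starts z))"
      using w uv[OF x(1)] x(2,3) by (auto simp: idisj_iff)
    then have "f \<notin> wE y" "f \<notin> wE z"
      using w(3) path_inner[OF G x(4) \<open>u \<noteq> v\<close>, of f] path_inner[OF G x(5) \<open>u \<noteq> v\<close>, of f] by auto
    then show "f \<in> wE x" using w x by auto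
  qed
  have p': "wE p \<inter> C = {} \<or> wE p \<subseteq> C" using all[OF p pq pr q r sub] by blast
  have q': "wE q \<inter> C = {} \<or> wE q \<subseteq> C"
    using all[OF q idisj_sym[OF pq] qr p r] sub by blast
  have r': "wE r \<inter> C = {} \<or> wE r \<subseteq> C"
    using all[OF r idisj_sym[OF pr] idisj_sym[OF qr] p q] sub by blast
  obtain ep where ep: "ep \<in> wE p" "u \<in> ends G ep" "\<And>f. f \<in> wE p \<Longrightarrow> u \<in> ends G f \<Longrightarrow> f = ep"
    using path_start_edge[OF G p \<open>u \<noteq> v\<close>] by blast
  obtain eq where eq: "eq \<in> wE q" "u \<in> ends G eq" "\<And>f. f \<in> wE q \<Longrightarrow> u \<in> ends G f \<Longrightarrow> f = eq"
    using path_start_edge[OF G q \<open>u \<noteq> v\<close>] by blast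
  obtain er where er: "er \<in> wE r" "u \<in> ends G er" "\<And>f. f \<in> wE r \<Longrightarrow> u \<in> ends G f \<Longrightarrow> f = er"
    using path_start_edge[OF G r \<open>u \<noteq> v\<close>] by blast
  have notin: "ep \<notin> wE q" "ep \<notin> wE r" "eq \<notin> wE p" "eq \<notin> wE r" "er \<notin> wE p" "er \<notin> wE q"
    using ep(1) eq(1) er(1) pq pr qr by (auto simp: idisj_iff)
  then have ne: "ep \<noteq> eq" "ep \<noteq> er" "eq \<noteq> er"
    using ep(1) eq(1) by auto
  have deg: "vert_degree G C u = card (C \<inter> {ep, eq, er})"
  proof -
    have "x \<in> {ep, eq, er}" if "x \<in> C" "u \<in> ends G x" for x
      using ep(3)[of x] eq(3)[of x] er(3)[of x] that sub by blast
    then have "{e \<in> C. u \<in> ends G e} = C \<inter> {ep, eq, er}"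
      using ep(2) eq(2) er(2) by auto
    moreover have *: "{e \<in> C. u \<in> ends G e \<and> is_loop G e} = {}"
      using sub path_no_loop[OF G p] path_no_loop[OF G q] path_no_loop[OF G r] by blast
    ultimately show ?thesis unfolding vert_degree_def * by simp
  qed
  have "C \<noteq> {}" using C by (simp add: is_cycle_def)
  then have "C \<inter> {ep, eq, er} \<noteq> {}"
    using sub p' q' r' ep(1) eq(1) er(1) by auto
  then have "u \<in> \<Union>(ends G ` C)"
    using ep(2) eq(2) er(2) by auto
  then have "vert_degree G C u = 2"
    using C unfolding is_cycle_def by blast
  then have c: "card (C \<inter> {ep, eq, er}) = 2" using deg by simp
  have "C = (if ep \<in> C then wE p else {}) \<union> (if eq \<in> C then wE q else {}) \<union> (if er \<in> C then wE r else {})"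
    using sub p' q' r' ep(1) eq(1) er(1) by (auto split: if_splits)
  moreover have "card (C \<inter> {ep, eq, er}) = (if ep \<in> C then 1 else 0) + (if eq \<in> C then 1 else 0) + (if er \<in> C then 1 else 0)"
    using ne by (auto simp: Int_insert_right)
  ultimately show ?thesis
    using c by (auto split: if_splits)
qed

text \<open>A theta has only three cycles; if the third one were unbalanced, the theta would contain
  exactly two balanced cycles.\<close>

lemma biased_theta:
  assumes B: "biased_graph (G, B)" and "u \<noteq> v"
    and p: "is_path G u p v" and q: "is_path G u q v" and r: "is_path G u r v"
    and pq: "idisj p q" and pr: "idisj p r" and qr: "idisj q r"
    and b: "wE p \<union> wE q \<in> B" "wE p \<union> wE r \<in> B"
  shows "wE q \<union> wE r \<in> B"
proof (rule ccontr)
  assume n: "wE q \<union> wE r \<notin> B"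
  have G: "mgraph G" using B by (simp only: biased_graph.simps)
  let ?T = "wE p \<union> wE q \<union> wE r"
  have "C \<in> {wE p \<union> wE q, wE p \<union> wE r}" if "C \<in> B" "C \<subseteq> ?T" for C
    using theta_cycles[OF G _ assms(2-8) that(2)] B that n by auto
  then have "{C \<in> B. C \<subseteq> ?T} = {wE p \<union> wE q, wE p \<union> wE r}"
    using b by auto
  moreover obtain e where "e \<in> wE q"
    using path_start_edge[OF G q assms(2)] by blast
  then have "wE p \<union> wE q \<noteq> wE p \<union> wE r"
    using pq qr by (auto simp: idisj_iff)
  ultimately have "card {C \<in> B. C \<subseteq> ?T} = 2" by simp
  moreover have "is_theta G ?T"
    unfolding is_theta_def using assms by blast
  ultimately show False using B by (metis biased_graph.simps)
qed

subsection \<open>Walks and paths\<close>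

lemma path_split_at:
  assumes "mgraph G" "is_path G u p v" "x \<in> insert v (wS p)"
  obtains p1 p2 where "p = p1 @ p2" "is_path G u p1 x" "is_path G x p2 v"
proof (cases "x = v")
  case True
  then show ?thesis
    using that[of p "[]"] assms(2) is_walk_verts[OF assms(1), of u p v] by (simp add: is_path_def)
next
  case False
  then obtain y where "y \<in> set p" "fst (snd y) = x"
    using assms(3) by (auto simp: walk_starts_def)
  then obtain h b p1 p2 where p12: "p = p1 @ (h, x, b) # p2"
    by (metis split_list prod.collapse)
  then show ?thesis
    using assms(2) that[of p1 "(h, x, b) # p2"] by (auto simp: is_path_append[OF assms(1)] is_path_Cons)
qed

lemma walk_to_path:
  assumes "mgraph G" "is_walk G u p v"
  shows "\<exists>q. is_path G u q v \<and> wE q \<subseteq> wE p"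
  using assms(2)
proof (induction p arbitrary: u)
  case Nil
  then have "is_path G u [] v" by auto
  then show ?case by blast
next
  case (Cons x p)
  obtain e b where x: "x = (e, u, b)" "(e, u, b) \<in> arcs G" "is_walk G b p v"
    using Cons.prems by (cases x) auto
  obtain q where q: "is_path G b q v" "wE q \<subseteq> wE p"
    using Cons.IH[OF x(3)] by blast
  show ?case
  proof (cases "u \<in> insert v (wS q)")
    case True
    obtain q1 q2 where "q = q1 @ q2" "is_path G u q2 v"
      by (rule path_split_at[OF assms(1) q(1) True])
    then show ?thesis
      using q x by (intro exI[of _ q2]) auto
  next
    case False
    then have "is_path G u (x # q) v"
      using q x by (simp add: is_path_Cons)
    then show ?thesis
      using q x by (intro exI[of _ "x # q"]) auto
  qed
qed

lemma not_distinct_starts_split: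
  assumes "\<not> distinct (walk_starts p)"
  obtains r1 e x y r2 f z r3 where "p = r1 @ ((e, x, y) # r2) @ (f, x, z) # r3"
proof -
  obtain xs w ys zs where d: "walk_starts p = xs @ [w] @ ys @ [w] @ zs"
    using not_distinct_decomp[OF assms] by blast
  then obtain r1 p1 where 1: "p = r1 @ p1" "walk_starts p1 = w # ys @ w # zs"
    unfolding walk_starts_def by (auto simp: map_eq_append_conv)
  then obtain e y p2 where 2: "p1 = (e, w, y) # p2" "walk_starts p2 = ys @ w # zs"
    by (cases p1) auto
  then obtain r2 p3 where 3: "p2 = r2 @ p3" "walk_starts p3 = w # zs"
    unfolding walk_starts_def by (auto simp: map_eq_append_conv)
  then obtain f z p4 where 4: "p3 = (f, w, z) # p4"
    by (cases p3) auto
  show thesis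
    using that[of r1 e w y r2 f z p4] 1 2 3 4 by simp
qed

lemma closed_walk_contains_cycle:
  assumes "mgraph G" "is_walk G u p u" "p \<noteq> []" "distinct (walk_edges p)"
  shows "\<exists>D \<subseteq> wE p. is_cycle G D"
  using assms(2-)
proof (induction p arbitrary: u rule: length_induct)
  case (1 p)
  show ?case
  proof (cases "distinct (walk_starts p)")
    case True
    then have "simple_closed_walk G (wE p) p"
      using 1 by (auto simp: simple_closed_walk_def)
    then show ?thesis
      using scw_is_cycle[OF assms(1)] 1 by blast
  next
    case False
    from not_distinct_starts_split[OF False] obtain r1 e x y r2 f z r3
      where p: "p = r1 @ ((e, x, y) # r2) @ (f, x, z) # r3" by blast
    then have "is_walk G x ((e, x, y) # r2) x"
      using 1(2) by (auto simp: is_walk_append[OF assms(1)])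
    moreover have "length ((e, x, y) # r2) < length p" "distinct (walk_edges ((e, x, y) # r2))"
      using p 1(4) by auto
    ultimately have "\<exists>D \<subseteq> wE ((e, x, y) # r2). is_cycle G D"
      using 1(1) by blast
    then show ?thesis
      using p by auto
  qed
qed

text \<open>A vertex repeated by the trail would cut off a closed trail on a proper subset of
  \<open>C\<close>, and this contains a cycle, contrary to minimality. The lemma serves to recognize
  projections of lifted cycles as simple closed walks.\<close>

lemma closed_trail_scw:
  assumes "mgraph G" "is_cycle G C" "is_walk G u p u" "distinct (walk_edges p)" "wE p = C"
  shows "simple_closed_walk G C p"
proof (cases "distinct (walk_starts p)")
  case True
  then show ?thesis using assms by (auto simp: simple_closed_walk_def)
next
  case False
  from not_distinct_starts_split[OF False] obtain r1 e x y r2 f z r3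
    where p: "p = r1 @ ((e, x, y) # r2) @ (f, x, z) # r3" by blast
  then have "is_walk G x ((e, x, y) # r2) x"
    using assms(3) by (auto simp: is_walk_append[OF assms(1)])
  moreover have "distinct (walk_edges ((e, x, y) # r2))"
    using p assms(4) by auto
  ultimately obtain D where D: "D \<subseteq> wE ((e, x, y) # r2)" "is_cycle G D"
    using closed_walk_contains_cycle[OF assms(1)] by blast
  have "D \<subseteq> C" using D p assms(5) by auto
  then have "D = C" using cycle_subset_eq[OF assms(1,2) D(2)] by blast
  moreover have "f \<in> C" "f \<notin> D" using p assms(4,5) D by auto
  ultimately show ?thesis by simp
qed

text \<open>A repeated vertex splits the walk into two shorter closed walks. Without one, the walk
  is empty, goes around a balanced cycle, or runs back and forth along one edge.\<close>

lemma closed_walk_gain_zero: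
  assumes "mgraph G" "zgain G \<gamma>" "\<And>C. is_cycle G C \<Longrightarrow> C \<subseteq> A \<Longrightarrow> bal G \<gamma> C"
    "is_walk G u p u" "wE p \<subseteq> A"
  shows "3 dvd gs \<gamma> p"
  using assms(4-)
proof (induction p arbitrary: u rule: length_induct)
  case (1 p)
  show ?case
  proof (cases "distinct (walk_starts p)")
    case False
    from not_distinct_starts_split[OF False] obtain r1 e x y r2 f z r3
      where p: "p = r1 @ ((e, x, y) # r2) @ (f, x, z) # r3" by blast
    have "is_walk G x ((e, x, y) # r2) x" "is_walk G u (r1 @ (f, x, z) # r3) u"
      using p 1(2) by (auto simp: is_walk_append[OF assms(1)])
    moreover have "length ((e, x, y) # r2) < length p" "length (r1 @ (f, x, z) # r3) < length p"
      "wE ((e, x, y) # r2) \<subseteq> A" "wE (r1 @ (f, x, z) # r3) \<subseteq> A"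
      using p 1(3) by auto
    ultimately have "3 dvd gs \<gamma> ((e, x, y) # r2)" "3 dvd gs \<gamma> (r1 @ (f, x, z) # r3)"
      using 1(1) by blast+
    from dvd_add[OF this] show ?thesis
      using p by (simp add: algebra_simps)
  next
    case True
    show ?thesis
    proof (cases "distinct (walk_edges p)")
      case d: True
      have s: "simple_closed_walk G (wE p) p"
        using 1 True d by (auto simp: simple_closed_walk_def)
      show ?thesis
      proof (cases "p = []")
        case False
        then have "is_cycle G (wE p)" using scw_is_cycle[OF assms(1) s] by blast
        then show ?thesis using assms(3)[of "wE p"] 1 s by (auto simp: bal_def)
      qed simp
    next
      case False
      obtain xs e ys zs where d: "walk_edges p = xs @ [e] @ ys @ [e] @ zs"
        using not_distinct_decomp[OF False] by blast
      then obtain r1 p1 where 1: "p = r1 @ p1" "walk_edges p1 = e # ys @ e # zs"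
        unfolding walk_edges_def by (auto simp: map_eq_append_conv)
      then obtain a b p2 where 2: "p1 = (e, a, b) # p2" "walk_edges p2 = ys @ e # zs"
        by (cases p1) auto
      then obtain r2 p3 where 3: "p2 = r2 @ p3" "walk_edges p3 = e # zs"
        unfolding walk_edges_def by (auto simp: map_eq_append_conv)
      then obtain c d r3 where 4: "p3 = (e, c, d) # r3"
        by (cases p3) auto
      \<comment> \<open>No vertex is repeated as a start although \<open>e\<close> is traversed
        twice, so the two traversals have opposite directions and nothing lies before, between or
        after them.\<close>
      have p: "p = r1 @ (e, a, b) # r2 @ (e, c, d) # r3"
        using 1 2 3 4 by simp
      then have w: "is_walk G u r1 a" "(e, a, b) \<in> arcs G" "is_walk G b r2 c" "(e, c, d) \<in> arcs G"
        "is_walk G d r3 u"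
        using \<open>is_walk G u p u\<close> by (auto simp: is_walk_append[OF assms(1)])
      have ac: "a \<noteq> c" using True p by auto
      then have cd: "c = b" "d = a"
        using arc_same_edge[OF assms(1) w(2,4)] by auto
      have "r2 = []" using w(3) True p cd by (cases r2) auto
      moreover have "r3 = []" using w(5) True p cd by (cases r3) auto
      moreover have "r1 = []" using w(1,5) True p cd calculation by (cases r1) auto
      ultimately show ?thesis
        using p cd zgainD[OF assms(2) w(2)] ac by simp
    qed
  qed
qed

subsection \<open>The graph of a minor\<close>

lemma component_eq_iff:
  assumes "mgraph G" "u \<in> verts G"
  shows "component G A u = component G A v \<longleftrightarrow> joined G A u v"
proof
  assume "component G A u = component G A v"
  moreover have "u \<in> component G A u"
    using joined_refl assms(2) by (simp add: component_def)
  ultimately have "joined G A v u" by (simp add: component_def)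
  then show "joined G A u v" by (rule joined_sym[OF assms(1)])
next
  assume "joined G A u v"
  then show "component G A u = component G A v"
    using joined_trans[OF assms(1)] joined_sym[OF assms(1)] unfolding component_def by blast
qed

lemma graph_minor_simps [simp]:
  "verts (graph_minor G A D) = component G A ` verts G"
  "edges (graph_minor G A D) = edges G - (A \<union> D)"
  "ends (graph_minor G A D) e = component G A ` ends G e"
  by (simp_all add: graph_minor_def)

lemma mgraph_graph_minor:
  assumes "mgraph G"
  shows "mgraph (graph_minor G A D)"
proof -
  have "card (component G A ` ends G e) = 1 \<or> card (component G A ` ends G e) = 2" if "e \<in> edges G" for e
  proof -
    obtain a b where "(e, a, b) \<in> arcs G" using edge_arcE[OF assms \<open>e \<in> edges G\<close>] .
    then show ?thesis by (auto simp: ends_arc[OF assms] card_insert_if)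
  qed
  then show ?thesis
    using assms mgraphD(1)[OF assms] by (auto simp: mgraph_def)
qed

lemma minor_arc:
  assumes "mgraph G" "(e, a, b) \<in> arcs G" "e \<notin> A \<union> D"
  shows "(e, component G A a, component G A b) \<in> arcs (graph_minor G A D)"
  by (rule arcsI[OF mgraph_graph_minor[OF assms(1)]])
    (use arc_edge[OF assms(2)] assms(3) ends_arc[OF assms(1,2)] in auto)

lemma minor_arcE:
  assumes "mgraph G" "(e, X, Y) \<in> arcs (graph_minor G A D)"
  obtains x y where "(e, x, y) \<in> arcs G" "X = component G A x" "Y = component G A y" "e \<notin> A \<union> D"
proof -
  have e: "e \<in> edges G" "e \<notin> A \<union> D"
    using arc_edge[OF assms(2)] by auto
  obtain a b where ab: "(e, a, b) \<in> arcs G" using edge_arcE[OF assms(1) e(1)] .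
  have "{X, Y} = {component G A a, component G A b}"
    using ends_arc[OF mgraph_graph_minor[OF assms(1)] assms(2)] ends_arc[OF assms(1) ab] by simp
  then show thesis
    using that[OF ab] that[OF arcs_sym[OF ab]] e by (auto simp: doubleton_eq_iff)
qed

definition proj :: "('v, 'e) mgraph \<Rightarrow> 'e set \<Rightarrow> ('v, 'e) walk \<Rightarrow> ('v set, 'e) walk" where
  "proj G A p = map (\<lambda>(e, a, b). (e, component G A a, component G A b)) (filter (\<lambda>(e, a, b). e \<notin> A) p)"

lemma proj_simps [simp]:
  "proj G A [] = []"
  "proj G A ((e, a, b) # p) = (if e \<in> A then proj G A p else (e, component G A a, component G A b) # proj G A p)"
  "proj G A (p @ q) = proj G A p @ proj G A q"
  by (simp_all add: proj_def)

lemma proj_edges: "walk_edges (proj G A p) = filter (\<lambda>e. e \<notin> A) (walk_edges p)"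
  by (induction p) auto

lemma proj_walk:
  assumes "mgraph G" "is_walk G u p v" "wE p \<inter> D = {}"
  shows "is_walk (graph_minor G A D) (component G A u) (proj G A p) (component G A v)"
  using assms(2,3)
proof (induction p arbitrary: u)
  case (Cons x p)
  obtain e b where x: "x = (e, u, b)" "(e, u, b) \<in> arcs G" "is_walk G b p v"
    using Cons.prems by (cases x) auto
  have IH: "is_walk (graph_minor G A D) (component G A b) (proj G A p) (component G A v)"
    using Cons.IH[OF x(3)] Cons.prems(2) x by auto
  show ?case
  proof (cases "e \<in> A")
    case True
    then have "component G A u = component G A b"
      using component_eq_iff[OF assms(1)] arc_verts[OF assms(1) x(2)] joined_arc[OF assms(1) x(2)] by blast
    then show ?thesis using IH True x by simp
  next
    case False
    then show ?thesis using IH x minor_arc[OF assms(1) x(2)] Cons.prems(2) by auto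
  qed
qed simp

lemma closed_path_Nil: "is_path G u p u \<Longrightarrow> p = []"
  by (cases p) (auto simp: is_path_Cons)

lemma is_walk_arcs: "is_walk G u p v \<Longrightarrow> set p \<subseteq> arcs G"
proof (induction p arbitrary: u)
  case (Cons x p)
  then show ?case by (cases x) force
qed simp

text \<open>Edges that become loops under the projection may have their gain negated; as the projected
  walk is a simple closed walk, such an edge can only occur alone.\<close>

lemma proj_gain:
  assumes "mgraph G" "is_walk G u p u" "wE p \<inter> D = {}"
    "simple_closed_walk (graph_minor G A D) C (proj G A p)"
    and A: "\<And>f x y. (f, x, y) \<in> arcs G \<Longrightarrow> f \<in> A \<Longrightarrow> 3 dvd \<gamma> (f, x, y)"
    and ne: "\<And>f x y. (f, x, y) \<in> arcs G \<Longrightarrow> f \<notin> A \<union> D \<Longrightarrow> component G A x \<noteq> component G A y \<Longrightarrow>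
      3 dvd \<gamma> (f, x, y) - \<delta> (f, component G A x, component G A y)"
    and eq: "\<And>f x y. (f, x, y) \<in> arcs G \<Longrightarrow> f \<notin> A \<union> D \<Longrightarrow> component G A x = component G A y \<Longrightarrow>
      3 dvd \<gamma> (f, x, y) - \<delta> (f, component G A x, component G A y) \<or>
      3 dvd \<gamma> (f, x, y) + \<delta> (f, component G A x, component G A y)"
  shows "3 dvd gs \<gamma> p \<longleftrightarrow> 3 dvd gs \<delta> (proj G A p)"
proof -
  let ?k = "component G A"
  let ?H = "graph_minor G A D"
  have H: "mgraph ?H" by (rule mgraph_graph_minor[OF assms(1)])
  have arcs_p: "x \<in> arcs G" "fst x \<notin> D" if "x \<in> set p" for x
  proof -
    show "x \<in> arcs G" using is_walk_arcs[OF assms(2)] that by blast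
    show "fst x \<notin> D" proof -
      have "fst x \<in> wE p" using that by (auto simp: walk_edges_def case_prod_unfold)
      then show ?thesis using assms(3) by blast
    qed
  qed
  show ?thesis
  proof (cases "\<exists>f x y. (f, x, y) \<in> set p \<and> f \<notin> A \<and> ?k x = ?k y")
    case True
    then obtain f x y where f: "(f, x, y) \<in> set p" "f \<notin> A" "?k x = ?k y" by blast
    obtain p1 p2 where p: "p = p1 @ (f, x, y) # p2" using split_list[OF f(1)] by blast
    have "simple_closed_walk ?H C (((f, ?k x, ?k y) # proj G A p2) @ proj G A p1)"
      using scw_rotate[OF H, of C "proj G A p1" "(f, ?k x, ?k y) # proj G A p2"] assms(4) p f by simp
    then have "is_path ?H (?k y) (proj G A p2 @ proj G A p1) (?k y)"
      using f(3) by (simp add: scw_Cons[OF H])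
    then have "proj G A p2 @ proj G A p1 = []"
      by (rule closed_path_Nil)
    then have nil: "proj G A p1 = []" "proj G A p2 = []"
      by simp_all
    have zero: "3 dvd gs \<gamma> q" if "proj G A q = []" "set q \<subseteq> set p" for q
      using that
    proof (induction q)
      case (Cons z q)
      obtain g c d where z: "z = (g, c, d)" by (cases z)
      have "g \<in> A" "(g, c, d) \<in> arcs G"
        using Cons.prems z arcs_p by (auto split: if_splits)
      then show ?case
        using Cons A[of g c d] z by (auto split: if_splits)
    qed simp
    have *: "3 dvd gs \<gamma> p1" "3 dvd gs \<gamma> p2"
      using zero nil p by auto
    have "3 dvd gs \<gamma> p \<longleftrightarrow> 3 dvd \<gamma> (f, x, y)"
    proof -
      have "gs \<gamma> p = gs \<gamma> p1 + gs \<gamma> p2 + \<gamma> (f, x, y)" using p by simp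
      then show ?thesis using * by (metis dvd_add dvd_add_right_iff)
    qed
    also have "\<dots> \<longleftrightarrow> 3 dvd \<delta> (f, ?k x, ?k y)"
      using eq[of f x y] f arcs_p[OF f(1)]
      by (metis (no_types, opaque_lifting) Un_iff diff_add_cancel dvd_add_right_iff dvd_add_left_iff fst_conv)
    also have "\<dots> \<longleftrightarrow> 3 dvd gs \<delta> (proj G A p)"
      using p nil f by simp
    finally show ?thesis .
  next
    case False
    have "3 dvd gs \<gamma> q - gs \<delta> (proj G A q)" if "set q \<subseteq> set p" for q
      using that
    proof (induction q)
      case (Cons z q)
      obtain g c d where z: "z = (g, c, d)" by (cases z)
      have g: "(g, c, d) \<in> arcs G" "g \<notin> D" and IH: "3 dvd gs \<gamma> q - gs \<delta> (proj G A q)"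
        using Cons z arcs_p[of z] by auto
      show ?case
      proof (cases "g \<in> A")
        case True
        from dvd_add[OF A[OF g(1) True] IH] show ?thesis
          using True z by (simp add: algebra_simps)
      next
        case gA: False
        then have "?k c \<noteq> ?k d" using False Cons.prems z by auto
        from dvd_add[OF ne[OF g(1) _ this] IH] show ?thesis
          using gA g z by (simp add: algebra_simps)
      qed
    qed simp
    from this[of p] show ?thesis
      by (metis diff_add_cancel dvd_add_right_iff order_refl)
  qed
qed


subsection \<open>Deleting isolated vertices\<close>

definition del_verts :: "('v, 'e) mgraph \<Rightarrow> 'v set \<Rightarrow> ('v, 'e) mgraph" where
  "del_verts G W = G\<lparr>verts := verts G - W\<rparr>"

lemma del_verts_simps [simp]:
  "verts (del_verts G W) = verts G - W" "edges (del_verts G W) = edges G"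
  "ends (del_verts G W) = ends G" "arcs (del_verts G W) = arcs G"
  by (simp_all add: del_verts_def arcs_def is_loop_def)

lemma mgraph_del_verts:
  assumes "mgraph G" "W \<subseteq> {v \<in> verts G. \<forall>e\<in>edges G. v \<notin> ends G e}"
  shows "mgraph (del_verts G W)"
  using assms unfolding mgraph_def by (simp; blast)

lemma del_verts_walk:
  assumes "mgraph G" "W \<subseteq> {v \<in> verts G. \<forall>e\<in>edges G. v \<notin> ends G e}" "p \<noteq> []"
  shows "is_walk (del_verts G W) u p v \<longleftrightarrow> is_walk G u p v"
  using assms(3)
proof (induction p arbitrary: u)
  case (Cons x p)
  obtain e a b where x: "x = (e, a, b)" by (cases x)
  show ?case
  proof (cases p)
    case Nil
    have "(e, a, b) \<in> arcs G \<Longrightarrow> b \<notin> W"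
      using assms(2) arc_edge arc_end2 by fast
    then show ?thesis using x Nil by auto
  next
    case (Cons y p')
    then show ?thesis using Cons.IH x by simp
  qed
qed simp

lemma del_verts_scw:
  assumes "mgraph G" "W \<subseteq> {v \<in> verts G. \<forall>e\<in>edges G. v \<notin> ends G e}" "p \<noteq> []"
  shows "simple_closed_walk (del_verts G W) C p \<longleftrightarrow> simple_closed_walk G C p"
  by (simp add: simple_closed_walk_def del_verts_walk[OF assms])

lemma del_verts_cycle:
  assumes "mgraph G" "W \<subseteq> {v \<in> verts G. \<forall>e\<in>edges G. v \<notin> ends G e}"
  shows "is_cycle (del_verts G W) C \<longleftrightarrow> is_cycle G C"
  unfolding is_cycle_scw[OF assms(1)] is_cycle_scw[OF mgraph_del_verts[OF assms]]
  using del_verts_scw[OF assms] by blast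

lemma del_verts_bal:
  assumes "mgraph G" "W \<subseteq> {v \<in> verts G. \<forall>e\<in>edges G. v \<notin> ends G e}"
  shows "bal (del_verts G W) \<gamma> C \<longleftrightarrow> bal G \<gamma> C"
  unfolding bal_def using del_verts_scw[OF assms] by (metis dvd_0_right gs_simps(1))

lemma del_verts_zgain: "zgain (del_verts G W) \<gamma> \<longleftrightarrow> zgain G \<gamma>"
  by (simp add: zgain_def)

subsection \<open>Pulling gains back from a minor\<close>

text \<open>For an edge that is no loop, this means that contracting it identifies two vertices of
  \<open>C\<close> without shortening \<open>C\<close>. An edge parallel to an edge of
  \<open>C\<close> counts as a chord, too.\<close>

definition chord :: "('v, 'e) mgraph \<Rightarrow> 'e set \<Rightarrow> 'e \<Rightarrow> bool" where
  "chord G C z \<longleftrightarrow> z \<notin> C \<and> ends G z \<subseteq> \<Union>(ends G ` C)"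

text \<open>Covers at once the two cases that occur when gains are pulled back: nothing is
  contracted, or a single edge.\<close>

lemma joined_at_most_one:
  assumes "mgraph G" "A \<subseteq> {z}" "joined G A u v" "u \<noteq> v"
  shows "z \<in> A \<and> {u, v} = ends G z"
proof -
  obtain p where p: "is_walk G u p v" "wE p \<subseteq> A"
    using assms(3) by (auto simp: joined_def)
  obtain q where q: "is_path G u q v" "wE q \<subseteq> wE p"
    using walk_to_path[OF assms(1) p(1)] by blast
  obtain e b q' where e: "q = (e, u, b) # q'" "(e, u, b) \<in> arcs G" "is_path G b q' v"
    using q(1) assms(4) by (cases q) (auto simp: is_path_Cons)
  have "e = z" "z \<in> A" using e q p assms(2) by auto
  moreover have "q' = []"
  proof -
    have "wE q' \<subseteq> {z}" using q(2) p(2) assms(2) e by auto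
    moreover have "z \<notin> wE q'"
      using path_distinct_edges[OF assms(1) q(1)] e \<open>e = z\<close> by simp
    ultimately have "wE q' = {}" using subset_singletonD by force
    then show ?thesis by simp
  qed
  ultimately show ?thesis using e ends_arc[OF assms(1) e(2)] by auto
qed

text \<open>One lemma for deletion, with \<open>A\<close> empty, and for contraction of the edge
  \<open>z\<close>. The contracted edge gets gain 0 and every other edge the gain of its image up to
  sign, so a cycle and its projection have gain zero together. The projection of \<open>C\<close> is
  again a simple closed walk unless \<open>z\<close> is contracted and is a chord of
  \<open>C\<close>.\<close>

lemma pull_gain:
  fixes G :: "('v, 'e) mgraph"
  assumes "mgraph G" "A \<subseteq> {z}" "z \<in> A \<Longrightarrow> \<not> is_loop G z"
    "W \<subseteq> isolated_verts (contract_delete (G, B) A D)"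
    "gainable (integer_mod_group 3) (delete_verts (contract_delete (G, B) A D) W)"
  shows "\<exists>\<gamma>. zgain G \<gamma> \<and> (\<forall>C. is_cycle G C \<longrightarrow> C \<inter> D = {} \<longrightarrow> (z \<in> A \<longrightarrow> \<not> chord G C z) \<longrightarrow>
    (C \<in> B \<longleftrightarrow> bal G \<gamma> C))"
proof -
  let ?H = "graph_minor G A D"
  let ?k = "component G A"
  let ?B = "{C. is_cycle ?H C \<and> (\<exists>C'. is_cycle G C' \<and> C \<subseteq> C' \<and> C' - C \<subseteq> A \<and> C' \<in> B)}"
  have H: "mgraph ?H" by (rule mgraph_graph_minor[OF assms(1)])
  have W: "W \<subseteq> {v \<in> verts ?H. \<forall>e\<in>edges ?H. v \<notin> ends ?H e}"
    using assms(4) by simp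
  have "gainable (integer_mod_group 3) (del_verts ?H W, ?B)"
    using assms(5) by (simp add: del_verts_def)
  then obtain \<delta> where \<delta>: "zgain ?H \<delta>" "?B = {C. is_cycle ?H C \<and> bal ?H \<delta> C}"
    unfolding gainable_Z3_iff[OF mgraph_del_verts[OF H W]] del_verts_cycle[OF H W] del_verts_bal[OF H W]
      del_verts_zgain by blast
  \<comment> \<open>Edges of \<open>G\<close> parallel to \<open>z\<close> become loops of the
    minor, whose two directions are one and the same arc. To obtain a gain of \<open>G\<close>, one
    end of each edge is chosen, and the gain of the loop is negated on the arc starting at the other
    end.\<close>
  define orient where "orient f = (SOME x. x \<in> ends G f)" for f
  define \<gamma> where "\<gamma> = (\<lambda>(f, x, y). if f \<in> A \<union> D then 0 else if ?k x \<noteq> ?k y \<or> x = y \<or> x = orient f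
    then \<delta> (f, ?k x, ?k y) else - \<delta> (f, ?k x, ?k y))"
  have orient: "orient f \<in> {x, y}" if "(f, x, y) \<in> arcs G" for f x y
    using someI[of "\<lambda>x. x \<in> ends G f" x] arc_end1[OF that] ends_arc[OF assms(1) that] by (simp add: orient_def)
  have "zgain G \<gamma>"
    unfolding zgain_def
  proof (intro allI impI)
    fix f x y assume f: "(f, x, y) \<in> arcs G" "x \<noteq> y"
    show "3 dvd \<gamma> (f, x, y) + \<gamma> (f, y, x)"
    proof (cases "f \<in> A \<union> D")
      case False
      show ?thesis
      proof (cases "?k x = ?k y")
        case True
        then show ?thesis using f False orient[OF f(1)] by (auto simp: \<gamma>_def)
      next
        case ne: False
        then show ?thesis
          using zgainD[OF \<delta>(1) minor_arc[OF assms(1) f(1) False]] False by (simp add: \<gamma>_def)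
      qed
    qed (simp add: \<gamma>_def)
  qed
  moreover have "C \<in> B \<longleftrightarrow> bal G \<gamma> C"
    if C: "is_cycle G C" "C \<inter> D = {}" "z \<in> A \<longrightarrow> \<not> chord G C z" for C
  proof -
    obtain p where p: "p \<noteq> []" "simple_closed_walk G C p"
      using C(1) is_cycle_scw[OF assms(1)] by blast
    obtain u where u: "is_walk G u p u" "distinct (walk_starts p)" "distinct (walk_edges p)" "wE p = C"
      using p by (auto simp: simple_closed_walk_def)
    have pw: "is_walk ?H (?k u) (proj G A p) (?k u)"
      by (rule proj_walk[OF assms(1) u(1)]) (use u C in auto)
    have pe: "wE (proj G A p) = C - A" "distinct (walk_edges (proj G A p))"
      using u by (auto simp: proj_edges)
    \<comment> \<open>Two different vertices are merged only if they are the ends of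
      \<open>z\<close>. Then \<open>z\<close>, being no chord, is an edge of \<open>C\<close>, and
      its arc starts at one of the two vertices. But this arc is dropped by the projection.\<close>
    have collide: "x = y" if "(f, x, x') \<in> set p" "(g, y, y') \<in> set p" "f \<notin> A" "g \<notin> A" "?k x = ?k y" for f g x x' y y'
    proof (rule ccontr)
      assume "x \<noteq> y"
      have xy: "x \<in> wS p" "y \<in> wS p"
        using that(1,2) by (force simp: walk_starts_def)+
      have "(f, x, x') \<in> arcs G" using is_walk_arcs[OF u(1)] that(1) by blast
      then have "joined G A x y"
        using component_eq_iff[OF assms(1), of x A y] arc_verts[OF assms(1)] that(5) by blast
      then have z: "z \<in> A" "{x, y} = ends G z"
        using joined_at_most_one[OF assms(1,2) _ \<open>x \<noteq> y\<close>] by blast+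
      have "ends G z \<subseteq> \<Union>(ends G ` C)"
        using xy z scw_ends[OF assms(1) p(2)] by auto
      then have "z \<in> C" using C(3) z(1) by (auto simp: chord_def)
      then obtain c d where c: "(z, c, d) \<in> set p"
        using u(4) by (force simp: walk_edges_def)
      then have "(z, c, d) \<in> arcs G" using is_walk_arcs[OF u(1)] by blast
      then have "c = x \<or> c = y" using ends_arc[OF assms(1)] z(2) by (metis doubleton_eq_iff)
      moreover have "a = b" if "a \<in> set p" "b \<in> set p" "fst (snd a) = fst (snd b)" for a b
        using u(2) that unfolding walk_starts_def distinct_map inj_on_def by (auto simp: case_prod_unfold)
      ultimately show False
        using c that(1-4) z(1) by fastforce
    qed
    have "distinct (walk_starts (proj G A p))"
    proof -
      have "inj_on (\<lambda>(e, a, b). ?k a) (set (filter (\<lambda>(e, a, b). e \<notin> A) p))"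
      proof (rule inj_onI)
        fix a b
        assume *: "a \<in> set (filter (\<lambda>(e, a, b). e \<notin> A) p)" "b \<in> set (filter (\<lambda>(e, a, b). e \<notin> A) p)"
          "(\<lambda>(e, a, b). ?k a) a = (\<lambda>(e, a, b). ?k a) b"
        then have "fst (snd a) = fst (snd b)"
          using collide[of "fst a" "fst (snd a)" "snd (snd a)" "fst b" "fst (snd b)" "snd (snd b)"]
          by (auto simp: case_prod_unfold)
        moreover have "inj_on (\<lambda>a. fst (snd a)) (set p)"
          using u(2) by (simp add: walk_starts_def distinct_map case_prod_unfold)
        ultimately show "a = b"
          using * by (auto dest: inj_onD)
      qed
      moreover have "distinct p" using u(3) by (auto simp: walk_edges_def distinct_map)
      ultimately have "distinct (map (\<lambda>(e, a, b). ?k a) (filter (\<lambda>(e, a, b). e \<notin> A) p))"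
        by (simp add: distinct_map)
      moreover have "walk_starts (proj G A p) = map (\<lambda>(e, a, b). ?k a) (filter (\<lambda>(e, a, b). e \<notin> A) p)"
        by (simp add: walk_starts_def proj_def case_prod_unfold)
      ultimately show ?thesis by simp
    qed
    then have ps: "simple_closed_walk ?H (C - A) (proj G A p)"
      using pw pe by (auto simp: simple_closed_walk_def)
    have "proj G A p \<noteq> []"
    proof
      assume "proj G A p = []"
      then have "C \<subseteq> A" using pe by simp
      moreover have "C \<noteq> {}" using p u by auto
      ultimately have Cz: "C = {z}" "z \<in> A" using assms(2) by auto
      then obtain x p' where x: "p = x # p'" using p by (cases p) auto
      obtain f a b where f: "x = (f, a, b)" by (cases x)
      have "f = z" "p' = []" using u(3,4) Cz x f by (auto simp: subset_singleton_iff)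
      then have "a = b" "(f, a, b) \<in> arcs G" using u(1) x f by auto
      then show False using assms(3) Cz(2) is_loop_arc[OF assms(1)] \<open>f = z\<close> by blast
    qed
    then have cyc: "is_cycle ?H (C - A)" using scw_is_cycle[OF H ps] by blast
    have "C \<in> B \<longleftrightarrow> C - A \<in> ?B"
    proof
      assume "C \<in> B"
      then show "C - A \<in> ?B" using cyc C(1) by blast
    next
      assume "C - A \<in> ?B"
      then obtain C' where C': "is_cycle G C'" "C - A \<subseteq> C'" "C' - (C - A) \<subseteq> A" "C' \<in> B" by blast
      \<comment> \<open>The two cycles differ at most in \<open>z\<close>, so one contains the
        other.\<close>
      have "C' \<subseteq> C \<or> C \<subseteq> C'"
        using C'(2,3) assms(2) by blast
      then have "C = C'"
        using cycle_subset_eq[OF assms(1)] C(1) C'(1) by metis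
      then show "C \<in> B" using C' by simp
    qed
    also have "\<dots> \<longleftrightarrow> bal ?H \<delta> (C - A)"
      using \<delta>(2) cyc by blast
    also have "\<dots> \<longleftrightarrow> 3 dvd gs \<delta> (proj G A p)"
      by (rule bal_scw[OF H \<delta>(1) ps])
    also have "\<dots> \<longleftrightarrow> 3 dvd gs \<gamma> p"
      by (rule proj_gain[OF assms(1) u(1) _ ps, symmetric]) (use u C in \<open>auto simp: \<gamma>_def\<close>)
    also have "\<dots> \<longleftrightarrow> bal G \<gamma> C"
      by (rule bal_scw[OF assms(1) \<open>zgain G \<gamma>\<close> p(2), symmetric])
    finally show ?thesis .
  qed
  ultimately show ?thesis by blast
qed

subsection \<open>Pushing gains to a minor\<close>

text \<open>Consecutive edges of \<open>p\<close> meet in the same component and are linked by a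
  path in \<open>A\<close> within it. The last conjunct confines the lift to the components visited
  by \<open>p\<close>, which keeps the pieces disjoint in the induction.\<close>

lemma lift_path:
  assumes "mgraph G"
  shows "is_path (graph_minor G A D) X p Y \<Longrightarrow> x \<in> verts G \<Longrightarrow> y \<in> verts G \<Longrightarrow>
    component G A x = X \<Longrightarrow> component G A y = Y \<Longrightarrow>
    \<exists>q. is_path G x q y \<and> wE p \<subseteq> wE q \<and> wE q \<subseteq> wE p \<union> A \<and> component G A ` insert y (wS q) \<subseteq> insert Y (wS p)"
proof (induction p arbitrary: X x)
  case Nil
  then have "X = Y" by simp
  then have "joined G A x y"
    using component_eq_iff[OF assms(1)] Nil by blast
  then obtain p where "is_walk G x p y" "wE p \<subseteq> A"
    by (auto simp: joined_def)
  then obtain q where q: "is_path G x q y" "wE q \<subseteq> A"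
    using walk_to_path[OF assms(1)] by blast
  have "component G A v = X" if "v \<in> insert y (wS q)" for v
    using walk_joined[OF assms(1), of x q y v] q that component_eq_iff[OF assms(1) Nil(2)] Nil(4) joined_mono
    by (metis is_path_walk)
  then show ?case using q \<open>X = Y\<close> by (intro exI[of _ q]) auto
next
  case (Cons z p)
  obtain f X' where z: "z = (f, X, X')" "(f, X, X') \<in> arcs (graph_minor G A D)"
    "is_path (graph_minor G A D) X' p Y" "X \<notin> insert Y (wS p)"
    using Cons.prems(1) by (cases z) (auto simp: is_path_Cons)
  obtain x1 y1 where f: "(f, x1, y1) \<in> arcs G" "X = component G A x1" "X' = component G A y1" "f \<notin> A \<union> D"
    using minor_arcE[OF assms z(2)] .
  obtain q where q: "is_path G y1 q y" "wE p \<subseteq> wE q" "wE q \<subseteq> wE p \<union> A"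
    "component G A ` insert y (wS q) \<subseteq> insert Y (wS p)"
    using Cons.IH[OF z(3) arc_verts(2)[OF assms f(1)] Cons.prems(3) f(3)[symmetric] Cons.prems(5)] by blast
  have "joined G A x x1"
    using component_eq_iff[OF assms Cons.prems(2)] Cons.prems(4) f(2) by simp
  then obtain r where "is_walk G x r x1" "wE r \<subseteq> A"
    by (auto simp: joined_def)
  then obtain r' where r: "is_path G x r' x1" "wE r' \<subseteq> A"
    using walk_to_path[OF assms(1)] by blast
  have rX: "component G A v = X" if "v \<in> insert x1 (wS r')" for v
    using walk_joined[OF assms(1), of x r' x1 v] r that component_eq_iff[OF assms(1) Cons.prems(2)] Cons.prems(4) joined_mono
    by (metis is_path_walk)
  have qX: "v \<notin> insert x1 (wS r')" if "v \<in> insert y (wS q)" for v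
    using rX[of v] that q(4) z(4) by auto
  have "is_path G x1 ((f, x1, y1) # q) y"
    using f(1) q(1) qX by (auto simp: is_path_Cons)
  moreover have "x1 \<notin> wS r'"
    using r(1) by (auto simp: is_path_def)
  ultimately have "is_path G x (r' @ (f, x1, y1) # q) y"
    unfolding is_path_append[OF assms] using r(1) qX by auto
  moreover have "wE (z # p) \<subseteq> wE (r' @ (f, x1, y1) # q)" "wE (r' @ (f, x1, y1) # q) \<subseteq> wE (z # p) \<union> A"
    using z q r by auto
  moreover have "component G A ` insert y (wS (r' @ (f, x1, y1) # q)) \<subseteq> insert Y (wS (z # p))"
  proof -
    have "component G A ` wS r' \<subseteq> {X}" "component G A x1 = X"
      using rX by auto
    then show ?thesis using z(1) q(4) by auto
  qed
  ultimately show ?case by blast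
qed

lemma lift_cycle:
  assumes "mgraph G" "is_cycle (graph_minor G A D) C"
  shows "\<exists>C'. is_cycle G C' \<and> C \<subseteq> C' \<and> C' - C \<subseteq> A"
proof -
  let ?H = "graph_minor G A D"
  have H: "mgraph ?H" by (rule mgraph_graph_minor[OF assms(1)])
  obtain p where p: "p \<noteq> []" "simple_closed_walk ?H C p"
    using assms(2) is_cycle_scw[OF H] by blast
  then obtain e X Y P where "p = (e, X, Y) # P" by (cases p) auto
  then have P: "(e, X, Y) \<in> arcs ?H" "is_path ?H Y P X" "e \<notin> wE P" "C = insert e (wE P)"
    using p(2) by (auto simp: scw_Cons[OF H])
  obtain x y where e: "(e, x, y) \<in> arcs G" "X = component G A x" "Y = component G A y" "e \<notin> A \<union> D"
    using minor_arcE[OF assms(1) P(1)] .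
  obtain q where q: "is_path G y q x" "wE P \<subseteq> wE q" "wE q \<subseteq> wE P \<union> A"
    using lift_path[OF assms(1) P(2) arc_verts(2,1)[OF assms(1) e(1)]] e by blast
  have "simple_closed_walk G (insert e (wE q)) ((e, x, y) # q)"
    using e q P by (auto simp: scw_Cons[OF assms(1)])
  then have "is_cycle G (insert e (wE q))"
    using scw_is_cycle[OF assms(1)] by blast
  then show ?thesis
    using q P by (intro exI[of _ "insert e (wE q)"]) auto
qed

text \<open>Closed walks in \<open>A\<close> have gain 0, so the gain of a walk in \<open>A\<close>
  from a fixed root of the component to \<open>v\<close> depends only on \<open>v\<close>. This is
  \<open>\<pi> v\<close>, and on \<open>A\<close> the gain becomes the difference of
  potentials.\<close>

lemma potential:
  assumes "mgraph G" "zgain G \<gamma>" "\<And>C. is_cycle G C \<Longrightarrow> C \<subseteq> A \<Longrightarrow> bal G \<gamma> C"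
  obtains \<pi> :: "'v \<Rightarrow> int" where "\<And>e u v. (e, u, v) \<in> arcs (G :: ('v, 'e) mgraph) \<Longrightarrow> e \<in> A \<Longrightarrow> 3 dvd \<gamma> (e, u, v) + \<pi> u - \<pi> v"
proof -
  \<comment> \<open>The predicate \<open>joined G A v\<close> is the same for all vertices of a
    component, so the choice operator returns one common root.\<close>
  define r where "r v = (SOME x. joined G A v x)" for v
  define w where "w v = (SOME p. is_walk G (r v) p v \<and> wE p \<subseteq> A)" for v
  have w: "is_walk G (r v) (w v) v \<and> wE (w v) \<subseteq> A" if "v \<in> verts G" for v
  proof -
    have "joined G A v (r v)"
      unfolding r_def by (rule someI[of _ v]) (rule joined_refl[OF that])
    then have "joined G A (r v) v" by (rule joined_sym[OF assms(1)])
    then obtain p where "is_walk G (r v) p v \<and> wE p \<subseteq> A" by (auto simp: joined_def)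
    then show ?thesis unfolding w_def by (rule someI)
  qed
  show thesis
  proof (rule that[of "\<lambda>v. gs \<gamma> (w v)"])
    fix e u v assume e: "(e, u, v) \<in> arcs G" "e \<in> A"
    have uv: "u \<in> verts G" "v \<in> verts G" using arc_verts[OF assms(1) e(1)] by auto
    have "joined G A u v" by (rule joined_arc[OF assms(1) e])
    then have "joined G A u = joined G A v"
      using joined_trans[OF assms(1)] joined_sym[OF assms(1)] by blast
    then have r: "r u = r v" by (simp add: r_def)
    have 1: "is_walk G (r u) (w u @ (e, u, v) # rev_walk (w v)) (r u)"
      using w[OF uv(1)] is_walk_rev[OF assms(1), of "r v" "w v" v] w[OF uv(2)] e r
      by (auto simp: is_walk_append[OF assms(1)])
    have 2: "is_walk G (r v) (w v @ rev_walk (w v)) (r v)"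
      using w[OF uv(2)] is_walk_rev[OF assms(1), of "r v" "w v" v]
      by (auto simp: is_walk_append[OF assms(1)])
    have "3 dvd gs \<gamma> (w u @ (e, u, v) # rev_walk (w v))"
      by (rule closed_walk_gain_zero[OF assms(1-3) 1]) (use w[OF uv(1)] w[OF uv(2)] e in auto)
    moreover have "3 dvd gs \<gamma> (w v @ rev_walk (w v))"
      by (rule closed_walk_gain_zero[OF assms(1-3) 2]) (use w[OF uv(2)] in auto)
    ultimately have "3 dvd gs \<gamma> (w u @ (e, u, v) # rev_walk (w v)) - gs \<gamma> (w v @ rev_walk (w v))"
      by (rule dvd_diff)
    then show "3 dvd \<gamma> (e, u, v) + gs \<gamma> (w u) - gs \<gamma> (w v)"
      by (simp add: algebra_simps)
  qed
qed

text \<open>Switching by a potential makes the gain vanish on \<open>A\<close> without changing the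
  gain of closed walks. Then a cycle of the minor and any of its lifts have gain zero together, so
  rightness on the lifts gives a gain of the minor.\<close>

lemma push_gain:
  fixes G :: "('v, 'e) mgraph"
  assumes "mgraph G" "A \<inter> D = {}" "zgain G \<gamma>"
    "W \<subseteq> isolated_verts (contract_delete (G, B) A D)"
    and bal_A: "\<And>C. is_cycle G C \<Longrightarrow> C \<subseteq> A \<Longrightarrow> bal G \<gamma> C"
    and lifts: "\<And>C C'. is_cycle (graph_minor G A D) C \<Longrightarrow> is_cycle G C' \<Longrightarrow> C \<subseteq> C' \<Longrightarrow> C' - C \<subseteq> A \<Longrightarrow>
      C' \<in> B \<longleftrightarrow> bal G \<gamma> C'"
  shows "gainable (integer_mod_group 3) (delete_verts (contract_delete (G, B) A D) W)"
proof -
  let ?H = "graph_minor G A D"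
  let ?k = "component G A"
  let ?B = "{C. is_cycle ?H C \<and> (\<exists>C'. is_cycle G C' \<and> C \<subseteq> C' \<and> C' - C \<subseteq> A \<and> C' \<in> B)}"
  have H: "mgraph ?H" by (rule mgraph_graph_minor[OF assms(1)])
  have W: "W \<subseteq> {v \<in> verts ?H. \<forall>e\<in>edges ?H. v \<notin> ends ?H e}"
    using assms(4) by simp
  obtain \<pi> where \<pi>: "\<And>e u v. (e, u, v) \<in> arcs G \<Longrightarrow> e \<in> A \<Longrightarrow> 3 dvd \<gamma> (e, u, v) + \<pi> u - \<pi> v"
    using potential[OF assms(1,3) bal_A] by metis
  define \<eta> where "\<eta> = (\<lambda>(e, u, v). \<gamma> (e, u, v) + \<pi> u - \<pi> v)"
  have \<eta>: "zgain G \<eta>"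
    using assms(3) by (simp add: zgain_def \<eta>_def algebra_simps)
  have gs_eq: "gs \<eta> p = gs \<gamma> p + \<pi> u - \<pi> v" if "is_walk G u p v" for p u v
    using that by (induction p arbitrary: u) (auto simp: \<eta>_def)
  \<comment> \<open>\<open>c\<close> picks an arc of \<open>G\<close> for every arc of the minor. It
    is unique unless the edge has become a loop; then either direction serves, since only the
    vanishing of the gain matters.\<close>
  define c where "c f X Y = (SOME xy. (f, xy) \<in> arcs G \<and> ?k (fst xy) = X \<and> ?k (snd xy) = Y)" for f X Y
  define \<delta> where "\<delta> = (\<lambda>(f, X, Y). \<eta> (f, c f X Y))"
  have c: "(f, c f (?k x) (?k y)) \<in> arcs G" "?k (fst (c f (?k x) (?k y))) = ?k x" "?k (snd (c f (?k x) (?k y))) = ?k y"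
    if "(f, x, y) \<in> arcs G" for f x y
    using someI[of "\<lambda>xy. (f, xy) \<in> arcs G \<and> ?k (fst xy) = ?k x \<and> ?k (snd xy) = ?k y" "(x, y)"] that
    by (simp_all add: c_def)
  have c_ne: "c f (?k x) (?k y) = (x, y)" if "(f, x, y) \<in> arcs G" "?k x \<noteq> ?k y" for f x y
    using c[OF that(1)] arc_same_edge[OF assms(1) that(1), of "fst (c f (?k x) (?k y))" "snd (c f (?k x) (?k y))"] that(2)
    by (metis prod.collapse)
  have c_eq: "c f (?k x) (?k y) = (x, y) \<or> c f (?k x) (?k y) = (y, x)" if "(f, x, y) \<in> arcs G" for f x y
    using c(1)[OF that] arc_same_edge[OF assms(1) that, of "fst (c f (?k x) (?k y))" "snd (c f (?k x) (?k y))"]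
    by (metis prod.collapse)
  have \<delta>: "zgain ?H \<delta>"
    unfolding zgain_def
  proof (intro allI impI)
    fix f X Y assume f: "(f, X, Y) \<in> arcs ?H" "X \<noteq> Y"
    obtain x y where xy: "(f, x, y) \<in> arcs G" "X = ?k x" "Y = ?k y"
      using minor_arcE[OF assms(1) f(1)] by metis
    then have "x \<noteq> y" using f by auto
    then show "3 dvd \<delta> (f, X, Y) + \<delta> (f, Y, X)"
      using c_ne[OF xy(1)] c_ne[OF arcs_sym[OF xy(1)]] xy(2,3) f(2) zgainD[OF \<eta> xy(1)] by (simp add: \<delta>_def)
  qed
  have status: "bal ?H \<delta> C \<longleftrightarrow> bal G \<gamma> C'"
    if C: "is_cycle ?H C" "is_cycle G C'" "C \<subseteq> C'" "C' - C \<subseteq> A" for C C'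
  proof -
    obtain p where p: "p \<noteq> []" "simple_closed_walk G C' p"
      using C(2) is_cycle_scw[OF assms(1)] by blast
    obtain u where u: "is_walk G u p u" "distinct (walk_edges p)" "wE p = C'"
      using p by (auto simp: simple_closed_walk_def)
    have CE: "C \<inter> A = {}" "C \<inter> D = {}" using C(1) by (auto simp: is_cycle_def)
    then have CD: "wE p \<inter> D = {}" using u C(3,4) assms(2) by blast
    have pe: "wE (proj G A p) = C" "distinct (walk_edges (proj G A p))"
      using u C CE by (auto simp: proj_edges)
    have s: "simple_closed_walk ?H C (proj G A p)"
      by (rule closed_trail_scw[OF H C(1) proj_walk[OF assms(1) u(1) CD] pe(2,1)])
    have "bal ?H \<delta> C \<longleftrightarrow> 3 dvd gs \<delta> (proj G A p)"
      by (rule bal_scw[OF H \<delta> s])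
    also have "\<dots> \<longleftrightarrow> 3 dvd gs \<eta> p"
    proof (rule proj_gain[OF assms(1) u(1) CD s, symmetric])
      fix f x y assume f: "(f, x, y) \<in> arcs G"
      show "3 dvd \<eta> (f, x, y)" if "f \<in> A"
        using \<pi>[OF f that] by (simp add: \<eta>_def)
      show "3 dvd \<eta> (f, x, y) - \<delta> (f, ?k x, ?k y)" if "?k x \<noteq> ?k y"
        using c_ne[OF f that] by (simp add: \<delta>_def)
      show "3 dvd \<eta> (f, x, y) - \<delta> (f, ?k x, ?k y) \<or> 3 dvd \<eta> (f, x, y) + \<delta> (f, ?k x, ?k y)"
        using c_eq[OF f] zgainD[OF \<eta> f] by (cases "x = y") (auto simp: \<delta>_def)
    qed
    also have "\<dots> \<longleftrightarrow> 3 dvd gs \<gamma> p"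
      using gs_eq[OF u(1)] by simp
    also have "\<dots> \<longleftrightarrow> bal G \<gamma> C'"
      by (rule bal_scw[OF assms(1,3) p(2), symmetric])
    finally show ?thesis .
  qed
  have "?B = {C. is_cycle ?H C \<and> bal ?H \<delta> C}"
    using status lifts lift_cycle[OF assms(1)] by blast
  then have "gainable (integer_mod_group 3) (del_verts ?H W, ?B)"
    unfolding gainable_Z3_iff[OF mgraph_del_verts[OF H W]] del_verts_cycle[OF H W] del_verts_bal[OF H W]
      del_verts_zgain using \<delta> by blast
  then show ?thesis
    by (simp add: del_verts_def)
qed

section \<open>Cutting a cycle at two vertices, and gains that are right on a cycle\<close>

lemma cycle_split:
  assumes "mgraph G" "is_cycle G C" "a \<in> \<Union>(ends G ` C)" "b \<in> \<Union>(ends G ` C)" "a \<noteq> b"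
  obtains P Q where "is_path G a P b" "is_path G a Q b" "idisj P Q" "C = wE P \<union> wE Q"
proof -
  obtain p where p: "p \<noteq> []" "simple_closed_walk G C p"
    using assms(2) is_cycle_scw[OF assms(1)] by blast
  have V: "\<Union>(ends G ` C) = wS p" by (rule scw_ends[OF assms(1) p(2)])
  then obtain x where "x \<in> set p" "fst (snd x) = a"
    using assms(3) by (auto simp: walk_starts_def)
  then obtain e c p1 p2 where "p = p1 @ (e, a, c) # p2"
    by (metis split_list prod.collapse)
  then obtain P0 where P0: "simple_closed_walk G C ((e, a, c) # P0)"
    using scw_rotate[OF assms(1), of C p1 "(e, a, c) # p2"] p(2) by auto
  then have e: "(e, a, c) \<in> arcs G" "is_path G c P0 a" "e \<notin> wE P0" "C = insert e (wE P0)"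
    by (auto simp: scw_Cons[OF assms(1)])
  have "b \<in> insert a (wS P0)"
    using scw_ends[OF assms(1) P0] assms(4,5) by auto
  from path_split_at[OF assms(1) e(2) this] obtain P1 P2
    where P12: "P0 = P1 @ P2" "is_path G c P1 b" "is_path G b P2 a" .
  have d: "distinct (wS' @ [a])" if "wS' = walk_starts (P1 @ P2)" for wS'
    using e(2) P12 that by (simp add: is_path_def)
  have "is_path G a ((e, a, c) # P1) b"
    using e P12 d assms(5) by (auto simp: is_path_Cons)
  moreover have "is_path G a (rev_walk P2) b"
    by (rule is_path_rev[OF assms(1) P12(3)])
  moreover have "idisj ((e, a, c) # P1) (rev_walk P2)"
  proof -
    have "wE P1 \<inter> wE P2 = {}"
      using path_distinct_edges[OF assms(1) e(2)] P12 by auto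
    moreover have "wS P1 \<inter> set (tl (walk_starts (rev_walk P2))) = {}"
    proof -
      have "walk_starts (rev_walk P2) @ [b] = rev (walk_starts P2 @ [a])"
        using walk_starts_rev P12(3) by (metis is_path_def)
      then have "walk_starts (rev_walk P2) @ [b] = a # rev (walk_starts P2)" by simp
      moreover have "P2 \<noteq> []" using P12(3) assms(5) by auto
      ultimately have "set (tl (walk_starts (rev_walk P2))) \<subseteq> wS P2"
        by (metis append_self_conv2 hd_append2 list.sel(3) list.set_sel(2) rev_walk_simps(6) set_rev subsetI tl_append2
            walk_starts_simps(5) Un_iff set_append)
      then show ?thesis using d[OF refl] by auto
    qed
    ultimately show ?thesis
      using e(3) P12 by (auto simp: idisj_iff)
  qed
  moreover have "C = wE ((e, a, c) # P1) \<union> wE (rev_walk P2)"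
    using e P12 by auto
  ultimately show thesis using that by blast
qed

lemma idisj_single:
  assumes "e \<notin> wE P"
  shows "idisj [(e, a, b)] P" "idisj P [(e, a, b)]"
  using assms by (auto simp: idisj_iff)

lemma cycle_loop:
  assumes "mgraph G" "is_cycle G {z}"
  shows "is_loop G z"
proof -
  obtain p where p: "p \<noteq> []" "simple_closed_walk G {z} p"
    using assms is_cycle_scw by blast
  then obtain e a b P where e: "p = (e, a, b) # P" by (cases p) auto
  then have "(e, a, b) \<in> arcs G" "is_path G b P a" "e \<notin> wE P" "{z} = insert e (wE P)"
    using p(2) by (auto simp: scw_Cons[OF assms(1)])
  moreover have "P = []" using calculation by (cases P) auto
  ultimately show ?thesis using is_loop_arc[OF assms(1)] by auto
qed

definition right :: "('v, 'e) mgraph \<Rightarrow> 'e set set \<Rightarrow> ('e \<times> 'v \<times> 'v \<Rightarrow> int) \<Rightarrow> 'e set \<Rightarrow> bool" where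
  "right G B \<gamma> C \<longleftrightarrow> (C \<in> B \<longleftrightarrow> bal G \<gamma> C)"

lemma gainable_right:
  assumes "biased_graph (G, B)"
  shows "gainable (integer_mod_group 3) (G, B) \<longleftrightarrow> (\<exists>\<gamma>. zgain G \<gamma> \<and> (\<forall>C. is_cycle G C \<longrightarrow> right G B \<gamma> C))"
proof -
  have "mgraph G" "\<forall>C\<in>B. is_cycle G C" using assms by (auto simp only: biased_graph.simps)
  then show ?thesis
    unfolding gainable_Z3_iff[OF \<open>mgraph G\<close>] right_def by blast
qed

lemma biased_mgraph: "biased_graph (G, B) \<Longrightarrow> mgraph G"
  by (simp only: biased_graph.simps)

lemma biased_cycle: "biased_graph (G, B) \<Longrightarrow> C \<in> B \<Longrightarrow> is_cycle G C"
  by (simp only: biased_graph.simps)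

lemma idisj_right:
  assumes "mgraph G" "zgain G \<gamma>" "is_path G u p v" "is_path G u q v" "u \<noteq> v" "idisj p q"
  shows "right G B \<gamma> (wE p \<union> wE q) \<longleftrightarrow> (wE p \<union> wE q \<in> B \<longleftrightarrow> 3 dvd gs \<gamma> p - gs \<gamma> q)"
  by (simp add: right_def idisj_bal[OF assms])

text \<open>The balanced right cycle says that \<open>p\<close> and \<open>q\<close> have equal
  gains. Exchanging \<open>p\<close> for \<open>q\<close> therefore preserves the gain condition,
  and by the theta property it preserves membership in \<open>B\<close>.\<close>

lemma right_theta:
  assumes "biased_graph (G, B)" "zgain G \<gamma>" "u \<noteq> v"
    "is_path G u p v" "is_path G u q v" "is_path G u r v" "idisj p q" "idisj p r" "idisj q r"
    "right G B \<gamma> (wE p \<union> wE q)" "right G B \<gamma> (wE p \<union> wE r)" "wE p \<union> wE q \<in> B"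
  shows "right G B \<gamma> (wE q \<union> wE r)"
proof -
  have G: "mgraph G" by (rule biased_mgraph[OF assms(1)])
  have pq: "3 dvd gs \<gamma> p - gs \<gamma> q"
    using idisj_right[OF G assms(2,4,5,3,7), of B] assms(10,12) by simp
  have pr: "wE p \<union> wE r \<in> B \<longleftrightarrow> 3 dvd gs \<gamma> p - gs \<gamma> r"
    using idisj_right[OF G assms(2,4,6,3,8), of B] assms(11) by simp
  have "wE q \<union> wE r \<in> B \<longleftrightarrow> wE p \<union> wE r \<in> B"
    using biased_theta[OF assms(1,3,4,5,6,7,8,9,12)] biased_theta[OF assms(1,3,5,4,6) idisj_sym[OF assms(7)] assms(9,8)] assms(12)
    by (auto simp: Un_commute)
  also have "\<dots> \<longleftrightarrow> 3 dvd (gs \<gamma> p - gs \<gamma> r) - (gs \<gamma> p - gs \<gamma> q)"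
    unfolding pr using pq by (rule dvd_diff_left_iff[symmetric])
  finally show ?thesis
    using idisj_right[OF G assms(2,5,6,3,9), of B] by simp
qed

section \<open>Gainability of all minors that involve a given edge\<close>

text \<open>All lifts of cycles of the minor avoid the deleted edge \<open>e\<close>. So one gain
  belonging to \<open>e\<close> serves for every minor in which \<open>e\<close> is deleted.\<close>

lemma minor_gainable_delete:
  assumes "biased_graph (G, B)" "A \<inter> D = {}" "balanced_edges (G, B) A" "zgain G \<gamma>" "e \<in> D"
    "W \<subseteq> isolated_verts (contract_delete (G, B) A D)"
    "\<And>C. is_cycle G C \<Longrightarrow> e \<notin> C \<Longrightarrow> right G B \<gamma> C"
  shows "gainable (integer_mod_group 3) (delete_verts (contract_delete (G, B) A D) W)"
proof (rule push_gain[OF biased_mgraph[OF assms(1)] assms(2,4,6)])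
  fix C assume "is_cycle G C" "C \<subseteq> A"
  then show "bal G \<gamma> C"
    using assms(2,3,5,7) by (auto simp: right_def)
next
  fix C C' assume *: "is_cycle (graph_minor G A D) C" "is_cycle G C'" "C \<subseteq> C'" "C' - C \<subseteq> A"
  then have "e \<notin> C'" using assms(2,5) by (auto simp: is_cycle_def)
  then show "C' \<in> B \<longleftrightarrow> bal G \<gamma> C'"
    using assms(7) * by (auto simp: right_def)
qed

text \<open>One gain belonging to \<open>z\<close> serves for every minor in which \<open>z\<close>
  is contracted, whatever else is removed. The difficulty is a lift with \<open>z\<close> as a
  chord: one of its two sides must lie in \<open>A\<close>, and a theta with \<open>z\<close>
  transfers rightness to the lift.\<close>

lemma minor_gainable_contract:
  assumes biased: "biased_graph (G, B)" and AD: "A \<inter> D = {}" and bA: "balanced_edges (G, B) A"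
    and \<gamma>: "zgain G \<gamma>" and z: "z \<in> A" "A \<subseteq> edges G" "\<not> is_loop G z"
    and W: "W \<subseteq> isolated_verts (contract_delete (G, B) A D)"
    and right: "\<And>C. is_cycle G C \<Longrightarrow> \<not> chord G C z \<Longrightarrow> right G B \<gamma> C"
  shows "gainable (integer_mod_group 3) (delete_verts (contract_delete (G, B) A D) W)"
proof -
  have G: "mgraph G" by (rule biased_mgraph[OF biased])
  obtain a b where ab: "(z, a, b) \<in> arcs G" using edge_arcE[OF G] z by blast
  then have ne: "a \<noteq> b" using is_loop_arc[OF G] z by blast
  have through: "right G B \<gamma> C" if "is_cycle G C" "z \<in> C" for C
    using right that by (auto simp: chord_def)
  have zp: "is_cycle G (insert z (wE P))" if "is_path G a P b" "z \<notin> wE P" for P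
    using idisj_cycle[OF G is_path_single[OF G ab ne] that(1) ne idisj_single(1)[OF that(2)]] by simp
  \<comment> \<open>If the side \<open>P\<close> lies in \<open>A\<close>, then \<open>P\<close> and
    \<open>z\<close> form a balanced cycle, which is right because it contains \<open>z\<close>; so
    does the cycle of \<open>Q\<close> and \<open>z\<close>. The theta of \<open>z\<close>,
    \<open>P\<close> and \<open>Q\<close> then makes \<open>P \<union> Q\<close> right.\<close>
  have split: "right G B \<gamma> C"
    if C: "is_cycle G C" and PQ: "\<And>P Q. is_path G a P b \<Longrightarrow> is_path G a Q b \<Longrightarrow> idisj P Q \<Longrightarrow> C = wE P \<union> wE Q \<Longrightarrow> z \<notin> C \<Longrightarrow>
      wE P \<subseteq> A \<or> wE Q \<subseteq> A" for C
  proof (cases "chord G C z")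
    case True
    then have "z \<notin> C" "a \<in> \<Union>(ends G ` C)" "b \<in> \<Union>(ends G ` C)"
      by (auto simp: chord_def ends_arc[OF G ab])
    with cycle_split[OF G C this(2,3) ne] obtain P Q where
      P: "is_path G a P b" "is_path G a Q b" "idisj P Q" "C = wE P \<union> wE Q" by blast
    have zz: "z \<notin> wE P" "z \<notin> wE Q" using P \<open>z \<notin> C\<close> by auto
    note zpath = is_path_single[OF G ab ne] and zs = idisj_single(1)[OF zz(1), of a b] idisj_single(1)[OF zz(2), of a b]
    have r: "right G B \<gamma> (insert z (wE P))" "right G B \<gamma> (insert z (wE Q))"
      using through zp P zz by auto
    have inB: "insert z (wE R) \<in> B" if "is_path G a R b" "wE R \<subseteq> A" "z \<notin> wE R" for R
      using bA zp[OF that(1,3)] that(2) z(1) by auto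
    show ?thesis
      using PQ[OF P \<open>z \<notin> C\<close>]
    proof
      assume "wE P \<subseteq> A"
      then show ?thesis
        using right_theta[OF biased \<gamma> ne zpath P(1,2) zs P(3)] r inB P zz by simp
    next
      assume "wE Q \<subseteq> A"
      then show ?thesis
        using right_theta[OF biased \<gamma> ne zpath P(2,1) zs(2,1) idisj_sym[OF P(3)]] r inB P zz
        by (simp add: Un_commute)
    qed
  qed (use right C in blast)
  show ?thesis
  proof (rule push_gain[OF G AD \<gamma> W])
    fix C assume C: "is_cycle G C" "C \<subseteq> A"
    then have "C \<in> B" using bA by auto
    moreover have "right G B \<gamma> C"
      by (rule split[OF C(1)]) (use C(2) in auto)
    ultimately show "bal G \<gamma> C" by (simp add: right_def)
  next
    fix C C' assume *: "is_cycle (graph_minor G A D) C" "is_cycle G C'" "C \<subseteq> C'" "C' - C \<subseteq> A"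
    have "right G B \<gamma> C'"
    proof (rule split[OF *(2)])
      fix P Q assume P: "is_path G a P b" "is_path G a Q b" "idisj P Q" "C' = wE P \<union> wE Q" "z \<notin> C'"
      let ?p = "P @ rev_walk Q"
      have s: "simple_closed_walk G C' ?p" using idisj_scw[OF G P(1,2) ne P(3)] P(4) by simp
      then have w: "is_walk G a ?p a" "wE ?p = C'" "distinct (walk_edges ?p)"
        using P is_walk_rev[OF G is_path_walk[OF P(2)]]
        by (auto simp: is_walk_append[OF G] is_path_def simple_closed_walk_def)
      have CE: "C \<inter> A = {}" "C \<inter> D = {}" using *(1) by (auto simp: is_cycle_def)
      then have CD: "wE ?p \<inter> D = {}" using w *(3,4) AD by blast
      have pe: "wE (proj G A ?p) = C" "distinct (walk_edges (proj G A ?p))"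
        using w * CE by (auto simp: proj_edges)
      have s: "simple_closed_walk (graph_minor G A D) C (proj G A ?p)"
        by (rule closed_trail_scw[OF mgraph_graph_minor[OF G] *(1) proj_walk[OF G w(1) CD] pe(2,1)])
      have kab: "component G A a = component G A b"
        using component_eq_iff[OF G arc_verts(1)[OF G ab]] joined_arc[OF G ab z(1)] by blast
      have CDP: "wE P \<inter> D = {}" "wE Q \<inter> D = {}" using CD by auto
      have 1: "hd (walk_starts (proj G A P)) = component G A a" if "proj G A P \<noteq> []"
        using is_walk_start[OF proj_walk[OF G is_path_walk[OF P(1)] CDP(1)] that] .
      have 2: "hd (walk_starts (proj G A (rev_walk Q))) = component G A b" if "proj G A (rev_walk Q) \<noteq> []"
        using is_walk_start[OF proj_walk[OF G is_walk_rev[OF G is_path_walk[OF P(2)]], of D A] that] CDP by simp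
      \<comment> \<open>\<open>a\<close> and \<open>b\<close> lie in one component. If both sides
        left a trace in the minor, the projected walk would start twice at that vertex.\<close>
      have "proj G A P = [] \<or> proj G A (rev_walk Q) = []"
      proof (rule ccontr)
        assume n: "\<not> ?thesis"
        then have "component G A a \<in> wS (proj G A P)" "component G A a \<in> wS (proj G A (rev_walk Q))"
          using 1 2 kab hd_in_set by (metis walk_starts_simps(5))+
        then show False using s by (auto simp: simple_closed_walk_def)
      qed
      moreover have "wE R \<subseteq> A" if "proj G A R = []" for R
      proof -
        have "filter (\<lambda>e. e \<notin> A) (walk_edges R) = []"
          using proj_edges[of G A R] that by simp
        then show ?thesis by (auto simp: filter_empty_conv)
      qed
      ultimately show "wE P \<subseteq> A \<or> wE Q \<subseteq> A" by (metis rev_walk_simps(4))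
    qed
    then show "C' \<in> B \<longleftrightarrow> bal G \<gamma> C'" by (simp add: right_def)
  qed
qed

subsection \<open>Excluded minors\<close>

text \<open>What being an excluded minor means for the gains of \<open>G\<close> itself, with gains
  pulled back from the minors at a single edge. Conversely, such a graph without loops turns out to
  be an excluded minor.\<close>

locale critical_graph =
  fixes G :: "('v, 'e) mgraph" and B :: "'e set set"
  assumes biased: "biased_graph (G, B)"
    and not_gainable: "\<And>\<gamma>. zgain G \<gamma> \<Longrightarrow> \<exists>C. is_cycle G C \<and> \<not> right G B \<gamma> C"
    and delete: "\<And>e. e \<in> edges G \<Longrightarrow> \<exists>\<gamma>. zgain G \<gamma> \<and> (\<forall>C. is_cycle G C \<longrightarrow> e \<notin> C \<longrightarrow> right G B \<gamma> C)"
    and contract: "\<And>z. z \<in> edges G \<Longrightarrow> \<not> is_loop G z \<Longrightarrow>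
      \<exists>\<gamma>. zgain G \<gamma> \<and> (\<forall>C. is_cycle G C \<longrightarrow> \<not> chord G C z \<longrightarrow> right G B \<gamma> C)"
    and no_isolated: "verts G = \<Union>(ends G ` edges G)"
begin

lemma G: "mgraph G"
  by (rule biased_mgraph[OF biased])

lemma path_appendI:
  assumes "is_path G u p w" "is_path G w q v" "wS p \<inter> insert v (wS q) = {}"
  shows "is_path G u (p @ q) v"
  using assms is_path_append[OF G] by blast

lemma critical:
  assumes "\<And>C. C \<in> \<L> \<Longrightarrow> is_cycle G C" "\<And>\<gamma>. zgain G \<gamma> \<Longrightarrow> \<forall>C\<in>\<L>. right G B \<gamma> C \<Longrightarrow> False" "z \<in> edges G"
  shows "z \<in> \<Union>\<L>" "\<not> is_loop G z \<Longrightarrow> \<exists>C\<in>\<L>. chord G C z"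
proof -
  show "z \<in> \<Union>\<L>"
  proof (rule ccontr)
    assume n: "z \<notin> \<Union>\<L>"
    obtain \<gamma> where "zgain G \<gamma>" "\<forall>C. is_cycle G C \<longrightarrow> z \<notin> C \<longrightarrow> right G B \<gamma> C"
      using delete[OF assms(3)] by blast
    then show False using assms(1,2) n by blast
  qed
  show "\<exists>C\<in>\<L>. chord G C z" if nl: "\<not> is_loop G z"
  proof (rule ccontr)
    assume n: "\<not> (\<exists>C\<in>\<L>. chord G C z)"
    obtain \<gamma> where "zgain G \<gamma>" "\<forall>C. is_cycle G C \<longrightarrow> \<not> chord G C z \<longrightarrow> right G B \<gamma> C"
      using contract[OF assms(3) nl] by blast
    then show False using assms(1,2) n by blast
  qed
qed

end

lemma excluded_minor_critical:
  assumes "excluded_minor_gainable (integer_mod_group 3) (G, B)"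
  shows "critical_graph G B"
proof -
  have biased: "biased_graph (G, B)" and nong: "\<not> gainable (integer_mod_group 3) (G, B)"
    and minors: "\<And>M. proper_minor M (G, B) \<Longrightarrow> gainable (integer_mod_group 3) M"
    using assms unfolding excluded_minor_gainable_def by blast+
  have G: "mgraph G" by (rule biased_mgraph[OF biased])
  have fin: "finite (edges G)" "finite (verts G)" using G by (auto simp: mgraph_def)
  have minor: "gainable (integer_mod_group 3) (delete_verts (contract_delete (G, B) A D) W)"
    if "A \<subseteq> edges G" "D \<subseteq> edges G" "A \<inter> D = {}" "balanced_edges (G, B) A"
      "W \<subseteq> isolated_verts (contract_delete (G, B) A D)" "A \<union> D \<noteq> {} \<or> W \<noteq> {}" for A D W
  proof (rule minors)
    let ?M = "delete_verts (contract_delete (G, B) A D) W"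
    have "is_minor ?M (G, B)"
      unfolding is_minor_def using that by (intro exI[of _ A] exI[of _ D] exI[of _ W]) simp
    moreover have "\<not> ?M \<cong>\<^sub>b (G, B)"
    proof
      assume "?M \<cong>\<^sub>b (G, B)"
      then obtain f g where f: "bij_betw f (component G A ` verts G - W) (verts G)"
        and g: "bij_betw g (edges G - (A \<union> D)) (edges G)"
        by auto
      show False
      \<comment> \<open>Counting suffices: an isomorphism would preserve the numbers of edges and
        vertices.\<close>
      proof (cases "A \<union> D = {}")
        case False
        then have "edges G - (A \<union> D) \<subset> edges G" using that(1,2) by blast
        from psubset_card_mono[OF fin(1) this] show False using bij_betw_same_card[OF g] by simp
      next
        case True
        then have "W \<noteq> {}" "W \<subseteq> component G A ` verts G" using that by auto
        then have "component G A ` verts G - W \<subset> component G A ` verts G" by auto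
        then have "card (component G A ` verts G - W) < card (component G A ` verts G)"
          using fin(2) by (intro psubset_card_mono) auto
        also have "\<dots> \<le> card (verts G)" using fin(2) by (rule card_image_le)
        finally show False using bij_betw_same_card[OF f] by simp
      qed
    qed
    ultimately show "proper_minor ?M (G, B)" by (simp add: proper_minor_def)
  qed
  have empty: "balanced_edges (G, B) {}" by (auto simp: is_cycle_def)
  show ?thesis
  proof
    show "biased_graph (G, B)" by (rule biased)
    show "\<exists>C. is_cycle G C \<and> \<not> right G B \<gamma> C" if "zgain G \<gamma>" for \<gamma>
      using nong gainable_right[OF biased] that by blast
    show "\<exists>\<gamma>. zgain G \<gamma> \<and> (\<forall>C. is_cycle G C \<longrightarrow> e \<notin> C \<longrightarrow> right G B \<gamma> C)" if "e \<in> edges G" for e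
    proof -
      have "gainable (integer_mod_group 3) (delete_verts (contract_delete (G, B) {} {e}) {})"
        by (rule minor) (use that empty in auto)
      then show ?thesis
        using pull_gain[OF G, of "{}" e "{}" B "{e}"] unfolding right_def by simp
    qed
    show "\<exists>\<gamma>. zgain G \<gamma> \<and> (\<forall>C. is_cycle G C \<longrightarrow> \<not> chord G C z \<longrightarrow> right G B \<gamma> C)"
      if "z \<in> edges G" "\<not> is_loop G z" for z
    proof -
      have "\<not> (is_cycle G C \<and> C \<subseteq> {z})" for C
        using cycle_loop[OF G, of z] that(2) by (auto simp: is_cycle_def subset_singleton_iff)
      then have "balanced_edges (G, B) {z}" by auto
      then have "gainable (integer_mod_group 3) (delete_verts (contract_delete (G, B) {z} {}) {})"
        by (intro minor) (use that in auto)
      then show ?thesis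
        using pull_gain[OF G, of "{z}" z "{}" B "{}"] that unfolding right_def by simp
    qed
    show "verts G = \<Union>(ends G ` edges G)"
    proof (rule ccontr)
      assume "verts G \<noteq> \<Union>(ends G ` edges G)"
      then obtain v where v: "v \<in> verts G" "\<And>e. e \<in> edges G \<Longrightarrow> v \<notin> ends G e"
        using mgraphD(1)[OF G] by blast
      \<comment> \<open>Removing just this vertex gives a proper minor, and its gain pulls back to
        one that is right on all cycles.\<close>
      let ?W = "{component G {} v}"
      have "component G {} v \<notin> component G {} ` ends G e" if "e \<in> edges G" for e
      proof
        assume "component G {} v \<in> component G {} ` ends G e"
        then obtain w where w: "w \<in> ends G e" "joined G {} v w"
          using component_eq_iff[OF G v(1)] by blast
        then have "v = w" using joined_at_most_one[OF G, of "{}" e v w] by blast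
        then show False using v(2)[OF that] w by blast
      qed
      then have W: "?W \<subseteq> isolated_verts (contract_delete (G, B) {} {})"
        using v(1) by auto
      then have "gainable (integer_mod_group 3) (delete_verts (contract_delete (G, B) {} {}) ?W)"
        by (intro minor) (use empty in auto)
      then have "\<exists>\<gamma>. zgain G \<gamma> \<and> (\<forall>C. is_cycle G C \<longrightarrow> right G B \<gamma> C)"
        using pull_gain[OF G _ _ W, of undefined] unfolding right_def by simp
      then show False using nong gainable_right[OF biased] by blast
    qed
  qed
qed

subsection \<open>Comparing two paths\<close>

lemma path_disjoint_append:
  assumes "mgraph G" "is_path G u (p @ q) v"
  shows "wS p \<inter> insert v (wS q) = {}"
  using assms by (auto simp: is_path_append)

lemma path_start_in: "is_path G u p v \<Longrightarrow> u \<noteq> v \<Longrightarrow> u \<in> wS p"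
  by (cases p) (auto simp: is_path_Cons)

lemma path_start_in': "is_path G u p v \<Longrightarrow> p \<noteq> [] \<Longrightarrow> u \<in> wS p"
  by (cases p) (auto simp: is_path_Cons)

lemma path_end_notin: "is_path G u p v \<Longrightarrow> v \<notin> wS p"
  by (simp add: is_path_def)

lemma path_start_V: "is_path G u p v \<Longrightarrow> u \<in> insert v (wS p)"
  by (auto dest: is_path_walk is_walk_start_in)

lemma path_end_unique: "is_path G u p v \<Longrightarrow> is_path G u p w \<Longrightarrow> v = w"
  by (rule is_walk_end_unique[OF is_path_walk is_path_walk])

lemma path_start_unique: "is_path G u p v \<Longrightarrow> is_path G w p x \<Longrightarrow> p \<noteq> [] \<Longrightarrow> u = w"
  by (rule is_walk_start_unique[OF is_path_walk is_path_walk])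

lemma path_rev_inner:
  assumes "mgraph G" "is_path G u p v" "p \<noteq> []"
  shows "wS (rev_walk p) - {v} = wS p - {u}" "wS (rev_walk p) = insert v (wS p - {u})"
proof -
  have "u \<notin> wS (rev_walk p)" "v \<notin> wS p" "u \<in> wS p" "v \<in> wS (rev_walk p)"
    using path_end_notin[OF is_path_rev[OF assms(1,2)]] path_end_notin[OF assms(2)] path_start_in'[OF assms(2,3)]
      path_start_in'[OF is_path_rev[OF assms(1,2)]] assms(3) by auto
  then show "wS (rev_walk p) - {v} = wS p - {u}" "wS (rev_walk p) = insert v (wS p - {u})"
    using walk_starts_rev_set[OF is_path_walk[OF assms(2)]] by auto
qed

text \<open>A path passes through each vertex only once, so the vertex \<open>t\<close> determines
  where it is cut.\<close>

lemma path_suffix_unique: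
  assumes "mgraph G" "is_path G a (X @ Y) b" "X @ Y = X' @ Y'" "is_path G t Y b" "is_path G t Y' b"
  shows "Y = Y'"
proof -
  have *: "k = []" if that: "k @ Y = Y'" "is_path G t Y b" "is_path G t Y' b"
    for Y Y' k
  proof -
    have kY: "is_path G t (k @ Y) b" using that(1,3) by simp
    then obtain w where w: "is_path G t k w" "is_path G w Y b"
      unfolding is_path_append[OF assms(1)] by blast
    have "w = t"
    proof (cases "Y = []")
      case True
      then show ?thesis using w that(2) by simp
    next
      case False
      then show ?thesis using path_start_unique[OF w(2) that(2)] by blast
    qed
    then have "is_path G t k t" using w by simp
    then show "k = []" by (rule closed_path_Nil)
  qed
  obtain k where "X = X' @ k \<and> k @ Y = Y' \<or> X @ k = X' \<and> Y = k @ Y'"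
    using assms(3) append_eq_append_conv2[of X Y X' Y'] by blast
  then show ?thesis
    using *[of k Y Y'] *[of k Y' Y] assms(4,5) by auto
qed

lemma first_hit:
  assumes "mgraph G" "is_path G d q b" "b \<in> S"
  shows "\<exists>r t q'. q = r @ q' \<and> is_path G d r t \<and> t \<in> S \<and> wS r \<inter> S = {} \<and> is_path G t q' b"
  using assms(2)
proof (induction q arbitrary: d)
  case Nil
  then show ?case using assms(3) by (intro exI[of _ "[]"]) auto
next
  case (Cons x q)
  obtain g c where x: "x = (g, d, c)" "(g, d, c) \<in> arcs G" "is_path G c q b" "d \<notin> insert b (wS q)"
    using Cons.prems by (cases x) (auto simp: is_path_Cons)
  show ?case
  proof (cases "d \<in> S")
    case True
    have "is_path G d [] d"
      using is_walk_verts(1)[OF assms(1) is_path_walk[OF Cons.prems]] by simp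
    then show ?thesis
      using True Cons.prems by (intro exI[of _ "[]"] exI[of _ d] exI[of _ "x # q"]) auto
  next
    case False
    obtain r t q' where r: "q = r @ q'" "is_path G c r t" "t \<in> S" "wS r \<inter> S = {}" "is_path G t q' b"
      using Cons.IH[OF x(3)] by blast
    have "is_path G d (x # r) t"
      using x r False by (auto simp: is_path_Cons)
    then show ?thesis
      using r x False by (intro exI[of _ "x # r"] exI[of _ t] exI[of _ q']) auto
  qed
qed

text \<open>Inner vertices of \<open>\<sigma>\<close> avoid \<open>P\<close>, so an edge of
  \<open>\<sigma>\<close> on \<open>P\<close> joins the ends of \<open>\<sigma>\<close> and is all
  of \<open>\<sigma>\<close>. The edge \<open>g\<close> excludes this.\<close>

lemma edges_off_path:
  assumes "mgraph G" "is_path G s \<sigma> t" "is_walk G a P b" "(wS \<sigma> - {s}) \<inter> insert b (wS P) = {}"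
    "g \<in> wE \<sigma>" "g \<notin> wE P"
  shows "wE \<sigma> \<inter> wE P = {}"
proof (rule ccontr)
  assume "wE \<sigma> \<inter> wE P \<noteq> {}"
  then obtain h where h: "h \<in> wE \<sigma>" "h \<in> wE P" by blast
  then obtain z where "z \<in> set \<sigma>" "fst z = h" by (auto simp: walk_edges_def)
  then obtain x y \<sigma>1 \<sigma>2 where s: "\<sigma> = \<sigma>1 @ (h, x, y) # \<sigma>2"
    by (metis split_list prod.collapse)
  then have p: "is_path G s \<sigma>1 x" "(h, x, y) \<in> arcs G" "is_path G y \<sigma>2 t" "wS \<sigma>1 \<inter> insert t (wS ((h, x, y) # \<sigma>2)) = {}"
    "x \<notin> wS \<sigma>2"
    using assms(2) by (auto simp: is_path_append[OF assms(1)] is_path_Cons)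
  have V: "{x, y} \<subseteq> insert b (wS P)"
    using walk_ends[OF assms(1,3)] h(2) ends_arc[OF assms(1) p(2)] by blast
  then have "x = s" using assms(4) s by auto
  then have "\<sigma>1 = []" using closed_path_Nil[of G s] p(1) by blast
  have "\<sigma>2 = []"
  proof (rule ccontr)
    assume "\<sigma>2 \<noteq> []"
    then have "y \<in> wS \<sigma>2" using path_start_in'[OF p(3)] by simp
    then show False using assms(4) V s p(5) \<open>x = s\<close> by auto
  qed
  then show False using s \<open>\<sigma>1 = []\<close> assms(5,6) h by simp
qed

text \<open>Follow \<open>Q\<close> along the common initial part \<open>\<alpha>\<close> to the
  vertex \<open>s\<close> where it leaves \<open>P\<close>, then along \<open>\<sigma>\<close> to
  its first return to \<open>P\<close>, at \<open>t\<close>. As \<open>Q\<close> does not revisit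
  vertices, \<open>t\<close> comes later than \<open>s\<close> on \<open>P\<close>, and
  \<open>\<pi>\<close> is the part of \<open>P\<close> that \<open>\<sigma>\<close>
  bypasses.\<close>

lemma bypass_first:
  assumes "mgraph G"
  shows "is_path G a P b \<Longrightarrow> is_path G a Q b \<Longrightarrow> P \<noteq> Q \<Longrightarrow>
    \<exists>\<alpha> \<pi> P' \<sigma> Q' s t. P = \<alpha> @ \<pi> @ P' \<and> Q = \<alpha> @ \<sigma> @ Q' \<and> is_path G a \<alpha> s \<and> is_path G s \<pi> t \<and>
      is_path G s \<sigma> t \<and> is_path G t P' b \<and> is_path G t Q' b \<and> s \<noteq> t \<and>
      (wS \<sigma> - {s}) \<inter> insert b (wS P) = {} \<and> fst (hd \<pi>) \<notin> wE Q \<and> fst (hd \<sigma>) \<notin> wE P"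
proof (induction P arbitrary: a Q)
  case Nil
  then have "a = b" by simp
  then have "Q = []" using closed_path_Nil[of G b Q] Nil by simp
  then show ?case using Nil by simp
next
  case (Cons x P1)
  obtain f c where x: "x = (f, a, c)" "(f, a, c) \<in> arcs G" "is_path G c P1 b" "a \<notin> insert b (wS P1)"
    using Cons.prems(1) by (cases x) (auto simp: is_path_Cons)
  have av: "a \<in> verts G" using arc_verts(1)[OF assms x(2)] .
  have "Q \<noteq> []" using Cons.prems(2) x(4) by auto
  then obtain g d Q1 where Q: "Q = (g, a, d) # Q1" "(g, a, d) \<in> arcs G" "is_path G d Q1 b" "a \<notin> insert b (wS Q1)"
    using Cons.prems(2) by (cases Q) (auto simp: is_path_Cons)
  show ?case
  proof (cases "f = g")
    case True
    then have "c = d" using arc_unique[OF assms x(2)] Q(2) by simp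
    then have "P1 \<noteq> Q1" using True Cons.prems(3) x Q by simp
    have pQ: "is_path G c Q1 b" using Q \<open>c = d\<close> by simp
    obtain \<alpha> \<pi> P' \<sigma> Q' s t where *: "P1 = \<alpha> @ \<pi> @ P'" "Q1 = \<alpha> @ \<sigma> @ Q'" "is_path G c \<alpha> s" "is_path G s \<pi> t"
      "is_path G s \<sigma> t" "is_path G t P' b" "is_path G t Q' b" "s \<noteq> t"
      "(wS \<sigma> - {s}) \<inter> insert b (wS P1) = {}" "fst (hd \<pi>) \<notin> wE Q1" "fst (hd \<sigma>) \<notin> wE P1"
      using Cons.IH[OF x(3) pQ \<open>P1 \<noteq> Q1\<close>] by blast
    have "\<pi> \<noteq> []" "\<sigma> \<noteq> []" using *(4,5,8) by auto
    then have "fst (hd \<pi>) \<in> wE P1" "fst (hd \<sigma>) \<in> wE Q1"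
      using *(1,2) by (cases \<pi>; cases \<sigma>; auto)+
    moreover have "f \<notin> wE P1" "f \<notin> wE Q1"
      using path_first_edge(1)[OF assms, of a f c P1 b] path_first_edge(1)[OF assms, of a f d Q1 b] Cons.prems(1,2) x Q True
      by auto
    ultimately have "fst (hd \<pi>) \<noteq> f" "fst (hd \<sigma>) \<noteq> f" by auto
    moreover have "is_path G a (x # \<alpha>) s"
      using x * path_start_V[OF *(4)] path_start_V[OF *(6)] by (auto simp: is_path_Cons)
    moreover have "a \<notin> wS \<sigma>" using Q * by auto
    ultimately have "x # P1 = (x # \<alpha>) @ \<pi> @ P' \<and> Q = (x # \<alpha>) @ \<sigma> @ Q' \<and> is_path G a (x # \<alpha>) s \<and>
      (wS \<sigma> - {s}) \<inter> insert b (wS (x # P1)) = {} \<and> fst (hd \<pi>) \<notin> wE Q \<and> fst (hd \<sigma>) \<notin> wE (x # P1)"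
      using *(1,2,9,10,11) x(1) Q(1) True \<open>c = d\<close> by auto
    then show ?thesis using *(4-8) by metis
  next
    case False
    obtain r t Q' where r: "Q1 = r @ Q'" "is_path G d r t" "t \<in> insert b (wS P1)" "wS r \<inter> insert b (wS P1) = {}"
      "is_path G t Q' b"
      using first_hit[OF assms Q(3), of "insert b (wS P1)"] by blast
    obtain \<pi>' P' where p: "P1 = \<pi>' @ P'" "is_path G c \<pi>' t" "is_path G t P' b"
      by (rule path_split_at[OF assms x(3) r(3)])
    have at: "a \<noteq> t" using r(3) x(4) by auto
    have "is_path G a (x # \<pi>') t" using x p at by (auto simp: is_path_Cons)
    moreover have "is_path G a ((g, a, d) # r) t" using Q r at by (auto simp: is_path_Cons)
    moreover have "f \<notin> wE Q" "g \<notin> wE (x # P1)"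
      using path_first_edge(2)[OF assms, of a g d Q1 b f] path_first_edge(2)[OF assms, of a f c P1 b g]
        arc_end1[OF x(2)] arc_end1[OF Q(2)] Cons.prems(1,2) x Q False by auto
    moreover have "is_path G a [] a" using av by simp
    moreover have "(wS ((g, a, d) # r) - {a}) \<inter> insert b (wS (x # P1)) = {}"
      using r(4) x(1) by auto
    moreover have "x # P1 = [] @ (x # \<pi>') @ P'" "Q = [] @ ((g, a, d) # r) @ Q'"
      using p(1) r(1) Q(1) by simp_all
    moreover have "fst (hd (x # \<pi>')) = f" "fst (hd ((g, a, d) # r)) = g"
      using x(1) by simp_all
    ultimately show ?thesis
      using r(5) p(3) at by metis
  qed
qed

lemma bypass_first_elim:
  assumes "mgraph G" "is_path G a P b" "is_path G a Q b" "P \<noteq> Q"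
  obtains \<alpha> \<pi> P' \<sigma> Q' s t where "P = \<alpha> @ \<pi> @ P'" "Q = \<alpha> @ \<sigma> @ Q'" "is_path G a \<alpha> s" "is_path G s \<pi> t"
    "is_path G s \<sigma> t" "is_path G t P' b" "is_path G t Q' b" "s \<noteq> t"
    "(wS \<sigma> - {s}) \<inter> insert b (wS P) = {}" "fst (hd \<pi>) \<notin> wE Q" "wE \<sigma> \<inter> wE P = {}"
proof -
  obtain \<alpha> \<pi> P' \<sigma> Q' s t where *: "P = \<alpha> @ \<pi> @ P'" "Q = \<alpha> @ \<sigma> @ Q'" "is_path G a \<alpha> s" "is_path G s \<pi> t"
    "is_path G s \<sigma> t" "is_path G t P' b" "is_path G t Q' b" "s \<noteq> t"
    "(wS \<sigma> - {s}) \<inter> insert b (wS P) = {}" "fst (hd \<pi>) \<notin> wE Q" "fst (hd \<sigma>) \<notin> wE P"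
    using bypass_first[OF assms] by blast
  have "fst (hd \<sigma>) \<in> wE \<sigma>" using *(5,8) by (cases \<sigma>) auto
  then have "wE \<sigma> \<inter> wE P = {}"
    using edges_off_path[OF assms(1) *(5) is_path_walk[OF assms(2)] *(9) _ *(11)] by blast
  then show thesis using that * by blast
qed

text \<open>The last bypass is the first one of the reversed paths.\<close>

lemma bypass_last_elim:
  assumes "mgraph G" "is_path G a P b" "is_path G a Q b" "P \<noteq> Q"
  obtains P' \<pi> \<beta> Q' \<sigma> s t f where "P = P' @ \<pi> @ \<beta>" "Q = Q' @ \<sigma> @ \<beta>" "is_path G a P' s" "is_path G s \<pi> t"
    "is_path G s \<sigma> t" "is_path G t \<beta> b" "is_path G a Q' s" "s \<noteq> t"
    "(wS \<sigma> - {s}) \<inter> insert b (wS P) = {}" "f \<in> wE \<pi>" "f \<notin> wE Q" "wE \<sigma> \<inter> wE P = {}"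
proof -
  note rv = is_path_rev[OF assms(1)]
  have "rev_walk P \<noteq> rev_walk Q" using assms(4) by (metis rev_walk_simps(5))
  then obtain \<alpha> \<pi> P' \<sigma> Q' s t where *: "rev_walk P = \<alpha> @ \<pi> @ P'" "rev_walk Q = \<alpha> @ \<sigma> @ Q'" "is_path G b \<alpha> s"
    "is_path G s \<pi> t" "is_path G s \<sigma> t" "is_path G t P' a" "is_path G t Q' a" "s \<noteq> t"
    "(wS \<sigma> - {s}) \<inter> insert a (wS (rev_walk P)) = {}" "fst (hd \<pi>) \<notin> wE (rev_walk Q)" "wE \<sigma> \<inter> wE (rev_walk P) = {}"
    by (rule bypass_first_elim[OF assms(1) rv[OF assms(2)] rv[OF assms(3)]])
  have P: "P = rev_walk P' @ rev_walk \<pi> @ rev_walk \<alpha>" and Q: "Q = rev_walk Q' @ rev_walk \<sigma> @ rev_walk \<alpha>"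
    using arg_cong[OF *(1), of rev_walk] arg_cong[OF *(2), of rev_walk] by simp_all
  have ne: "\<sigma> \<noteq> []" using *(5,8) by auto
  have "(wS (rev_walk \<sigma>) - {t}) \<inter> insert b (wS P) = {}"
    using *(9) path_rev_inner(1)[OF assms(1) *(5) ne] walk_starts_rev_set[OF is_path_walk[OF assms(2)]] by simp
  moreover have "fst (hd \<pi>) \<in> wE (rev_walk \<pi>)" using *(4,8) by (cases \<pi>) auto
  moreover have "wE (rev_walk \<sigma>) \<inter> wE P = {}" using *(11) by simp
  ultimately show thesis
    using that[OF P Q rv[OF *(6)] rv[OF *(4)] rv[OF *(5)] rv[OF *(3)] rv[OF *(7)], of "fst (hd \<pi>)"] *(8,10) by simp
qed

text \<open>A segment that starts strictly later than \<open>\<sigma>\<close> starts at or after its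
  end: otherwise its first vertex, which lies in \<open>S\<close>, would be an inner vertex of
  \<open>\<sigma>\<close>.\<close>

lemma segment_order:
  assumes "mgraph G" "is_path G s \<sigma> t" "is_path G a X s" "is_path G a X' s'"
    "(wS \<sigma> - {s}) \<inter> S = {}" "s' \<in> S" "X @ \<sigma> @ Y = X' @ Z" "X' = X @ \<rho>" "\<rho> \<noteq> []"
  shows "\<exists>\<nu>. \<rho> = \<sigma> @ \<nu>"
proof -
  have "\<sigma> @ Y = \<rho> @ Z" using assms(7,8) by simp
  then obtain k where "\<sigma> = \<rho> @ k \<and> k @ Y = Z \<or> \<sigma> @ k = \<rho> \<and> Y = k @ Z"
    using append_eq_append_conv2[of \<sigma> Y \<rho> Z] by blast
  then show ?thesis
  proof
    assume k: "\<sigma> = \<rho> @ k \<and> k @ Y = Z"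
    show ?thesis
    proof (cases "k = []")
      case True
      then show ?thesis using k by auto
    next
      case False
      obtain w where w: "is_path G s \<rho> w" "is_path G w k t" "wS \<rho> \<inter> insert t (wS k) = {}"
        using assms(2) k is_path_append[OF assms(1)] by blast
      have "is_path G a X s \<and> is_path G s \<rho> s'"
      proof -
        obtain u where u: "is_path G a X u" "is_path G u \<rho> s'"
          using assms(4,8) is_path_append[OF assms(1)] by blast
        then have "u = s" using path_end_unique[OF u(1) assms(3)] by blast
        then show ?thesis using u by simp
      qed
      then have "w = s'" using path_end_unique[OF w(1)] by blast
      then have "s' \<in> wS \<sigma>" "s' \<noteq> s"
        using k w path_start_in'[OF w(2) False] path_start_in'[OF w(1) assms(9)] by auto
      then show ?thesis using assms(5,6) by blast
    qed
  qed auto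
qed

text \<open>Segments of one walk with ends in \<open>S\<close> and no inner vertices in
  \<open>S\<close> cannot overlap partially. Applied with \<open>S\<close> the vertices of
  \<open>P\<close> and two bypasses as segments of \<open>Q\<close>.\<close>

lemma segments:
  assumes "mgraph G" "is_path G s \<sigma> t" "is_path G a X s" "is_path G s' \<sigma>' t'" "is_path G a X' s'"
    "(wS \<sigma> - {s}) \<inter> S = {}" "(wS \<sigma>' - {s'}) \<inter> S = {}" "{s, t, s', t'} \<subseteq> S" "s \<noteq> t" "s' \<noteq> t'"
    "X @ \<sigma> @ Y = X' @ \<sigma>' @ Y'"
  shows "X = X' \<and> \<sigma> = \<sigma>' \<or> (\<exists>\<nu>. X' = X @ \<sigma> @ \<nu>) \<or> (\<exists>\<nu>. X = X' @ \<sigma>' @ \<nu>)"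
proof -
  obtain k where "X = X' @ k \<or> X' = X @ k"
    using assms(11) append_eq_append_conv2[of X "\<sigma> @ Y" X' "\<sigma>' @ Y'"] by blast
  then consider "X = X'" | "X' = X @ k" "k \<noteq> []" | "X = X' @ k" "k \<noteq> []"
    by (cases "k = []") auto
  then show ?thesis
  proof cases
    case 1
    then have ss: "s = s'" using path_end_unique[OF assms(3)] assms(5) by blast
    have *: "k = []" if h: "is_path G s \<sigma> t" "is_path G s \<sigma>' t'" "\<sigma>' = \<sigma> @ k" "t \<in> S" "(wS \<sigma>' - {s}) \<inter> S = {}" "s \<noteq> t"
      for \<sigma> \<sigma>' t t' k
    proof (rule ccontr)
      assume "k \<noteq> []"
      obtain w where w: "is_path G s \<sigma> w" "is_path G w k t'"
        using h(2) unfolding h(3) is_path_append[OF assms(1)] by blast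
      have "w = t" using path_end_unique[OF w(1) h(1)] .
      then have "t \<in> wS \<sigma>'" using path_start_in'[OF w(2) \<open>k \<noteq> []\<close>] h(3) by auto
      then show False using h(4,5,6) by blast
    qed
    obtain k where "\<sigma> = \<sigma>' @ k \<or> \<sigma>' = \<sigma> @ k"
      using assms(11) 1 append_eq_append_conv2[of \<sigma> Y \<sigma>' Y'] by auto
    then have "\<sigma> = \<sigma>'"
    proof
      assume k: "\<sigma> = \<sigma>' @ k"
      have "k = []" by (rule *[of \<sigma>' t' \<sigma> t]) (use k assms(2,4,6-10) ss in auto)
      then show ?thesis using k by simp
    next
      assume k: "\<sigma>' = \<sigma> @ k"
      have "k = []" by (rule *[of \<sigma> t \<sigma>' t']) (use k assms(2,4,6-10) ss in auto)
      then show ?thesis using k by simp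
    qed
    then show ?thesis using 1 by blast
  next
    case 2
    then show ?thesis
      using segment_order[OF assms(1,2,3,5,6) _ assms(11) 2] assms(8) by blast
  next
    case 3
    then show ?thesis
      using segment_order[OF assms(1,4,5,3,7) _ assms(11)[symmetric] 3] assms(8) by blast
  qed
qed

subsection \<open>Small graphs\<close>

lemma digon_scw:
  assumes "mgraph G" "(x, a, b) \<in> arcs G" "(y, a, b) \<in> arcs G" "x \<noteq> y" "a \<noteq> b"
  shows "simple_closed_walk G {x, y} [(x, a, b), (y, b, a)]"
  using assms arcs_sym[OF assms(3)] arc_verts[OF assms(1,2)] by (simp add: scw_Cons[OF assms(1)] is_path_Cons)

lemma triangle_scw:
  assumes "mgraph G" "(x, a, b) \<in> arcs G" "(y, b, c) \<in> arcs G" "(z, c, a) \<in> arcs G" "distinct [a, b, c]"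
  shows "simple_closed_walk G {x, y, z} [(x, a, b), (y, b, c), (z, c, a)]"
proof -
  have "x \<noteq> y" "x \<noteq> z"
    using ends_arc[OF assms(1,2)] ends_arc[OF assms(1,3)] ends_arc[OF assms(1,4)] assms(5)
    by (auto simp: doubleton_eq_iff)
  then show ?thesis
    using assms arc_verts[OF assms(1,2)] by (auto simp: scw_Cons[OF assms(1)] is_path_Cons)
qed

lemma quadrangle_scw:
  assumes "mgraph G" "(x, a, b) \<in> arcs G" "(y, b, c) \<in> arcs G" "(z, c, d) \<in> arcs G" "(w, d, a) \<in> arcs G"
    "distinct [a, b, c, d]"
  shows "simple_closed_walk G {x, y, z, w} [(x, a, b), (y, b, c), (z, c, d), (w, d, a)]"
proof -
  have "x \<noteq> y" "x \<noteq> z" "x \<noteq> w"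
    using ends_arc[OF assms(1,2)] ends_arc[OF assms(1,3)] ends_arc[OF assms(1,4)] ends_arc[OF assms(1,5)] assms(6)
    by (auto simp: doubleton_eq_iff)
  then show ?thesis
    using assms arc_verts[OF assms(1,2)] by (auto simp: scw_Cons[OF assms(1)] is_path_Cons)
qed

section \<open>The cycles of the small graphs\<close>

text \<open>In the small graphs below, these conditions at all vertices already single out the
  cycles among the nonempty edge sets, so that listing the cycles is a finite case
  distinction.\<close>

lemma cycle_degree:
  assumes "mgraph G" "is_cycle G C" "\<And>x. x \<in> edges G \<Longrightarrow> \<not> is_loop G x"
    "{x \<in> edges G. v \<in> ends G x} = S"
  shows "card (C \<inter> S) \<in> {0, 2}"
proof (cases "v \<in> \<Union>(ends G ` C)")
  case True
  have sub: "C \<subseteq> edges G" using assms(2) by (simp add: is_cycle_def)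
  have 1: "{x \<in> C. v \<in> ends G x} = C \<inter> S" using sub assms(4) by blast
  have 2: "{x \<in> C. v \<in> ends G x \<and> is_loop G x} = {}" using sub assms(3) by blast
  have "vert_degree G C v = 2" using assms(2) True unfolding is_cycle_def by blast
  then show ?thesis unfolding vert_degree_def 1 2 by simp
next
  case False
  then have "C \<inter> S = {}" using assms(4) by blast
  then show ?thesis by simp
qed

lemma card_Int_insert:
  "card (C \<inter> {x}) = (if x \<in> C then 1 else 0)"
  "finite S \<Longrightarrow> x \<notin> S \<Longrightarrow> card (C \<inter> insert x S) = (if x \<in> C then 1 else 0) + card (C \<inter> S)"
  by (simp_all add: Int_insert_right)

text \<open>Three digons and eight triangles: the degrees at \<open>a\<close>, \<open>m\<close> and
  \<open>b\<close> leave no other nonempty edge set.\<close>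

lemma doubled_triangle_cycles:
  assumes "mgraph G" "edges G = {f1, g1, f2, g2, e, e'}" "distinct [f1, g1, f2, g2, e, e']" "distinct [a, m, b]"
    "ends G f1 = {a, m}" "ends G g1 = {a, m}" "ends G f2 = {m, b}" "ends G g2 = {m, b}"
    "ends G e = {a, b}" "ends G e' = {a, b}" "is_cycle G C"
  shows "C \<in> {{f1, g1}, {f2, g2}, {e, e'}, {f1, f2, e}, {f1, g2, e}, {g1, f2, e}, {g1, g2, e},
    {f1, f2, e'}, {f1, g2, e'}, {g1, f2, e'}, {g1, g2, e'}}"
proof -
  have nl: "\<not> is_loop G x" if "x \<in> edges G" for x
    using that assms(2,4-10) by (auto simp: is_loop_def)
  have "card (C \<inter> {f1, g1, e, e'}) = (if f1 \<in> C then 1 else 0) + (if g1 \<in> C then 1 else 0) + (if e \<in> C then 1 else 0) + (if e' \<in> C then 1 else 0)"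
    using assms(3) by (simp add: card_Int_insert)
  moreover have "card (C \<inter> {f1, g1, e, e'}) \<in> {0, 2}"
    by (rule cycle_degree[OF assms(1,11) nl, of a]) (use assms(2-10) in auto)
  ultimately have d1: "(if f1 \<in> C then 1 else 0) + (if g1 \<in> C then 1 else 0) + (if e \<in> C then 1 else 0) + (if e' \<in> C then 1 else 0) \<in> {0, 2::nat}"
    by (simp only:)
  have "card (C \<inter> {f1, g1, f2, g2}) = (if f1 \<in> C then 1 else 0) + (if g1 \<in> C then 1 else 0) + (if f2 \<in> C then 1 else 0) + (if g2 \<in> C then 1 else 0)"
    using assms(3) by (simp add: card_Int_insert)
  moreover have "card (C \<inter> {f1, g1, f2, g2}) \<in> {0, 2}"
    by (rule cycle_degree[OF assms(1,11) nl, of m]) (use assms(2-10) in auto)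
  ultimately have d2: "(if f1 \<in> C then 1 else 0) + (if g1 \<in> C then 1 else 0) + (if f2 \<in> C then 1 else 0) + (if g2 \<in> C then 1 else 0) \<in> {0, 2::nat}"
    by (simp only:)
  have "card (C \<inter> {f2, g2, e, e'}) = (if f2 \<in> C then 1 else 0) + (if g2 \<in> C then 1 else 0) + (if e \<in> C then 1 else 0) + (if e' \<in> C then 1 else 0)"
    using assms(3) by (simp add: card_Int_insert)
  moreover have "card (C \<inter> {f2, g2, e, e'}) \<in> {0, 2}"
    by (rule cycle_degree[OF assms(1,11) nl, of b]) (use assms(2-10) in auto)
  ultimately have d3: "(if f2 \<in> C then 1 else 0) + (if g2 \<in> C then 1 else 0) + (if e \<in> C then 1 else 0) + (if e' \<in> C then 1 else 0) \<in> {0, 2::nat}"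
    by (simp only:)
  have sub: "C \<subseteq> {f1, g1, f2, g2, e, e'}" and ne: "C \<noteq> {}"
    using assms(2,11) by (auto simp: is_cycle_def)
  have "f1 \<in> C \<or> g1 \<in> C \<or> f2 \<in> C \<or> g2 \<in> C \<or> e \<in> C \<or> e' \<in> C"
    using sub ne by blast
  then have "(f1 \<in> C \<and> g1 \<in> C \<and> f2 \<notin> C \<and> g2 \<notin> C \<and> e \<notin> C \<and> e' \<notin> C) \<or>
    (f1 \<notin> C \<and> g1 \<notin> C \<and> f2 \<in> C \<and> g2 \<in> C \<and> e \<notin> C \<and> e' \<notin> C) \<or>
    (f1 \<notin> C \<and> g1 \<notin> C \<and> f2 \<notin> C \<and> g2 \<notin> C \<and> e \<in> C \<and> e' \<in> C) \<or>
    (f1 \<in> C \<and> g1 \<notin> C \<and> f2 \<in> C \<and> g2 \<notin> C \<and> e \<in> C \<and> e' \<notin> C) \<or>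
    (f1 \<in> C \<and> g1 \<notin> C \<and> f2 \<notin> C \<and> g2 \<in> C \<and> e \<in> C \<and> e' \<notin> C) \<or>
    (f1 \<notin> C \<and> g1 \<in> C \<and> f2 \<in> C \<and> g2 \<notin> C \<and> e \<in> C \<and> e' \<notin> C) \<or>
    (f1 \<notin> C \<and> g1 \<in> C \<and> f2 \<notin> C \<and> g2 \<in> C \<and> e \<in> C \<and> e' \<notin> C) \<or>
    (f1 \<in> C \<and> g1 \<notin> C \<and> f2 \<in> C \<and> g2 \<notin> C \<and> e \<notin> C \<and> e' \<in> C) \<or>
    (f1 \<in> C \<and> g1 \<notin> C \<and> f2 \<notin> C \<and> g2 \<in> C \<and> e \<notin> C \<and> e' \<in> C) \<or>
    (f1 \<notin> C \<and> g1 \<in> C \<and> f2 \<in> C \<and> g2 \<notin> C \<and> e \<notin> C \<and> e' \<in> C) \<or>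
    (f1 \<notin> C \<and> g1 \<in> C \<and> f2 \<notin> C \<and> g2 \<in> C \<and> e \<notin> C \<and> e' \<in> C)"
    using d1 d2 d3
    by (cases "f1 \<in> C"; cases "g1 \<in> C"; cases "f2 \<in> C"; cases "g2 \<in> C"; cases "e \<in> C"; cases "e' \<in> C"; simp)
  moreover have C: "C = {f1, g1, f2, g2, e, e'} \<inter> C" using sub by blast
  ultimately show ?thesis
    by (elim disjE conjE) (subst C; simp add: Int_insert_left)+
qed

text \<open>Four triangles and three quadrangles, again by the degrees at the vertices
  alone.\<close>

lemma K4_cycles:
  assumes "mgraph G" "edges G = {ab, ac, ad, bc, bd, cd}" "distinct [ab, ac, ad, bc, bd, cd]" "distinct [a, b, c, d]"
    "ends G ab = {a, b}" "ends G ac = {a, c}" "ends G ad = {a, d}" "ends G bc = {b, c}" "ends G bd = {b, d}"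
    "ends G cd = {c, d}" "is_cycle G C"
  shows "C \<in> {{ab, bc, ac}, {ab, bd, ad}, {ac, cd, ad}, {bc, cd, bd}, {ab, bc, cd, ad}, {ab, bd, cd, ac}, {ac, bc, bd, ad}}"
proof -
  have nl: "\<not> is_loop G x" if "x \<in> edges G" for x
    using that assms(2,4-10) by (auto simp: is_loop_def)
  have "card (C \<inter> {ab, ac, ad}) = (if ab \<in> C then 1 else 0) + (if ac \<in> C then 1 else 0) + (if ad \<in> C then 1 else 0)"
    using assms(3) by (simp add: card_Int_insert)
  moreover have "card (C \<inter> {ab, ac, ad}) \<in> {0, 2}"
    by (rule cycle_degree[OF assms(1,11) nl, of a]) (use assms(2-10) in auto)
  ultimately have d1: "(if ab \<in> C then 1 else 0) + (if ac \<in> C then 1 else 0) + (if ad \<in> C then 1 else 0) \<in> {0, 2::nat}"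
    by (simp only:)
  have "card (C \<inter> {ab, bc, bd}) = (if ab \<in> C then 1 else 0) + (if bc \<in> C then 1 else 0) + (if bd \<in> C then 1 else 0)"
    using assms(3) by (simp add: card_Int_insert)
  moreover have "card (C \<inter> {ab, bc, bd}) \<in> {0, 2}"
    by (rule cycle_degree[OF assms(1,11) nl, of b]) (use assms(2-10) in auto)
  ultimately have d2: "(if ab \<in> C then 1 else 0) + (if bc \<in> C then 1 else 0) + (if bd \<in> C then 1 else 0) \<in> {0, 2::nat}"
    by (simp only:)
  have "card (C \<inter> {ac, bc, cd}) = (if ac \<in> C then 1 else 0) + (if bc \<in> C then 1 else 0) + (if cd \<in> C then 1 else 0)"
    using assms(3) by (simp add: card_Int_insert)
  moreover have "card (C \<inter> {ac, bc, cd}) \<in> {0, 2}"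
    by (rule cycle_degree[OF assms(1,11) nl, of c]) (use assms(2-10) in auto)
  ultimately have d3: "(if ac \<in> C then 1 else 0) + (if bc \<in> C then 1 else 0) + (if cd \<in> C then 1 else 0) \<in> {0, 2::nat}"
    by (simp only:)
  have "card (C \<inter> {ad, bd, cd}) = (if ad \<in> C then 1 else 0) + (if bd \<in> C then 1 else 0) + (if cd \<in> C then 1 else 0)"
    using assms(3) by (simp add: card_Int_insert)
  moreover have "card (C \<inter> {ad, bd, cd}) \<in> {0, 2}"
    by (rule cycle_degree[OF assms(1,11) nl, of d]) (use assms(2-10) in auto)
  ultimately have d4: "(if ad \<in> C then 1 else 0) + (if bd \<in> C then 1 else 0) + (if cd \<in> C then 1 else 0) \<in> {0, 2::nat}"
    by (simp only:)
  have sub: "C \<subseteq> {ab, ac, ad, bc, bd, cd}" and ne: "C \<noteq> {}"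
    using assms(2,11) by (auto simp: is_cycle_def)
  have "ab \<in> C \<or> ac \<in> C \<or> ad \<in> C \<or> bc \<in> C \<or> bd \<in> C \<or> cd \<in> C"
    using sub ne by blast
  then have "(ab \<in> C \<and> ac \<in> C \<and> ad \<notin> C \<and> bc \<in> C \<and> bd \<notin> C \<and> cd \<notin> C) \<or>
    (ab \<in> C \<and> ac \<notin> C \<and> ad \<in> C \<and> bc \<notin> C \<and> bd \<in> C \<and> cd \<notin> C) \<or>
    (ab \<notin> C \<and> ac \<in> C \<and> ad \<in> C \<and> bc \<notin> C \<and> bd \<notin> C \<and> cd \<in> C) \<or>
    (ab \<notin> C \<and> ac \<notin> C \<and> ad \<notin> C \<and> bc \<in> C \<and> bd \<in> C \<and> cd \<in> C) \<or>
    (ab \<in> C \<and> ac \<notin> C \<and> ad \<in> C \<and> bc \<in> C \<and> bd \<notin> C \<and> cd \<in> C) \<or>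
    (ab \<in> C \<and> ac \<in> C \<and> ad \<notin> C \<and> bc \<notin> C \<and> bd \<in> C \<and> cd \<in> C) \<or>
    (ab \<notin> C \<and> ac \<in> C \<and> ad \<in> C \<and> bc \<in> C \<and> bd \<in> C \<and> cd \<notin> C)"
    using d1 d2 d3 d4
    by (cases "ab \<in> C"; cases "ac \<in> C"; cases "ad \<in> C"; cases "bc \<in> C"; cases "bd \<in> C"; cases "cd \<in> C"; simp)
  moreover have C: "C = {ab, ac, ad, bc, bd, cd} \<inter> C" using sub by blast
  ultimately show ?thesis
    by (elim disjE conjE) (subst C; simp add: Int_insert_left insert_commute)+
qed

lemma parallel_cycles:
  assumes "mgraph G" "\<And>x. x \<in> edges G \<Longrightarrow> ends G x = {a, b}" "a \<noteq> b" "is_cycle G C"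
  obtains x y where "C = {x, y}" "x \<noteq> y" "x \<in> edges G" "y \<in> edges G"
proof -
  have nl: "\<not> is_loop G x" if "x \<in> edges G" for x
    using that assms(2,3) by (auto simp: is_loop_def)
  have "card (C \<inter> edges G) \<in> {0, 2}"
    by (rule cycle_degree[OF assms(1,4) nl, of a]) (use assms(2) in auto)
  moreover have C: "C \<inter> edges G = C" "C \<noteq> {}" using assms(4) by (auto simp: is_cycle_def)
  ultimately have "card C = 2" using is_cycle_finite[OF assms(1,4)] by simp
  then show thesis using that C by (auto simp: card_2_iff)
qed

section \<open>Recognizing the three graphs up to isomorphism\<close>

lemma iso_4K2:
  assumes "mgraph G" "verts G = {a, b}" "a \<noteq> b" "\<And>x. x \<in> edges G \<Longrightarrow> ends G x = {a, b}" "card (edges G) = 4"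
  shows "(G, {}) \<cong>\<^sub>b (multi_K2 4, {})"
proof -
  have "finite (edges G)" using assms(1) by (simp add: mgraph_def)
  then obtain g where "bij_betw g (edges G) {0..<card (edges G)}"
    using ex_bij_betw_finite_nat by blast
  then have g: "bij_betw g (edges G) {..<4::nat}"
    using assms(5) by (simp add: atLeast0LessThan)
  have "bij_betw (\<lambda>x. if x = a then 0 else 1) (verts G) {0, 1::nat}"
    using assms(2,3) by (auto simp: bij_betw_def inj_on_def)
  then show ?thesis
    using g assms(3,4) by (auto simp: multi_K2_def intro!: exI[of _ "\<lambda>x. if x = a then 0 else 1::nat"] exI[of _ g])
qed

lemma complete_graph_edges:
  "edges (complete_graph 3) = {{0, 1}, {1, 2}, {0, 2}}"
  "edges (complete_graph 4) = {{0, 1}, {0, 2}, {0, 3}, {1, 2}, {1, 3}, {2, 3}}"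
proof -
  have 3: "{..<3} = {0, 1, 2::nat}" and 4: "{..<4} = {0, 1, 2, 3::nat}" by auto
  show "edges (complete_graph 3) = {{0, 1}, {1, 2}, {0, 2}}" (is "_ = ?R3")
    unfolding complete_graph_def 3 mgraph.simps
  proof (intro equalityI subsetI)
    fix e assume "e \<in> {e. e \<subseteq> {0, 1, 2::nat} \<and> card e = 2}"
    then obtain x y where e: "e = {x, y}" "x \<noteq> y" "x \<in> {0, 1, 2::nat}" "y \<in> {0, 1, 2::nat}"
      by (auto simp: card_2_iff)
    from e(3,4,2) show "e \<in> ?R3"
      unfolding e(1) by (elim insertE emptyE) (simp_all add: doubleton_eq_iff)
  qed auto
  show "edges (complete_graph 4) = {{0, 1}, {0, 2}, {0, 3}, {1, 2}, {1, 3}, {2, 3}}" (is "_ = ?R4")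
    unfolding complete_graph_def 4 mgraph.simps
  proof (intro equalityI subsetI)
    fix e assume "e \<in> {e. e \<subseteq> {0, 1, 2, 3::nat} \<and> card e = 2}"
    then obtain x y where e: "e = {x, y}" "x \<noteq> y" "x \<in> {0, 1, 2, 3::nat}" "y \<in> {0, 1, 2, 3::nat}"
      by (auto simp: card_2_iff)
    from e(3,4,2) show "e \<in> ?R4"
      unfolding e(1) by (elim insertE emptyE) (simp_all add: doubleton_eq_iff)
  qed auto
qed

lemma mgraph_complete: "mgraph (complete_graph n)"
proof -
  have "finite {e. e \<subseteq> {..<n} \<and> card e = 2}" by (rule finite_subset[of _ "Pow {..<n}"]) auto
  then show ?thesis by (auto simp: mgraph_def complete_graph_def)
qed

lemma UNIV_sign: "UNIV = {Positive, Negative}"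
  using sign.exhaust by auto

lemma mgraph_doubled: "mgraph G \<Longrightarrow> mgraph (doubled_graph G)"
  by (auto simp: mgraph_def doubled_graph_def UNIV_sign)

lemma doubled_K3_simps:
  "verts (doubled_graph (complete_graph 3)) = {0, 1, 2}"
  "edges (doubled_graph (complete_graph 3)) = {({0, 1}, Positive), ({0, 1}, Negative), ({1, 2}, Positive), ({1, 2}, Negative),
    ({0, 2}, Negative), ({0, 2}, Positive)}"
  "ends (doubled_graph (complete_graph 3)) (x, s) = x"
proof -
  show "verts (doubled_graph (complete_graph 3)) = {0, 1, 2}"
    by (auto simp: doubled_graph_def complete_graph_def)
  show "edges (doubled_graph (complete_graph 3)) = {({0, 1}, Positive), ({0, 1}, Negative), ({1, 2}, Positive), ({1, 2}, Negative),
    ({0, 2}, Negative), ({0, 2}, Positive)}"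
    unfolding doubled_graph_def mgraph.simps complete_graph_edges UNIV_sign by auto
  show "ends (doubled_graph (complete_graph 3)) (x, s) = x"
    by (simp add: doubled_graph_def complete_graph_def)
qed

lemma mgraph_doubled_K3: "mgraph (doubled_graph (complete_graph 3))"
  by (intro mgraph_doubled mgraph_complete)

lemma even_Negative:
  "even (card {x \<in> C. snd x = Negative}) \<longleftrightarrow> even (card (C \<inter> {x. snd x = Negative}))"
  by (simp add: Int_def)

lemma doubled_K3_cycles:
  assumes "is_cycle (doubled_graph (complete_graph 3)) C"
  shows "C \<in> {{({0, 1}, Positive), ({0, 1}, Negative)}, {({1, 2}, Positive), ({1, 2}, Negative)},
    {({0, 2}, Negative), ({0, 2}, Positive)},
    {({0, 1}, Positive), ({1, 2}, Positive), ({0, 2}, Negative)}, {({0, 1}, Positive), ({1, 2}, Negative), ({0, 2}, Negative)},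
    {({0, 1}, Negative), ({1, 2}, Positive), ({0, 2}, Negative)}, {({0, 1}, Negative), ({1, 2}, Negative), ({0, 2}, Negative)},
    {({0, 1}, Positive), ({1, 2}, Positive), ({0, 2}, Positive)}, {({0, 1}, Positive), ({1, 2}, Negative), ({0, 2}, Positive)},
    {({0, 1}, Negative), ({1, 2}, Positive), ({0, 2}, Positive)}, {({0, 1}, Negative), ({1, 2}, Negative), ({0, 2}, Positive)}}"
  by (rule doubled_triangle_cycles[OF mgraph_doubled_K3 doubled_K3_simps(2) _ _ _ _ _ _ _ _ assms, of 0 1 2])
    (simp_all add: doubled_K3_simps doubleton_eq_iff)

lemma doubled_K3_triangle:
  "is_cycle (doubled_graph (complete_graph 3)) {({0, 1}, s), ({1, 2}, s'), ({0, 2}, s'')}"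
proof -
  let ?D = "doubled_graph (complete_graph 3)"
  have E: "(x, t) \<in> edges ?D" if "x \<in> {{0, 1}, {1, 2}, {0, 2}}" for x t
    using that by (cases t) (auto simp: doubled_K3_simps)
  have "simple_closed_walk ?D {({0, 1}, s), ({1, 2}, s'), ({0, 2}, s'')}
    [(({0, 1}, s), 0, 1), (({1, 2}, s'), 1, 2), (({0, 2}, s''), 2, 0)]"
    by (rule triangle_scw[OF mgraph_doubled_K3])
      (auto intro!: arcsI[OF mgraph_doubled_K3 E] simp: doubled_K3_simps)
  then show ?thesis using scw_is_cycle[OF mgraph_doubled_K3] by blast
qed

lemma Collect_eq_set: "(\<And>x. P x \<Longrightarrow> x \<in> R) \<Longrightarrow> (\<And>x. x \<in> R \<Longrightarrow> P x) \<Longrightarrow> {x. P x} = R"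
  by blast

lemma plus_minus_K3_balanced:
  "snd (plus_minus (complete_graph 3)) =
    {{({0, 1}, Positive), ({1, 2}, Negative), ({0, 2}, Negative)}, {({0, 1}, Negative), ({1, 2}, Positive), ({0, 2}, Negative)},
     {({0, 1}, Positive), ({1, 2}, Positive), ({0, 2}, Positive)}, {({0, 1}, Negative), ({1, 2}, Negative), ({0, 2}, Positive)}}"
  (is "_ = ?R")
proof -
  show ?thesis
    unfolding plus_minus_def snd_conv
  proof (rule Collect_eq_set)
    fix C assume C: "is_cycle (doubled_graph (complete_graph 3)) C \<and> even (card {x \<in> C. snd x = Negative})"
    show "C \<in> ?R"
      using doubled_K3_cycles[OF conjunct1[OF C]] conjunct2[OF C] unfolding even_Negative
      by (elim insertE emptyE) (simp_all add: Int_insert_left doubleton_eq_iff)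
  next
    fix C assume "C \<in> ?R"
    then show "is_cycle (doubled_graph (complete_graph 3)) C \<and> even (card {x \<in> C. snd x = Negative})"
      using doubled_K3_triangle unfolding even_Negative
      by (elim insertE emptyE) (simp_all add: Int_insert_left doubleton_eq_iff)
  qed
qed

text \<open>Suitable signs are positive for \<open>f1\<close>, \<open>f2\<close>, \<open>e'\<close>
  and negative for \<open>g1\<close>, \<open>g2\<close>, \<open>e\<close>: the four triangles
  assumed balanced are then those with an even number of negative edges.\<close>

lemma iso_plus_minus_K3:
  assumes "biased_graph (G, B)" "edges G = {f1, g1, f2, g2, e, e'}" "distinct [f1, g1, f2, g2, e, e']" "distinct [a, m, b]"
    "verts G = {a, m, b}"
    "ends G f1 = {a, m}" "ends G g1 = {a, m}" "ends G f2 = {m, b}" "ends G g2 = {m, b}"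
    "ends G e = {a, b}" "ends G e' = {a, b}"
    "{f1, g2, e} \<in> B" "{g1, f2, e} \<in> B" "{f1, f2, e'} \<in> B" "{g1, g2, e'} \<in> B"
    "{f1, g1} \<notin> B" "{f2, g2} \<notin> B" "{e, e'} \<notin> B" "{f1, f2, e} \<notin> B" "{g1, g2, e} \<notin> B" "{f1, g2, e'} \<notin> B" "{g1, f2, e'} \<notin> B"
  shows "(G, B) \<cong>\<^sub>b plus_minus (complete_graph 3)"
proof -
  let ?D = "doubled_graph (complete_graph 3)"
  define f where "f = (\<lambda>x. if x = a then 0 else if x = m then 1 else 2::nat)"
  define g where "g = (\<lambda>x. if x = f1 then ({0, 1::nat}, Positive) else if x = g1 then ({0, 1}, Negative)
    else if x = f2 then ({1, 2}, Positive) else if x = g2 then ({1, 2}, Negative)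
    else if x = e then ({0, 2}, Negative) else ({0, 2}, Positive))"
  have f: "f a = 0" "f m = 1" "f b = 2" using assms(4) by (auto simp: f_def)
  have g: "g f1 = ({0, 1}, Positive)" "g g1 = ({0, 1}, Negative)" "g f2 = ({1, 2}, Positive)" "g g2 = ({1, 2}, Negative)"
    "g e = ({0, 2}, Negative)" "g e' = ({0, 2}, Positive)" using assms(3) by (auto simp: g_def)
  have "bij_betw f (verts G) (verts ?D)"
    unfolding assms(5) doubled_K3_simps bij_betw_def using f by (auto simp: inj_on_def)
  moreover have "bij_betw g (edges G) (edges ?D)"
    unfolding assms(2) doubled_K3_simps bij_betw_def using g by (auto simp: inj_on_def doubleton_eq_iff)
  moreover have "\<forall>x\<in>edges G. ends ?D (g x) = f ` ends G x"
    using assms(2,6-11) f g by (auto simp: doubled_K3_simps)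
  moreover have "B = {{f1, g2, e}, {g1, f2, e}, {f1, f2, e'}, {g1, g2, e'}}"
  proof
    show "B \<subseteq> {{f1, g2, e}, {g1, f2, e}, {f1, f2, e'}, {g1, g2, e'}}"
    proof
      fix C assume "C \<in> B"
      then have "is_cycle G C" by (rule biased_cycle[OF assms(1)])
      from doubled_triangle_cycles[OF biased_mgraph[OF assms(1)] assms(2-4,6-11) this]
      show "C \<in> {{f1, g2, e}, {g1, f2, e}, {f1, f2, e'}, {g1, g2, e'}}"
        using \<open>C \<in> B\<close> assms(16-22) by auto
    qed
  qed (use assms(12-15) in auto)
  then have "snd (plus_minus (complete_graph 3)) = (\<lambda>C. g ` C) ` B"
    unfolding plus_minus_K3_balanced using g by auto
  then have "{C. is_cycle ?D C \<and> even (card {x \<in> C. snd x = Negative})} = (\<lambda>C. g ` C) ` B"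
    by (simp add: plus_minus_def)
  ultimately show ?thesis
    unfolding plus_minus_def biased_iso.simps by blast
qed

lemma K4_simps:
  "verts (complete_graph 4) = {0, 1, 2, 3}" "ends (complete_graph n) x = x"
  by (auto simp: complete_graph_def)

lemma iso_minus_K4:
  assumes "biased_graph (G, B)" "edges G = {ab, ac, ad, bc, bd, cd}" "distinct [ab, ac, ad, bc, bd, cd]" "distinct [a, b, c, d]"
    "verts G = {a, b, c, d}"
    "ends G ab = {a, b}" "ends G ac = {a, c}" "ends G ad = {a, d}" "ends G bc = {b, c}" "ends G bd = {b, d}"
    "ends G cd = {c, d}"
    "{ab, bc, ac} \<notin> B" "{ab, bd, ad} \<notin> B" "{ac, cd, ad} \<notin> B" "{bc, cd, bd} \<notin> B"
    "{ab, bc, cd, ad} \<in> B" "{ab, bd, cd, ac} \<in> B" "{ac, bc, bd, ad} \<in> B"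
  shows "(G, B) \<cong>\<^sub>b all_negative (complete_graph 4)"
proof -
  let ?K = "complete_graph 4"
  define f where "f = (\<lambda>x. if x = a then 0 else if x = b then 1 else if x = c then 2 else 3::nat)"
  define g where "g = (\<lambda>x. if x = ab then {0, 1::nat} else if x = ac then {0, 2} else if x = ad then {0, 3}
    else if x = bc then {1, 2} else if x = bd then {1, 3} else {2, 3})"
  have f: "f a = 0" "f b = 1" "f c = 2" "f d = 3" using assms(4) by (auto simp: f_def)
  have g: "g ab = {0, 1}" "g ac = {0, 2}" "g ad = {0, 3}" "g bc = {1, 2}" "g bd = {1, 3}" "g cd = {2, 3}"
    using assms(3) by (auto simp: g_def)
  have "bij_betw f (verts G) (verts ?K)"
    unfolding assms(5) K4_simps bij_betw_def using f by (auto simp: inj_on_def)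
  moreover have "bij_betw g (edges G) (edges ?K)"
    unfolding assms(2) complete_graph_edges bij_betw_def using g by (auto simp: inj_on_def doubleton_eq_iff)
  moreover have "\<forall>x\<in>edges G. ends ?K (g x) = f ` ends G x"
    using assms(2,6-11) f g by (auto simp: K4_simps)
  moreover have B: "B = {{ab, bc, cd, ad}, {ab, bd, cd, ac}, {ac, bc, bd, ad}}"
  proof
    show "B \<subseteq> {{ab, bc, cd, ad}, {ab, bd, cd, ac}, {ac, bc, bd, ad}}"
    proof
      fix C assume "C \<in> B"
      then have "is_cycle G C" by (rule biased_cycle[OF assms(1)])
      from K4_cycles[OF biased_mgraph[OF assms(1)] assms(2-4,6-11) this]
      show "C \<in> {{ab, bc, cd, ad}, {ab, bd, cd, ac}, {ac, bc, bd, ad}}"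
        using \<open>C \<in> B\<close> assms(12-15) by auto
    qed
  qed (use assms(16-18) in auto)
  moreover have "{C. is_cycle ?K C \<and> even (card C)} = (\<lambda>C. g ` C) ` B"
  proof -
    let ?R = "{{{0, 1}, {1, 2}, {2, 3}, {0, 3}}, {{0, 1}, {1, 3}, {2, 3}, {0, 2}}, {{0, 2}, {1, 2}, {1, 3}, {0, 3::nat}}}"
    have 1: "C \<in> ?R" if "is_cycle ?K C" "even (card C)" for C
    proof -
      have "C \<in> {{{0, 1}, {1, 2}, {0, 2}}, {{0, 1}, {1, 3}, {0, 3}}, {{0, 2}, {2, 3}, {0, 3}}, {{1, 2}, {2, 3}, {1, 3}},
        {{0, 1}, {1, 2}, {2, 3}, {0, 3}}, {{0, 1}, {1, 3}, {2, 3}, {0, 2}}, {{0, 2}, {1, 2}, {1, 3}, {0, 3}}}"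
        by (rule K4_cycles[OF mgraph_complete complete_graph_edges(2) _ _ _ _ _ _ _ _ that(1), of 0 1 2 3])
          (simp_all add: K4_simps doubleton_eq_iff)
      then show ?thesis using that(2) by (elim insertE emptyE) (simp_all add: doubleton_eq_iff)
    qed
    have quad: "is_cycle ?K {{x, y}, {y, z}, {z, w}, {w, x}}" if "distinct [x, y, z, w]" "{x, y, z, w} \<subseteq> {0, 1, 2, 3}" for x y z w
    proof -
      have "({p, q}, p, q) \<in> arcs ?K" if "p \<noteq> q" "p \<in> {0, 1, 2, 3}" "q \<in> {0, 1, 2, 3}" for p q
        by (rule arcsI[OF mgraph_complete]) (use that in \<open>auto simp: complete_graph_def\<close>)
      then have "simple_closed_walk ?K {{x, y}, {y, z}, {z, w}, {w, x}}
        [({x, y}, x, y), ({y, z}, y, z), ({z, w}, z, w), ({w, x}, w, x)]"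
        by (intro quadrangle_scw[OF mgraph_complete]) (use that in auto)
      then show ?thesis using scw_is_cycle[OF mgraph_complete] by blast
    qed
    have 2: "is_cycle ?K C \<and> even (card C)" if "C \<in> ?R" for C
      using that quad[of 0 1 2 3] quad[of 0 1 3 2] quad[of 0 2 1 3]
      by (elim insertE emptyE) (simp_all add: doubleton_eq_iff insert_commute)
    have "{C. is_cycle ?K C \<and> even (card C)} = ?R"
      by (rule Collect_eq_set) (use 1 2 in \<open>simp_all only:\<close>)
    also have "\<dots> = (\<lambda>C. g ` C) ` B"
      unfolding B using g by simp
    finally show ?thesis .
  qed
  ultimately show ?thesis
    unfolding all_negative_def biased_iso.simps by blast
qed

subsection \<open>Parallel edges\<close>

lemma bal_cong:
  assumes "\<And>f x y. f \<in> C \<Longrightarrow> \<gamma> (f, x, y) = \<delta> (f, x, y)"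
  shows "bal G \<gamma> C \<longleftrightarrow> bal G \<delta> C"
proof -
  have "gs \<gamma> p = gs \<delta> p" if "simple_closed_walk G C p" for p
  proof (rule gs_cong)
    fix x assume "x \<in> set p"
    then have "fst x \<in> C"
      using that by (auto simp: simple_closed_walk_def walk_edges_def case_prod_unfold)
    then show "\<gamma> x = \<delta> x" using assms by (metis prod.collapse)
  qed
  then show ?thesis by (simp add: bal_def)
qed

lemma path_edge_joining_ends:
  assumes "mgraph G" "is_path G a P b" "e \<in> wE P" "ends G e = {a, b}"
  shows "P = [(e, a, b)]"
proof -
  obtain f c P' where P: "P = (f, a, c) # P'" "(f, a, c) \<in> arcs G" "is_path G c P' b" "a \<notin> insert b (wS P')"
    using assms(2,3) by (cases P) (auto simp: is_path_Cons)
  have "e = f"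
    using path_first_edge(2)[OF assms(1), of a f c P' b e] assms(2-4) P(1) by auto
  then have "c = b"
    using ends_arc[OF assms(1) P(2)] assms(4) P(4) by (auto simp: doubleton_eq_iff)
  then have "P' = []" using closed_path_Nil[of G b P'] P(3) by blast
  then show ?thesis using P(1) \<open>e = f\<close> \<open>c = b\<close> by simp
qed

text \<open>The cycle of the path and \<open>x\<close> is cut at the ends of the segment
  \<open>p\<close> instead of at \<open>a\<close> and \<open>b\<close>. Exchanging \<open>p\<close>
  for a parallel segment thus takes place in a theta whose third path is the rest of this
  cycle.\<close>

lemma complement_path:
  assumes "mgraph G" "is_path G a (\<alpha> @ p @ \<beta>) b" "(x, a, b) \<in> arcs G" "x \<notin> wE (\<alpha> @ p @ \<beta>)"
    "is_path G a \<alpha> s" "is_path G s p t" "is_path G t \<beta> b" "s \<noteq> t"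
  shows "is_path G s (rev_walk \<alpha> @ (x, a, b) # rev_walk \<beta>) t" "idisj p (rev_walk \<alpha> @ (x, a, b) # rev_walk \<beta>)"
    "wE p \<union> wE (rev_walk \<alpha> @ (x, a, b) # rev_walk \<beta>) = insert x (wE (\<alpha> @ p @ \<beta>))"
proof -
  have d1: "wS \<alpha> \<inter> insert b (wS (p @ \<beta>)) = {}"
    by (rule path_disjoint_append[OF assms(1,2)])
  have d2: "wS (\<alpha> @ p) \<inter> insert b (wS \<beta>) = {}"
    by (rule path_disjoint_append[OF assms(1)]) (use assms(2) in simp)
  have ra: "insert a (wS (rev_walk \<alpha>)) = insert s (wS \<alpha>)" and rb: "insert t (wS (rev_walk \<beta>)) = insert b (wS \<beta>)"
    using walk_starts_rev_set[OF is_path_walk[OF assms(5)]] walk_starts_rev_set[OF is_path_walk[OF assms(7)]] by auto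
  have sp: "s \<in> wS p" using path_start_in[OF assms(6,8)] .
  have disj: "insert s (wS \<alpha>) \<inter> insert b (wS \<beta>) = {}"
    using d1 d2 sp by auto
  have aV: "a \<in> insert s (wS \<alpha>)" using ra by auto
  have rp: "is_path G s (rev_walk \<alpha>) a" "is_path G b (rev_walk \<beta>) t"
    using is_path_rev[OF assms(1)] assms(5,7) by blast+
  have 1: "is_path G a ((x, a, b) # rev_walk \<beta>) t"
    using assms(3) rp(2) rb aV disj by (auto simp: is_path_Cons)
  show "is_path G s (rev_walk \<alpha> @ (x, a, b) # rev_walk \<beta>) t"
    unfolding is_path_append[OF assms(1)]
  proof (intro exI[of _ a] conjI rp(1) 1)
    have "a \<notin> wS (rev_walk \<alpha>)" using rp(1) by (simp add: is_path_def)
    then show "wS (rev_walk \<alpha>) \<inter> insert t (wS ((x, a, b) # rev_walk \<beta>)) = {}"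
      using ra rb disj by (simp only: walk_starts_simps list.set) blast
  qed
  then have r: "walk_starts (rev_walk \<alpha> @ (x, a, b) # rev_walk \<beta>) = s # tl (walk_starts (rev_walk \<alpha> @ (x, a, b) # rev_walk \<beta>))"
    by (rule path_starts_tl[OF _ assms(8)])
  have pt: "walk_starts p = s # tl (walk_starts p)"
    by (rule path_starts_tl[OF assms(6,8)])
  then have "set (tl (walk_starts p)) \<subseteq> wS p" "s \<notin> set (tl (walk_starts p))"
    using assms(6) unfolding is_path_def by (metis list.set_intros(2) subsetI, metis distinct.simps(2) distinct_append)
  moreover have "set (tl (walk_starts (rev_walk \<alpha> @ (x, a, b) # rev_walk \<beta>))) \<subseteq> insert s (wS \<alpha>) \<union> insert b (wS \<beta>)"
  proof -
    have "wS (rev_walk \<alpha> @ (x, a, b) # rev_walk \<beta>) \<subseteq> insert s (wS \<alpha>) \<union> insert b (wS \<beta>)"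
      using ra rb by auto
    then show ?thesis using r by (metis (no_types, lifting) list.set_intros(2) subset_eq)
  qed
  moreover have "wS p \<inter> (insert s (wS \<alpha>) \<union> insert b (wS \<beta>)) \<subseteq> {s}"
    using d1 d2 by auto
  moreover have "wE p \<inter> wE (rev_walk \<alpha> @ (x, a, b) # rev_walk \<beta>) = {}"
    using path_distinct_edges[OF assms(1,2)] assms(4) by auto
  ultimately show "idisj p (rev_walk \<alpha> @ (x, a, b) # rev_walk \<beta>)"
    unfolding idisj_iff by blast
  show "wE p \<union> wE (rev_walk \<alpha> @ (x, a, b) # rev_walk \<beta>) = insert x (wE (\<alpha> @ p @ \<beta>))"
    by auto
qed

text \<open>There are only three residues; this is why four parallel edges without balanced cycle
  admit no gain.\<close>

lemma four_residues:
  fixes x y z w :: int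
  assumes "\<not> 3 dvd x - y" "\<not> 3 dvd x - z" "\<not> 3 dvd x - w" "\<not> 3 dvd y - z" "\<not> 3 dvd y - w" "\<not> 3 dvd z - w"
  shows False
  using assms by presburger

text \<open>An unbalanced pair of parallel edges in a critical graph that is neither of the two
  expected outcomes. These assumptions are contradictory, as \<open>no_digon\<close> shows. The gain
  \<open>\<psi>\<close> comes from deleting \<open>e'\<close>.\<close>

locale digon_graph = critical_graph G B for G :: "('v, 'e) mgraph" and B +
  fixes e e' :: 'e and a b :: 'v and \<psi> :: "'e \<times> 'v \<times> 'v \<Rightarrow> int"
  assumes e_arc: "(e, a, b) \<in> arcs G" and e'_arc: "(e', a, b) \<in> arcs G" and ne: "a \<noteq> b" and ee': "e \<noteq> e'"
    and unb: "{e, e'} \<notin> B"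
    and \<psi>: "zgain G \<psi>" and \<psi>_right: "\<And>C. is_cycle G C \<Longrightarrow> e' \<notin> C \<Longrightarrow> right G B \<psi> C"
    and not_4K2: "\<not> (G, B) \<cong>\<^sub>b (multi_K2 4, {})"
    and not_plus_minus_K3: "\<not> (G, B) \<cong>\<^sub>b plus_minus (complete_graph 3)"
begin

text \<open>Together with \<open>e'\<close>, these paths form all cycles through \<open>e'\<close>
  except \<open>{e, e'}\<close>.\<close>

definition ap :: "('v, 'e) walk \<Rightarrow> bool" where
  "ap P \<longleftrightarrow> is_path G a P b \<and> e \<notin> wE P \<and> e' \<notin> wE P"

text \<open>The gain relative to \<open>e\<close>: by the choice of \<open>\<psi>\<close>, it
  vanishes modulo 3 exactly if \<open>P\<close> and \<open>e\<close> form a balanced cycle.\<close>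

definition val :: "('v, 'e) walk \<Rightarrow> int" where
  "val P = gs \<psi> P - \<psi> (e, a, b)"

text \<open>A path \<open>P\<close> for which \<open>P \<union> {e}\<close> is unbalanced determines which of the two nonzero gains
  relative to \<open>e\<close> the edge \<open>e'\<close> must have; the vote says whether that gain is 1.\<close>

definition vote :: "('v, 'e) walk \<Rightarrow> bool" where
  "vote P \<longleftrightarrow> (insert e' (wE P) \<in> B \<longleftrightarrow> 3 dvd val P - 1)"

lemma e_path: "is_path G a [(e, a, b)] b" and e'_path: "is_path G a [(e', a, b)] b"
  using is_path_single[OF G e_arc ne] is_path_single[OF G e'_arc ne] by auto

lemma ends_e: "ends G e = {a, b}" and ends_e': "ends G e' = {a, b}"
  using ends_arc[OF G e_arc] ends_arc[OF G e'_arc] by auto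

lemma ap_right:
  assumes "ap P" "zgain G \<gamma>"
  shows "right G B \<gamma> (insert e (wE P)) \<longleftrightarrow> (insert e (wE P) \<in> B \<longleftrightarrow> 3 dvd gs \<gamma> P - \<gamma> (e, a, b))"
    "right G B \<gamma> (insert e' (wE P)) \<longleftrightarrow> (insert e' (wE P) \<in> B \<longleftrightarrow> 3 dvd gs \<gamma> P - \<gamma> (e', a, b))"
  using idisj_right[OF G assms(2) _ e_path ne idisj_single(2), of P B] idisj_right[OF G assms(2) _ e'_path ne idisj_single(2), of P B]
    assms(1) by (simp_all add: ap_def)

lemma ap_cycle:
  assumes "ap P"
  shows "is_cycle G (insert e (wE P))" "is_cycle G (insert e' (wE P))"
  using idisj_cycle[OF G _ e_path ne idisj_single(2), of P] idisj_cycle[OF G _ e'_path ne idisj_single(2), of P] assms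
  by (simp_all add: ap_def)

lemma digon_right:
  assumes "zgain G \<gamma>"
  shows "right G B \<gamma> {e, e'} \<longleftrightarrow> \<not> 3 dvd \<gamma> (e, a, b) - \<gamma> (e', a, b)"
  using idisj_right[OF G assms e_path e'_path ne, of B] unb ee' by (simp add: idisj_iff insert_commute)

lemma digon_cycle: "is_cycle G {e, e'}"
  using idisj_cycle[OF G e_path e'_path ne] ee' by (simp add: idisj_iff insert_commute)

lemma ap_val: "ap P \<Longrightarrow> insert e (wE P) \<in> B \<longleftrightarrow> 3 dvd val P"
  using ap_right(1)[of P \<psi>] \<psi> \<psi>_right[OF ap_cycle(1)] ee' by (simp add: ap_def val_def)

lemma ap_theta:
  assumes "ap P" "insert e (wE P) \<in> B"
  shows "insert e' (wE P) \<notin> B"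
  using biased_theta[OF biased ne _ e_path e'_path idisj_single(2) idisj_single(2), of P] assms unb ee'
  by (auto simp: ap_def idisj_iff insert_commute)

lemma ap_V: "ap P \<Longrightarrow> \<Union>(ends G ` insert e (wE P)) = insert b (wS P)" "ap P \<Longrightarrow> \<Union>(ends G ` insert e' (wE P)) = insert b (wS P)"
proof -
  assume P: "ap P"
  then have "P \<noteq> []" using ne by (auto simp: ap_def)
  then have "\<Union>(ends G ` wE P) = insert b (wS P)" "a \<in> wS P"
    using walk_ends_eq[OF G is_path_walk, of a P b] path_start_in[of G a P b] P ne by (auto simp: ap_def)
  then show "\<Union>(ends G ` insert e (wE P)) = insert b (wS P)" "\<Union>(ends G ` insert e' (wE P)) = insert b (wS P)"
    using ends_e ends_e' by auto
qed

lemma ap_edge: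
  assumes "ap P" "z \<in> wE P"
  shows "z \<in> edges G" "\<not> is_loop G z" "z \<noteq> e" "z \<noteq> e'"
  using assms is_walk_edges[of G a P b] path_no_loop[OF G, of a P b z] by (auto simp: ap_def is_path_def)

lemma ap_arc:
  assumes "ap P" "(z, x, y) \<in> set P"
  shows "(z, x, y) \<in> arcs G" "ends G z = {x, y}" "z \<in> wE P"
proof -
  show "(z, x, y) \<in> arcs G" using is_walk_arcs[of G a P b] assms by (auto simp: ap_def is_path_def)
  then show "ends G z = {x, y}" by (rule ends_arc[OF G])
  show "z \<in> wE P" using assms(2) by (force simp: walk_edges_def)
qed

text \<open>If all votes agreed, \<open>e'\<close> could be given the gain of \<open>e\<close> plus
  the common vote. This is right on the cycles of \<open>e'\<close> with voting paths, on those with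
  paths of value 0 by the theta with \<open>e\<close>, on \<open>{e, e'}\<close> because the
  difference is nonzero, and on the cycles avoiding \<open>e'\<close> by the choice of
  \<open>\<psi>\<close>.\<close>

lemma votes_differ:
  obtains P Q where "ap P" "ap Q" "\<not> 3 dvd val P" "\<not> 3 dvd val Q" "vote P \<noteq> vote Q"
proof -
  have "\<exists>P Q. ap P \<and> ap Q \<and> \<not> 3 dvd val P \<and> \<not> 3 dvd val Q \<and> vote P \<noteq> vote Q"
  proof (rule ccontr)
    assume "\<not> ?thesis"
    then have same: "\<And>P Q. ap P \<Longrightarrow> ap Q \<Longrightarrow> \<not> 3 dvd val P \<Longrightarrow> \<not> 3 dvd val Q \<Longrightarrow> vote P = vote Q"
      by blast
    \<comment> \<open>The value \<open>- 1\<close> also serves if no path votes at all.\<close>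
    define \<epsilon> :: int where "\<epsilon> = (if \<exists>P. ap P \<and> \<not> 3 dvd val P \<and> vote P then 1 else - 1)"
    have \<epsilon>: "\<not> 3 dvd \<epsilon>" "\<not> 3 dvd - \<epsilon>" by (auto simp: \<epsilon>_def)
    have st: "insert e' (wE P) \<in> B \<longleftrightarrow> 3 dvd val P - \<epsilon>" if P: "ap P" for P
    proof (cases "3 dvd val P")
      case True
      then show ?thesis using ap_theta[OF P] ap_val[OF P] \<epsilon> by (simp add: dvd_diff_right_iff)
    next
      case False
      show ?thesis
      proof (cases "vote P")
        case True
        then have "\<epsilon> = 1" using P False by (auto simp: \<epsilon>_def)
        then show ?thesis using True by (simp add: vote_def)
      next
        case nv: False
        then have "\<epsilon> = - 1" using same P False unfolding \<epsilon>_def by metis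
        moreover have "3 dvd val P + 1 \<longleftrightarrow> \<not> 3 dvd val P - 1" using False by presburger
        ultimately show ?thesis using nv by (simp add: vote_def)
      qed
    qed
    define c where "c = \<psi> (e, a, b) + \<epsilon>"
    define \<gamma> where "\<gamma> = (\<lambda>(f, x, y). if f = e' then (if x = a then c else - c) else \<psi> (f, x, y))"
    have \<gamma>: "zgain G \<gamma>"
      unfolding zgain_def
    proof (intro allI impI)
      fix f x y assume f: "(f, x, y) \<in> arcs G" "x \<noteq> y"
      show "3 dvd \<gamma> (f, x, y) + \<gamma> (f, y, x)"
      proof (cases "f = e'")
        case True
        then have "{x, y} = {a, b}" using ends_arc[OF G f(1)] ends_e' by simp
        then show ?thesis using True f(2) by (auto simp: \<gamma>_def doubleton_eq_iff)
      next
        case False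
        then show ?thesis using zgainD[OF \<psi> f] by (simp add: \<gamma>_def)
      qed
    qed
    obtain C where C: "is_cycle G C" "\<not> right G B \<gamma> C" using not_gainable[OF \<gamma>] by blast
    have "right G B \<gamma> C"
    proof (cases "e' \<in> C")
      case False
      have "bal G \<gamma> C \<longleftrightarrow> bal G \<psi> C"
        by (rule bal_cong) (use False in \<open>auto simp: \<gamma>_def\<close>)
      then show ?thesis using \<psi>_right[OF C(1) False] by (simp add: right_def)
    next
      case True
      obtain P where P: "is_path G a P b" "e' \<notin> wE P" "C = insert e' (wE P)"
        using cycle_through_arc[OF G C(1) arcs_sym[OF e'_arc] True] by blast
      show ?thesis
      proof (cases "e \<in> wE P")
        case True
        then have "P = [(e, a, b)]" using path_edge_joining_ends[OF G P(1) _ ends_e] by blast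
        then show ?thesis using P(3) digon_right[OF \<gamma>] ee' \<epsilon> by (simp add: \<gamma>_def c_def insert_commute)
      next
        case False
        then have ap: "ap P" using P by (simp add: ap_def)
        have "gs \<gamma> P = gs \<psi> P"
        proof (rule gs_cong)
          fix x assume x: "x \<in> set P"
          obtain f y z where "x = (f, y, z)" by (cases x)
          then show "\<gamma> x = \<psi> x" using ap_arc(3)[OF ap, of f y z] x P(2) by (auto simp: \<gamma>_def)
        qed
        then show ?thesis
          using st[OF ap] ap_right(2)[OF ap \<gamma>] P(3) by (simp add: val_def \<gamma>_def c_def algebra_simps)
      qed
    qed
    then show False using C(2) by blast
  qed
  then show thesis using that by blast
qed

text \<open>If the votes differ, \<open>P, Q, e, e'\<close> are parallel paths without any balanced cycle among them.\<close>

lemma adjacent_votes: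
  assumes P: "ap P" "P = \<alpha> @ p @ \<beta>" and Q: "ap Q" "Q = \<alpha> @ q @ \<beta>"
    and pp: "is_path G a \<alpha> s" "is_path G s p t" "is_path G s q t" "is_path G t \<beta> b" and st: "s \<noteq> t"
    and pq: "idisj p q" and nz: "\<not> 3 dvd val P" "\<not> 3 dvd val Q"
  shows "vote P = vote Q"
proof (rule ccontr)
  assume votes: "vote P \<noteq> vote Q"
  have Pp: "is_path G a (\<alpha> @ p @ \<beta>) b" "e' \<notin> wE (\<alpha> @ p @ \<beta>)"
    and Qp: "is_path G a (\<alpha> @ q @ \<beta>) b" "e' \<notin> wE (\<alpha> @ q @ \<beta>)"
    using P Q by (simp_all add: ap_def)
  let ?r = "rev_walk \<alpha> @ (e', a, b) # rev_walk \<beta>"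
  have r: "is_path G s ?r t" "idisj p ?r" "wE p \<union> wE ?r = insert e' (wE P)"
    using complement_path[OF G Pp(1) e'_arc Pp(2) pp(1,2,4) st] P(2) by simp_all
  have r': "idisj q ?r" "wE q \<union> wE ?r = insert e' (wE Q)"
    using complement_path[OF G Qp(1) e'_arc Qp(2) pp(1,3,4) st] Q(2) by simp_all
  let ?pq = "wE p \<union> wE q"
  have pq_cycle: "is_cycle G ?pq" by (rule idisj_cycle[OF G pp(2,3) st pq])
  have "e' \<notin> ?pq" using Pp(2) Qp(2) by auto
  then have pq_B: "?pq \<in> B \<longleftrightarrow> 3 dvd gs \<psi> p - gs \<psi> q"
    using idisj_right[OF G \<psi> pp(2,3) st pq, of B] \<psi>_right[OF pq_cycle] by blast
  have diff: "gs \<gamma> P - gs \<gamma> Q = gs \<gamma> p - gs \<gamma> q" for \<gamma>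
    using P(2) Q(2) by simp
  then have val_diff: "gs \<psi> p - gs \<psi> q = val P - val Q"
    by (simp add: val_def)
  \<comment> \<open>If \<open>p\<close> and \<open>q\<close> formed a balanced cycle,
    \<open>P\<close> and \<open>Q\<close> would have equal values, and the theta with the rest of
    the cycle through \<open>e'\<close> would give both cycles through \<open>e'\<close> the same
    status. Then the votes would agree.\<close>
  have unb_pq: "?pq \<notin> B"
  proof
    assume B: "?pq \<in> B"
    then have "3 dvd val P - val Q" using pq_B val_diff by simp
    then have "3 dvd val P - 1 \<longleftrightarrow> 3 dvd val Q - 1" by presburger
    moreover have "insert e' (wE P) \<in> B \<longleftrightarrow> insert e' (wE Q) \<in> B"
      using biased_theta[OF biased st pp(2,3) r(1) pq r(2) r'(1)] biased_theta[OF biased st pp(3,2) r(1) idisj_sym[OF pq] r'(1) r(2)] B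
      unfolding r(3) r'(2) by (auto simp: Un_commute)
    ultimately show False using votes by (simp add: vote_def)
  qed
  then have "\<not> 3 dvd val P - val Q" using pq_B val_diff by simp
  \<comment> \<open>The values are the two different nonzero residues, so different votes mean equal
    status of the two cycles through \<open>e'\<close>. That both are balanced is excluded by the
    theta with the unbalanced cycle of \<open>p\<close> and \<open>q\<close>.\<close>
  then have "3 dvd val P - 1 \<longleftrightarrow> \<not> 3 dvd val Q - 1" using nz by presburger
  then have "insert e' (wE P) \<in> B \<longleftrightarrow> insert e' (wE Q) \<in> B"
    using votes by (auto simp: vote_def)
  moreover have "\<not> (insert e' (wE P) \<in> B \<and> insert e' (wE Q) \<in> B)"
    using biased_theta[OF biased st r(1) pp(2,3) idisj_sym[OF r(2)] idisj_sym[OF r'(1)] pq] unb_pq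
    unfolding r(3)[unfolded Un_commute[of "wE p"]] r'(2)[unfolded Un_commute[of "wE q"]] by blast
  ultimately have unb': "insert e' (wE P) \<notin> B" "insert e' (wE Q) \<notin> B" by blast+
  have unb_e: "insert e (wE P) \<notin> B" "insert e (wE Q) \<notin> B"
    using ap_val P(1) Q(1) nz by blast+
  \<comment> \<open>The six cycles formed by pairs of the four paths \<open>e\<close>,
    \<open>e'\<close>, \<open>P\<close>, \<open>Q\<close>, where the pair \<open>P\<close>,
    \<open>Q\<close> is stripped of its common parts. All of them are unbalanced.\<close>
  let ?L = "{{e, e'}, insert e (wE P), insert e' (wE P), insert e (wE Q), insert e' (wE Q), ?pq}"
  have cyc: "is_cycle G C" if "C \<in> ?L" for C
    using that digon_cycle ap_cycle[OF P(1)] ap_cycle[OF Q(1)] pq_cycle by blast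
  have contra: False if \<gamma>: "zgain G \<gamma>" "\<forall>C\<in>?L. right G B \<gamma> C" for \<gamma>
  proof (rule four_residues)
    show "\<not> 3 dvd \<gamma> (e, a, b) - \<gamma> (e', a, b)" using digon_right[OF \<gamma>(1)] \<gamma>(2) by blast
    have "\<not> 3 dvd gs \<gamma> P - \<gamma> (e, a, b)" "\<not> 3 dvd gs \<gamma> P - \<gamma> (e', a, b)"
      "\<not> 3 dvd gs \<gamma> Q - \<gamma> (e, a, b)" "\<not> 3 dvd gs \<gamma> Q - \<gamma> (e', a, b)"
      using ap_right[OF P(1) \<gamma>(1)] ap_right[OF Q(1) \<gamma>(1)] \<gamma>(2) unb' unb_e by blast+
    then show "\<not> 3 dvd \<gamma> (e, a, b) - gs \<gamma> P" "\<not> 3 dvd \<gamma> (e', a, b) - gs \<gamma> P"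
      "\<not> 3 dvd \<gamma> (e, a, b) - gs \<gamma> Q" "\<not> 3 dvd \<gamma> (e', a, b) - gs \<gamma> Q"
      by (simp_all add: dvd_diff_commute)
    have "right G B \<gamma> ?pq" using \<gamma>(2) by blast
    then show "\<not> 3 dvd gs \<gamma> P - gs \<gamma> Q"
      using idisj_right[OF G \<gamma>(1) pp(2,3) st pq, of B] unb_pq diff[of \<gamma>] by simp
  qed
  have crit: "z \<in> \<Union>?L" "\<not> is_loop G z \<Longrightarrow> \<exists>C\<in>?L. chord G C z" if z: "z \<in> edges G" for z
    by (rule critical(1)[where \<L> = ?L, OF cyc contra z], assumption+)
      (rule critical(2)[where \<L> = ?L, OF cyc contra z], assumption+)
  have pne: "p \<noteq> []" "q \<noteq> []" using pp(2,3) st by auto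
  have Vp: "\<Union>(ends G ` wE p) = insert t (wS p)" "\<Union>(ends G ` wE q) = insert t (wS q)"
    using walk_ends_eq[OF G is_path_walk] pp(2,3) pne by blast+
  have chordE: "ends G z \<subseteq> {a, b} \<or> (z \<notin> wE P \<and> ends G z \<subseteq> insert b (wS P)) \<or> (z \<notin> wE Q \<and> ends G z \<subseteq> insert b (wS Q)) \<or>
    z \<notin> ?pq \<and> ends G z \<subseteq> insert t (wS p) \<union> insert t (wS q)" if zs: "z \<in> edges G" "\<not> is_loop G z" for z
  proof -
    obtain C where C: "C \<in> ?L" "chord G C z" using crit(2)[OF zs] by blast
    have V0: "\<Union>(ends G ` {e, e'}) = {a, b}" using ends_e ends_e' by auto
    have V1: "\<Union>(ends G ` ?pq) = insert t (wS p) \<union> insert t (wS q)" using Vp by auto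
    show ?thesis
      using C(1) by (elim insertE emptyE)
        (use C(2) in \<open>simp_all only: chord_def V0 V1 ap_V[OF P(1)] ap_V[OF Q(1)] insert_iff de_Morgan_disj simp_thms\<close>)
  qed
  \<comment> \<open>The first edge of \<open>\<alpha>\<close> lies on both \<open>P\<close> and
    \<open>Q\<close>, so it could be a chord only of \<open>{e, e'}\<close> or of the cycle of
    \<open>p\<close> and \<open>q\<close>. In the former case it would end at \<open>b\<close>, in
    the latter \<open>a\<close> would lie on \<open>p\<close> or \<open>q\<close>.\<close>
  have \<alpha>: "\<alpha> = []"
  proof (cases \<alpha>)
    case (Cons x \<alpha>')
    then obtain z y where x: "x = (z, a, y)" using pp(1) by (cases x) (auto simp: is_path_Cons)
    then have z: "(z, a, y) \<in> set P" "z \<in> wE P" "z \<in> wE Q" using Cons P Q by auto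
    have ez: "ends G z = {a, y}" using ap_arc(2)[OF P(1) z(1)] .
    have "is_path G y (\<alpha>' @ p @ \<beta>) b" and aP: "a \<notin> insert b (wS (\<alpha>' @ p @ \<beta>))"
      using Pp(1) Cons x by (auto simp: is_path_Cons)
    moreover have "\<alpha>' @ p @ \<beta> \<noteq> []" using pne by simp
    ultimately have "y \<noteq> b" using closed_path_Nil[of G b] by blast
    moreover have aQ: "a \<notin> insert b (wS (\<alpha>' @ q @ \<beta>))"
      using Qp(1) Cons x by (auto simp: is_path_Cons)
    moreover have "t \<in> insert b (wS \<beta>)" using path_start_V[OF pp(4)] .
    ultimately show ?thesis
      using chordE[OF ap_edge(1,2)[OF P(1) z(2)]] z ez aP ap_edge(2)[OF P(1) z(2)] is_loop_arc[OF G ap_arc(1)[OF P(1) z(1)]] by auto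
  qed simp
  then have as: "a = s" using pp(1) by simp
  have \<beta>: "\<beta> = []"
  proof (cases \<beta> rule: rev_cases)
    case (snoc \<beta>' x)
    then obtain z y where x: "x = (z, y, b)" "(z, y, b) \<in> arcs G"
      using pp(4) is_walk_snoc[OF G] by (cases x) (auto simp: is_path_def)
    then have z: "(z, y, b) \<in> set P" "z \<in> wE P" "z \<in> wE Q" using snoc P Q by auto
    have d: "wS p \<inter> insert b (wS \<beta>) = {}" "wS q \<inter> insert b (wS \<beta>) = {}"
      using path_disjoint_append[OF G, of a p \<beta> b] path_disjoint_append[OF G, of a q \<beta> b] Pp Qp \<alpha> by auto
    have "a \<in> wS p" using path_start_in'[OF pp(2) pne(1)] as by simp
    then have "y \<noteq> a" using d snoc x by auto
    moreover have "b \<noteq> t" using closed_path_Nil[of G b \<beta>] pp(4) snoc by auto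
    ultimately show ?thesis
      using chordE[OF ap_edge(1,2)[OF P(1) z(2)]] z ap_arc(2)[OF P(1) z(1)] d is_loop_arc[OF G x(2)] ap_edge(2)[OF P(1) z(2)] by auto
  qed simp
  then have bt: "b = t" using pp(4) by simp
  have eqs: "P = p" "Q = q" using P Q \<alpha> \<beta> by simp_all
  \<comment> \<open>If \<open>p'\<close> had an inner vertex, its first edge would end in one. This
    vertex is not on \<open>q'\<close> and is no end of \<open>e\<close>, so the edge would be a
    chord of neither the digon nor a cycle through \<open>q'\<close>.\<close>
  have single: "\<exists>z. p' = [(z, a, b)]" if h: "ap p'" "ap q'" "idisj p' q'"
    "\<And>z. z \<in> wE p' \<Longrightarrow> ends G z \<subseteq> {a, b} \<or> ends G z \<subseteq> insert b (wS q')" for p' q'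
  proof -
    obtain z y p'' where p': "p' = (z, a, y) # p''" "(z, a, y) \<in> arcs G" "is_path G y p'' b" "a \<notin> insert b (wS p'')"
      using h(1) ne by (cases p') (auto simp: ap_def is_path_Cons)
    have "p'' = []"
    proof (rule ccontr)
      assume n: "p'' \<noteq> []"
      then have y: "y \<in> wS p''" using path_start_in'[OF p'(3)] by simp
      have "y \<noteq> b" "y \<noteq> a" using y p' path_end_notin[OF p'(3)] by auto
      have "wS q' = insert a (set (tl (walk_starts q')))"
        using path_starts_tl[of G a q' b] h(2) ne by (metis ap_def list.simps(15))
      then have "y \<notin> insert b (wS q')"
        using h(3) y p' \<open>y \<noteq> b\<close> \<open>y \<noteq> a\<close> by (auto simp: idisj_iff)
      then show False
        using h(4)[of z] p' ends_arc[OF G p'(2)] \<open>y \<noteq> b\<close> \<open>y \<noteq> a\<close> by auto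
    qed
    then show ?thesis using p' by auto
  qed
  have "ends G z \<subseteq> {a, b} \<or> ends G z \<subseteq> insert b (wS q)" if "z \<in> wE p" for z
    using chordE[of z] ap_edge[of P z] P(1) that eqs by auto
  then obtain f where f: "p = [(f, a, b)]"
    using single[of p q] P(1) Q(1) eqs pq by auto
  have "ends G z \<subseteq> {a, b} \<or> ends G z \<subseteq> insert b (wS p)" if "z \<in> wE q" for z
    using chordE[of z] ap_edge[of Q z] Q(1) that eqs by auto
  then obtain g where g: "q = [(g, a, b)]"
    using single[of q p] P(1) Q(1) eqs idisj_sym[OF pq] by auto
  have d: "f \<noteq> g" "f \<noteq> e" "f \<noteq> e'" "g \<noteq> e" "g \<noteq> e'"
    using pq P(1) Q(1) eqs f g by (auto simp: idisj_iff ap_def)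
  have fg: "f \<in> edges G" "g \<in> edges G" "ends G f = {a, b}" "ends G g = {a, b}"
    using ap_edge(1)[OF P(1), of f] ap_edge(1)[OF Q(1), of g] ap_arc(2)[OF P(1), of f a b] ap_arc(2)[OF Q(1), of g a b]
    unfolding eqs f g by simp_all
  have E: "edges G = {e, e', f, g}"
  proof
    show "edges G \<subseteq> {e, e', f, g}" using crit(1) eqs f g by fastforce
    show "{e, e', f, g} \<subseteq> edges G" using fg arc_edge[OF e_arc] arc_edge[OF e'_arc] by simp
  qed
  have ends: "ends G x = {a, b}" if "x \<in> edges G" for x
    using that E fg ends_e ends_e' by auto
  have V: "verts G = {a, b}" using no_isolated E ends by auto
  have "B = {}"
  proof (rule ccontr)
    assume "B \<noteq> {}"
    then obtain C where C: "C \<in> B" by blast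
    obtain x y where xy: "C = {x, y}" "x \<noteq> y" "x \<in> edges G" "y \<in> edges G"
      using parallel_cycles[OF G ends ne biased_cycle[OF biased C]] .
    have n: "{e, e'} \<notin> B" "{e, f} \<notin> B" "{e', f} \<notin> B" "{e, g} \<notin> B" "{e', g} \<notin> B" "{f, g} \<notin> B"
      using unb unb' unb_e unb_pq unfolding eqs f g by (simp_all add: insert_commute)
    then have n': "{e', e} \<notin> B" "{f, e} \<notin> B" "{f, e'} \<notin> B" "{g, e} \<notin> B" "{g, e'} \<notin> B" "{g, f} \<notin> B"
      by (simp_all add: insert_commute)
    show False
      using xy(3,4) C xy(2) unfolding xy(1) E
      by (elim insertE emptyE) (simp_all add: n n')
  qed
  moreover have "card (edges G) = 4" unfolding E using d ee' by simp
  ultimately show False using iso_4K2[OF G V ne ends] not_4K2 by simp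
qed

end

section \<open>Two paths that differ in two segments\<close>

text \<open>After subtraction of \<open>x\<close>, the residues \<open>p\<close> and
  \<open>s\<close> are opposite and nonzero, so the nonzero residue \<open>y\<close> equals exactly
  one of them, contrary to the last assumption.\<close>

lemma square_residues:
  fixes p s r r' x y :: int
  assumes "3 dvd p + s - r - r'" "\<not> 3 dvd x - y" "\<not> 3 dvd p - x" "\<not> 3 dvd s - x" "3 dvd r - x" "3 dvd r' - x"
    "3 dvd p - y \<longleftrightarrow> 3 dvd s - y"
  shows False
  using assms by presburger

text \<open>Two pairs of distinct residues modulo 3 have all three residues among their four
  sums.\<close>

lemma sum_residues:
  fixes f f' g g' y :: int
  assumes "\<not> 3 dvd f + f' - y" "\<not> 3 dvd g + g' - y" "\<not> 3 dvd g + f' - y" "\<not> 3 dvd f + g' - y" "\<not> 3 dvd f - g" "\<not> 3 dvd f' - g'"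
  shows False
  using assms by presburger

context digon_graph
begin

text \<open>Two paths \<open>P\<close>, \<open>S\<close> and two mixed paths \<open>R1\<close>,
  \<open>R2\<close> made of their pieces. The values of \<open>P\<close> and \<open>S\<close> are
  opposite, so disagreeing votes give both the same status with \<open>e'\<close>. No gain is right
  on the cycles that \<open>e\<close> and \<open>e'\<close> form with each other and with the four
  paths, and criticality then restricts the edges of \<open>G\<close>.\<close>

lemma four_paths:
  assumes ap: "ap P" "ap S" "ap R1" "ap R2"
    and sum: "\<And>\<gamma>. zgain G \<gamma> \<Longrightarrow> 3 dvd gs \<gamma> P + gs \<gamma> S - gs \<gamma> R1 - gs \<gamma> R2"
    and v: "\<not> 3 dvd val P" "3 dvd val R1" "3 dvd val R2"
    and votes: "vote P \<noteq> vote S"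
  shows "\<not> 3 dvd val S" "insert e' (wE P) \<in> B \<longleftrightarrow> insert e' (wE S) \<in> B"
    "\<And>z. z \<in> edges G \<Longrightarrow> z \<in> {e, e'} \<union> wE P \<union> wE S \<union> wE R1 \<union> wE R2"
    "\<And>z. z \<in> edges G \<Longrightarrow> \<not> is_loop G z \<Longrightarrow> ends G z = {a, b} \<or>
      (\<exists>R\<in>{P, S, R1, R2}. z \<notin> wE R \<and> ends G z \<subseteq> insert b (wS R))"
proof -
  have vs: "3 dvd val P + val S"
  proof -
    have "val P + val S = (gs \<psi> P + gs \<psi> S - gs \<psi> R1 - gs \<psi> R2) + (val R1 + val R2)"
      by (simp add: val_def)
    then show ?thesis using sum[OF \<psi>] v(2,3) by simp
  qed
  show vS: "\<not> 3 dvd val S" using vs v(1) by presburger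
  have "3 dvd val P - 1 \<longleftrightarrow> \<not> 3 dvd val S - 1" using vs v(1) by presburger
  then show st: "insert e' (wE P) \<in> B \<longleftrightarrow> insert e' (wE S) \<in> B"
    using votes by (auto simp: vote_def)
  have unb_e: "insert e (wE P) \<notin> B" "insert e (wE S) \<notin> B" and bal_e: "insert e (wE R1) \<in> B" "insert e (wE R2) \<in> B"
    using ap_val[OF ap(1)] ap_val[OF ap(2)] ap_val[OF ap(3)] ap_val[OF ap(4)] v vS by blast+
  let ?L = "insert {e, e'} ((\<lambda>R. insert e (wE R)) ` {P, S, R1, R2} \<union> (\<lambda>R. insert e' (wE R)) ` {P, S, R1, R2})"
  have cyc: "is_cycle G C" if "C \<in> ?L" for C
    using that digon_cycle ap_cycle ap by blast
  have contra: False if \<gamma>: "zgain G \<gamma>" "\<forall>C\<in>?L. right G B \<gamma> C" for \<gamma>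
  proof -
    define x y where "x = \<gamma> (e, a, b)" and "y = \<gamma> (e', a, b)"
    have "\<not> 3 dvd x - y" using digon_right[OF \<gamma>(1)] \<gamma>(2) by (simp add: x_def y_def)
    moreover have "\<not> 3 dvd gs \<gamma> P - x" "\<not> 3 dvd gs \<gamma> S - x" "3 dvd gs \<gamma> R1 - x" "3 dvd gs \<gamma> R2 - x"
      using ap_right(1)[OF ap(1) \<gamma>(1)] ap_right(1)[OF ap(2) \<gamma>(1)] ap_right(1)[OF ap(3) \<gamma>(1)] ap_right(1)[OF ap(4) \<gamma>(1)]
        \<gamma>(2) unb_e bal_e by (simp_all add: x_def)
    moreover have "3 dvd gs \<gamma> P - y \<longleftrightarrow> 3 dvd gs \<gamma> S - y"
      using ap_right(2)[OF ap(1) \<gamma>(1)] ap_right(2)[OF ap(2) \<gamma>(1)] \<gamma>(2) st by (simp add: y_def)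
    ultimately show False by (rule square_residues[OF sum[OF \<gamma>(1)]])
  qed
  have crit: "z \<in> \<Union>?L" "\<not> is_loop G z \<Longrightarrow> \<exists>C\<in>?L. chord G C z" if z: "z \<in> edges G" for z
    by (rule critical(1)[where \<L> = ?L, OF cyc contra z], assumption+)
      (rule critical(2)[where \<L> = ?L, OF cyc contra z], assumption+)
  show "z \<in> {e, e'} \<union> wE P \<union> wE S \<union> wE R1 \<union> wE R2" if "z \<in> edges G" for z
    using crit(1)[OF that] by auto
  show "ends G z = {a, b} \<or> (\<exists>R\<in>{P, S, R1, R2}. z \<notin> wE R \<and> ends G z \<subseteq> insert b (wS R))"
    if z: "z \<in> edges G" "\<not> is_loop G z" for z
  proof -
    obtain C where C: "C \<in> ?L" "chord G C z" using crit(2)[OF z] by blast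
    have V0: "\<Union>(ends G ` {e, e'}) = {a, b}" using ends_e ends_e' by auto
    consider "C = {e, e'}" | R where "R \<in> {P, S, R1, R2}" "C = insert e (wE R) \<or> C = insert e' (wE R)"
      using C(1) by blast
    then show ?thesis
    proof cases
      case 1
      then have "ends G z \<subseteq> {a, b}" using C(2) V0 by (simp only: chord_def)
      then have "ends G z = {a, b}"
        using mgraphD(2)[OF G z(1)] z(2) ne card_subset_eq[of "{a, b}" "ends G z"] by (auto simp: is_loop_def)
      then show ?thesis by blast
    next
      case 2
      then have "ap R" using ap by blast
      then have "ends G z \<subseteq> insert b (wS R)" "z \<notin> wE R"
        using 2(2) C(2) ap_V[OF \<open>ap R\<close>] by (auto simp only: chord_def insert_iff)
      then show ?thesis using 2(1) by blast
    qed
  qed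
qed

lemma path_inner_start:
  assumes "is_path G u p v" "p = (z, x, y) # p'" "p' \<noteq> []"
  shows "x = u" "y \<in> wS p'" "y \<noteq> x" "y \<noteq> v" "(z, x, y) \<in> arcs G" "ends G z = {x, y}"
proof -
  have p: "(z, x, y) \<in> arcs G" "x = u" "is_path G y p' v" "x \<notin> insert v (wS p')"
    using assms(1,2) by (auto simp: is_path_Cons)
  then show "x = u" "y \<in> wS p'" "y \<noteq> x" "y \<noteq> v" "(z, x, y) \<in> arcs G" "ends G z = {x, y}"
    using path_start_in'[OF p(3) assms(3)] path_end_notin[OF p(3)] ends_arc[OF G p(1)] by auto
qed

text \<open>If the votes differed, the restriction on chords would reduce all four segments to
  single edges, and \<open>G\<close> would be a doubled triangle on \<open>a\<close>,
  \<open>m\<close>, \<open>b\<close>. It remains to determine the balanced cycles.\<close>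

lemma triangle_votes:
  assumes paths: "is_path G a p1 m" "is_path G a q1 m" "is_path G m p2 b" "is_path G m q2 b"
    and ap: "ap (p1 @ p2)" "ap (q1 @ q2)" "ap (q1 @ p2)" "ap (p1 @ q2)"
    and inner: "(wS q1 - {a}) \<inter> insert b (wS (p1 @ p2)) = {}" "(wS q2 - {m}) \<inter> insert b (wS (p1 @ p2)) = {}"
    and disj: "wE q1 \<inter> wE (p1 @ p2) = {}" "wE q2 \<inter> wE (p1 @ p2) = {}"
    and m: "a \<noteq> m" "m \<noteq> b"
    and v: "\<not> 3 dvd val (p1 @ p2)" "3 dvd val (q1 @ p2)" "3 dvd val (p1 @ q2)"
  shows "vote (p1 @ p2) = vote (q1 @ q2)"
proof (rule ccontr)
  assume "vote (p1 @ p2) \<noteq> vote (q1 @ q2)"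
  have vS: "\<not> 3 dvd val (q1 @ q2)"
    and stS: "insert e' (wE (p1 @ p2)) \<in> B \<longleftrightarrow> insert e' (wE (q1 @ q2)) \<in> B"
    and cover: "\<And>z. z \<in> edges G \<Longrightarrow> z \<in> {e, e'} \<union> wE (p1 @ p2) \<union> wE (q1 @ q2) \<union> wE (q1 @ p2) \<union> wE (p1 @ q2)"
    and chords: "\<And>z. z \<in> edges G \<Longrightarrow> \<not> is_loop G z \<Longrightarrow> ends G z = {a, b} \<or>
      (\<exists>R\<in>{p1 @ p2, q1 @ q2, q1 @ p2, p1 @ q2}. z \<notin> wE R \<and> ends G z \<subseteq> insert b (wS R))"
    using four_paths[OF ap _ v \<open>vote (p1 @ p2) \<noteq> vote (q1 @ q2)\<close>] by (auto simp only: gs_simps algebra_simps diff_self dvd_0_right)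
  have d: "wS p1 \<inter> insert b (wS p2) = {}" "wS q1 \<inter> insert b (wS q2) = {}"
    using path_disjoint_append[OF G, of a p1 p2 b] path_disjoint_append[OF G, of a q1 q2 b] ap(1,2) by (simp_all add: ap_def)
  have pne: "p1 \<noteq> []" "q1 \<noteq> []" "p2 \<noteq> []" "q2 \<noteq> []" using paths m by auto
  have st: "a \<in> wS p1" "a \<in> wS q1" "m \<in> wS p2" "m \<in> wS q2"
    using path_start_in' paths pne by metis+
  have edge: "z \<in> edges G" "\<not> is_loop G z" if "z \<in> wE p1 \<union> wE q1 \<union> wE p2 \<union> wE q2" for z
    using that ap_edge(1,2)[OF ap(1), of z] ap_edge(1,2)[OF ap(2), of z] by auto
  \<comment> \<open>The second vertex \<open>y\<close> of a longer \<open>p1\<close> lies only on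
    those of the four paths that contain \<open>p1\<close> and hence its first edge. So this edge is
    a chord of none of the cycles. The other three segments are treated alike.\<close>
  have p1: "tl p1 = []"
  proof (rule ccontr)
    assume t: "tl p1 \<noteq> []"
    obtain z x y where p: "p1 = (z, x, y) # tl p1" using pne(1) by (metis list.exhaust_sel prod_cases3)
    note i = path_inner_start[OF paths(1) p t]
    have y: "y \<in> wS p1" "y \<notin> insert b (wS p2)" "y \<noteq> a" "y \<noteq> m"
      using i d(1) st p by (metis walk_starts_simps(2) list.set_intros(2) disjoint_iff insertCI)+
    have z: "z \<in> wE p1" using p by (metis walk_edges_simps(2) list.set_intros(1))
    have "y \<notin> wS q1" "y \<notin> wS q2" using inner y by auto
    then show False
      using chords[OF edge, of z] z i(6) y by (auto simp: doubleton_eq_iff)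
  qed
  have q1: "tl q1 = []"
  proof (rule ccontr)
    assume t: "tl q1 \<noteq> []"
    obtain z x y where p: "q1 = (z, x, y) # tl q1" using pne(2) by (metis list.exhaust_sel prod_cases3)
    note i = path_inner_start[OF paths(2) p t]
    have y: "y \<in> wS q1" "y \<notin> insert b (wS q2)" "y \<noteq> a"
      using i d(2) st p by (metis walk_starts_simps(2) list.set_intros(2) disjoint_iff insertCI)+
    have z: "z \<in> wE q1" using p by (metis walk_edges_simps(2) list.set_intros(1))
    have "y \<notin> insert b (wS (p1 @ p2))" using inner y by auto
    then show False
      using chords[OF edge, of z] z i(6) y by (auto simp: doubleton_eq_iff)
  qed
  have p2: "tl p2 = []"
  proof (rule ccontr)
    assume t: "tl p2 \<noteq> []"
    obtain z x y where p: "p2 = (z, x, y) # tl p2" using pne(3) by (metis list.exhaust_sel prod_cases3)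
    note i = path_inner_start[OF paths(3) p t]
    have y: "y \<in> wS p2" "y \<noteq> b" "y \<noteq> m"
      using i p by (metis walk_starts_simps(2) list.set_intros(2))+
    have z: "z \<in> wE p2" using p by (metis walk_edges_simps(2) list.set_intros(1))
    have y': "y \<notin> wS p1" "y \<noteq> a" using d(1) y st by auto
    then have "y \<notin> wS q1" "y \<notin> wS q2" using inner y by auto
    then show False
      using chords[OF edge, of z] z i(6) y y' by (auto simp: doubleton_eq_iff)
  qed
  have q2: "tl q2 = []"
  proof (rule ccontr)
    assume t: "tl q2 \<noteq> []"
    obtain z x y where p: "q2 = (z, x, y) # tl q2" using pne(4) by (metis list.exhaust_sel prod_cases3)
    note i = path_inner_start[OF paths(4) p t]
    have y: "y \<in> wS q2" "y \<noteq> b" "y \<noteq> m"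
      using i p by (metis walk_starts_simps(2) list.set_intros(2))+
    have z: "z \<in> wE q2" using p by (metis walk_edges_simps(2) list.set_intros(1))
    have y': "y \<notin> wS q1" "y \<noteq> a" using d(2) y st by auto
    have "y \<notin> insert b (wS (p1 @ p2))" using inner y by auto
    then show False
      using chords[OF edge, of z] z i(6) y y' by (auto simp: doubleton_eq_iff)
  qed
  have single: "\<exists>z. p = [(z, u, w)] \<and> (z, u, w) \<in> arcs G" if "is_path G u p w" "p \<noteq> []" "tl p = []" for u p w
    using that by (cases p) (auto simp: is_path_Cons)
  obtain f1 g1 f2 g2 where f: "p1 = [(f1, a, m)]" "q1 = [(g1, a, m)]" "p2 = [(f2, m, b)]" "q2 = [(g2, m, b)]"
    and arcs: "(f1, a, m) \<in> arcs G" "(g1, a, m) \<in> arcs G" "(f2, m, b) \<in> arcs G" "(g2, m, b) \<in> arcs G"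
    using single[OF paths(1) pne(1) p1] single[OF paths(2) pne(2) q1] single[OF paths(3) pne(3) p2] single[OF paths(4) pne(4) q2]
    by blast
  have dist: "distinct [f1, g1, f2, g2, e, e']"
    using disj ap path_distinct_edges[OF G, of a "p1 @ p2" b] path_distinct_edges[OF G, of a "q1 @ q2" b] ee'
    unfolding f ap_def by auto
  have E: "edges G = {f1, g1, f2, g2, e, e'}"
  proof
    show "edges G \<subseteq> {f1, g1, f2, g2, e, e'}" using cover unfolding f by auto
    show "{f1, g1, f2, g2, e, e'} \<subseteq> edges G"
      using arc_edge[OF arcs(1)] arc_edge[OF arcs(2)] arc_edge[OF arcs(3)] arc_edge[OF arcs(4)]
        arc_edge[OF e_arc] arc_edge[OF e'_arc] by simp
  qed
  note ends = ends_arc[OF G arcs(1)] ends_arc[OF G arcs(2)] ends_arc[OF G arcs(3)] ends_arc[OF G arcs(4)] ends_e ends_e'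
  have V: "verts G = {a, m, b}"
    unfolding no_isolated E using ends by auto
  have e_stat: "{f1, f2, e} \<notin> B" "{g1, g2, e} \<notin> B" "{g1, f2, e} \<in> B" "{f1, g2, e} \<in> B"
    using ap_val[OF ap(1)] ap_val[OF ap(2)] ap_val[OF ap(3)] ap_val[OF ap(4)] v vS
    unfolding f by (simp_all add: insert_commute)
  have e'_R: "{g1, f2, e'} \<notin> B" "{f1, g2, e'} \<notin> B"
    using ap_theta[OF ap(3)] ap_theta[OF ap(4)] e_stat unfolding f by (simp_all add: insert_commute)
  have S1: "is_path G a [(x, a, m)] m" if "(x, a, m) \<in> arcs G" for x by (rule is_path_single[OF G that m(1)])
  have S2: "is_path G m [(x, m, b)] b" if "(x, m, b) \<in> arcs G" for x by (rule is_path_single[OF G that m(2)])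
  have L1: "is_path G a [(e, a, b), (x, b, m)] m" if "(x, m, b) \<in> arcs G" for x
    using e_arc arcs_sym[OF that] ne m arc_verts[OF G that] by (auto simp: is_path_Cons)
  have L2: "is_path G m [(x, m, a), (e, a, b)] b" if "(x, a, m) \<in> arcs G" for x
    using e_arc arcs_sym[OF that] ne m arc_verts[OF G e_arc] by (auto simp: is_path_Cons)
  \<comment> \<open>If \<open>{f1, g1}\<close> were balanced, a theta would make
    \<open>{f1, f2, e}\<close> balanced along with \<open>{g1, f2, e}\<close>.\<close>
  have fg1: "{f1, g1} \<notin> B"
  proof
    assume "{f1, g1} \<in> B"
    then have "{f1, f2, e} \<in> B"
      using biased_theta[OF biased m(1) S1[OF arcs(2)] S1[OF arcs(1)] L1[OF arcs(3)]] dist e_stat(3)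
      by (auto simp: idisj_iff insert_commute)
    then show False using e_stat by blast
  qed
  have fg2: "{f2, g2} \<notin> B"
  proof
    assume "{f2, g2} \<in> B"
    then have "{f1, f2, e} \<in> B"
      using biased_theta[OF biased m(2) S2[OF arcs(4)] S2[OF arcs(3)] L2[OF arcs(1)]] dist e_stat(4)
      by (auto simp: idisj_iff insert_commute)
    then show False using e_stat by blast
  qed
  have dm: "distinct [a, m, b]" using m ne by simp
  have st': "{f1, f2, e'} \<in> B \<longleftrightarrow> {g1, g2, e'} \<in> B"
    using stS unfolding f by (simp add: insert_commute)
  show False
  proof (cases "{f1, f2, e'} \<in> B")
    case True
    then have "(G, B) \<cong>\<^sub>b plus_minus (complete_graph 3)"
      by (intro iso_plus_minus_K3[OF biased E dist dm V ends]) (use e_stat e'_R fg1 fg2 unb st' in auto)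
    then show False using not_plus_minus_K3 by blast
  next
    \<comment> \<open>Now all four triangles through \<open>e'\<close> and both digons at
      \<open>m\<close> are unbalanced. In the gain obtained by contracting \<open>e'\<close>, the
      four paths through \<open>m\<close> would all have to avoid the gain of \<open>e'\<close>,
      which two pairs of distinct residues cannot do.\<close>
    case False
    obtain \<gamma> where \<gamma>: "zgain G \<gamma>" "\<And>C. is_cycle G C \<Longrightarrow> \<not> chord G C e' \<Longrightarrow> right G B \<gamma> C"
      using contract[of e'] arc_edge[OF e'_arc] is_loop_arc[OF G e'_arc] ne by blast
    have through: "\<not> 3 dvd gs \<gamma> P - \<gamma> (e', a, b)" if "ap P" "insert e' (wE P) \<notin> B" for P
      using ap_right(2)[OF that(1) \<gamma>(1)] that(2) \<gamma>(2)[OF ap_cycle(2)[OF that(1)]] by (simp add: chord_def)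
    have t: "\<not> 3 dvd gs \<gamma> (p1 @ p2) - \<gamma> (e', a, b)" "\<not> 3 dvd gs \<gamma> (q1 @ q2) - \<gamma> (e', a, b)"
      "\<not> 3 dvd gs \<gamma> (q1 @ p2) - \<gamma> (e', a, b)" "\<not> 3 dvd gs \<gamma> (p1 @ q2) - \<gamma> (e', a, b)"
      by (rule through[OF ap(1)], use False in \<open>simp add: f insert_commute\<close>)
        (rule through[OF ap(2)], use False st' in \<open>simp add: f insert_commute\<close>,
         rule through[OF ap(3)], use e'_R in \<open>simp add: f insert_commute\<close>,
         rule through[OF ap(4)], use e'_R in \<open>simp add: f insert_commute\<close>)
    have dj: "idisj [(f1, a, m)] [(g1, a, m)]" "idisj [(f2, m, b)] [(g2, m, b)]"
      using dist by (auto simp: idisj_iff)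
    have "\<not> chord G {f1, g1} e'" "\<not> chord G {f2, g2} e'"
      using ends m ne by (auto simp: chord_def)
    then have "right G B \<gamma> {f1, g1}" "right G B \<gamma> {f2, g2}"
      using \<gamma>(2)[OF idisj_cycle[OF G S1[OF arcs(1)] S1[OF arcs(2)] m(1) dj(1)]]
        \<gamma>(2)[OF idisj_cycle[OF G S2[OF arcs(3)] S2[OF arcs(4)] m(2) dj(2)]] by (simp_all add: insert_commute)
    then have "\<not> 3 dvd \<gamma> (f1, a, m) - \<gamma> (g1, a, m)" "\<not> 3 dvd \<gamma> (f2, m, b) - \<gamma> (g2, m, b)"
      using idisj_right[OF G \<gamma>(1) S1[OF arcs(1)] S1[OF arcs(2)] m(1) dj(1), of B]
        idisj_right[OF G \<gamma>(1) S2[OF arcs(3)] S2[OF arcs(4)] m(2) dj(2), of B] fg1 fg2 by (simp_all add: insert_commute)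
    from sum_residues[OF _ _ _ _ this] show False
      using t unfolding f by simp
  qed
qed

end

section \<open>Separated and interlacing bypasses, and agreement of all votes\<close>

context digon_graph
begin

text \<open>The two bypassed segments are separated by \<open>\<mu>\<close>. An edge of
  \<open>\<alpha>\<close>, \<open>\<mu>\<close> or \<open>\<beta>\<close> lies on all four paths, so
  it could only be a chord of \<open>{e, e'}\<close> and would join \<open>a\<close> to
  \<open>b\<close>, leaving no room for \<open>p1\<close> and \<open>p2\<close>. Hence these parts
  are empty and the triangle case applies.\<close>

lemma square_votes:
  assumes paths: "is_path G a \<alpha> s" "is_path G s p1 t" "is_path G s q1 t" "is_path G t \<mu> t'"
      "is_path G t' p2 s'" "is_path G t' q2 s'" "is_path G s' \<beta> b"
    and ap: "ap (\<alpha> @ p1 @ \<mu> @ p2 @ \<beta>)" "ap (\<alpha> @ q1 @ \<mu> @ q2 @ \<beta>)" "ap (\<alpha> @ q1 @ \<mu> @ p2 @ \<beta>)" "ap (\<alpha> @ p1 @ \<mu> @ q2 @ \<beta>)"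
    and ne: "s \<noteq> t" "t' \<noteq> s'"
    and inner: "(wS q1 - {s}) \<inter> insert b (wS (\<alpha> @ p1 @ \<mu> @ p2 @ \<beta>)) = {}" "(wS q2 - {t'}) \<inter> insert b (wS (\<alpha> @ p1 @ \<mu> @ p2 @ \<beta>)) = {}"
    and disj: "wE q1 \<inter> wE (\<alpha> @ p1 @ \<mu> @ p2 @ \<beta>) = {}" "wE q2 \<inter> wE (\<alpha> @ p1 @ \<mu> @ p2 @ \<beta>) = {}"
    and v: "\<not> 3 dvd val (\<alpha> @ p1 @ \<mu> @ p2 @ \<beta>)" "3 dvd val (\<alpha> @ q1 @ \<mu> @ p2 @ \<beta>)" "3 dvd val (\<alpha> @ p1 @ \<mu> @ q2 @ \<beta>)"
  shows "vote (\<alpha> @ p1 @ \<mu> @ p2 @ \<beta>) = vote (\<alpha> @ q1 @ \<mu> @ q2 @ \<beta>)"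
    (is "vote ?P = vote ?S")
proof (rule ccontr)
  assume votes: "vote ?P \<noteq> vote ?S"
  have chords: "\<And>z. z \<in> edges G \<Longrightarrow> \<not> is_loop G z \<Longrightarrow> ends G z = {a, b} \<or>
      (\<exists>R\<in>{?P, ?S, \<alpha> @ q1 @ \<mu> @ p2 @ \<beta>, \<alpha> @ p1 @ \<mu> @ q2 @ \<beta>}. z \<notin> wE R \<and> ends G z \<subseteq> insert b (wS R))"
    by (rule four_paths(4)[OF ap _ v votes]) simp_all
  have pne: "p1 \<noteq> []" "p2 \<noteq> []" using paths ne by auto
  have "wE \<alpha> \<union> wE \<mu> \<union> wE \<beta> = {}"
  proof (rule ccontr)
    assume "wE \<alpha> \<union> wE \<mu> \<union> wE \<beta> \<noteq> {}"
    then obtain z where z: "z \<in> wE \<alpha> \<union> wE \<mu> \<union> wE \<beta>" by (auto simp only: ex_in_conv[symmetric])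
    then have zP: "z \<in> wE ?P" by auto
    have "ends G z = {a, b}"
      using chords[OF ap_edge(1,2)[OF ap(1) zP]] z by auto
    then have "?P = [(z, a, b)]"
      using path_edge_joining_ends[OF G _ zP] ap(1) by (simp only: ap_def)
    then have "length ?P = 1" by simp
    then show False using pne by (cases p1; cases p2) auto
  qed
  then have nil: "\<alpha> = []" "\<mu> = []" "\<beta> = []" by auto
  then have eqs: "a = s" "t = t'" "s' = b" using paths(1,4,7) by auto
  have "vote (p1 @ p2) = vote (q1 @ q2)"
    by (rule triangle_votes[of p1 t q1 p2 q2])
      (use paths ap inner disj v ne eqs nil in simp_all)
  then show False using votes nil by simp
qed

text \<open>The bypasses interlace: \<open>q1\<close> skips the vertex \<open>t'\<close> where
  \<open>q2\<close> starts, and the path using both runs through \<open>\<mu>\<close> backwards, so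
  that \<open>\<mu>\<close> cancels in the sum of gains. Again \<open>\<alpha>\<close> and
  \<open>\<beta>\<close> are empty. So is \<open>\<mu>\<close>, and the triangle case with
  \<open>t' = t\<close> remains.\<close>

lemma crossing_votes:
  assumes paths: "is_path G a \<alpha> s" "is_path G s p1 t'" "is_path G s q1 t" "is_path G t' \<mu> t"
      "is_path G t p2 s'" "is_path G t' q2 s'" "is_path G s' \<beta> b"
    and ap: "ap (\<alpha> @ p1 @ \<mu> @ p2 @ \<beta>)" "ap (\<alpha> @ q1 @ rev_walk \<mu> @ q2 @ \<beta>)" "ap (\<alpha> @ q1 @ p2 @ \<beta>)" "ap (\<alpha> @ p1 @ q2 @ \<beta>)"
    and ne: "s \<noteq> t'" "t \<noteq> s'" "s \<noteq> t" "t' \<noteq> s'"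
    and inner: "(wS q1 - {s}) \<inter> insert b (wS (\<alpha> @ p1 @ \<mu> @ p2 @ \<beta>)) = {}" "(wS q2 - {t'}) \<inter> insert b (wS (\<alpha> @ p1 @ \<mu> @ p2 @ \<beta>)) = {}"
    and disj: "wE q1 \<inter> wE (\<alpha> @ p1 @ \<mu> @ p2 @ \<beta>) = {}" "wE q2 \<inter> wE (\<alpha> @ p1 @ \<mu> @ p2 @ \<beta>) = {}"
    and v: "\<not> 3 dvd val (\<alpha> @ p1 @ \<mu> @ p2 @ \<beta>)" "3 dvd val (\<alpha> @ q1 @ p2 @ \<beta>)" "3 dvd val (\<alpha> @ p1 @ q2 @ \<beta>)"
  shows "vote (\<alpha> @ p1 @ \<mu> @ p2 @ \<beta>) = vote (\<alpha> @ q1 @ rev_walk \<mu> @ q2 @ \<beta>)"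
    (is "vote ?P = vote ?S")
proof (rule ccontr)
  assume votes: "vote ?P \<noteq> vote ?S"
  let ?R1 = "\<alpha> @ q1 @ p2 @ \<beta>"
  let ?R2 = "\<alpha> @ p1 @ q2 @ \<beta>"
  have chords: "\<And>z. z \<in> edges G \<Longrightarrow> \<not> is_loop G z \<Longrightarrow> ends G z = {a, b} \<or>
      (\<exists>R\<in>{?P, ?S, ?R1, ?R2}. z \<notin> wE R \<and> ends G z \<subseteq> insert b (wS R))"
  proof (rule four_paths(4)[OF ap _ v votes])
    fix \<gamma> assume "zgain G \<gamma>"
    then have "3 dvd gs \<gamma> \<mu> + gs \<gamma> (rev_walk \<mu>)" by (rule gs_rev_path[OF _ paths(4)])
    then show "3 dvd gs \<gamma> ?P + gs \<gamma> ?S - gs \<gamma> ?R1 - gs \<gamma> ?R2"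
      by (simp add: algebra_simps)
  qed
  have pne: "p1 \<noteq> []" "p2 \<noteq> []" "q1 \<noteq> []" "q2 \<noteq> []" using paths ne by auto
  have not_ab: "ends G z \<noteq> {a, b}" if z: "z \<in> wE ?P" for z
  proof
    assume "ends G z = {a, b}"
    then have "?P = [(z, a, b)]"
      using path_edge_joining_ends[OF G _ z] ap(1) by (simp only: ap_def)
    then have "length ?P = 1" by simp
    then show False using pne by (cases p1; cases p2) auto
  qed
  have "wE \<alpha> \<union> wE \<beta> = {}"
  proof (rule ccontr)
    assume "wE \<alpha> \<union> wE \<beta> \<noteq> {}"
    then obtain z where z: "z \<in> wE \<alpha> \<union> wE \<beta>" by (auto simp only: ex_in_conv[symmetric])
    then have zP: "z \<in> wE ?P" by auto
    then show False
      using chords[OF ap_edge(1,2)[OF ap(1) zP]] not_ab[OF zP] z by auto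
  qed
  then have nil: "\<alpha> = []" "\<beta> = []" by auto
  then have eqs: "a = s" "s' = b" using paths(1,7) by auto
  have pP: "is_path G a (p1 @ \<mu> @ p2) b" and pS: "is_path G a (q1 @ rev_walk \<mu> @ q2) b"
    using ap(1,2) nil by (simp_all add: ap_def)
  have "\<mu> = []"
  proof (cases \<mu>)
    case (Cons w \<mu>')
    then obtain z y where w: "w = (z, t', y)" "(z, t', y) \<in> arcs G" "is_path G y \<mu>' t"
      using paths(4) by (cases w) (auto simp: is_path_Cons)
    have z: "z \<in> wE ?P" "z \<in> wE ?S" using Cons w by auto
    have dP1: "wS p1 \<inter> insert b (wS (\<mu> @ p2)) = {}" and dS1: "wS q1 \<inter> insert b (wS (rev_walk \<mu> @ q2)) = {}"
      by (rule path_disjoint_append[OF G pP], rule path_disjoint_append[OF G pS])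
    have dP2: "wS (p1 @ \<mu>) \<inter> insert b (wS p2) = {}" and dS2: "wS (q1 @ rev_walk \<mu>) \<inter> insert b (wS q2) = {}"
      using path_disjoint_append[OF G, of a "p1 @ \<mu>" p2 b] path_disjoint_append[OF G, of a "q1 @ rev_walk \<mu>" q2 b] pP pS
      by simp_all
    have t': "t' \<in> wS \<mu>" "t' \<in> wS q2" using Cons w path_start_in[OF paths(6) ne(4)] by auto
    have y: "y \<in> wS (rev_walk \<mu>)" using Cons w by simp
    have y': "y \<in> wS \<mu>' \<union> wS p2"
      using path_start_V[OF w(3)] path_start_in[OF paths(5) ne(2)] by auto
    \<comment> \<open>The first edge of \<open>\<mu>\<close> lies on \<open>?P\<close> and
      \<open>?S\<close>, and each of the two other paths misses one of its ends, so it is no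
      chord.\<close>
    have "t' \<notin> insert b (wS ?R1)" using dP2 dS1 t' nil by auto
    moreover have "y \<notin> insert b (wS ?R2)" using dP1 dS2 y y' nil Cons w by auto
    ultimately show ?thesis
      using chords[OF ap_edge(1,2)[OF ap(1) z(1)]] not_ab[OF z(1)] z ends_arc[OF G w(2)] by auto
  qed simp
  then have "t' = t" using paths(4) by simp
  have "vote (p1 @ p2) = vote (q1 @ q2)"
    by (rule triangle_votes[of p1 t q1 p2 q2])
      (use paths ap inner disj v ne eqs nil \<open>\<mu> = []\<close> \<open>t' = t\<close> in simp_all)
  then show False using votes nil \<open>\<mu> = []\<close> by simp
qed

lemma apI: "is_path G a R b \<Longrightarrow> wE R \<subseteq> wE P \<union> wE Q \<Longrightarrow> ap P \<Longrightarrow> ap Q \<Longrightarrow> ap R"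
  by (auto simp: ap_def)

text \<open>Take two disagreeing paths with smallest union. Bypassing \<open>P\<close> by the first or by the
  last segment of \<open>Q\<close> off \<open>P\<close> must give a path of value 0, and using both segments
  gives a path \<open>S\<close> of value \<open>- val P\<close> that is closer to \<open>Q\<close>.\<close>

lemma votes_agree:
  "ap P \<Longrightarrow> ap Q \<Longrightarrow> \<not> 3 dvd val P \<Longrightarrow> \<not> 3 dvd val Q \<Longrightarrow> vote P = vote Q"
proof (induction "card (wE P \<union> wE Q)" arbitrary: P Q rule: less_induct)
  case less
  show ?case
  proof (rule ccontr)
    assume votes: "vote P \<noteq> vote Q"
    then have PQ: "P \<noteq> Q" by blast
    have P: "is_path G a P b" and Q: "is_path G a Q b" using less.prems by (simp_all add: ap_def)
    \<comment> \<open>A path inside the union that drops an edge of \<open>P\<close> off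
      \<open>Q\<close> forms a smaller pair with \<open>Q\<close>, so the induction hypothesis
      applies to it.\<close>
    have closer: "vote R = vote Q"
      if R: "ap R" "\<not> 3 dvd val R" "wE R \<subseteq> wE P \<union> wE Q" "f \<in> wE P" "f \<notin> wE Q" "f \<notin> wE R" for R f
    proof (rule less.hyps[OF _ R(1) less.prems(2) R(2) less.prems(4)])
      show "card (wE R \<union> wE Q) < card (wE P \<union> wE Q)"
        by (rule psubset_card_mono) (use R in auto)
    qed
    obtain \<alpha> \<pi> P' \<sigma> Q' s t where 1: "P = \<alpha> @ \<pi> @ P'" "Q = \<alpha> @ \<sigma> @ Q'" "is_path G a \<alpha> s" "is_path G s \<pi> t"
      "is_path G s \<sigma> t" "is_path G t P' b" "is_path G t Q' b" "s \<noteq> t"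
      "(wS \<sigma> - {s}) \<inter> insert b (wS P) = {}" "fst (hd \<pi>) \<notin> wE Q" "wE \<sigma> \<inter> wE P = {}"
      by (rule bypass_first_elim[OF G P Q PQ])
    obtain P'' \<pi>' \<beta> Q'' \<sigma>' t' s' f' where 2: "P = P'' @ \<pi>' @ \<beta>" "Q = Q'' @ \<sigma>' @ \<beta>" "is_path G a P'' t'" "is_path G t' \<pi>' s'"
      "is_path G t' \<sigma>' s'" "is_path G s' \<beta> b" "is_path G a Q'' t'" "t' \<noteq> s'"
      "(wS \<sigma>' - {t'}) \<inter> insert b (wS P) = {}" "f' \<in> wE \<pi>'" "f' \<notin> wE Q" "wE \<sigma>' \<inter> wE P = {}"
      by (rule bypass_last_elim[OF G P Q PQ])
    define f where "f = fst (hd \<pi>)"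
    have ne: "\<pi> \<noteq> []" "\<sigma> \<noteq> []" "\<pi>' \<noteq> []" "\<sigma>' \<noteq> []" using 1(4,5,8) 2(4,5,8) by auto
    have f: "f \<in> wE \<pi>" "f \<notin> wE Q" using ne(1) 1(10) by (cases \<pi>; auto simp: f_def)+
    note dist = path_distinct_edges[OF G P]
    have dP: "wS \<alpha> \<inter> insert b (wS (\<pi> @ P')) = {}" "wS (\<alpha> @ \<pi>) \<inter> insert b (wS P') = {}"
      "wS P'' \<inter> insert b (wS (\<pi>' @ \<beta>)) = {}" "wS (P'' @ \<pi>') \<inter> insert b (wS \<beta>) = {}"
      using path_disjoint_append[OF G, of a \<alpha> "\<pi> @ P'" b] path_disjoint_append[OF G, of a "\<alpha> @ \<pi>" P' b]
        path_disjoint_append[OF G, of a P'' "\<pi>' @ \<beta>" b] path_disjoint_append[OF G, of a "P'' @ \<pi>'" \<beta> b] P 1(1) 2(1)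
      by simp_all
    have idj: "idisj \<pi> \<sigma>" "idisj \<pi>' \<sigma>'"
    proof -
      have *: "set (tl (walk_starts r)) = wS r - {u}" if "is_path G u r w" "u \<noteq> w" for r u w
        using path_starts_tl[OF that] that(1) unfolding is_path_def
        by (metis Diff_insert_absorb distinct.simps(2) distinct_append list.simps(15))
      show "idisj \<pi> \<sigma>"
        unfolding idisj_iff *[OF 1(4,8)] *[OF 1(5,8)] using 1(1,9,11) by auto
      show "idisj \<pi>' \<sigma>'"
        unfolding idisj_iff *[OF 2(4,8)] *[OF 2(5,8)] using 2(1,9,12) by auto
    qed
    have s\<pi>: "s \<in> wS \<pi>" "t' \<in> wS \<pi>'" "s \<in> wS \<sigma>" "t' \<in> wS \<sigma>'"
      using path_start_in 1(4,5,8) 2(4,5,8) by metis+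
    have tP': "t \<in> insert b (wS P')" "s' \<in> insert b (wS \<beta>)"
      using path_start_V[OF 1(6)] path_start_V[OF 2(6)] by simp_all
    have \<sigma>P: "wS \<sigma> \<inter> insert b (wS P') = {}"
      using 1(1,9) dP(2) s\<pi>(1) by auto
    have \<sigma>\<alpha>: "wS \<alpha> \<inter> wS \<sigma> = {}"
      using 1(1,9) dP(1) s\<pi>(1) by auto
    let ?R1 = "\<alpha> @ \<sigma> @ P'"
    have R1: "is_path G a ?R1 b"
      by (intro path_appendI[OF 1(3)] path_appendI[OF 1(5,6)]) (use \<sigma>P \<sigma>\<alpha> dP(1) in auto)
    have apR1: "ap ?R1" by (rule apI[OF R1 _ less.prems(1,2)]) (use 1(1,2) in auto)
    \<comment> \<open>Otherwise \<open>P\<close> agrees with \<open>?R1\<close>, from which it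
      differs in one segment only, and \<open>?R1\<close> agrees with \<open>Q\<close> by
      induction.\<close>
    have v1: "3 dvd val ?R1"
    proof (rule ccontr)
      assume v: "\<not> 3 dvd val ?R1"
      have "vote P = vote ?R1"
        by (rule adjacent_votes[OF less.prems(1) 1(1) apR1 refl 1(3,4,5,6,8) idj(1) less.prems(3) v])
      moreover have "f \<in> wE P" "f \<notin> wE ?R1" using f 1(1,2) dist by auto
      then have "vote ?R1 = vote Q"
        by (intro closer[OF apR1 v]) (use f 1(1,2) in auto)
      ultimately show False using votes by simp
    qed
    let ?R2 = "P'' @ \<sigma>' @ \<beta>"
    have \<sigma>'P: "wS \<sigma>' \<inter> insert b (wS \<beta>) = {}"
      using 2(1,9) dP(4) s\<pi>(2) by auto
    have \<sigma>'P'': "wS P'' \<inter> wS \<sigma>' = {}"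
      using 2(1,9) dP(3) s\<pi>(2) by auto
    have R2: "is_path G a ?R2 b"
      by (intro path_appendI[OF 2(3)] path_appendI[OF 2(5,6)]) (use \<sigma>'P \<sigma>'P'' dP(3) in auto)
    have apR2: "ap ?R2" by (rule apI[OF R2 _ less.prems(1,2)]) (use 2(1,2) in auto)
    have v2: "3 dvd val ?R2"
    proof (rule ccontr)
      assume v: "\<not> 3 dvd val ?R2"
      have "vote P = vote ?R2"
        by (rule adjacent_votes[OF less.prems(1) 2(1) apR2 refl 2(3,4,5,6,8) idj(2) less.prems(3) v])
      moreover have "f' \<in> wE P" "f' \<notin> wE ?R2" using 2(1,2,10,11) dist by auto
      then have "vote ?R2 = vote Q"
        by (intro closer[OF apR2 v]) (use 2 in auto)
      ultimately show False using votes by simp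
    qed
    have "{s, t} \<subseteq> insert b (wS P)" using s\<pi>(1) tP'(1) 1(1) by auto
    moreover have "{t', s'} \<subseteq> insert b (wS P)" using s\<pi>(2) tP'(2) 2(1) by auto
    ultimately have "{s, t, t', s'} \<subseteq> insert b (wS P)" by simp
    \<comment> \<open>On \<open>Q\<close>, the first bypass \<open>\<sigma>\<close> and the last
      bypass \<open>\<sigma>'\<close> coincide or one precedes the other.\<close>
    from segments[OF G 1(5,3) 2(5,7) 1(9) 2(9) this 1(8) 2(8) trans[OF 1(2)[symmetric] 2(2)]]
    have "\<alpha> = Q'' \<and> \<sigma> = \<sigma>' \<or> (\<exists>\<nu>. Q'' = \<alpha> @ \<sigma> @ \<nu>) \<or> (\<exists>\<nu>. \<alpha> = Q'' @ \<sigma>' @ \<nu>)" .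
    then show False
    proof (elim disjE exE conjE)
      \<comment> \<open>With a single bypass, \<open>?R1\<close> is \<open>Q\<close> itself, whose
        value is nonzero.\<close>
      assume eq: "\<alpha> = Q''" "\<sigma> = \<sigma>'"
      then have "Q' = \<beta>" using 1(2) 2(2) by simp
      have "t = s'" using path_end_unique[OF 1(5)] 2(5) eq path_start_unique[OF 1(5) _ ne(2)] by metis
      have "P' = \<beta>"
        by (rule path_suffix_unique[OF G, of a "\<alpha> @ \<pi>" P' b "P'' @ \<pi>'" \<beta> t]) (use P 1(1,6) 2(1,6) \<open>t = s'\<close> in auto)
      then have "?R1 = Q" using 1(2) \<open>Q' = \<beta>\<close> by simp
      then show False using v1 less.prems(4) by simp
    next
      \<comment> \<open>The last bypass cannot precede the first, because \<open>\<alpha>\<close> is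
        part of \<open>P\<close>.\<close>
      fix \<nu> assume "\<alpha> = Q'' @ \<sigma>' @ \<nu>"
      then have "wE \<sigma>' \<subseteq> wE P" using 1(1) by auto
      then have "wE \<sigma>' = {}" using 2(12) by (simp only: Int_absorb2)
      then show False using ne(4) by simp
    next
      fix \<nu> assume Q'': "Q'' = \<alpha> @ \<sigma> @ \<nu>"
      have Qeq: "Q = \<alpha> @ \<sigma> @ \<nu> @ \<sigma>' @ \<beta>" using Q'' 2(2) by simp
      have dQ: "wS (\<alpha> @ \<sigma> @ \<nu>) \<inter> insert b (wS (\<sigma>' @ \<beta>)) = {}" "wS (\<alpha> @ \<sigma>) \<inter> insert b (wS (\<nu> @ \<sigma>' @ \<beta>)) = {}"
        "wS (\<alpha> @ \<sigma> @ \<nu> @ \<sigma>') \<inter> insert b (wS \<beta>) = {}"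
        using path_disjoint_append[OF G, of a "\<alpha> @ \<sigma> @ \<nu>" "\<sigma>' @ \<beta>" b] path_disjoint_append[OF G, of a "\<alpha> @ \<sigma>" "\<nu> @ \<sigma>' @ \<beta>" b]
          path_disjoint_append[OF G, of a "\<alpha> @ \<sigma> @ \<nu> @ \<sigma>'" \<beta> b] Q Qeq by simp_all
      \<comment> \<open>\<open>Q\<close> continues from \<open>t\<close> after
        \<open>\<sigma>\<close>, and \<open>t\<close> comes before the part \<open>\<beta>\<close>
        because \<open>\<sigma>'\<close> is not empty.\<close>
      have tQ: "t \<in> wS (\<nu> @ \<sigma>')"
      proof -
        have "is_path G a ((\<alpha> @ \<sigma>) @ \<nu> @ \<sigma>' @ \<beta>) b" using Q Qeq by simp
        then obtain w where w: "is_path G a (\<alpha> @ \<sigma>) w" "is_path G w (\<nu> @ \<sigma>' @ \<beta>) b"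
          unfolding is_path_append[OF G] by blast
        have "is_path G a (\<alpha> @ \<sigma>) t" by (rule path_appendI[OF 1(3,5)]) (use \<sigma>\<alpha> 1(1,6) tP'(1) dP in auto)
        then have "w = t" using path_end_unique[OF w(1)] by blast
        moreover have "w \<in> wS (\<nu> @ \<sigma>' @ \<beta>)" using path_start_in'[OF w(2)] ne(4) by simp
        moreover have "(\<nu> @ \<sigma>') @ \<beta> = \<nu> @ \<sigma>' @ \<beta>" by simp
        moreover have "hd (walk_starts (\<nu> @ \<sigma>' @ \<beta>)) = w" using is_walk_start[OF is_path_walk[OF w(2)]] ne(4) by simp
        ultimately show ?thesis using ne(4)
          by (metis append_is_Nil_conv hd_append2 hd_in_set walk_starts_simps(3,5))
      qed
      have t\<beta>: "t \<notin> insert b (wS \<beta>)" using dQ(3) tQ by auto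
      \<comment> \<open>On \<open>P\<close>, either \<open>\<pi>\<close> ends before
        \<open>\<pi>'\<close> starts, possibly at the same vertex, or \<open>\<pi>'\<close> starts
        strictly before the end of \<open>\<pi>\<close>.\<close>
      have "(\<exists>\<mu>. P'' = \<alpha> @ \<pi> @ \<mu>) \<or> (\<exists>\<rho>. \<alpha> @ \<pi> = P'' @ \<rho> \<and> \<rho> \<noteq> [])"
      proof -
        obtain k where "\<alpha> @ \<pi> = P'' @ k \<or> P'' = (\<alpha> @ \<pi>) @ k"
          using append_eq_append_conv2[of "\<alpha> @ \<pi>" P' P'' "\<pi>' @ \<beta>"] 1(1) 2(1) by auto
        then show ?thesis by (cases "k = []") auto
      qed
      then show False
      proof (elim disjE exE conjE)
        fix \<mu> assume P'': "P'' = \<alpha> @ \<pi> @ \<mu>"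
        then have Peq: "P = \<alpha> @ \<pi> @ \<mu> @ \<pi>' @ \<beta>" using 2(1) by simp
        then have P': "P' = \<mu> @ \<pi>' @ \<beta>" using 1(1) by simp
        have \<mu>: "is_path G t \<mu> t'"
        proof -
          obtain w where w: "is_path G a (\<alpha> @ \<pi>) w" "is_path G w \<mu> t'"
            using 2(3) unfolding P'' append_assoc[symmetric] is_path_append[OF G, of a "\<alpha> @ \<pi>"] by blast
          have "is_path G a (\<alpha> @ \<pi>) t" by (rule path_appendI[OF 1(3,4)]) (use dP(1) tP'(1) P' 1(6) path_start_V[OF 1(6)] in auto)
          then show ?thesis using path_end_unique[OF w(1)] w(2) by blast
        qed
        let ?S = "\<alpha> @ \<sigma> @ \<mu> @ \<sigma>' @ \<beta>"
        have S: "is_path G a ?S b"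
          by (intro path_appendI[OF 1(3)] path_appendI[OF 1(5)] path_appendI[OF \<mu>] path_appendI[OF 2(5,6)])
            (use dQ dP \<sigma>P \<sigma>\<alpha> \<sigma>'P \<sigma>'P'' P' P'' in auto)
        have apS: "ap ?S" by (rule apI[OF S _ less.prems(1,2)]) (use Qeq Peq in auto)
        have eq: "vote (\<alpha> @ \<pi> @ \<mu> @ \<pi>' @ \<beta>) = vote ?S"
          by (rule square_votes[OF 1(3,4,5) \<mu> 2(4,5,6)])
            (use less.prems(1,3) Peq P' P'' apS apR1 apR2 v1 v2 1(8,9,11) 2(8,9,12) in simp_all)
        have "val P + val ?S = val ?R1 + val ?R2"
          using Peq P' P'' by (simp add: val_def)
        then have vS: "\<not> 3 dvd val ?S"
          using v1 v2 less.prems(3) by (metis dvd_add dvd_add_left_iff)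
        have "f \<notin> wE ?S" "f \<in> wE P" "wE ?S \<subseteq> wE P \<union> wE Q"
          using f Peq Qeq dist 1(1) by auto
        then have "vote ?S = vote Q" by (intro closer[OF apS vS]) (use f in auto)
        then show False using eq Peq votes by simp
      next
        fix \<rho> assume \<rho>: "\<alpha> @ \<pi> = P'' @ \<rho>" "\<rho> \<noteq> []"
        \<comment> \<open>On \<open>Q\<close> the last bypass starts after the first one, so its
          start \<open>t'\<close> is neither \<open>s\<close> nor on \<open>\<alpha>\<close>. Hence
          on \<open>P\<close> it is an inner vertex of \<open>\<pi>\<close>.\<close>
        have t'Q: "t' \<notin> insert s (wS \<alpha>)" using dQ(1) s\<pi> by auto
        obtain \<pi>1 where \<pi>1: "P'' = \<alpha> @ \<pi>1" "\<pi> = \<pi>1 @ \<rho>"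
        proof -
          obtain k where "\<alpha> = P'' @ k \<and> k @ \<pi> = \<rho> \<or> \<alpha> @ k = P'' \<and> \<pi> = k @ \<rho>"
            using append_eq_append_conv2[of \<alpha> \<pi> P'' \<rho>] \<rho> by blast
          then show thesis
          proof (elim disjE conjE)
            assume k: "\<alpha> = P'' @ k" "k @ \<pi> = \<rho>"
            obtain w where w: "is_path G a P'' w" "is_path G w k s" using 1(3) k is_path_append[OF G] by blast
            have "w = t'" using path_end_unique[OF w(1) 2(3)] .
            then have "t' \<in> insert s (wS \<alpha>)" using path_start_V[OF w(2)] k by auto
            then show thesis using t'Q by blast
          next
            assume "\<alpha> @ k = P''" "\<pi> = k @ \<rho>"
            then show thesis using that by metis
          qed
        qed
        have p\<pi>1: "is_path G s \<pi>1 t'"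
        proof -
          obtain w where "is_path G a \<alpha> w" "is_path G w \<pi>1 t'"
            using 2(3) unfolding \<pi>1(1) is_path_append[OF G] by blast
          then show ?thesis using path_end_unique[OF 1(3)] by blast
        qed
        have p\<rho>: "is_path G t' \<rho> t"
        proof -
          obtain w where "is_path G s \<pi>1 w" "is_path G w \<rho> t"
            using 1(4) unfolding \<pi>1(2) is_path_append[OF G] by blast
          then show ?thesis using path_end_unique[OF p\<pi>1] by blast
        qed
        have "s \<noteq> t'" using t'Q by blast
        then have \<pi>1ne: "\<pi>1 \<noteq> []" using p\<pi>1 by auto
        \<comment> \<open>\<open>\<rho>\<close> is the overlap of \<open>\<pi>\<close> and
          \<open>\<pi>'\<close>, from \<open>t'\<close> to \<open>t\<close>. A path using both
          bypasses has to run through it backwards.\<close>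
        have "\<rho> @ P' = \<pi>' @ \<beta>" using 1(1) 2(1) \<pi>1 by simp
        obtain \<pi>2 where \<pi>2: "\<pi>' = \<rho> @ \<pi>2" "P' = \<pi>2 @ \<beta>"
        proof -
          obtain k where "\<rho> = \<pi>' @ k \<and> k @ P' = \<beta> \<or> \<rho> @ k = \<pi>' \<and> P' = k @ \<beta>"
            using append_eq_append_conv2[of \<rho> P' \<pi>' \<beta>] \<open>\<rho> @ P' = \<pi>' @ \<beta>\<close> by blast
          then show thesis
          proof (elim disjE conjE)
            assume k: "\<rho> = \<pi>' @ k" "k @ P' = \<beta>"
            have "t \<in> insert b (wS \<beta>)" using tP'(1) k by auto
            then show thesis using t\<beta> by blast
          next
            assume "\<rho> @ k = \<pi>'" "P' = k @ \<beta>"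
            then show thesis using that by metis
          qed
        qed
        have p\<pi>2: "is_path G t \<pi>2 s'"
        proof -
          obtain w where "is_path G t' \<rho> w" "is_path G w \<pi>2 s'"
            using 2(4) unfolding \<pi>2(1) is_path_append[OF G] by blast
          then show ?thesis using path_end_unique[OF p\<rho>] by blast
        qed
        have "t \<noteq> s'" using t\<beta> tP'(2) by blast
        have Peq: "P = \<alpha> @ \<pi>1 @ \<rho> @ \<pi>2 @ \<beta>" using 1(1) \<pi>1 \<pi>2 by simp
        have rr: "wS (rev_walk \<rho>) = insert t (wS \<rho> - {t'})" "is_path G t (rev_walk \<rho>) t'"
          using path_rev_inner(2)[OF G p\<rho> \<rho>(2)] is_path_rev[OF G p\<rho>] by auto
        let ?S = "\<alpha> @ \<sigma> @ rev_walk \<rho> @ \<sigma>' @ \<beta>"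
        have "t \<in> insert b (wS P')" by (rule tP')
        have t_in: "t \<in> wS \<pi>2" using path_start_in[OF p\<pi>2 \<open>t \<noteq> s'\<close>] .
        have t'_in: "t' \<in> wS \<rho>" using path_start_in'[OF p\<rho> \<rho>(2)] .
        have ds: "wS \<sigma> \<inter> wS \<sigma>' = {}" "wS \<sigma> \<inter> insert b (wS \<beta>) = {}" "wS \<alpha> \<inter> wS \<sigma>' = {}" "wS \<alpha> \<inter> insert b (wS \<beta>) = {}"
          using dQ by auto
        have dr: "wS \<sigma> \<inter> wS (rev_walk \<rho>) = {}"
          unfolding rr(1) using 1(1,9) dP(1,2) s\<pi>(1) \<sigma>P tP'(1) \<pi>1 Peq p\<pi>1 path_start_in'[OF p\<pi>1 \<pi>1ne]
            path_disjoint_append[OF G, of s \<pi>1 \<rho> t] 1(4) by auto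
        have dr': "wS (rev_walk \<rho>) \<inter> insert b (wS \<sigma>' \<union> wS \<beta>) = {}"
        proof -
          have "wS \<rho> \<inter> insert b (wS \<beta>) = {}" using dP(2) \<pi>1(2) \<pi>2(2) by auto
          moreover have "(wS \<rho> - {t'}) \<inter> wS \<sigma>' = {}" using 2(9) Peq by auto
          moreover have "t \<notin> wS \<sigma>'" using 2(9) Peq t_in p\<rho> path_end_notin[OF p\<rho>] t'_in by auto
          ultimately show ?thesis unfolding rr(1) using t\<beta> by auto
        qed
        have dr'': "wS \<alpha> \<inter> wS (rev_walk \<rho>) = {}"
          unfolding rr(1) using dP(1) \<pi>1(2) tP'(1) \<pi>2(2) t_in by auto
        have S: "is_path G a ?S b"
          by (intro path_appendI[OF 1(3)] path_appendI[OF 1(5)] path_appendI[OF rr(2)] path_appendI[OF 2(5,6)])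
            (use ds dr dr' dr'' \<sigma>'P \<sigma>\<alpha> in auto)
        have apS: "ap ?S" by (rule apI[OF S _ less.prems(1,2)]) (use Qeq Peq in auto)
        have eq: "vote (\<alpha> @ \<pi>1 @ \<rho> @ \<pi>2 @ \<beta>) = vote ?S"
          by (rule crossing_votes[OF 1(3) p\<pi>1 1(5) p\<rho> p\<pi>2 2(5,6)])
            (use less.prems(1,3) Peq \<pi>1(1) \<pi>2(2) apS apR1 apR2 v1 v2 1(8,9,11) 2(8,9,12) \<open>s \<noteq> t'\<close> \<open>t \<noteq> s'\<close> in simp_all)
        have "3 dvd gs \<psi> \<rho> + gs \<psi> (rev_walk \<rho>)" by (rule gs_rev_path[OF \<psi> p\<rho>])
        moreover have "val P + val ?S = val ?R1 + val ?R2 + (gs \<psi> \<rho> + gs \<psi> (rev_walk \<rho>))"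
          using Peq \<pi>1(1) \<pi>2(2) by (simp add: val_def)
        ultimately have vS: "\<not> 3 dvd val ?S"
          using v1 v2 less.prems(3) by (metis dvd_add dvd_add_left_iff)
        have "f \<in> wE \<pi>1" using \<pi>1ne \<pi>1(2) unfolding f_def by (cases \<pi>1) auto
        then have "f \<notin> wE ?S" "f \<in> wE P" "wE ?S \<subseteq> wE P \<union> wE Q"
          using f Peq Qeq dist by auto
        then have "vote ?S = vote Q" by (intro closer[OF apS vS]) (use f in auto)
        then show False using eq Peq votes by simp
      qed
    qed
  qed
qed

lemma no_digon: False
  using votes_differ votes_agree by metis

end

subsection \<open>Subdivisions of \<open>K\<^sub>4\<close>\<close>

lemma path_inner_tl: "is_path G u p v \<Longrightarrow> u \<noteq> v \<Longrightarrow> set (tl (walk_starts p)) = wS p - {u}"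
  using path_starts_tl[of G u p v] unfolding is_path_def
  by (metis Diff_insert_absorb distinct.simps(2) distinct_append list.simps(15))

lemma path_idisj_iff:
  assumes "is_path G u p v" "is_path G u q v" "u \<noteq> v"
  shows "idisj p q \<longleftrightarrow> (wS p - {u}) \<inter> (wS q - {u}) = {} \<and> wE p \<inter> wE q = {}"
  by (simp add: idisj_iff path_inner_tl[OF assms(1,3)] path_inner_tl[OF assms(2,3)])

text \<open>In the two lemmas below \<open>p, p', q, q', t, w\<close> are the gains of the edges
  \<open>ax, xb, ay, yb, xy, ab\<close> of a \<open>K\<^sub>4\<close>.\<close>

lemma K4_residues_unbalanced:
  fixes p p' q q' t w :: int
  assumes "\<not> 3 dvd (p + p') - w" "\<not> 3 dvd (q + q') - w" "\<not> 3 dvd (p + t) - q" "\<not> 3 dvd p' - (t + q')"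
    "\<not> 3 dvd (p + p') - (q + q')"
  shows "3 dvd (p + t + q') - w" "3 dvd (q - t + p') - w"
  using assms by presburger+

lemma K4_residues_balanced:
  fixes p p' q q' t w :: int
  assumes "\<not> 3 dvd (p + p') - w" "\<not> 3 dvd (p + t) - q" "3 dvd (p + p') - (q + q')"
  shows "\<not> 3 dvd (p + t + q') - w \<or> \<not> 3 dvd (q - t + p') - w"
  using assms by presburger

text \<open>A subdivided \<open>K\<^sub>4\<close> in \<open>G\<close> with branch vertices
  \<open>a\<close>, \<open>b\<close>, \<open>x\<close>, \<open>y\<close>. The side \<open>ab\<close>
  is the single edge \<open>e\<close>, the vertices \<open>x\<close> and \<open>y\<close> divide two
  disjoint paths from \<open>a\<close> to \<open>b\<close>, and the bridge \<open>\<tau>\<close> is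
  the sixth side.\<close>

locale K4_subdivision = critical_graph G B for G :: "('v, 'e) mgraph" and B +
  fixes e :: 'e and a b x y :: 'v and pa pb qa qb \<tau> :: "('v, 'e) walk"
  assumes e_arc: "(e, a, b) \<in> arcs G" and ne: "a \<noteq> b" "a \<noteq> x" "x \<noteq> b" "a \<noteq> y" "y \<noteq> b"
    and paths: "is_path G a pa x" "is_path G x pb b" "is_path G a qa y" "is_path G y qb b" "is_path G x \<tau> y"
    and P: "is_path G a (pa @ pb) b" and Q: "is_path G a (qa @ qb) b"
    and e_notin: "e \<notin> wE pa \<union> wE pb \<union> wE qa \<union> wE qb \<union> wE \<tau>"
    and inner: "(wS (pa @ pb) - {a}) \<inter> (wS (qa @ qb) - {a}) = {}" "wE (pa @ pb) \<inter> wE (qa @ qb) = {}"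
    and \<tau>_inner: "(wS \<tau> - {x}) \<inter> (insert b (wS (pa @ pb) \<union> wS (qa @ qb))) = {}"
      "wE \<tau> \<inter> (wE (pa @ pb) \<union> wE (qa @ qb)) = {}"
begin

lemma starts: "a \<in> wS pa" "x \<in> wS pb" "a \<in> wS qa" "y \<in> wS qb"
  using path_start_in[OF paths(1) ne(2)] path_start_in[OF paths(2) ne(3)] path_start_in[OF paths(3) ne(4)]
    path_start_in[OF paths(4) ne(5)] by simp_all

lemma disjoint_parts: "wS pa \<inter> insert b (wS pb) = {}" "wS qa \<inter> insert b (wS qb) = {}" "b \<notin> wS pb" "b \<notin> wS qb"
  using path_disjoint_append[OF G P] path_disjoint_append[OF G Q] path_end_notin[OF paths(2)] path_end_notin[OF paths(4)]
  by simp_all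

lemma xy: "x \<noteq> y" using inner starts ne by auto

lemma \<tau>_start: "x \<in> wS \<tau>" by (rule path_start_in[OF paths(5) xy])

lemma more_disjoint: "(wS pa - {a}) \<inter> wS qa = {}" "(wS pa - {a}) \<inter> wS qb = {}" "wS pb \<inter> wS qa = {}" "wS pb \<inter> wS qb = {}"
  "wS pa \<inter> wS qb = {}" "wS pa \<inter> wS \<tau> = {}" "wS \<tau> \<inter> insert b (wS qb) = {}" "wS pb \<inter> wS \<tau> = {x}" "wS qa \<inter> wS \<tau> = {}" "b \<notin> wS \<tau>" "y \<notin> wS \<tau>"
  using inner(1) \<tau>_inner(1) disjoint_parts starts ne xy \<tau>_start by auto

text \<open>The paths from \<open>a\<close> to \<open>b\<close> across the bridge. With
  \<open>e\<close> they form two of the three quadrangles; the third is the outer cycle of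
  \<open>pa @ pb\<close> and \<open>qa @ qb\<close>.\<close>

definition D1 where "D1 = pa @ \<tau> @ qb"
definition D2 where "D2 = qa @ rev_walk \<tau> @ pb"

lemma \<tau>_rev: "is_path G y (rev_walk \<tau>) x" "wS (rev_walk \<tau>) = insert y (wS \<tau> - {x})"
proof -
  have "\<tau> \<noteq> []" using xy paths(5) by auto
  then show "is_path G y (rev_walk \<tau>) x" "wS (rev_walk \<tau>) = insert y (wS \<tau> - {x})"
    using is_path_rev[OF G paths(5)] path_rev_inner(2)[OF G paths(5)] by blast+
qed

lemma pa\<tau>: "is_path G a (pa @ \<tau>) y"
  by (rule path_appendI[OF paths(1,5)]) (use more_disjoint starts in auto)

lemma \<tau>qb: "is_path G x (\<tau> @ qb) b"
  by (rule path_appendI[OF paths(5,4)]) (use more_disjoint in auto)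

lemma D1: "is_path G a D1 b"
  unfolding D1_def by (rule path_appendI[OF paths(1) \<tau>qb]) (use more_disjoint disjoint_parts in auto)

lemma D2: "is_path G a D2 b"
  unfolding D2_def
proof (rule path_appendI[OF paths(3) path_appendI[OF \<tau>_rev(1) paths(2)]])
  show "wS (rev_walk \<tau>) \<inter> insert b (wS pb) = {}"
    using more_disjoint disjoint_parts starts ne unfolding \<tau>_rev by auto
  show "wS qa \<inter> insert b (wS (rev_walk \<tau> @ pb)) = {}"
    using more_disjoint disjoint_parts starts unfolding walk_starts_simps set_append \<tau>_rev by auto
qed

lemma e_path: "is_path G a [(e, a, b)] b"
  by (rule is_path_single[OF G e_arc ne(1)])

lemma e_idisj: "idisj (pa @ pb) [(e, a, b)]" "idisj (qa @ qb) [(e, a, b)]" "idisj D1 [(e, a, b)]" "idisj D2 [(e, a, b)]"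
  using e_notin by (auto intro!: idisj_single simp: D1_def D2_def)

lemma PQ_idisj: "idisj (pa @ pb) (qa @ qb)"
  unfolding path_idisj_iff[OF P Q ne(1)] using inner by blast

lemma axy_idisj: "idisj (pa @ \<tau>) qa"
  unfolding path_idisj_iff[OF pa\<tau> paths(3) ne(4)] using more_disjoint inner(2) \<tau>_inner(2) by auto

lemma xyb_idisj: "idisj pb (\<tau> @ qb)"
  unfolding path_idisj_iff[OF paths(2) \<tau>qb ne(3)] using more_disjoint inner(2) \<tau>_inner(2) by auto

text \<open>All cycles of the subdivision: four subdivided triangles and three subdivided
  quadrangles.\<close>

abbreviation "cycles \<equiv> {insert e (wE (pa @ pb)), insert e (wE (qa @ qb)), insert e (wE D1), insert e (wE D2),
  wE (pa @ \<tau>) \<union> wE qa, wE pb \<union> wE (\<tau> @ qb), wE (pa @ pb) \<union> wE (qa @ qb)}"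

lemma cycles: "C \<in> cycles \<Longrightarrow> is_cycle G C"
  using idisj_cycle[OF G P e_path ne(1) e_idisj(1)] idisj_cycle[OF G Q e_path ne(1) e_idisj(2)]
    idisj_cycle[OF G D1 e_path ne(1) e_idisj(3)] idisj_cycle[OF G D2 e_path ne(1) e_idisj(4)]
    idisj_cycle[OF G pa\<tau> paths(3) ne(4) axy_idisj] idisj_cycle[OF G paths(2) \<tau>qb ne(3) xyb_idisj]
    idisj_cycle[OF G P Q ne(1) PQ_idisj]
  by (elim insertE emptyE) simp_all

lemma rights:
  assumes "zgain G \<gamma>"
  shows "right G B \<gamma> (insert e (wE (pa @ pb))) \<longleftrightarrow>
      (insert e (wE (pa @ pb)) \<in> B \<longleftrightarrow> 3 dvd (gs \<gamma> pa + gs \<gamma> pb) - \<gamma> (e, a, b))"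
    "right G B \<gamma> (insert e (wE (qa @ qb))) \<longleftrightarrow>
      (insert e (wE (qa @ qb)) \<in> B \<longleftrightarrow> 3 dvd (gs \<gamma> qa + gs \<gamma> qb) - \<gamma> (e, a, b))"
    "right G B \<gamma> (insert e (wE D1)) \<longleftrightarrow>
      (insert e (wE D1) \<in> B \<longleftrightarrow> 3 dvd (gs \<gamma> pa + gs \<gamma> \<tau> + gs \<gamma> qb) - \<gamma> (e, a, b))"
    "right G B \<gamma> (insert e (wE D2)) \<longleftrightarrow>
      (insert e (wE D2) \<in> B \<longleftrightarrow> 3 dvd (gs \<gamma> qa - gs \<gamma> \<tau> + gs \<gamma> pb) - \<gamma> (e, a, b))"
    "right G B \<gamma> (wE (pa @ \<tau>) \<union> wE qa) \<longleftrightarrow>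
      (wE (pa @ \<tau>) \<union> wE qa \<in> B \<longleftrightarrow> 3 dvd (gs \<gamma> pa + gs \<gamma> \<tau>) - gs \<gamma> qa)"
    "right G B \<gamma> (wE pb \<union> wE (\<tau> @ qb)) \<longleftrightarrow>
      (wE pb \<union> wE (\<tau> @ qb) \<in> B \<longleftrightarrow> 3 dvd gs \<gamma> pb - (gs \<gamma> \<tau> + gs \<gamma> qb))"
    "right G B \<gamma> (wE (pa @ pb) \<union> wE (qa @ qb)) \<longleftrightarrow>
      (wE (pa @ pb) \<union> wE (qa @ qb) \<in> B \<longleftrightarrow> 3 dvd (gs \<gamma> pa + gs \<gamma> pb) - (gs \<gamma> qa + gs \<gamma> qb))"
proof -
  have "3 dvd gs \<gamma> \<tau> + gs \<gamma> (rev_walk \<tau>)" by (rule gs_rev_path[OF assms paths(5)])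
  then have r: "3 dvd gs \<gamma> D2 - \<gamma> (e, a, b) \<longleftrightarrow> 3 dvd (gs \<gamma> qa - gs \<gamma> \<tau> + gs \<gamma> pb) - \<gamma> (e, a, b)"
    using dvd_diff_left_iff[of 3 "gs \<gamma> \<tau> + gs \<gamma> (rev_walk \<tau>)" "gs \<gamma> D2 - \<gamma> (e, a, b)"]
    by (simp add: D2_def algebra_simps)
  show "right G B \<gamma> (insert e (wE D2)) \<longleftrightarrow>
      (insert e (wE D2) \<in> B \<longleftrightarrow> 3 dvd (gs \<gamma> qa - gs \<gamma> \<tau> + gs \<gamma> pb) - \<gamma> (e, a, b))"
    using idisj_right[OF G assms D2 e_path ne(1) e_idisj(4), of B] r by simp
  show "right G B \<gamma> (insert e (wE D1)) \<longleftrightarrow>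
      (insert e (wE D1) \<in> B \<longleftrightarrow> 3 dvd (gs \<gamma> pa + gs \<gamma> \<tau> + gs \<gamma> qb) - \<gamma> (e, a, b))"
    using idisj_right[OF G assms D1 e_path ne(1) e_idisj(3), of B] by (simp add: D1_def add.assoc)
qed (use idisj_right[OF G assms P e_path ne(1) e_idisj(1), of B] idisj_right[OF G assms Q e_path ne(1) e_idisj(2), of B]
    idisj_right[OF G assms pa\<tau> paths(3) ne(4) axy_idisj, of B] idisj_right[OF G assms paths(2) \<tau>qb ne(3) xyb_idisj, of B]
    idisj_right[OF G assms P Q ne(1) PQ_idisj, of B] in simp_all)

lemma ends_e: "ends G e = {a, b}"
  by (rule ends_arc[OF G e_arc])

lemma path_V: "is_path G u r w \<Longrightarrow> u \<noteq> w \<Longrightarrow> \<Union>(ends G ` wE r) = insert w (wS r)"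
  by (rule walk_ends_eq[OF G is_path_walk]) auto

lemma e_cycle_V:
  assumes "is_path G a R b"
  shows "\<Union>(ends G ` insert e (wE R)) = insert b (wS R)"
  using path_V[OF assms ne(1)] ends_e path_start_in[OF assms ne(1)] by auto

lemma cycle_Vs:
  "\<Union>(ends G ` insert e (wE (pa @ pb))) = insert b (wS pa \<union> wS pb)"
  "\<Union>(ends G ` insert e (wE (qa @ qb))) = insert b (wS qa \<union> wS qb)"
  "\<Union>(ends G ` insert e (wE D1)) = insert b (wS pa \<union> wS \<tau> \<union> wS qb)"
  "\<Union>(ends G ` insert e (wE D2)) = insert b (insert y (wS qa \<union> wS \<tau> \<union> wS pb))"
  "\<Union>(ends G ` (wE (pa @ \<tau>) \<union> wE qa)) = insert y (wS pa \<union> wS \<tau> \<union> wS qa)"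
  "\<Union>(ends G ` (wE pb \<union> wE (\<tau> @ qb))) = insert b (wS pb \<union> wS \<tau> \<union> wS qb)"
  "\<Union>(ends G ` (wE (pa @ pb) \<union> wE (qa @ qb))) = insert b (wS pa \<union> wS pb \<union> wS qa \<union> wS qb)"
proof -
  show "\<Union>(ends G ` insert e (wE (pa @ pb))) = insert b (wS pa \<union> wS pb)"
    unfolding e_cycle_V[OF P] by simp
  show "\<Union>(ends G ` insert e (wE (qa @ qb))) = insert b (wS qa \<union> wS qb)"
    unfolding e_cycle_V[OF Q] by simp
  show "\<Union>(ends G ` insert e (wE D1)) = insert b (wS pa \<union> wS \<tau> \<union> wS qb)"
    unfolding e_cycle_V[OF D1] by (auto simp: D1_def)
  show "\<Union>(ends G ` insert e (wE D2)) = insert b (insert y (wS qa \<union> wS \<tau> \<union> wS pb))"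
    unfolding e_cycle_V[OF D2] using \<tau>_rev(2) starts by (auto simp: D2_def)
  show "\<Union>(ends G ` (wE (pa @ \<tau>) \<union> wE qa)) = insert y (wS pa \<union> wS \<tau> \<union> wS qa)"
    unfolding image_Un Union_Un_distrib path_V[OF pa\<tau> ne(4)] path_V[OF paths(3) ne(4)] by auto
  show "\<Union>(ends G ` (wE pb \<union> wE (\<tau> @ qb))) = insert b (wS pb \<union> wS \<tau> \<union> wS qb)"
    unfolding image_Un Union_Un_distrib path_V[OF paths(2) ne(3)] path_V[OF \<tau>qb ne(3)] by auto
  show "\<Union>(ends G ` (wE (pa @ pb) \<union> wE (qa @ qb))) = insert b (wS pa \<union> wS pb \<union> wS qa \<union> wS qb)"
    unfolding image_Un Union_Un_distrib path_V[OF P ne(1)] path_V[OF Q ne(1)] by auto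
qed

text \<open>If all cycles but possibly \<open>D2 \<union> {e}\<close> are unbalanced, contracting an edge of \<open>pa\<close> and
  an edge of \<open>qb\<close> would give four parallel edges without balanced cycle.\<close>

lemma unbalanced_False:
  assumes "insert e (wE (pa @ pb)) \<notin> B" "insert e (wE (qa @ qb)) \<notin> B" "insert e (wE D1) \<notin> B"
    "wE (pa @ \<tau>) \<union> wE qa \<notin> B" "wE pb \<union> wE (\<tau> @ qb) \<notin> B" "wE (pa @ pb) \<union> wE (qa @ qb) \<notin> B"
  shows False
proof -
  obtain z w pa' where z: "pa = (z, a, w) # pa'" "(z, a, w) \<in> arcs G" "is_path G w pa' x" "a \<notin> insert x (wS pa')"
    using paths(1) ne(2) by (cases pa) (auto simp: is_path_Cons)
  have w: "w \<in> insert x (wS pa')" by (rule path_start_V[OF z(3)])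
  have "z \<in> edges G" "\<not> is_loop G z"
    using arc_edge[OF z(2)] is_loop_arc[OF G z(2)] w z(4) by auto
  then obtain \<gamma> where \<gamma>: "zgain G \<gamma>" "\<And>C. is_cycle G C \<Longrightarrow> \<not> chord G C z \<Longrightarrow> right G B \<gamma> C"
    using contract by blast
  have ez: "ends G z = {a, w}" by (rule ends_arc[OF G z(2)])
  \<comment> \<open>Each of the cycles except that of \<open>D2\<close> and \<open>e\<close>
    contains \<open>z\<close> or misses one end of \<open>z\<close>. Hence the gain is right on the
    six cycles assumed unbalanced.\<close>
  have "w \<notin> insert b (wS qa \<union> wS qb)"
    using w z(1,4) more_disjoint starts disjoint_parts ne by auto
  then have n1: "\<not> chord G (insert e (wE (qa @ qb))) z"
    unfolding chord_def cycle_Vs ez by blast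
  have "a \<notin> insert b (wS pb \<union> wS \<tau> \<union> wS qb)"
    using more_disjoint starts disjoint_parts ne by auto
  then have n2: "\<not> chord G (wE pb \<union> wE (\<tau> @ qb)) z"
    unfolding chord_def cycle_Vs ez by blast
  have n3: "\<not> chord G (insert e (wE (pa @ pb))) z" "\<not> chord G (insert e (wE D1)) z" "\<not> chord G (wE (pa @ \<tau>) \<union> wE qa) z"
    "\<not> chord G (wE (pa @ pb) \<union> wE (qa @ qb)) z"
  proof -
    have "z \<in> wE pa" using z(1) by simp
    then show "\<not> chord G (insert e (wE (pa @ pb))) z" "\<not> chord G (insert e (wE D1)) z"
      "\<not> chord G (wE (pa @ \<tau>) \<union> wE qa) z" "\<not> chord G (wE (pa @ pb) \<union> wE (qa @ qb)) z"
      by (simp_all add: chord_def D1_def)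
  qed
  let ?v = "\<gamma> (e, a, b)"
  have "right G B \<gamma> (insert e (wE (pa @ pb)))" "right G B \<gamma> (insert e (wE (qa @ qb)))" "right G B \<gamma> (insert e (wE D1))"
    "right G B \<gamma> (wE (pa @ \<tau>) \<union> wE qa)" "right G B \<gamma> (wE pb \<union> wE (\<tau> @ qb))" "right G B \<gamma> (wE (pa @ pb) \<union> wE (qa @ qb))"
    using \<gamma>(2) cycles n1 n2 n3 by simp_all
  then have nz: "\<not> 3 dvd (gs \<gamma> pa + gs \<gamma> pb) - ?v" "\<not> 3 dvd (gs \<gamma> qa + gs \<gamma> qb) - ?v"
    "\<not> 3 dvd (gs \<gamma> pa + gs \<gamma> \<tau> + gs \<gamma> qb) - ?v" "\<not> 3 dvd (gs \<gamma> pa + gs \<gamma> \<tau>) - gs \<gamma> qa"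
    "\<not> 3 dvd gs \<gamma> pb - (gs \<gamma> \<tau> + gs \<gamma> qb)" "\<not> 3 dvd (gs \<gamma> pa + gs \<gamma> pb) - (gs \<gamma> qa + gs \<gamma> qb)"
    unfolding rights[OF \<gamma>(1)] using assms by blast+
  have eqs: "gs \<gamma> pa + gs \<gamma> \<tau> + gs \<gamma> qb - (gs \<gamma> qa + gs \<gamma> qb) = (gs \<gamma> pa + gs \<gamma> \<tau>) - gs \<gamma> qa"
    "gs \<gamma> pa + gs \<gamma> pb - (gs \<gamma> pa + gs \<gamma> \<tau> + gs \<gamma> qb) = gs \<gamma> pb - (gs \<gamma> \<tau> + gs \<gamma> qb)"
    by simp_all
  show False
  \<comment> \<open>The four parallel paths are \<open>D1\<close>, \<open>e\<close>,
    \<open>qa @ qb\<close> and \<open>pa @ pb\<close>. Comparing \<open>D1\<close> with the last two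
    reduces to the triangles without \<open>e\<close>, because the paths share \<open>qb\<close> and
    \<open>pa\<close>, respectively.\<close>
  proof (rule four_residues)
    show "\<not> 3 dvd gs \<gamma> pa + gs \<gamma> \<tau> + gs \<gamma> qb - ?v" by (rule nz)
    show "\<not> 3 dvd gs \<gamma> pa + gs \<gamma> \<tau> + gs \<gamma> qb - (gs \<gamma> qa + gs \<gamma> qb)" unfolding eqs by (rule nz)
    show "\<not> 3 dvd gs \<gamma> pa + gs \<gamma> \<tau> + gs \<gamma> qb - (gs \<gamma> pa + gs \<gamma> pb)"
      by (subst dvd_diff_commute) (unfold eqs, rule nz)
    show "\<not> 3 dvd ?v - (gs \<gamma> qa + gs \<gamma> qb)" "\<not> 3 dvd ?v - (gs \<gamma> pa + gs \<gamma> pb)"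
      by (subst dvd_diff_commute, rule nz)+
    show "\<not> 3 dvd gs \<gamma> qa + gs \<gamma> qb - (gs \<gamma> pa + gs \<gamma> pb)"
      by (subst dvd_diff_commute) (rule nz)
  qed
qed

text \<open>The status of all seven cycles is that in \<open>-K\<^sub>4\<close>; what remains is to
  exclude subdivided sides and further edges. No gain is right on the seven cycles, so they cover
  \<open>G\<close> and every edge that is no loop is a chord of one of them.\<close>

lemma minus_K4:
  assumes "insert e (wE (pa @ pb)) \<notin> B" "insert e (wE (qa @ qb)) \<notin> B" "insert e (wE D1) \<in> B" "insert e (wE D2) \<in> B"
    "wE (pa @ \<tau>) \<union> wE qa \<notin> B" "wE pb \<union> wE (\<tau> @ qb) \<notin> B" "wE (pa @ pb) \<union> wE (qa @ qb) \<in> B"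
  shows "(G, B) \<cong>\<^sub>b all_negative (complete_graph 4)"
proof -
  have contra: False if \<gamma>: "zgain G \<gamma>" "\<forall>C\<in>cycles. right G B \<gamma> C" for \<gamma>
  proof -
    have "\<not> 3 dvd (gs \<gamma> pa + gs \<gamma> pb) - \<gamma> (e, a, b)" "\<not> 3 dvd (gs \<gamma> pa + gs \<gamma> \<tau>) - gs \<gamma> qa"
      "3 dvd (gs \<gamma> pa + gs \<gamma> pb) - (gs \<gamma> qa + gs \<gamma> qb)" "3 dvd (gs \<gamma> pa + gs \<gamma> \<tau> + gs \<gamma> qb) - \<gamma> (e, a, b)"
      "3 dvd (gs \<gamma> qa - gs \<gamma> \<tau> + gs \<gamma> pb) - \<gamma> (e, a, b)"
    proof -
      have "right G B \<gamma> (insert e (wE (pa @ pb)))" "right G B \<gamma> (wE (pa @ \<tau>) \<union> wE qa)"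
        "right G B \<gamma> (wE (pa @ pb) \<union> wE (qa @ qb))" "right G B \<gamma> (insert e (wE D1))" "right G B \<gamma> (insert e (wE D2))"
        by (rule bspec[OF \<gamma>(2)], simp only: insert_iff simp_thms)+
      then show "\<not> 3 dvd (gs \<gamma> pa + gs \<gamma> pb) - \<gamma> (e, a, b)" "\<not> 3 dvd (gs \<gamma> pa + gs \<gamma> \<tau>) - gs \<gamma> qa"
        "3 dvd (gs \<gamma> pa + gs \<gamma> pb) - (gs \<gamma> qa + gs \<gamma> qb)" "3 dvd (gs \<gamma> pa + gs \<gamma> \<tau> + gs \<gamma> qb) - \<gamma> (e, a, b)"
        "3 dvd (gs \<gamma> qa - gs \<gamma> \<tau> + gs \<gamma> pb) - \<gamma> (e, a, b)"
        unfolding rights[OF \<gamma>(1)] using assms by blast+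
    qed
    then show False using K4_residues_balanced by blast
  qed
  have crit: "z \<in> \<Union>cycles" "\<not> is_loop G z \<Longrightarrow> \<exists>C\<in>cycles. chord G C z" if z: "z \<in> edges G" for z
    by (rule critical(1)[where \<L> = cycles, OF cycles contra z], assumption+)
      (rule critical(2)[where \<L> = cycles, OF cycles contra z], assumption+)
  \<comment> \<open>Each cycle contains the side \<open>r\<close> or misses its inner vertices. If
    there were an inner vertex, the first edge of \<open>r\<close> would therefore be a chord of no
    cycle.\<close>
  have single: "\<exists>z. r = [(z, u, w)] \<and> (z, u, w) \<in> arcs G"
    if h: "is_path G u r w" "u \<noteq> w" "\<And>C. C \<in> cycles \<Longrightarrow> wE r \<subseteq> C \<or> (wS r - {u}) \<inter> \<Union>(ends G ` C) = {}" for u r w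
  proof -
    obtain z v r' where z: "r = (z, u, v) # r'" "(z, u, v) \<in> arcs G" "is_path G v r' w" "u \<notin> insert w (wS r')"
      using h(1,2) by (cases r) (auto simp: is_path_Cons)
    have "r' = []"
    proof (rule ccontr)
      assume "r' \<noteq> []"
      then have v: "v \<in> wS r - {u}" using path_start_in'[OF z(3)] z(1,4) by auto
      then have nl: "\<not> is_loop G z" using is_loop_arc[OF G z(2)] by auto
      obtain C where C: "C \<in> cycles" "chord G C z" using crit(2)[OF arc_edge[OF z(2)] nl] by blast
      then have "z \<notin> C" "v \<in> \<Union>(ends G ` C)" using ends_arc[OF G z(2)] by (auto simp: chord_def)
      then show False using h(3)[OF C(1)] z(1) v by auto
    qed
    then show ?thesis using z by auto
  qed
  note dj = more_disjoint disjoint_parts starts ne xy \<tau>_start paths(1-5)[THEN path_end_notin]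
  have 1: "wE pa \<subseteq> C \<or> (wS pa - {a}) \<inter> \<Union>(ends G ` C) = {}" if "C \<in> cycles" for C
    using that
  proof (elim insertE emptyE)
    assume C: "C = insert e (wE (pa @ pb))"
    show ?thesis unfolding C by (rule disjI1) (auto simp: D1_def D2_def)
  next
    assume C: "C = insert e (wE (qa @ qb))"
    show ?thesis unfolding C cycle_Vs by (rule disjI2) (use dj in auto)
  next
    assume C: "C = insert e (wE D1)"
    show ?thesis unfolding C by (rule disjI1) (auto simp: D1_def D2_def)
  next
    assume C: "C = insert e (wE D2)"
    show ?thesis unfolding C cycle_Vs by (rule disjI2) (use dj in auto)
  next
    assume C: "C = wE (pa @ \<tau>) \<union> wE qa"
    show ?thesis unfolding C by (rule disjI1) (auto simp: D1_def D2_def)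
  next
    assume C: "C = wE pb \<union> wE (\<tau> @ qb)"
    show ?thesis unfolding C cycle_Vs by (rule disjI2) (use dj in auto)
  next
    assume C: "C = wE (pa @ pb) \<union> wE (qa @ qb)"
    show ?thesis unfolding C by (rule disjI1) (auto simp: D1_def D2_def)
  qed
  have 2: "wE pb \<subseteq> C \<or> (wS pb - {x}) \<inter> \<Union>(ends G ` C) = {}" if "C \<in> cycles" for C
    using that
  proof (elim insertE emptyE)
    assume C: "C = insert e (wE (pa @ pb))"
    show ?thesis unfolding C by (rule disjI1) (auto simp: D1_def D2_def)
  next
    assume C: "C = insert e (wE (qa @ qb))"
    show ?thesis unfolding C cycle_Vs by (rule disjI2) (use dj in auto)
  next
    assume C: "C = insert e (wE D1)"
    show ?thesis unfolding C cycle_Vs by (rule disjI2) (use dj in auto)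
  next
    assume C: "C = insert e (wE D2)"
    show ?thesis unfolding C by (rule disjI1) (auto simp: D1_def D2_def)
  next
    assume C: "C = wE (pa @ \<tau>) \<union> wE qa"
    show ?thesis unfolding C cycle_Vs by (rule disjI2) (use dj in auto)
  next
    assume C: "C = wE pb \<union> wE (\<tau> @ qb)"
    show ?thesis unfolding C by (rule disjI1) (auto simp: D1_def D2_def)
  next
    assume C: "C = wE (pa @ pb) \<union> wE (qa @ qb)"
    show ?thesis unfolding C by (rule disjI1) (auto simp: D1_def D2_def)
  qed
  have 3: "wE qa \<subseteq> C \<or> (wS qa - {a}) \<inter> \<Union>(ends G ` C) = {}" if "C \<in> cycles" for C
    using that
  proof (elim insertE emptyE)
    assume C: "C = insert e (wE (pa @ pb))"
    show ?thesis unfolding C cycle_Vs by (rule disjI2) (use dj in auto)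
  next
    assume C: "C = insert e (wE (qa @ qb))"
    show ?thesis unfolding C by (rule disjI1) (auto simp: D1_def D2_def)
  next
    assume C: "C = insert e (wE D1)"
    show ?thesis unfolding C cycle_Vs by (rule disjI2) (use dj in auto)
  next
    assume C: "C = insert e (wE D2)"
    show ?thesis unfolding C by (rule disjI1) (auto simp: D1_def D2_def)
  next
    assume C: "C = wE (pa @ \<tau>) \<union> wE qa"
    show ?thesis unfolding C by (rule disjI1) (auto simp: D1_def D2_def)
  next
    assume C: "C = wE pb \<union> wE (\<tau> @ qb)"
    show ?thesis unfolding C cycle_Vs by (rule disjI2) (use dj in auto)
  next
    assume C: "C = wE (pa @ pb) \<union> wE (qa @ qb)"
    show ?thesis unfolding C by (rule disjI1) (auto simp: D1_def D2_def)
  qed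
  have 4: "wE qb \<subseteq> C \<or> (wS qb - {y}) \<inter> \<Union>(ends G ` C) = {}" if "C \<in> cycles" for C
    using that
  proof (elim insertE emptyE)
    assume C: "C = insert e (wE (pa @ pb))"
    show ?thesis unfolding C cycle_Vs by (rule disjI2) (use dj in auto)
  next
    assume C: "C = insert e (wE (qa @ qb))"
    show ?thesis unfolding C by (rule disjI1) (auto simp: D1_def D2_def)
  next
    assume C: "C = insert e (wE D1)"
    show ?thesis unfolding C by (rule disjI1) (auto simp: D1_def D2_def)
  next
    assume C: "C = insert e (wE D2)"
    show ?thesis unfolding C cycle_Vs by (rule disjI2) (use dj in auto)
  next
    assume C: "C = wE (pa @ \<tau>) \<union> wE qa"
    show ?thesis unfolding C cycle_Vs by (rule disjI2) (use dj in auto)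
  next
    assume C: "C = wE pb \<union> wE (\<tau> @ qb)"
    show ?thesis unfolding C by (rule disjI1) (auto simp: D1_def D2_def)
  next
    assume C: "C = wE (pa @ pb) \<union> wE (qa @ qb)"
    show ?thesis unfolding C by (rule disjI1) (auto simp: D1_def D2_def)
  qed
  have 5: "wE \<tau> \<subseteq> C \<or> (wS \<tau> - {x}) \<inter> \<Union>(ends G ` C) = {}" if "C \<in> cycles" for C
    using that
  proof (elim insertE emptyE)
    assume C: "C = insert e (wE (pa @ pb))"
    show ?thesis unfolding C cycle_Vs by (rule disjI2) (use dj in auto)
  next
    assume C: "C = insert e (wE (qa @ qb))"
    show ?thesis unfolding C cycle_Vs by (rule disjI2) (use dj in auto)
  next
    assume C: "C = insert e (wE D1)"
    show ?thesis unfolding C by (rule disjI1) (auto simp: D1_def D2_def)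
  next
    assume C: "C = insert e (wE D2)"
    show ?thesis unfolding C by (rule disjI1) (auto simp: D1_def D2_def)
  next
    assume C: "C = wE (pa @ \<tau>) \<union> wE qa"
    show ?thesis unfolding C by (rule disjI1) (auto simp: D1_def D2_def)
  next
    assume C: "C = wE pb \<union> wE (\<tau> @ qb)"
    show ?thesis unfolding C by (rule disjI1) (auto simp: D1_def D2_def)
  next
    assume C: "C = wE (pa @ pb) \<union> wE (qa @ qb)"
    show ?thesis unfolding C cycle_Vs by (rule disjI2) (use dj in auto)
  qed
  obtain ac cb ad db cd where f: "pa = [(ac, a, x)]" "pb = [(cb, x, b)]" "qa = [(ad, a, y)]" "qb = [(db, y, b)]" "\<tau> = [(cd, x, y)]"
    and arcs: "(ac, a, x) \<in> arcs G" "(cb, x, b) \<in> arcs G" "(ad, a, y) \<in> arcs G" "(db, y, b) \<in> arcs G" "(cd, x, y) \<in> arcs G"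
    using single[OF paths(1) ne(2) 1] single[OF paths(2) ne(3) 2] single[OF paths(3) ne(4) 3] single[OF paths(4) ne(5) 4]
      single[OF paths(5) xy 5] by blast
  have dist: "distinct [e, ac, ad, cb, db, cd]"
    using e_notin inner(2) \<tau>_inner(2) path_distinct_edges[OF G P] path_distinct_edges[OF G Q] unfolding f by auto
  have E: "edges G = {e, ac, ad, cb, db, cd}"
  proof
    show "edges G \<subseteq> {e, ac, ad, cb, db, cd}"
    proof
      fix z assume "z \<in> edges G"
      from crit(1)[OF this] have "z \<in> insert e (wE pa \<union> wE pb \<union> wE qa \<union> wE qb \<union> wE \<tau>)"
        by (auto simp: D1_def D2_def)
      then show "z \<in> {e, ac, ad, cb, db, cd}" unfolding f by auto
    qed
    show "{e, ac, ad, cb, db, cd} \<subseteq> edges G"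
      using arc_edge[OF arcs(1)] arc_edge[OF arcs(2)] arc_edge[OF arcs(3)] arc_edge[OF arcs(4)] arc_edge[OF arcs(5)]
        arc_edge[OF e_arc] by simp
  qed
  have ends: "ends G e = {a, b}" "ends G ac = {a, x}" "ends G ad = {a, y}" "ends G cb = {b, x}" "ends G db = {b, y}" "ends G cd = {x, y}"
    using ends_e ends_arc[OF G arcs(1)] ends_arc[OF G arcs(2)] ends_arc[OF G arcs(3)] ends_arc[OF G arcs(4)] ends_arc[OF G arcs(5)]
    by auto
  have V: "verts G = {a, b, x, y}"
    unfolding no_isolated E using ends by auto
  note status = assms[unfolded D1_def D2_def, unfolded f]
  show ?thesis
    by (rule iso_minus_K4[OF biased E dist _ V ends])
      (use status ne xy in \<open>simp_all add: insert_commute\<close>)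
qed

end

section \<open>Rightness on the outer cycle of the subdivision\<close>

context K4_subdivision
begin

text \<open>The symmetry of the subdivision that exchanges its two sides and reverses the bridge. It
  also exchanges \<open>D1\<close> and \<open>D2\<close>.\<close>

lemma swap: "K4_subdivision G B e a b y x qa qb pa pb (rev_walk \<tau>)"
proof
  show "(e, a, b) \<in> arcs G" by (rule e_arc)
  show "a \<noteq> b" "a \<noteq> y" "y \<noteq> b" "a \<noteq> x" "x \<noteq> b" using ne by simp_all
  show "is_path G a qa y" "is_path G y qb b" "is_path G a pa x" "is_path G x pb b" "is_path G y (rev_walk \<tau>) x"
    using paths(1-4) \<tau>_rev(1) by simp_all
  show "is_path G a (qa @ qb) b" "is_path G a (pa @ pb) b" using P Q by simp_all
  show "e \<notin> wE qa \<union> wE qb \<union> wE pa \<union> wE pb \<union> wE (rev_walk \<tau>)" using e_notin by simp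
  show "(wS (qa @ qb) - {a}) \<inter> (wS (pa @ pb) - {a}) = {}" "wE (qa @ qb) \<inter> wE (pa @ pb) = {}"
    using inner by blast+
  show "(wS (rev_walk \<tau>) - {y}) \<inter> insert b (wS (qa @ qb) \<union> wS (pa @ pb)) = {}"
    unfolding \<tau>_rev(2) using \<tau>_inner(1) by blast
  show "wE (rev_walk \<tau>) \<inter> (wE (qa @ qb) \<union> wE (pa @ pb)) = {}"
    unfolding rev_walk_simps using \<tau>_inner(2) by blast
qed

lemma unbalanced_False':
  assumes "insert e (wE (pa @ pb)) \<notin> B" "insert e (wE (qa @ qb)) \<notin> B" "insert e (wE D2) \<notin> B"
    "wE (pa @ \<tau>) \<union> wE qa \<notin> B" "wE pb \<union> wE (\<tau> @ qb) \<notin> B" "wE (pa @ pb) \<union> wE (qa @ qb) \<notin> B"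
  shows False
proof -
  interpret swap: K4_subdivision G B e a b y x qa qb pa pb "rev_walk \<tau>" by (rule swap)
  show False
  proof (rule swap.unbalanced_False)
    show "insert e (wE swap.D1) \<notin> B" using assms(3) by (simp add: swap.D1_def D2_def)
    show "wE (qa @ rev_walk \<tau>) \<union> wE pa \<notin> B" using assms(4) by (simp add: ac_simps)
    show "wE qb \<union> wE (rev_walk \<tau> @ pb) \<notin> B" using assms(5) by (simp add: ac_simps)
    show "wE (qa @ qb) \<union> wE (pa @ pb) \<notin> B" using assms(6) by (simp add: ac_simps)
  qed (use assms in simp_all)
qed

text \<open>The outer cycle cut at \<open>x\<close> and \<open>y\<close> into a path through
  \<open>a\<close> and a path through \<open>b\<close>. With \<open>\<tau>\<close> they form the
  theta that contains the two triangles without \<open>e\<close>.\<close>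

lemma side_paths:
  "is_path G x (rev_walk pa @ qa) y" "is_path G x (pb @ rev_walk qb) y"
  "idisj \<tau> (rev_walk pa @ qa)" "idisj \<tau> (pb @ rev_walk qb)" "idisj (rev_walk pa @ qa) (pb @ rev_walk qb)"
proof -
  have "pa \<noteq> []" "qb \<noteq> []" using starts by auto
  then have r: "wS (rev_walk pa) = insert x (wS pa - {a})" "wS (rev_walk qb) = insert b (wS qb - {y})"
    using path_rev_inner(2)[OF G paths(1)] path_rev_inner(2)[OF G paths(4)] by auto
  note rp = is_path_rev[OF G paths(1)] is_path_rev[OF G paths(4)]
  note dj = more_disjoint disjoint_parts starts ne xy \<tau>_start paths(1-5)[THEN path_end_notin]
  show 1: "is_path G x (rev_walk pa @ qa) y"
    by (rule path_appendI[OF rp(1) paths(3)]) (unfold r, use dj in auto)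
  show 2: "is_path G x (pb @ rev_walk qb) y"
    by (rule path_appendI[OF paths(2) rp(2)]) (unfold r, use dj in auto)
  have V: "wS (rev_walk pa @ qa) = insert x (wS pa - {a}) \<union> wS qa" "wS (pb @ rev_walk qb) = wS pb \<union> insert b (wS qb - {y})"
    by (simp_all add: r)
  have E: "wE (rev_walk pa @ qa) = wE pa \<union> wE qa" "wE (pb @ rev_walk qb) = wE pb \<union> wE qb"
    by simp_all
  have "wE pa \<inter> wE pb = {}" "wE qa \<inter> wE qb = {}"
    using path_distinct_edges[OF G P] path_distinct_edges[OF G Q] by simp_all
  then have Es: "wE \<tau> \<inter> (wE pa \<union> wE qa) = {}" "wE \<tau> \<inter> (wE pb \<union> wE qb) = {}" "(wE pa \<union> wE qa) \<inter> (wE pb \<union> wE qb) = {}"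
    using \<tau>_inner(2) inner(2) by auto
  show "idisj \<tau> (rev_walk pa @ qa)" "idisj \<tau> (pb @ rev_walk qb)" "idisj (rev_walk pa @ qa) (pb @ rev_walk qb)"
    unfolding path_idisj_iff[OF paths(5) 1 xy] path_idisj_iff[OF paths(5) 2 xy] path_idisj_iff[OF 1 2 xy] V E
    using Es dj by auto
qed

text \<open>If the outer cycle were wrong, no triangle could be balanced, since a balanced right
  triangle would pass rightness on to it in a theta. Residues settle the rest: if the outer cycle is
  balanced, so are the other two quadrangles, which is \<open>-K\<^sub>4\<close>; if not, one of
  these is unbalanced, and contracting an edge refutes this.\<close>

lemma right_outer_cycle:
  assumes \<phi>: "zgain G \<phi>" and rightC: "\<And>C. C \<in> cycles \<Longrightarrow> C \<noteq> wE (pa @ pb) \<union> wE (qa @ qb) \<Longrightarrow> right G B \<phi> C"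
    and "\<not> (G, B) \<cong>\<^sub>b all_negative (complete_graph 4)"
  shows "right G B \<phi> (wE (pa @ pb) \<union> wE (qa @ qb))"
proof (rule ccontr)
  let ?C = "wE (pa @ pb) \<union> wE (qa @ qb)"
  assume wrong: "\<not> right G B \<phi> ?C"
  have "e \<notin> ?C" using e_notin by auto
  then have ne': "insert e X \<noteq> ?C" for X by blast
  have r: "right G B \<phi> (insert e (wE (pa @ pb)))" "right G B \<phi> (insert e (wE (qa @ qb)))"
    "right G B \<phi> (insert e (wE D1))" "right G B \<phi> (insert e (wE D2))"
    by (rule rightC[OF _ ne'], simp only: insert_iff simp_thms)+
  obtain h where h: "h \<in> wE \<tau>" "h \<notin> ?C"
    using path_start_edge[OF G paths(5) xy] \<tau>_inner(2) by blast
  have r': "right G B \<phi> (wE (pa @ \<tau>) \<union> wE qa)" "right G B \<phi> (wE pb \<union> wE (\<tau> @ qb))"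
    by (rule rightC, simp only: insert_iff simp_thms, use h in auto)+
  note ei = e_idisj(1,2)[THEN idisj_sym]
  have 1: "insert e (wE (pa @ pb)) \<notin> B"
    using right_theta[OF biased \<phi> ne(1) e_path P Q ei PQ_idisj] r wrong by auto
  have 2: "insert e (wE (qa @ qb)) \<notin> B"
    using right_theta[OF biased \<phi> ne(1) e_path Q P ei(2,1) idisj_sym[OF PQ_idisj]] r wrong by (auto simp: Un_commute)
  have eq: "wE \<tau> \<union> wE (rev_walk pa @ qa) = wE (pa @ \<tau>) \<union> wE qa" "wE \<tau> \<union> wE (pb @ rev_walk qb) = wE pb \<union> wE (\<tau> @ qb)"
    "wE (rev_walk pa @ qa) \<union> wE (pb @ rev_walk qb) = ?C" "wE (pb @ rev_walk qb) \<union> wE (rev_walk pa @ qa) = ?C"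
    by auto
  have 3: "wE (pa @ \<tau>) \<union> wE qa \<notin> B"
    using right_theta[OF biased \<phi> xy paths(5) side_paths(1,2,3,4,5)] r' wrong unfolding eq by blast
  have 4: "wE pb \<union> wE (\<tau> @ qb) \<notin> B"
    using right_theta[OF biased \<phi> xy paths(5) side_paths(2,1,4,3) idisj_sym[OF side_paths(5)]] r' wrong unfolding eq by blast
  have nz: "\<not> 3 dvd (gs \<phi> pa + gs \<phi> pb) - \<phi> (e, a, b)" "\<not> 3 dvd (gs \<phi> qa + gs \<phi> qb) - \<phi> (e, a, b)"
    "\<not> 3 dvd (gs \<phi> pa + gs \<phi> \<tau>) - gs \<phi> qa" "\<not> 3 dvd gs \<phi> pb - (gs \<phi> \<tau> + gs \<phi> qb)"
    using r(1,2) r' 1 2 3 4 unfolding rights[OF \<phi>] by blast+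
  show False
  proof (cases "?C \<in> B")
    case True
    then have "\<not> 3 dvd (gs \<phi> pa + gs \<phi> pb) - (gs \<phi> qa + gs \<phi> qb)"
      using wrong unfolding rights[OF \<phi>] by blast
    from K4_residues_unbalanced[OF nz this] have "insert e (wE D1) \<in> B" "insert e (wE D2) \<in> B"
      using r(3,4) unfolding rights[OF \<phi>] by blast+
    then show False using minus_K4[OF 1 2 _ _ 3 4 True] assms(3) by blast
  next
    case False
    then have "3 dvd (gs \<phi> pa + gs \<phi> pb) - (gs \<phi> qa + gs \<phi> qb)"
      using wrong unfolding rights[OF \<phi>] by blast
    from K4_residues_balanced[OF nz(1,3) this] have "insert e (wE D1) \<notin> B \<or> insert e (wE D2) \<notin> B"
      using r(3,4) unfolding rights[OF \<phi>] by blast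
    then show False
      using unbalanced_False[OF 1 2 _ 3 4 False] unbalanced_False'[OF 1 2 _ 3 4 False] by blast
  qed
qed

end

section \<open>Bridges taken from a path\<close>

lemma subpath_between:
  assumes "mgraph G" "is_path G c r v" "y1 \<in> insert v (wS r)" "y2 \<in> insert v (wS r)"
  shows "\<exists>\<tau>. is_path G y1 \<tau> y2 \<and> insert y2 (wS \<tau>) \<subseteq> insert v (wS r)"
proof -
  obtain r1 r2 where r: "r = r1 @ r2" "is_path G c r1 y1" "is_path G y1 r2 v"
    by (rule path_split_at[OF assms(1-3)])
  show ?thesis
  proof (cases "y2 \<in> insert v (wS r2)")
    case True
    obtain r3 r4 where "r2 = r3 @ r4" "is_path G y1 r3 y2" "is_path G y2 r4 v"
      by (rule path_split_at[OF assms(1) r(3) True])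
    then show ?thesis using r assms(4) by (intro exI[of _ r3]) auto
  next
    case False
    then have "y2 \<in> insert y1 (wS r1)" using assms(4) r by auto
    then obtain r3 r4 where s: "r1 = r3 @ r4" "is_path G c r3 y2" "is_path G y2 r4 y1"
      using path_split_at[OF assms(1) r(2)] by metis
    have "insert y2 (wS (rev_walk r4)) = insert y1 (wS r4)"
      by (rule walk_starts_rev_set[OF is_path_walk[OF s(3)]])
    then show ?thesis
      using is_path_rev[OF assms(1) s(3)] assms(3) r(1) s(1) by (intro exI[of _ "rev_walk r4"]) auto
  qed
qed

text \<open>Stop at the first vertex in \<open>J\<close>, and walk back from there to the first
  vertex in \<open>I\<close>.\<close>

lemma shortest_bridge:
  assumes "mgraph G" "is_path G y1 \<tau> y2" "y1 \<in> I" "y2 \<in> J" "I \<inter> J = {}"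
  shows "\<exists>x y \<sigma>. is_path G x \<sigma> y \<and> x \<in> I \<and> y \<in> J \<and> (wS \<sigma> - {x}) \<inter> (I \<union> J) = {} \<and> insert y (wS \<sigma>) \<subseteq> insert y2 (wS \<tau>)"
proof -
  obtain r y q where r: "\<tau> = r @ q" "is_path G y1 r y" "y \<in> J" "wS r \<inter> J = {}" "is_path G y q y2"
    using first_hit[OF assms(1,2,4)] by blast
  have rv: "insert y1 (wS (rev_walk r)) = insert y (wS r)"
    by (rule walk_starts_rev_set[OF is_path_walk[OF r(2)]])
  obtain r' x q' where r': "rev_walk r = r' @ q'" "is_path G y r' x" "x \<in> I" "wS r' \<inter> I = {}" "is_path G x q' y1"
    using first_hit[OF assms(1) is_path_rev[OF assms(1) r(2)] assms(3)] by blast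
  have xy: "x \<noteq> y" using r(3) r'(3) assms(5) by blast
  then have "r' \<noteq> []" using r'(2) by auto
  then have w: "wS (rev_walk r') = insert x (wS r' - {y})"
    by (rule path_rev_inner(2)[OF assms(1) r'(2)])
  have sub: "wS r' \<subseteq> insert y (wS r)" using rv r'(1) by auto
  have x_in: "x \<in> insert y (wS r)" using path_start_V[OF r'(5)] r'(1) rv by auto
  have "y \<in> insert y2 (wS q)" by (rule path_start_V[OF r(5)])
  then have "insert y (wS (rev_walk r')) \<subseteq> insert y2 (wS \<tau>)"
    unfolding w using sub x_in r(1) by auto
  moreover have "(wS (rev_walk r') - {x}) \<inter> (I \<union> J) = {}"
    unfolding w using sub r(4) r'(4) by blast
  ultimately show ?thesis
    using is_path_rev[OF assms(1) r'(2)] r'(3) r(3) by blast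
qed

section \<open>Classification of the critical graphs\<close>

context critical_graph
begin

text \<open>Unbalanced pairs are excluded by \<open>no_digon\<close>. In a balanced pair,
  \<open>e'\<close> can copy the gain of \<open>e\<close>: the theta with \<open>{e, e'}\<close>
  carries rightness from a cycle through \<open>e\<close> to the corresponding one through
  \<open>e'\<close>, and the gain would be right everywhere.\<close>

lemma no_parallel:
  assumes "(e, a, b) \<in> arcs G" "(e', a, b) \<in> arcs G" "a \<noteq> b"
    "\<not> (G, B) \<cong>\<^sub>b (multi_K2 4, {})" "\<not> (G, B) \<cong>\<^sub>b plus_minus (complete_graph 3)"
  shows "e = e'"
proof (rule ccontr)
  assume ee': "e \<noteq> e'"
  have e_path: "is_path G a [(e, a, b)] b" and e'_path: "is_path G a [(e', a, b)] b"
    using is_path_single[OF G] assms by blast+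
  obtain \<psi> where \<psi>: "zgain G \<psi>" "\<And>C. is_cycle G C \<Longrightarrow> e' \<notin> C \<Longrightarrow> right G B \<psi> C"
    using delete[OF arc_edge[OF assms(2)]] by blast
  show False
  proof (cases "{e, e'} \<in> B")
    case False
    then interpret digon_graph G B e e' a b \<psi>
      by unfold_locales (use assms ee' \<psi> in simp_all)
    show False by (rule no_digon)
  next
    case True
    define \<gamma> where "\<gamma> = (\<lambda>(f, x, y). \<psi> (if f = e' then e else f, x, y))"
    have same: "(f, x, y) \<in> arcs G \<Longrightarrow> (if f = e' then e else f, x, y) \<in> arcs G" for f x y
      using ends_arc[OF G assms(1)] ends_arc[OF G assms(2)] ends_arc[OF G, of f x y] arcsI[OF G arc_edge[OF assms(1)], of x y]
      by auto
    have \<gamma>: "zgain G \<gamma>"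
      unfolding zgain_def \<gamma>_def using zgainD[OF \<psi>(1) same] by simp
    obtain C where C: "is_cycle G C" "\<not> right G B \<gamma> C" using not_gainable[OF \<gamma>] by blast
    have "right G B \<gamma> C"
    proof (cases "e' \<in> C")
      case False
      have "bal G \<gamma> C \<longleftrightarrow> bal G \<psi> C"
        by (rule bal_cong) (use False in \<open>auto simp: \<gamma>_def\<close>)
      then show ?thesis using \<psi>(2)[OF C(1) False] by (simp add: right_def)
    next
      case e'C: True
      obtain R where R: "is_path G a R b" "e' \<notin> wE R" "C = insert e' (wE R)"
        using cycle_through_arc[OF G C(1) arcs_sym[OF assms(2)] e'C] by blast
      have ee: "idisj [(e, a, b)] [(e', a, b)]" using ee' by (simp add: idisj_iff)
      have digon: "right G B \<gamma> {e, e'}"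
        using idisj_right[OF G \<gamma> e_path e'_path assms(3) ee, of B] True by (simp add: \<gamma>_def insert_commute)
      show ?thesis
      proof (cases "e \<in> wE R")
        case True
        then have "R = [(e, a, b)]"
          using path_edge_joining_ends[OF G R(1)] ends_arc[OF G assms(1)] by blast
        then show ?thesis using digon R(3) by (simp add: insert_commute)
      next
        case False
        have "is_cycle G (insert e (wE R))"
          using idisj_cycle[OF G e_path R(1) assms(3) idisj_single(1)[OF False]] by simp
        moreover have "e' \<notin> insert e (wE R)" using ee' R(2) by simp
        ultimately have "right G B \<psi> (insert e (wE R))" by (rule \<psi>(2))
        moreover have "bal G \<gamma> (insert e (wE R)) \<longleftrightarrow> bal G \<psi> (insert e (wE R))"
          by (rule bal_cong) (use \<open>e' \<notin> insert e (wE R)\<close> in \<open>auto simp: \<gamma>_def\<close>)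
        ultimately have "right G B \<gamma> (insert e (wE R))" by (simp add: right_def)
        then show ?thesis
          using right_theta[OF biased \<gamma> assms(3) e_path e'_path R(1) ee idisj_single(1)[OF False] idisj_single(1)[OF R(2)]]
            digon True R(3) by (simp add: insert_commute)
      qed
    qed
    then show False using C(2) by blast
  qed
qed

text \<open>If all edges were loops, every cycle would be a single loop, and gain 0 on balanced
  loops with gain 1 on the others would be right everywhere.\<close>

lemma non_loop_edge: "\<exists>e\<in>edges G. \<not> is_loop G e"
proof (rule ccontr)
  assume "\<not> ?thesis"
  then have loops: "\<And>e. e \<in> edges G \<Longrightarrow> is_loop G e" by blast
  define \<gamma> :: "'e \<times> 'v \<times> 'v \<Rightarrow> int" where "\<gamma> = (\<lambda>(e, u, v). if {e} \<in> B then 0 else 1)"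
  have \<gamma>: "zgain G \<gamma>"
    unfolding zgain_def
  proof (intro allI impI)
    fix f u v assume f: "(f, u, v) \<in> arcs G" "u \<noteq> v"
    then show "3 dvd \<gamma> (f, u, v) + \<gamma> (f, v, u)"
      using is_loop_arc[OF G f(1)] loops[OF arc_edge[OF f(1)]] by blast
  qed
  obtain C where C: "is_cycle G C" "\<not> right G B \<gamma> C" using not_gainable[OF \<gamma>] by blast
  then obtain p where p: "p \<noteq> []" "simple_closed_walk G C p" using is_cycle_scw[OF G] by blast
  then obtain e u v P where e: "p = (e, u, v) # P" by (cases p) auto
  then have arc: "(e, u, v) \<in> arcs G" "is_path G v P u" "C = insert e (wE P)"
    using p(2) by (auto simp: scw_Cons[OF G])
  then have "u = v" using is_loop_arc[OF G arc(1)] loops[OF arc_edge[OF arc(1)]] by blast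
  then have "P = []" using arc(2) closed_path_Nil[of G v] by blast
  then have "C = {e}" "gs \<gamma> p = \<gamma> (e, u, v)" using arc(3) e by simp_all
  moreover have "3 dvd \<gamma> (e, u, v) \<longleftrightarrow> {e} \<in> B" by (simp add: \<gamma>_def)
  ultimately show False
    using C(2) bal_scw[OF G \<gamma> p(2)] by (simp only: right_def)
qed

lemma longest_path:
  obtains e a b p v where "is_path G a ((e, a, b) # p) v"
    "\<And>f y. (f, a, y) \<in> arcs G \<Longrightarrow> y \<noteq> a \<Longrightarrow> y \<in> insert v (wS ((e, a, b) # p))"
proof -
  let ?P = "\<lambda>(u, p, v). is_path G u p v"
  obtain e0 a0 b0 where e0: "(e0, a0, b0) \<in> arcs G" "a0 \<noteq> b0"
    using non_loop_edge edge_arcE[OF G] is_loop_arc[OF G] by metis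
  then have init: "?P (a0, [(e0, a0, b0)], b0)"
    using is_path_single[OF G] by auto
  have "\<forall>x. ?P x \<longrightarrow> length (fst (snd x)) < card (verts G)"
    using path_length[OF G] by auto
  then obtain z where z: "?P z" "\<forall>y. ?P y \<longrightarrow> length (fst (snd y)) \<le> length (fst (snd z))"
    using ex_has_greatest_nat[of ?P "(a0, [(e0, a0, b0)], b0)" "\<lambda>x. length (fst (snd x))"] init by blast
  obtain u q v where q: "z = (u, q, v)" by (cases z)
  have path: "is_path G u q v" and max: "\<And>u' p' v'. is_path G u' p' v' \<Longrightarrow> length p' \<le> length q"
    using z q by auto
  have "q \<noteq> []" using max[of a0 "[(e0, a0, b0)]" b0] init by auto
  then obtain e b p where p: "q = (e, u, b) # p" using path by (cases q) (auto simp: is_path_Cons)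
  show thesis
  proof (rule that)
    show "is_path G u ((e, u, b) # p) v" using path p by simp
    fix f y assume f: "(f, u, y) \<in> arcs G" "y \<noteq> u"
    show "y \<in> insert v (wS ((e, u, b) # p))"
    proof (rule ccontr)
      assume "y \<notin> insert v (wS ((e, u, b) # p))"
      then have "is_path G y ((f, y, u) # q) v"
        using path p arcs_sym[OF f(1)] by (simp add: is_path_Cons)
      then show False using max[of y "(f, y, u) # q" v] by simp
    qed
  qed
qed

text \<open>Contract the first edge \<open>e = ab\<close> of a longest path. A cycle with chord \<open>e\<close> consists of two
  paths from \<open>a\<close> to \<open>b\<close>. As all neighbours of \<open>a\<close> lie on the longest path, a subpath of it
  connects the two paths, so that the cycle is part of a subdivided \<open>K\<^sub>4\<close>.\<close>

theorem classification:
  "(G, B) \<cong>\<^sub>b (multi_K2 4, {}) \<or> (G, B) \<cong>\<^sub>b plus_minus (complete_graph 3) \<or>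
    (G, B) \<cong>\<^sub>b all_negative (complete_graph 4)"
proof (rule ccontr)
  assume no: "\<not> ?thesis"
  then have parallel: "\<And>e e' a b. (e, a, b) \<in> arcs G \<Longrightarrow> (e', a, b) \<in> arcs G \<Longrightarrow> a \<noteq> b \<Longrightarrow> e = e'"
    using no_parallel by blast
  obtain e a b p v where p: "is_path G a ((e, a, b) # p) v"
    and max: "\<And>f y. (f, a, y) \<in> arcs G \<Longrightarrow> y \<noteq> a \<Longrightarrow> y \<in> insert v (wS ((e, a, b) # p))"
    by (rule longest_path) (rule that)
  have e: "(e, a, b) \<in> arcs G" "is_path G b p v" "a \<notin> insert v (wS p)"
    using p by (auto simp: is_path_Cons)
  have ab: "a \<noteq> b" using path_start_V[OF e(2)] e(3) by auto
  have nl: "\<not> is_loop G e" using is_loop_arc[OF G e(1)] ab by simp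
  obtain \<phi> where \<phi>: "zgain G \<phi>" "\<And>C. is_cycle G C \<Longrightarrow> \<not> chord G C e \<Longrightarrow> right G B \<phi> C"
    using contract[OF arc_edge[OF e(1)] nl] by blast
  obtain C where C: "is_cycle G C" "\<not> right G B \<phi> C" using not_gainable[OF \<phi>(1)] by blast
  have ee: "ends G e = {a, b}" by (rule ends_arc[OF G e(1)])
  have "chord G C e" using \<phi>(2)[OF C(1)] C(2) by blast
  then have eC: "e \<notin> C" "a \<in> \<Union>(ends G ` C)" "b \<in> \<Union>(ends G ` C)" by (auto simp: chord_def ee)
  obtain P Q where PQ: "is_path G a P b" "is_path G a Q b" "idisj P Q" "C = wE P \<union> wE Q"
    by (rule cycle_split[OF G C(1) eC(2,3) ab])
  \<comment> \<open>The second vertex of \<open>R\<close> is a neighbour of \<open>a\<close> other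
    than \<open>b\<close>, because \<open>e\<close> has no parallel edge. By the choice of the
    longest path it lies on this path, beyond \<open>b\<close>.\<close>
  have second: "\<exists>y. y \<in> wS R \<and> y \<noteq> a \<and> y \<noteq> b \<and> y \<in> insert v (wS (tl p)) \<and> p \<noteq> []" if R: "is_path G a R b" "e \<notin> wE R" for R
  proof -
    obtain f y R' where f: "R = (f, a, y) # R'" "(f, a, y) \<in> arcs G" "is_path G y R' b" "a \<notin> insert b (wS R')"
      using R(1) ab by (cases R) (auto simp: is_path_Cons)
    have "y \<noteq> b"
    proof
      assume "y = b"
      then have "f = e" using parallel[OF _ e(1) ab] f(2) by blast
      then show False using R(2) f(1) by simp
    qed
    then have "R' \<noteq> []" using f(3) by auto
    then have y: "y \<in> wS R'" by (rule path_start_in'[OF f(3)])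
    then have "y \<noteq> a" using f(4) by auto
    then have "y \<in> insert v (wS p)" using max[OF f(2)] by auto
    moreover have "p \<noteq> []" using calculation \<open>y \<noteq> b\<close> e(2) by auto
    moreover have "y \<in> insert v (wS (tl p))"
      using calculation \<open>y \<noteq> b\<close> e(2) by (cases p) (auto simp: is_path_Cons)
    ultimately show ?thesis using y f(1) \<open>y \<noteq> a\<close> \<open>y \<noteq> b\<close> by auto
  qed
  have eP: "e \<notin> wE P" "e \<notin> wE Q" using eC(1) PQ(4) by auto
  obtain y1 where y1: "y1 \<in> wS P" "y1 \<noteq> a" "y1 \<noteq> b" "y1 \<in> insert v (wS (tl p))" "p \<noteq> []"
    using second[OF PQ(1) eP(1)] by blast
  obtain y2 where y2: "y2 \<in> wS Q" "y2 \<noteq> a" "y2 \<noteq> b" "y2 \<in> insert v (wS (tl p))"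
    using second[OF PQ(2) eP(2)] by blast
  obtain g c where g: "p = (g, b, c) # tl p" "is_path G c (tl p) v" "b \<notin> insert v (wS (tl p))"
    using e(2) y1(5) by (cases p) (auto simp: is_path_Cons)
  have "wS p = insert b (wS (tl p))" by (subst g(1)) simp
  then have a_tl: "a \<notin> insert v (wS (tl p))" using e(3) by auto
  \<comment> \<open>\<open>\<tau>0\<close> runs inside the longest path after \<open>b\<close>, so
    neither it nor the bridge taken from it meets \<open>a\<close> or \<open>b\<close>.\<close>
  obtain \<tau>0 where \<tau>0: "is_path G y1 \<tau>0 y2" "insert y2 (wS \<tau>0) \<subseteq> insert v (wS (tl p))"
    using subpath_between[OF G g(2) y1(4) y2(4)] by blast
  let ?I = "wS P - {a}"
  let ?J = "wS Q - {a}"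
  have IJ: "?I \<inter> ?J = {}" "wE P \<inter> wE Q = {}" using PQ(3) unfolding path_idisj_iff[OF PQ(1,2) ab] by blast+
  have y12: "y1 \<in> ?I" "y2 \<in> ?J" using y1 y2 by auto
  obtain x y \<tau> where \<tau>: "is_path G x \<tau> y" "x \<in> ?I" "y \<in> ?J" "(wS \<tau> - {x}) \<inter> (?I \<union> ?J) = {}"
    "insert y (wS \<tau>) \<subseteq> insert y2 (wS \<tau>0)"
    using shortest_bridge[OF G \<tau>0(1) y12 IJ(1)] by blast
  have \<tau>ab: "a \<notin> insert y (wS \<tau>)" "b \<notin> insert y (wS \<tau>)"
    using \<tau>(5) \<tau>0(2) a_tl g(3) by blast+
  have x\<tau>: "x \<in> insert y (wS \<tau>)" by (rule path_start_V[OF \<tau>(1)])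
  have nb: "b \<notin> wS P" "b \<notin> wS Q" using path_end_notin[OF PQ(1)] path_end_notin[OF PQ(2)] by simp_all
  obtain pa pb where pa: "P = pa @ pb" "is_path G a pa x" "is_path G x pb b"
    by (rule path_split_at[OF G PQ(1), of x]) (use \<tau>(2) in auto)
  obtain qa qb where qa: "Q = qa @ qb" "is_path G a qa y" "is_path G y qb b"
    by (rule path_split_at[OF G PQ(2), of y]) (use \<tau>(3) in auto)
  have \<tau>V: "(wS \<tau> - {x}) \<inter> insert b (wS P \<union> wS Q) = {}"
    using \<tau>(4) \<tau>ab by auto
  \<comment> \<open>An edge of \<open>\<tau>\<close> on \<open>R\<close> would have both ends at the
    single common vertex \<open>w\<close> and thus be a loop.\<close>
  have off: "wE \<tau> \<inter> wE R = {}" if R: "is_walk G a R b" "insert y (wS \<tau>) \<inter> insert b (wS R) \<subseteq> {w}" for R w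
  proof (rule ccontr)
    assume "wE \<tau> \<inter> wE R \<noteq> {}"
    then obtain h where h: "h \<in> wE \<tau>" "h \<in> wE R" by auto
    have "ends G h \<subseteq> {w}"
      using walk_ends[OF G is_path_walk[OF \<tau>(1)]] walk_ends[OF G R(1)] h R(2) by blast
    moreover have "h \<in> edges G" using is_walk_edges[OF R(1)] h(2) by blast
    then obtain r s where rs: "(h, r, s) \<in> arcs G" using edge_arcE[OF G] by blast
    ultimately have "r = s" using ends_arc[OF G rs] by auto
    then show False using path_no_loop[OF G \<tau>(1) h(1)] is_loop_arc[OF G rs] by blast
  qed
  have xQ: "x \<notin> insert b (wS Q)" using \<tau>(2) IJ(1) nb(1) by blast
  have yP: "y \<notin> insert b (wS P)" using \<tau>(3) IJ(1) nb(2) by blast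
  have "insert y (wS \<tau>) \<inter> insert b (wS P) \<subseteq> {x}" using \<tau>V yP by blast
  from off[OF is_path_walk[OF PQ(1)] this] have \<tau>P: "wE \<tau> \<inter> wE P = {}" .
  have "insert y (wS \<tau>) \<inter> insert b (wS Q) \<subseteq> {y}" using \<tau>V xQ by blast
  from off[OF is_path_walk[OF PQ(2)] this] have \<tau>Q: "wE \<tau> \<inter> wE Q = {}" .
  have "e \<notin> wE \<tau>"
    using walk_ends[OF G is_path_walk[OF \<tau>(1)]] ee \<tau>ab by auto
  then interpret K4_subdivision G B e a b x y pa pb qa qb \<tau>
  proof unfold_locales
    show "(e, a, b) \<in> arcs G" "a \<noteq> b" by (rule e(1), rule ab)
    show "a \<noteq> x" "x \<noteq> b" "a \<noteq> y" "y \<noteq> b" using \<tau>(2,3) nb by auto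
    show "is_path G a pa x" "is_path G x pb b" "is_path G a qa y" "is_path G y qb b" "is_path G x \<tau> y"
      by (fact pa(2) pa(3) qa(2) qa(3) \<tau>(1))+
    show "is_path G a (pa @ pb) b" "is_path G a (qa @ qb) b" using PQ(1,2) pa(1) qa(1) by simp_all
    show "e \<notin> wE pa \<union> wE pb \<union> wE qa \<union> wE qb \<union> wE \<tau>" using eP \<open>e \<notin> wE \<tau>\<close> pa(1) qa(1) by simp
    show "(wS (pa @ pb) - {a}) \<inter> (wS (qa @ qb) - {a}) = {}" "wE (pa @ pb) \<inter> wE (qa @ qb) = {}"
      using IJ pa(1) qa(1) by simp_all
    show "(wS \<tau> - {x}) \<inter> insert b (wS (pa @ pb) \<union> wS (qa @ qb)) = {}" using \<tau>V pa(1) qa(1) by simp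
    show "wE \<tau> \<inter> (wE (pa @ pb) \<union> wE (qa @ qb)) = {}" using \<tau>P \<tau>Q pa(1) qa(1) by (simp add: Int_Un_distrib)
  qed
  have "right G B \<phi> (wE (pa @ pb) \<union> wE (qa @ qb))"
  proof (rule right_outer_cycle[OF \<phi>(1)])
    \<comment> \<open>Of the six other cycles, four contain \<open>e\<close>, and the two triangles
      without \<open>e\<close> miss \<open>b\<close> or \<open>a\<close>. So none has
      \<open>e\<close> as a chord, and \<open>\<phi>\<close> is right on all of them.\<close>
    have 1: "\<not> chord G (wE (pa @ \<tau>) \<union> wE qa) e"
      unfolding chord_def cycle_Vs ee using \<tau>ab disjoint_parts ne by auto
    have 2: "\<not> chord G (wE pb \<union> wE (\<tau> @ qb)) e"
      unfolding chord_def cycle_Vs ee using \<tau>ab disjoint_parts starts ne by auto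
    fix C assume C: "C \<in> cycles" "C \<noteq> wE (pa @ pb) \<union> wE (qa @ qb)"
    have "\<not> chord G C e"
      using C by (elim insertE emptyE) (use 1 2 in \<open>simp_all add: chord_def\<close>)
    then show "right G B \<phi> C" using \<phi>(2) cycles C(1) by blast
  next
    show "\<not> (G, B) \<cong>\<^sub>b all_negative (complete_graph 4)" using no by blast
  qed
  then show False using C(2) PQ(4) pa(1) qa(1) by simp
qed

end

subsection \<open>The three excluded minors\<close>

lemma component_empty:
  assumes "mgraph G" "v \<in> verts G"
  shows "component G {} v = {v}"
proof -
  have "w = v" if "joined G {} v w" for w
    using joined_at_most_one[OF assms(1), of "{}" undefined v w] that by blast
  then show ?thesis
    using joined_refl[OF assms(2)] by (auto simp: component_def)
qed

text \<open>The vertices of the trivial minor are singletons, so the projection is injective on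
  vertices and keeps walks simple.\<close>

lemma trivial_minor_cycle:
  assumes "mgraph G" "is_cycle G C"
  shows "is_cycle (graph_minor G {} {}) C"
proof -
  let ?H = "graph_minor G {} {}"
  obtain p where p: "p \<noteq> []" "simple_closed_walk G C p" using assms is_cycle_scw by blast
  then obtain u where u: "is_walk G u p u" "distinct (walk_starts p)" "distinct (walk_edges p)" "wE p = C"
    by (auto simp: simple_closed_walk_def)
  have w: "is_walk ?H (component G {} u) (proj G {} p) (component G {} u)"
    by (rule proj_walk[OF assms(1) u(1)]) simp
  have s: "walk_starts (proj G {} p) = map (component G {}) (walk_starts p)"
    by (simp add: walk_starts_def proj_def case_prod_unfold)
  have "wS p \<subseteq> verts G"
    using is_walk_arcs[OF u(1)] arc_verts(1)[OF assms(1)] by (auto simp: walk_starts_def)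
  then have "inj_on (component G {}) (wS p)"
    using component_empty[OF assms(1)] by (intro inj_onI) (metis singleton_inject subsetD)
  then have "distinct (walk_starts (proj G {} p))"
    unfolding s using u(2) by (simp add: distinct_map)
  then have "simple_closed_walk ?H C (proj G {} p)"
    using w u by (auto simp: simple_closed_walk_def proj_edges)
  moreover have "proj G {} p \<noteq> []" using p(1) by (cases p) auto
  ultimately show ?thesis using scw_is_cycle[OF mgraph_graph_minor[OF assms(1)]] by blast
qed

lemma trivial_minor_iso:
  assumes "biased_graph (G, B)"
  shows "delete_verts (contract_delete (G, B) {} {}) {} \<cong>\<^sub>b (G, B)"
proof -
  have G: "mgraph G" by (rule biased_mgraph[OF assms])
  let ?H = "graph_minor G {} {}"
  let ?B = "{C. is_cycle ?H C \<and> (\<exists>C'. is_cycle G C' \<and> C \<subseteq> C' \<and> C' - C \<subseteq> {} \<and> C' \<in> B)}"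
  have B: "?B = B"
  proof (rule Collect_eq_set)
    fix C assume "is_cycle ?H C \<and> (\<exists>C'. is_cycle G C' \<and> C \<subseteq> C' \<and> C' - C \<subseteq> {} \<and> C' \<in> B)"
    then obtain C' where "C \<subseteq> C'" "C' - C \<subseteq> {}" "C' \<in> B" by blast
    then have "C = C'" by auto
    then show "C \<in> B" using \<open>C' \<in> B\<close> by simp
  next
    fix C assume "C \<in> B"
    moreover have "is_cycle G C" using \<open>C \<in> B\<close> by (rule biased_cycle[OF assms])
    ultimately show "is_cycle ?H C \<and> (\<exists>C'. is_cycle G C' \<and> C \<subseteq> C' \<and> C' - C \<subseteq> {} \<and> C' \<in> B)"
      using trivial_minor_cycle[OF G] by blast
  qed
  have "component G {} ` S = (\<lambda>v. {v}) ` S" if "S \<subseteq> verts G" for S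
    using component_empty[OF G] that by (intro image_cong) auto
  then have "bij_betw the_elem (verts ?H) (verts G)"
    "\<forall>e\<in>edges ?H. ends G (id e) = the_elem ` ends ?H e"
    using mgraphD(1)[OF G] by (auto simp: bij_betw_def inj_on_def image_image)
  moreover have "bij_betw id (edges ?H) (edges G)" by simp
  moreover have "B = (\<lambda>C. id ` C) ` ?B" unfolding B by simp
  ultimately show ?thesis
    unfolding contract_delete.simps delete_verts.simps biased_iso.simps
    by (intro exI[of _ the_elem] exI[of _ id]) simp
qed

text \<open>A minor that deletes or contracts some edge inherits the gain belonging to that edge,
  whatever else is done to \<open>G\<close>. A minor that does neither is isomorphic to
  \<open>G\<close>, because there are no isolated vertices to remove.\<close>

lemma (in critical_graph) excluded_minor:
  assumes no_loops: "\<And>e. e \<in> edges G \<Longrightarrow> \<not> is_loop G e"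
  shows "excluded_minor_gainable (integer_mod_group 3) (G, B)"
  unfolding excluded_minor_gainable_def
proof (intro conjI allI impI)
  show "biased_graph (G, B)" by (rule biased)
  show "\<not> gainable (integer_mod_group 3) (G, B)"
    using gainable_right[OF biased] not_gainable by blast
  fix M assume M: "proper_minor M (G, B)"
  then obtain A D W where m: "A \<subseteq> edges G" "D \<subseteq> edges G" "A \<inter> D = {}" "balanced_edges (G, B) A"
    "W \<subseteq> isolated_verts (contract_delete (G, B) A D)" "M = delete_verts (contract_delete (G, B) A D) W"
    unfolding proper_minor_def is_minor_def fst_conv by blast
  consider e where "e \<in> D" | e where "e \<in> A" | "A = {}" "D = {}" by blast
  then show "gainable (integer_mod_group 3) M"
  proof cases
    case 1
    then obtain \<gamma> where "zgain G \<gamma>" "\<And>C. is_cycle G C \<Longrightarrow> e \<notin> C \<Longrightarrow> right G B \<gamma> C"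
      using delete m(2) by blast
    then show ?thesis unfolding m(6) using minor_gainable_delete[OF biased m(3,4) _ 1 m(5)] by blast
  next
    case 2
    then have nl: "e \<in> edges G" "\<not> is_loop G e" using m(1) no_loops by blast+
    then obtain \<gamma> where "zgain G \<gamma>" "\<And>C. is_cycle G C \<Longrightarrow> \<not> chord G C e \<Longrightarrow> right G B \<gamma> C"
      using contract by blast
    then show ?thesis unfolding m(6) using minor_gainable_contract[OF biased m(3,4) _ 2 m(1) nl(2) m(5)] by blast
  next
    case 3
    have "W = {}"
    proof (rule ccontr)
      assume "W \<noteq> {}"
      then obtain w where "w \<in> W" by blast
      then have w: "w \<in> component G {} ` verts G" "\<And>e. e \<in> edges G \<Longrightarrow> w \<notin> component G {} ` ends G e"
        using m(5) 3 by auto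
      then show False using no_isolated by blast
    qed
    then have "M \<cong>\<^sub>b (G, B)" using trivial_minor_iso[OF biased] m(6) 3 by simp
    then show ?thesis using M by (simp add: proper_minor_def)
  qed
qed

section \<open>Balance of digons, triangles and quadrangles, and bias given by parity\<close>

lemma dvd3_reverse:
  fixes r s t :: int
  assumes "3 dvd s + t"
  shows "3 dvd r + t \<longleftrightarrow> 3 dvd r - s"
  using assms by presburger

lemma digon_bal:
  assumes "mgraph G" "zgain G \<gamma>" "(x, a, b) \<in> arcs G" "(y, a, b) \<in> arcs G" "x \<noteq> y" "a \<noteq> b"
  shows "bal G \<gamma> {x, y} \<longleftrightarrow> 3 dvd \<gamma> (x, a, b) - \<gamma> (y, a, b)"
  unfolding bal_scw[OF assms(1,2) digon_scw[OF assms(1,3-6)]]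
  using dvd3_reverse[OF zgainD[OF assms(2,4,6)]] by simp

lemma triangle_bal:
  assumes "mgraph G" "zgain G \<gamma>" "(x, a, b) \<in> arcs G" "(y, b, c) \<in> arcs G" "(z, a, c) \<in> arcs G" "distinct [a, b, c]"
  shows "bal G \<gamma> {x, y, z} \<longleftrightarrow> 3 dvd (\<gamma> (x, a, b) + \<gamma> (y, b, c)) - \<gamma> (z, a, c)"
proof -
  have "a \<noteq> c" using assms(6) by simp
  then show ?thesis
    unfolding bal_scw[OF assms(1,2) triangle_scw[OF assms(1,3,4) arcs_sym[OF assms(5)] assms(6)]]
    using dvd3_reverse[OF zgainD[OF assms(2,5)], of "\<gamma> (x, a, b) + \<gamma> (y, b, c)"] by (simp add: add.assoc)
qed

lemma quadrangle_bal:
  assumes "mgraph G" "zgain G \<gamma>" "(x, a, b) \<in> arcs G" "(y, b, c) \<in> arcs G" "(z, c, d) \<in> arcs G" "(w, a, d) \<in> arcs G"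
    "distinct [a, b, c, d]"
  shows "bal G \<gamma> {x, y, z, w} \<longleftrightarrow> 3 dvd (\<gamma> (x, a, b) + \<gamma> (y, b, c) + \<gamma> (z, c, d)) - \<gamma> (w, a, d)"
proof -
  have "a \<noteq> d" using assms(7) by simp
  then show ?thesis
    unfolding bal_scw[OF assms(1,2) quadrangle_scw[OF assms(1,3,4,5) arcs_sym[OF assms(6)] assms(7)]]
    using dvd3_reverse[OF zgainD[OF assms(2,6)], of "\<gamma> (x, a, b) + \<gamma> (y, b, c) + \<gamma> (z, c, d)"] by (simp add: add.assoc)
qed

text \<open>Among the parities of three paths the number of equal pairs is 1 or 3, never 2.\<close>

lemma signed_biased_graph:
  assumes G: "mgraph G"
  shows "biased_graph (G, {C. is_cycle G C \<and> even (card (C \<inter> N))})"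
proof -
  let ?B = "{C. is_cycle G C \<and> even (card (C \<inter> N))}"
  have "card {C \<in> ?B. C \<subseteq> T} \<noteq> 2" if theta: "is_theta G T" for T
  proof -
    obtain u v p q r where t: "u \<noteq> v" "is_path G u p v" "is_path G u q v" "is_path G u r v"
      "idisj p q" "idisj p r" "idisj q r" and T: "T = wE p \<union> wE q \<union> wE r"
      using theta unfolding is_theta_def by blast
    have card: "card ((X \<union> Y) \<inter> N) = card (X \<inter> N) + card (Y \<inter> N)" if "X \<inter> Y = {}" "finite X" "finite Y" for X Y
      unfolding Int_Un_distrib2 by (rule card_Un_disjoint) (use that in auto)
    have disj: "wE p \<inter> wE q = {}" "wE p \<inter> wE r = {}" "wE q \<inter> wE r = {}"
      using t(5-7) by (auto simp: idisj_iff)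
    note cyc = idisj_cycle[OF G t(2,3,1,5)] idisj_cycle[OF G t(2,4,1,6)] idisj_cycle[OF G t(3,4,1,7)]
    have mem: "wE p \<union> wE q \<in> ?B \<longleftrightarrow> (even (card (wE p \<inter> N)) \<longleftrightarrow> even (card (wE q \<inter> N)))"
      "wE p \<union> wE r \<in> ?B \<longleftrightarrow> (even (card (wE p \<inter> N)) \<longleftrightarrow> even (card (wE r \<inter> N)))"
      "wE q \<union> wE r \<in> ?B \<longleftrightarrow> (even (card (wE q \<inter> N)) \<longleftrightarrow> even (card (wE r \<inter> N)))"
      using cyc card[OF disj(1)] card[OF disj(2)] card[OF disj(3)] by auto
    have ne: "wE p \<noteq> {}" "wE q \<noteq> {}" "wE r \<noteq> {}"
      using t(1-4) by auto
    have dist: "wE p \<union> wE q \<noteq> wE p \<union> wE r" "wE p \<union> wE q \<noteq> wE q \<union> wE r" "wE p \<union> wE r \<noteq> wE q \<union> wE r"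
      using ne disj by (metis Int_Un_distrib Int_absorb Un_empty_left Un_empty_right Int_commute)+
    have "C \<in> {wE p \<union> wE q, wE p \<union> wE r, wE q \<union> wE r}" if "C \<in> ?B" "C \<subseteq> T" for C
      using theta_cycles[OF G _ t] that unfolding T by blast
    then have eq: "{C \<in> ?B. C \<subseteq> T} = (if wE p \<union> wE q \<in> ?B then {wE p \<union> wE q} else {}) \<union>
      (if wE p \<union> wE r \<in> ?B then {wE p \<union> wE r} else {}) \<union> (if wE q \<union> wE r \<in> ?B then {wE q \<union> wE r} else {})"
      unfolding T by (auto split: if_splits)
    show ?thesis
      unfolding eq mem using dist by auto
  qed
  then show ?thesis using G by simp
qed

section \<open>Criticality of the three graphs\<close>

lemma mgraph_multi_K2: "mgraph (multi_K2 n)"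
  by (auto simp: mgraph_def multi_K2_def)

lemma critical_4K2: "critical_graph (multi_K2 4) {}"
proof
  let ?G = "multi_K2 4"
  have E: "edges ?G = {..<4}" "ends ?G x = {0, 1}" for x by (simp_all add: multi_K2_def)
  have arc: "(x, 0, 1) \<in> arcs ?G" if "x < 4" for x
    by (rule arcsI[OF mgraph_multi_K2]) (use that E in auto)
  show "biased_graph (?G, {})" using mgraph_multi_K2 by simp
  show "verts ?G = \<Union>(ends ?G ` edges ?G)" by (auto simp: multi_K2_def lessThan_empty_iff)
  have right: "right ?G {} \<gamma> {x, y} \<longleftrightarrow> \<not> 3 dvd \<gamma> (x, 0, 1) - \<gamma> (y, 0, 1)"
    if "zgain ?G \<gamma>" "x < 4" "y < 4" "x \<noteq> y" for \<gamma> x y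
    using digon_bal[OF mgraph_multi_K2 that(1) arc[OF that(2)] arc[OF that(3)] that(4)] by (simp add: right_def)
  have digon: "is_cycle ?G {x, y}" if "x < 4" "y < 4" "x \<noteq> y" for x y
    using scw_is_cycle[OF mgraph_multi_K2 digon_scw[OF mgraph_multi_K2 arc[OF that(1)] arc[OF that(2)] that(3)]] by simp
  have cycleE: "\<exists>x y. C = {x, y} \<and> x < 4 \<and> y < 4 \<and> x \<noteq> y" if "is_cycle ?G C" for C
    using parallel_cycles[OF mgraph_multi_K2 E(2) _ that] E(1) by (metis lessThan_iff zero_neq_one)
  show "\<exists>C. is_cycle ?G C \<and> \<not> right ?G {} \<gamma> C" if \<gamma>: "zgain ?G \<gamma>" for \<gamma>
  proof (rule ccontr)
    assume "\<not> ?thesis"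
    then have "\<not> 3 dvd \<gamma> (x, 0, 1) - \<gamma> (y, 0, 1)" if "x < 4" "y < 4" "x \<noteq> y" for x y
      using right[OF \<gamma> that] digon[OF that] by blast
    then show False
      using four_residues[of "\<gamma> (0, 0, 1)" "\<gamma> (1, 0, 1)" "\<gamma> (2, 0, 1)" "\<gamma> (3, 0, 1)"] by simp
  qed
  have oriented: "zgain ?G (\<lambda>(h, u, v). if u = 0 then val h else - val h)" for val :: "nat \<Rightarrow> int"
    by (auto simp: zgain_def arcs_def E)
  show "\<exists>\<gamma>. zgain ?G \<gamma> \<and> (\<forall>C. is_cycle ?G C \<longrightarrow> e \<notin> C \<longrightarrow> right ?G {} \<gamma> C)" if "e \<in> edges ?G" for e
  proof -
    \<comment> \<open>Numbering the other three edges 0, 1, 2 gives them different residues.\<close>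
    define val :: "nat \<Rightarrow> int" where "val x = (if x < e then int x else int x - 1)" for x
    have "right ?G {} (\<lambda>(h, u, v). if u = 0 then val h else - val h) C" if C: "is_cycle ?G C" "e \<notin> C" for C
    proof -
      obtain x y where xy: "C = {x, y}" "x < 4" "y < 4" "x \<noteq> y" using cycleE[OF C(1)] by blast
      have "e < 4" "x \<noteq> e" "y \<noteq> e" using xy(1) C(2) \<open>e \<in> edges ?G\<close> by (auto simp: E)
      then have "0 \<le> val x" "val x \<le> 2" "0 \<le> val y" "val y \<le> 2" "val x \<noteq> val y"
        using xy(2-4) by (auto simp: val_def)
      then have "\<not> 3 dvd val x - val y" by presburger
      then show ?thesis using right[OF oriented xy(2-4)] xy(1) by simp
    qed
    then show ?thesis using oriented by blast
  qed
  show "\<exists>\<gamma>. zgain ?G \<gamma> \<and> (\<forall>C. is_cycle ?G C \<longrightarrow> \<not> chord ?G C z \<longrightarrow> right ?G {} \<gamma> C)" if "z \<in> edges ?G" for z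
  proof -
    \<comment> \<open>A cycle without \<open>z\<close> as a chord contains \<open>z\<close>, so it
      is enough that the gain of \<open>z\<close> differs from those of all other edges.\<close>
    define val :: "nat \<Rightarrow> int" where "val x = (if x = z then 0 else 1)" for x
    have "right ?G {} (\<lambda>(h, u, v). if u = 0 then val h else - val h) C" if C: "is_cycle ?G C" "\<not> chord ?G C z" for C
    proof -
      obtain x y where xy: "C = {x, y}" "x < 4" "y < 4" "x \<noteq> y" using cycleE[OF C(1)] by blast
      then have "z = x \<or> z = y" using C(2) by (auto simp: chord_def E)
      then have "\<not> 3 dvd val x - val y" using xy(4) by (auto simp: val_def)
      then show ?thesis using right[OF oriented xy(2-4)] xy(1) by simp
    qed
    then show ?thesis using oriented by blast
  qed
qed

text \<open>A gain that is wrong only on a spanning cycle \<open>T\<close> serves both for deleting an edge of \<open>T\<close> and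
  for contracting an edge outside \<open>T\<close>.\<close>

lemma critical_graphI:
  assumes biased: "biased_graph (G, B)" and "verts G = \<Union>(ends G ` edges G)"
    and "\<And>\<gamma>. zgain G \<gamma> \<Longrightarrow> \<exists>C. is_cycle G C \<and> \<not> right G B \<gamma> C"
    and except: "\<And>T. T \<in> \<T> \<Longrightarrow> \<exists>\<gamma>. zgain G \<gamma> \<and> (\<forall>C. is_cycle G C \<longrightarrow> C \<noteq> T \<longrightarrow> right G B \<gamma> C)"
    and "\<And>T. T \<in> \<T> \<Longrightarrow> \<Union>(ends G ` T) = verts G" "edges G \<subseteq> \<Union>\<T>" "\<Inter>\<T> \<inter> edges G = {}"
  shows "critical_graph G B"
proof
  show "\<exists>\<gamma>. zgain G \<gamma> \<and> (\<forall>C. is_cycle G C \<longrightarrow> e \<notin> C \<longrightarrow> right G B \<gamma> C)" if e: "e \<in> edges G" for e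
  proof -
    obtain T where T: "T \<in> \<T>" "e \<in> T" using e assms(6) by blast
    then show ?thesis using except[OF T(1)] by blast
  qed
  show "\<exists>\<gamma>. zgain G \<gamma> \<and> (\<forall>C. is_cycle G C \<longrightarrow> \<not> chord G C z \<longrightarrow> right G B \<gamma> C)" if z: "z \<in> edges G" for z
  proof -
    obtain T where T: "T \<in> \<T>" "z \<notin> T" using z assms(7) by blast
    then have "chord G T z"
      using assms(5)[OF T(1)] mgraphD(1)[OF biased_mgraph[OF biased] z] by (simp add: chord_def)
    then show ?thesis using except[OF T(1)] by blast
  qed
qed (use assms in auto)

lemma critical_plus_minus_K3:
  "critical_graph (doubled_graph (complete_graph 3)) (snd (plus_minus (complete_graph 3)))" (is "critical_graph ?D ?B")
proof -
  have B: "?B = {C. is_cycle ?D C \<and> even (card (C \<inter> {x. snd x = Negative}))}"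
    unfolding plus_minus_def snd_conv even_Negative ..
  define T :: "sign \<Rightarrow> sign \<Rightarrow> sign \<Rightarrow> (nat set \<times> sign) set"
    where "T t t' t'' = {({0, 1}, t), ({1, 2}, t'), ({0, 2}, t'')}" for t t' t''
  have digon_notin: "{(x, Positive), (x, Negative)} \<notin> ?B" for x
    unfolding B by (simp add: Int_insert_left)
  have T_in: "T t t' t'' \<in> ?B \<longleftrightarrow> ((t = Negative) = (t' = Negative)) = (t'' = Positive)" for t t' t''
    unfolding B T_def using doubled_K3_triangle[of t t' t'']
    by (cases t; cases t'; cases t'') (simp_all add: Int_insert_left doubleton_eq_iff)
  have cycleE: "(\<exists>u v. (u, v) \<in> {(0, 1), (1, 2), (0, 2)} \<and> C = {({u, v}, Positive), ({u, v}, Negative)}) \<or> (\<exists>t t' t''. C = T t t' t'')"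
    if "is_cycle ?D C" for C
    using doubled_K3_cycles[OF that] unfolding T_def
    by (elim insertE emptyE) (simp add: insert_commute; blast)+
  have arc: "(({u, v}, t), u, v) \<in> arcs ?D" if "(u, v) \<in> {(0, 1), (1, 2), (0, 2)}" for u v t
  proof (rule arcsI[OF mgraph_doubled_K3])
    show "({u, v}, t) \<in> edges ?D" using that by (cases t) (auto simp: doubled_K3_simps)
  qed (use that in \<open>auto simp: doubled_K3_simps(3)\<close>)
  have digon: "is_cycle ?D {({u, v}, Positive), ({u, v}, Negative)}"
    and digon_right: "zgain ?D \<gamma> \<Longrightarrow> right ?D ?B \<gamma> {({u, v}, Positive), ({u, v}, Negative)} \<longleftrightarrow>
      \<not> 3 dvd \<gamma> (({u, v}, Positive), u, v) - \<gamma> (({u, v}, Negative), u, v)"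
    if uv: "(u, v) \<in> {(0, 1), (1, 2), (0, 2)}" for u v \<gamma>
  proof -
    have "u \<noteq> v" using uv by auto
    then show "is_cycle ?D {({u, v}, Positive), ({u, v}, Negative)}"
      using scw_is_cycle[OF mgraph_doubled_K3 digon_scw[OF mgraph_doubled_K3 arc[OF uv] arc[OF uv]]] by simp
    show "right ?D ?B \<gamma> {({u, v}, Positive), ({u, v}, Negative)} \<longleftrightarrow>
      \<not> 3 dvd \<gamma> (({u, v}, Positive), u, v) - \<gamma> (({u, v}, Negative), u, v)" if "zgain ?D \<gamma>"
      using digon_bal[OF mgraph_doubled_K3 that arc[OF uv, of Positive] arc[OF uv, of Negative]] \<open>u \<noteq> v\<close> digon_notin
      by (simp add: right_def)
  qed
  have T_right: "right ?D ?B \<gamma> (T t t' t'') \<longleftrightarrow> (((t = Negative) = (t' = Negative)) = (t'' = Positive) \<longleftrightarrow>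
    3 dvd (\<gamma> (({0, 1}, t), 0, 1) + \<gamma> (({1, 2}, t'), 1, 2)) - \<gamma> (({0, 2}, t''), 0, 2))" if "zgain ?D \<gamma>" for \<gamma> t t' t''
    unfolding right_def T_in
    using triangle_bal[OF mgraph_doubled_K3 that arc arc arc, of 0 1 2 t t' t''] by (simp add: T_def)
  have except: "\<exists>\<gamma>. zgain ?D \<gamma> \<and> (\<forall>C. is_cycle ?D C \<longrightarrow> C \<noteq> T s s' s'' \<longrightarrow> right ?D ?B \<gamma> C)"
    if s: "T s s' s'' \<in> ?B" for s s' s''
  proof -
    \<comment> \<open>The first two gains minus the third add up to -2 on \<open>T s s' s''\<close>,
      and every edge with the other sign adds 1. Modulo 3 the sum vanishes exactly at two changes of
      sign, that is, on the other balanced triangles. The two edges of a digon always differ by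
      1.\<close>
    define w :: "nat set \<times> sign \<Rightarrow> int" where "w = (\<lambda>(x, t). if x = {0, 1} then (if t = s then 0 else 1)
      else if x = {1, 2} then (if t = s' then -1 else 0) else (if t = s'' then 1 else 0))"
    have w: "w ({0, 1}, t) = (if t = s then 0 else 1)" "w ({1, 2}, t) = (if t = s' then -1 else 0)"
      "w ({0, 2}, t) = (if t = s'' then 1 else 0)" for t
      by (simp_all add: w_def doubleton_eq_iff)
    define \<gamma> where "\<gamma> = (\<lambda>(h, u, v :: nat). if u < v then w h else - w h)"
    have \<gamma>: "zgain ?D \<gamma>" by (auto simp: zgain_def \<gamma>_def)
    have "right ?D ?B \<gamma> C" if C: "is_cycle ?D C" "C \<noteq> T s s' s''" for C
      using cycleE[OF C(1)]
    proof (elim disjE exE conjE)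
      fix u v assume uv: "(u, v) \<in> {(0, 1), (1, 2), (0, 2)}" and C: "C = {({u, v}, Positive), ({u, v}, Negative)}"
      show ?thesis
        unfolding C digon_right[OF uv \<gamma>]
        by (use uv in \<open>elim insertE emptyE\<close>; cases s; cases s'; cases s''; simp add: \<gamma>_def w del: One_nat_def)
    next
      fix t t' t'' assume C': "C = T t t' t''"
      have "t \<noteq> s \<or> t' \<noteq> s' \<or> t'' \<noteq> s''" using C(2) C' by blast
      then show ?thesis
        using s unfolding C' T_right[OF \<gamma>] T_in
        by (cases s; cases s'; cases s''; cases t; cases t'; cases t''; simp add: \<gamma>_def w del: One_nat_def)
    qed
    then show ?thesis using \<gamma> by blast
  qed
  \<comment> \<open>The four balanced triangles; each of them is spanning.\<close>
  let ?\<T> = "{T Positive Positive Positive, T Positive Negative Negative, T Negative Positive Negative, T Negative Negative Positive}"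
  show ?thesis
  proof (rule critical_graphI[where \<T> = ?\<T>])
    show "biased_graph (?D, ?B)" unfolding B by (rule signed_biased_graph[OF mgraph_doubled_K3])
    show "verts ?D = \<Union>(ends ?D ` edges ?D)" unfolding doubled_K3_simps by (auto simp: doubled_K3_simps)
    show "edges ?D \<subseteq> \<Union>?\<T>" unfolding doubled_K3_simps T_def by simp
    show "\<Inter>?\<T> \<inter> edges ?D = {}" unfolding T_def by (auto simp: doubleton_eq_iff)
    show "\<exists>\<gamma>. zgain ?D \<gamma> \<and> (\<forall>C. is_cycle ?D C \<longrightarrow> C \<noteq> X \<longrightarrow> right ?D ?B \<gamma> C)" if "X \<in> ?\<T>" for X
      using that by (elim insertE emptyE; hypsubst) (rule except; simp add: T_in)+
    show "\<Union>(ends ?D ` X) = verts ?D" if "X \<in> ?\<T>" for X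
      using that by (elim insertE emptyE; hypsubst) (simp add: T_def doubled_K3_simps; blast)+
    show "\<exists>C. is_cycle ?D C \<and> \<not> right ?D ?B \<gamma> C" if \<gamma>: "zgain ?D \<gamma>" for \<gamma>
    proof (rule ccontr)
      assume "\<not> ?thesis"
      then have all: "right ?D ?B \<gamma> C" if "is_cycle ?D C" for C using that by blast
      have tri: "((t = Negative) = (t' = Negative)) = (t'' = Positive) \<longleftrightarrow>
        3 dvd (\<gamma> (({0, 1}, t), 0, 1) + \<gamma> (({1, 2}, t'), 1, 2)) - \<gamma> (({0, 2}, t''), 0, 2)" for t t' t''
        using all[OF doubled_K3_triangle[of t t' t'']] unfolding T_def[symmetric] T_right[OF \<gamma>] .
      \<comment> \<open>Modulo 3, \<open>f - g\<close> equals both \<open>e - e'\<close> and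
        \<open>e' - e\<close>. So twice the difference vanishes, and hence the difference
        itself.\<close>
      have arith: "\<not> 3 dvd f - g \<Longrightarrow> 3 dvd (f + x) - e \<Longrightarrow> 3 dvd (g + x) - e' \<Longrightarrow> 3 dvd (f + y) - e' \<Longrightarrow> 3 dvd (g + y) - e \<Longrightarrow> False"
        for f g x y e e' :: int by presburger
      have "\<not> 3 dvd \<gamma> (({0, 1}, Positive), 0, 1) - \<gamma> (({0, 1}, Negative), 0, 1)"
        using all[OF digon] digon_right[OF _ \<gamma>] by simp
      then show False
        by (rule arith[where x = "\<gamma> (({1, 2}, Positive), 1, 2)" and y = "\<gamma> (({1, 2}, Negative), 1, 2)"
          and e = "\<gamma> (({0, 2}, Positive), 0, 2)" and e' = "\<gamma> (({0, 2}, Negative), 0, 2)"]) (simp_all flip: tri del: One_nat_def)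
    qed
  qed
qed

lemma critical_minus_K4:
  "critical_graph (complete_graph 4) (snd (all_negative (complete_graph 4)))" (is "critical_graph ?K ?B")
proof -
  note K = mgraph_complete[of 4]
  have B: "?B = {C. is_cycle ?K C \<and> even (card (C \<inter> UNIV))}" by (simp add: all_negative_def)
  have arc: "({u, v}, u, v) \<in> arcs ?K" if "u \<noteq> v" "u \<in> {0, 1, 2, 3}" "v \<in> {0, 1, 2, 3}" for u v
    by (rule arcsI[OF K]) (use that in \<open>auto simp: complete_graph_def\<close>)
  define tri :: "nat \<Rightarrow> nat \<Rightarrow> nat \<Rightarrow> nat set set" where "tri a b c = {{a, b}, {b, c}, {a, c}}" for a b c
  define quad :: "nat \<Rightarrow> nat \<Rightarrow> nat \<Rightarrow> nat \<Rightarrow> nat set set" where "quad a b c d = {{a, b}, {b, c}, {c, d}, {a, d}}" for a b c d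
  have tri: "is_cycle ?K (tri a b c)"
    "zgain ?K \<gamma> \<Longrightarrow> right ?K ?B \<gamma> (tri a b c) \<longleftrightarrow> \<not> 3 dvd (\<gamma> ({a, b}, a, b) + \<gamma> ({b, c}, b, c)) - \<gamma> ({a, c}, a, c)"
    if d: "distinct [a, b, c]" "{a, b, c} \<subseteq> {0, 1, 2, 3}" for a b c \<gamma>
  proof -
    have arcs: "({a, b}, a, b) \<in> arcs ?K" "({b, c}, b, c) \<in> arcs ?K" "({a, c}, a, c) \<in> arcs ?K" "({a, c}, c, a) \<in> arcs ?K"
      using arc[of a b] arc[of b c] arc[of a c] arc[of c a] d by (auto simp: insert_commute)
    show "is_cycle ?K (tri a b c)"
      using scw_is_cycle[OF K triangle_scw[OF K arcs(1,2,4) d(1)]] by (simp add: tri_def)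
    have "card (tri a b c) = 3" using d(1) by (simp add: tri_def doubleton_eq_iff)
    then have "tri a b c \<notin> ?B" by (simp add: all_negative_def)
    then show "right ?K ?B \<gamma> (tri a b c) \<longleftrightarrow> \<not> 3 dvd (\<gamma> ({a, b}, a, b) + \<gamma> ({b, c}, b, c)) - \<gamma> ({a, c}, a, c)" if "zgain ?K \<gamma>"
      using triangle_bal[OF K that arcs(1-3) d(1)] by (simp add: right_def tri_def)
  qed
  have quad: "is_cycle ?K (quad a b c d)" "quad a b c d \<in> ?B"
    "zgain ?K \<gamma> \<Longrightarrow> right ?K ?B \<gamma> (quad a b c d) \<longleftrightarrow>
      3 dvd (\<gamma> ({a, b}, a, b) + \<gamma> ({b, c}, b, c) + \<gamma> ({c, d}, c, d)) - \<gamma> ({a, d}, a, d)"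
    if d: "distinct [a, b, c, d]" "{a, b, c, d} \<subseteq> {0, 1, 2, 3}" for a b c d \<gamma>
  proof -
    have arcs: "({a, b}, a, b) \<in> arcs ?K" "({b, c}, b, c) \<in> arcs ?K" "({c, d}, c, d) \<in> arcs ?K"
      "({a, d}, a, d) \<in> arcs ?K" "({a, d}, d, a) \<in> arcs ?K"
      using arc[of a b] arc[of b c] arc[of c d] arc[of a d] arc[of d a] d by (auto simp: insert_commute)
    show cyc: "is_cycle ?K (quad a b c d)"
      using scw_is_cycle[OF K quadrangle_scw[OF K arcs(1-3,5) d(1)]] by (simp add: quad_def)
    have "card (quad a b c d) = 4" using d(1) by (simp add: quad_def doubleton_eq_iff)
    then show "quad a b c d \<in> ?B" using cyc by (simp add: all_negative_def)
    then show "right ?K ?B \<gamma> (quad a b c d) \<longleftrightarrow>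
      3 dvd (\<gamma> ({a, b}, a, b) + \<gamma> ({b, c}, b, c) + \<gamma> ({c, d}, c, d)) - \<gamma> ({a, d}, a, d)" if "zgain ?K \<gamma>"
      using quadrangle_bal[OF K that arcs(1-4) d(1)] by (simp add: right_def quad_def)
  qed
  have except: "\<exists>\<gamma>. zgain ?K \<gamma> \<and> (\<forall>C. is_cycle ?K C \<longrightarrow> C \<noteq> quad a c b d \<longrightarrow> right ?K ?B \<gamma> C)"
    if d: "distinct [a, b, c, d]" "{a, b, c, d} \<subseteq> {0, 1, 2, 3}"
      and E: "edges ?K = {{a, b}, {a, c}, {a, d}, {b, c}, {b, d}, {c, d}}" for a b c d
  proof -
    \<comment> \<open>The edges \<open>ac\<close> and \<open>bd\<close> form a perfect matching,
      oriented from \<open>a\<close> to \<open>c\<close> and from \<open>b\<close> to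
      \<open>d\<close>. A triangle contains exactly one of them and is unbalanced. Of the two
      quadrangles through both, \<open>quad a b d c\<close> traverses one of them backwards, so the
      gains cancel; \<open>quad a c b d\<close> traverses both forwards and is the only wrong
      cycle.\<close>
    define \<gamma> :: "nat set \<times> nat \<times> nat \<Rightarrow> int" where "\<gamma> = (\<lambda>(h, u, v). if (u, v) \<in> {(a, c), (b, d)} then 1
      else if (v, u) \<in> {(a, c), (b, d)} then -1 else 0)"
    have \<gamma>: "zgain ?K \<gamma>" using d(1) by (auto simp: zgain_def \<gamma>_def)
    have "right ?K ?B \<gamma> C" if C: "is_cycle ?K C" "C \<noteq> quad a c b d" for C
    proof -
      have "C \<in> {{{a, b}, {b, c}, {a, c}}, {{a, b}, {b, d}, {a, d}}, {{a, c}, {c, d}, {a, d}}, {{b, c}, {c, d}, {b, d}},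
        {{a, b}, {b, c}, {c, d}, {a, d}}, {{a, b}, {b, d}, {c, d}, {a, c}}, {{a, c}, {b, c}, {b, d}, {a, d}}}"
        by (rule K4_cycles[OF K E _ d(1) _ _ _ _ _ _ C(1)]) (use d(1) in \<open>simp_all add: K4_simps doubleton_eq_iff\<close>)
      moreover have "{{a, b}, {b, d}, {c, d}, {a, c}} = quad a b d c" "{{a, c}, {b, c}, {b, d}, {a, d}} = quad a c b d"
        by (simp_all add: quad_def insert_commute)
      ultimately have "C \<in> {tri a b c, tri a b d, tri a c d, tri b c d, quad a b c d, quad a b d c}"
        using C(2) by (simp add: tri_def quad_def)
      then show ?thesis
        using d by (elim insertE emptyE; hypsubst) (subst tri(2)[OF _ _ \<gamma>] quad(3)[OF _ _ \<gamma>]; simp add: \<gamma>_def)+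
    qed
    then show ?thesis using \<gamma> by blast
  qed
  let ?\<T> = "{quad 0 2 1 3, quad 0 1 2 3, quad 0 1 3 2}"
  show ?thesis
  proof (rule critical_graphI[where \<T> = ?\<T>])
    show "biased_graph (?K, ?B)" unfolding B by (rule signed_biased_graph[OF K])
    show "verts ?K = \<Union>(ends ?K ` edges ?K)" unfolding K4_simps complete_graph_edges by auto
    show "edges ?K \<subseteq> \<Union>?\<T>" unfolding complete_graph_edges quad_def by simp
    show "\<Inter>?\<T> \<inter> edges ?K = {}" unfolding quad_def by (auto simp: doubleton_eq_iff)
    show "\<exists>\<gamma>. zgain ?K \<gamma> \<and> (\<forall>C. is_cycle ?K C \<longrightarrow> C \<noteq> X \<longrightarrow> right ?K ?B \<gamma> C)" if "X \<in> ?\<T>" for X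
      using that
    proof (elim insertE emptyE; hypsubst)
      show "\<exists>\<gamma>. zgain ?K \<gamma> \<and> (\<forall>C. is_cycle ?K C \<longrightarrow> C \<noteq> quad 0 2 1 3 \<longrightarrow> right ?K ?B \<gamma> C)"
        by (rule except) (simp_all add: complete_graph_edges insert_commute)
      show "\<exists>\<gamma>. zgain ?K \<gamma> \<and> (\<forall>C. is_cycle ?K C \<longrightarrow> C \<noteq> quad 0 1 2 3 \<longrightarrow> right ?K ?B \<gamma> C)"
        by (rule except) (simp_all add: complete_graph_edges insert_commute)
      show "\<exists>\<gamma>. zgain ?K \<gamma> \<and> (\<forall>C. is_cycle ?K C \<longrightarrow> C \<noteq> quad 0 1 3 2 \<longrightarrow> right ?K ?B \<gamma> C)"
        by (rule except) (simp_all add: complete_graph_edges insert_commute)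
    qed
    show "\<Union>(ends ?K ` X) = verts ?K" if "X \<in> ?\<T>" for X
      using that by (elim insertE emptyE; hypsubst) (simp add: quad_def K4_simps; blast)+
    show "\<exists>C. is_cycle ?K C \<and> \<not> right ?K ?B \<gamma> C" if \<gamma>: "zgain ?K \<gamma>" for \<gamma>
    proof (rule ccontr)
      assume "\<not> ?thesis"
      then have all: "right ?K ?B \<gamma> C" if "is_cycle ?K C" for C using that by blast
      \<comment> \<open>The three quadrangles force twice the gain of the triangle on 0, 1, 2 to
        vanish modulo 3, and hence the gain itself.\<close>
      have arith: "\<not> 3 dvd (p + q) - r \<Longrightarrow> 3 dvd (p + q + s) - t \<Longrightarrow> 3 dvd (p + u + s') - r \<Longrightarrow> 3 dvd (r + q' + u) - t \<Longrightarrow>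
        3 dvd q + q' \<Longrightarrow> 3 dvd s + s' \<Longrightarrow> False" for p q r s t u q' s' :: int by presburger
      have Q: "3 dvd (\<gamma> ({a, b}, a, b) + \<gamma> ({b, c}, b, c) + \<gamma> ({c, d}, c, d)) - \<gamma> ({a, d}, a, d)"
        if "distinct [a, b, c, d]" "{a, b, c, d} \<subseteq> {0, 1, 2, 3}" for a b c d
        using all[OF quad(1)[OF that]] quad(3)[OF that \<gamma>] by blast
      have R: "3 dvd \<gamma> ({a, b}, a, b) + \<gamma> ({b, a}, b, a)" if "a \<noteq> b" "{a, b} \<subseteq> {0, 1, 2, 3}" for a b
        using zgainD[OF \<gamma> arc[of a b]] that by (simp add: insert_commute)
      have "\<not> 3 dvd (\<gamma> ({0, 1}, 0, 1) + \<gamma> ({1, 2}, 1, 2)) - \<gamma> ({0, 2}, 0, 2)"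
        using all[OF tri(1)[of 0 1 2]] tri(2)[of 0 1 2, OF _ _ \<gamma>] by simp
      then show False
        by (rule arith[OF _ Q[of 0 1 2 3] Q[of 0 1 3 2] Q[of 0 2 1 3] R[of 1 2] R[of 2 3]]) simp_all
    qed
  qed
qed

theorem theorem1p2:
  fixes \<Omega> :: "('v, 'e) biased"
  shows "excluded_minor_gainable (integer_mod_group 3) (multi_K2 4, {}) \<and>
    excluded_minor_gainable (integer_mod_group 3) (plus_minus (complete_graph 3)) \<and>
    excluded_minor_gainable (integer_mod_group 3) (all_negative (complete_graph 4)) \<and>
    (excluded_minor_gainable (integer_mod_group 3) \<Omega> \<longrightarrow>
      \<Omega> \<cong>\<^sub>b (multi_K2 4, {}) \<or>
      \<Omega> \<cong>\<^sub>b plus_minus (complete_graph 3) \<or>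
      \<Omega> \<cong>\<^sub>b all_negative (complete_graph 4))"
proof (intro conjI impI)
  have "\<not> is_loop (multi_K2 4) e" for e by (simp add: is_loop_def multi_K2_def)
  then show "excluded_minor_gainable (integer_mod_group 3) (multi_K2 4, {})"
    by (rule critical_graph.excluded_minor[OF critical_4K2])
  have "\<not> is_loop (doubled_graph (complete_graph 3)) e" if "e \<in> edges (doubled_graph (complete_graph 3))" for e
    using that by (auto simp: is_loop_def doubled_graph_def complete_graph_def)
  from critical_graph.excluded_minor[OF critical_plus_minus_K3 this]
  show "excluded_minor_gainable (integer_mod_group 3) (plus_minus (complete_graph 3))"
    by (simp add: plus_minus_def)
  have "\<not> is_loop (complete_graph 4) e" if "e \<in> edges (complete_graph 4)" for e
    using that by (auto simp: is_loop_def complete_graph_def)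
  from critical_graph.excluded_minor[OF critical_minus_K4 this]
  show "excluded_minor_gainable (integer_mod_group 3) (all_negative (complete_graph 4))"
    by (simp add: all_negative_def)
  assume \<Omega>: "excluded_minor_gainable (integer_mod_group 3) \<Omega>"
  obtain G B where GB: "\<Omega> = (G, B)" by (cases \<Omega>)
  show "\<Omega> \<cong>\<^sub>b (multi_K2 4, {}) \<or> \<Omega> \<cong>\<^sub>b plus_minus (complete_graph 3) \<or> \<Omega> \<cong>\<^sub>b all_negative (complete_graph 4)"
    unfolding GB by (rule critical_graph.classification[OF excluded_minor_critical[OF \<Omega>[unfolded GB]]])
qed

end
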